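(* Let $\mathcal{M}$ be a von Neumann algebra with a faithful normal semifinite weight $\nu$, and let $\psi$ be an Orlicz function. For any $a$ in either $L^\psi(\mathcal{M})$ or $L_\psi(\mathcal{M})$ we have $$t\mu_t(a)\le\mu_1(a)\qquad\text{for all }0<t\le1.$$
   Context: Orlicz functions: convex $\psi:[0,\infty)\to[0,\infty]$ with $\psi(0)=0$, $\lim_{u\to\infty}\psi(u)=\infty$, neither identically zero nor infinite valued on all of $(0,\infty)$, left continuous at $b_\psi=\sup\{u>0:\psi(u)<\infty\}$. $\psi^*(u)=\sup_{v>0}(uv-\psi(v))$, $\psi^{-1}(t)=\sup\{s:\psi(s)\le t\}$. Fundamental functions of $L^\psi(\mathbb{R})$ (Luxemburg norm) and $L_\psi(\mathbb{R})$ (Orlicz norm): $\varphi_\psi(t)=1/\psi^{-1}(1/t)$ and $\widetilde{\varphi}_\psi(t)=t/\varphi_{\psi^*}(t)$, $t>0$. $\mathcal{A}=\mathcal{M}\rtimes_{\sigma^\nu}\mathbb{R}$ is the crossed product by the modular group of $\nu$, $\mathcal{M}$ being identified with its canonical image in $\mathcal{A}$; $(\theta_s)_{s\in\mathbb{R}}$ is the dual action; $\tau_{\mathcal{A}}$ is the canonical trace, with $\tau_{\mathcal{A}}\circ\theta_s=e^{-s}\tau_{\mathcal{A}}$; $\widetilde{\mathcal{A}}$ is the $*$-algebra of $\tau_{\mathcal{A}}$-measurable operators, to which $\theta_s$ extends; $h=d\widetilde{\nu}/d\tau_{\mathcal{A}}$ is the density of the dual weight, a positive non-singular operator affiliated with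 $\mathcal{A}$, with $\theta_s(h)=e^{-s}h$. $L^1(\mathcal{M})=\{x\in\widetilde{\mathcal{A}}:\theta_s(x)=e^{-s}x\ \forall s\in\mathbb{R}\}$ is the Haagerup space. $\mathfrak{n}_\nu=\{a\in\mathcal{M}:\nu(a^*a)<\infty\}$. $[\cdot]$ denotes closure of a closable operator and products of $\tau_{\mathcal{A}}$-measurable operators are strong products. For $x\in\widetilde{\mathcal{A}}$, $\mu_t(x)=\inf\{s\ge0:\tau_{\mathcal{A}}(\chi_{(s,\infty)}(|x|))\le t\}$. For a projection $e\in\mathfrak{n}_\nu$, $[e\widetilde{\varphi}_{\psi^*}(h)^{1/2}]$, $[\widetilde{\varphi}_{\psi^*}(h)^{1/2}e]$ and the analogous operators with $\varphi_{\psi^*}$ belong to $\widetilde{\mathcal{A}}$. Define $$L^\psi(\mathcal{M})=\{a\in\widetilde{\mathcal{A}}:[e\widetilde{\varphi}_{\psi^*}(h)^{1/2}]a[\widetilde{\varphi}_{\psi^*}(h)^{1/2}f]\in L^1(\mathcal{M})\text{ for all projections }e,f\in\mathfrak{n}_\nu\},$$ $$L_\psi(\mathcal{M})=\{a\in\widetilde{\mathcal{A}}:[e\varphi_{\psi^*}(h)^{1/2}]a[\varphi_{\psi^*}(h)^{1/2}f]\in L^1(\mathcal{M})\text{ for all projections }e,f\in\mathfrak{n}_\nu\}.$$ *)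

theory Defs
  imports "HOL-Analysis.Analysis" "HOL-Library.Nonpos_Ints"
begin

section \<open>Complex Hilbert spaces and bounded operators\<close>

text \<open>The inner product is linear in the first argument.  The real inner product, norm and topology
  inherited from \<^class>\<open>real_inner\<close> are those of the underlying real Hilbert space.\<close>

class chilbert_space = real_inner + complete_space +
  fixes scaleC :: "complex \<Rightarrow> 'a \<Rightarrow> 'a" (infixr "*\<^sub>C" 75)
    and cinner :: "'a \<Rightarrow> 'a \<Rightarrow> complex"
  assumes scaleC_add_right: "c *\<^sub>C (x + y) = c *\<^sub>C x + c *\<^sub>C y"
    and scaleC_add_left: "(c + d) *\<^sub>C x = c *\<^sub>C x + d *\<^sub>C x"
    and scaleC_scaleC: "c *\<^sub>C (d *\<^sub>C x) = (c * d) *\<^sub>C x"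
    and scaleC_of_real: "complex_of_real r *\<^sub>C x = scaleR r x"
    and cinner_commute: "cinner y x = cnj (cinner x y)"
    and cinner_add_left: "cinner (x + y) z = cinner x z + cinner y z"
    and cinner_scaleC_left: "cinner (c *\<^sub>C x) y = c * cinner x y"
    and inner_eq_Re_cinner: "inner x y = Re (cinner x y)"

instantiation complex :: chilbert_space
begin
definition scaleC_complex :: "complex \<Rightarrow> complex \<Rightarrow> complex" where "scaleC_complex c x = c * x"
definition cinner_complex :: "complex \<Rightarrow> complex \<Rightarrow> complex" where "cinner_complex x y = x * cnj y"
instance
  by standard (auto simp: scaleC_complex_def cinner_complex_def algebra_simps inner_complex_def
      scaleR_conv_of_real)
end

definition bounded_clinear :: "('a::chilbert_space \<Rightarrow> 'b::chilbert_space) \<Rightarrow> bool" where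
  "bounded_clinear T \<longleftrightarrow> bounded_linear T \<and> (\<forall>c x. T (c *\<^sub>C x) = c *\<^sub>C T x)"

definition cadj :: "('a::chilbert_space \<Rightarrow> 'a) \<Rightarrow> ('a \<Rightarrow> 'a)" where
  "cadj T = (THE S. bounded_clinear S \<and> (\<forall>x y. cinner (T x) y = cinner x (S y)))"

definition positive_op :: "('a::chilbert_space \<Rightarrow> 'a) \<Rightarrow> bool" where
  "positive_op T \<longleftrightarrow> bounded_clinear T \<and> (\<forall>x. cinner (T x) x \<in> \<real>\<^sub>\<ge>\<^sub>0)"

definition op_le :: "('a::chilbert_space \<Rightarrow> 'a) \<Rightarrow> ('a \<Rightarrow> 'a) \<Rightarrow> bool" where
  "op_le S T \<longleftrightarrow> positive_op (\<lambda>x. T x - S x)"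

definition is_projection :: "('a::chilbert_space \<Rightarrow> 'a) \<Rightarrow> bool" where
  "is_projection p \<longleftrightarrow> bounded_clinear p \<and> p \<circ> p = p \<and> cadj p = p"


section \<open>Von Neumann algebras and weights\<close>

definition commutant :: "('a::chilbert_space \<Rightarrow> 'a) set \<Rightarrow> ('a \<Rightarrow> 'a) set" where
  "commutant S = {T. bounded_clinear T \<and> (\<forall>A\<in>S. T \<circ> A = A \<circ> T)}"

definition von_neumann_algebra :: "('a::chilbert_space \<Rightarrow> 'a) set \<Rightarrow> bool" where
  "von_neumann_algebra M \<longleftrightarrow>
     (\<forall>x\<in>M. bounded_clinear x \<and> cadj x \<in> M) \<and> commutant (commutant M) = M"

definition pos_part :: "('a::chilbert_space \<Rightarrow> 'a) set \<Rightarrow> ('a \<Rightarrow> 'a) set" where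
  "pos_part M = {x\<in>M. positive_op x}"

text \<open>Weights are functions on all operators of which only the values on \<^term>\<open>pos_part M\<close> matter.
  In \<^typ>\<open>ennreal\<close> one has \<open>0 * \<infinity> = 0\<close>.\<close>

definition is_weight :: "('a::chilbert_space \<Rightarrow> 'a) set \<Rightarrow> (('a \<Rightarrow> 'a) \<Rightarrow> ennreal) \<Rightarrow> bool" where
  "is_weight M \<nu> \<longleftrightarrow>
     (\<forall>x\<in>pos_part M. \<forall>y\<in>pos_part M. \<nu> (\<lambda>\<xi>. x \<xi> + y \<xi>) = \<nu> x + \<nu> y) \<and>
     (\<forall>x\<in>pos_part M. \<forall>c\<ge>0. \<nu> (\<lambda>\<xi>. scaleR c (x \<xi>)) = ennreal c * \<nu> x)"

definition faithful_weight ::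
    "('a::chilbert_space \<Rightarrow> 'a) set \<Rightarrow> (('a \<Rightarrow> 'a) \<Rightarrow> ennreal) \<Rightarrow> bool" where
  "faithful_weight M \<nu> \<longleftrightarrow> (\<forall>x\<in>pos_part M. \<nu> x = 0 \<longrightarrow> x = (\<lambda>\<xi>. 0))"

definition normal_weight ::
    "('a::chilbert_space \<Rightarrow> 'a) set \<Rightarrow> (('a \<Rightarrow> 'a) \<Rightarrow> ennreal) \<Rightarrow> bool" where
  "normal_weight M \<nu> \<longleftrightarrow>
     (\<forall>D x. D \<subseteq> pos_part M \<and> D \<noteq> {} \<and> x \<in> pos_part M \<and>
        (\<forall>y\<in>D. \<forall>z\<in>D. \<exists>w\<in>D. op_le y w \<and> op_le z w) \<and>
        (\<forall>y\<in>D. op_le y x) \<and>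
        (\<forall>z\<in>pos_part M. (\<forall>y\<in>D. op_le y z) \<longrightarrow> op_le x z)
      \<longrightarrow> \<nu> x = (SUP y\<in>D. \<nu> y))"

definition n_ideal ::
    "('a::chilbert_space \<Rightarrow> 'a) set \<Rightarrow> (('a \<Rightarrow> 'a) \<Rightarrow> ennreal) \<Rightarrow> ('a \<Rightarrow> 'a) set" where
  "n_ideal M \<nu> = {x\<in>M. \<nu> (cadj x \<circ> x) < \<infinity>}"

text \<open>Strong density of the left ideal \<^term>\<open>n_ideal M \<nu>\<close>; for left ideals this is the same as
  \<open>\<sigma>\<close>-weak density.\<close>

definition semifinite_weight ::
    "('a::chilbert_space \<Rightarrow> 'a) set \<Rightarrow> (('a \<Rightarrow> 'a) \<Rightarrow> ennreal) \<Rightarrow> bool" where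
  "semifinite_weight M \<nu> \<longleftrightarrow>
     (\<forall>x\<in>M. \<forall>F. finite F \<longrightarrow> (\<forall>\<epsilon>>0. \<exists>y\<in>n_ideal M \<nu>. \<forall>\<xi>\<in>F. norm (x \<xi> - y \<xi>) < \<epsilon>))"

definition fns_weight :: "('a::chilbert_space \<Rightarrow> 'a) set \<Rightarrow> (('a \<Rightarrow> 'a) \<Rightarrow> ennreal) \<Rightarrow> bool" where
  "fns_weight M \<nu> \<longleftrightarrow>
     is_weight M \<nu> \<and> faithful_weight M \<nu> \<and> normal_weight M \<nu> \<and> semifinite_weight M \<nu>"

definition fns_trace :: "('a::chilbert_space \<Rightarrow> 'a) set \<Rightarrow> (('a \<Rightarrow> 'a) \<Rightarrow> ennreal) \<Rightarrow> bool" where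
  "fns_trace M \<tau> \<longleftrightarrow> fns_weight M \<tau> \<and> (\<forall>x\<in>M. \<tau> (cadj x \<circ> x) = \<tau> (x \<circ> cadj x))"


section \<open>Unbounded operators\<close>

text \<open>Unbounded operators are represented by their graphs, so that inclusion of operators is \<open>\<subseteq>\<close>,
  the closure of a closable operator is the topological \<^const>\<open>closure\<close> of its graph, and the
  composite "first \<open>S\<close>, then \<open>T\<close>" is \<open>S O T\<close>.\<close>

type_synonym 'a uop = "('a \<times> 'a) set"

definition graph :: "('a \<Rightarrow> 'a) \<Rightarrow> 'a uop" where
  "graph T = {(\<xi>, T \<xi>) |\<xi>. True}"

definition clinear_graph :: "'a::chilbert_space uop \<Rightarrow> bool" where
  "clinear_graph T \<longleftrightarrow> single_valued T \<and> (0, 0) \<in> T \<and>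
     (\<forall>(\<xi>, \<eta>)\<in>T. \<forall>(\<xi>', \<eta>')\<in>T. (\<xi> + \<xi>', \<eta> + \<eta>') \<in> T) \<and>
     (\<forall>c. \<forall>(\<xi>, \<eta>)\<in>T. (c *\<^sub>C \<xi>, c *\<^sub>C \<eta>) \<in> T)"

definition closed_densely_defined :: "'a::chilbert_space uop \<Rightarrow> bool" where
  "closed_densely_defined T \<longleftrightarrow> clinear_graph T \<and> closed T \<and> closure (Domain T) = UNIV"

definition graph_adj :: "'a::chilbert_space uop \<Rightarrow> 'a uop" where
  "graph_adj T = {(\<eta>, \<zeta>). \<forall>(\<xi>, \<omega>)\<in>T. cinner \<omega> \<eta> = cinner \<xi> \<zeta>}"

definition positive_selfadjoint :: "'a::chilbert_space uop \<Rightarrow> bool" where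
  "positive_selfadjoint T \<longleftrightarrow> closed_densely_defined T \<and> graph_adj T = T \<and>
     (\<forall>(\<xi>, \<eta>)\<in>T. cinner \<eta> \<xi> \<in> \<real>\<^sub>\<ge>\<^sub>0)"

definition nonsingular :: "'a::chilbert_space uop \<Rightarrow> bool" where
  "nonsingular T \<longleftrightarrow> (\<forall>\<xi>. (\<xi>, 0) \<in> T \<longrightarrow> \<xi> = 0)"

definition affiliated :: "('a::chilbert_space \<Rightarrow> 'a) set \<Rightarrow> 'a uop \<Rightarrow> bool" where
  "affiliated A T \<longleftrightarrow> (\<forall>u\<in>commutant A. \<forall>(\<xi>, \<eta>)\<in>T. (u \<xi>, u \<eta>) \<in> T)"

text \<open>The strong product \<open>[xy]\<close>: apply \<open>y\<close> first, and close.\<close>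

definition sprod :: "'a::chilbert_space uop \<Rightarrow> 'a uop \<Rightarrow> 'a uop" where
  "sprod x y = closure (y O x)"


section \<open>Borel functional calculus\<close>

definition spectral_measure :: "(real set \<Rightarrow> 'a::chilbert_space \<Rightarrow> 'a) \<Rightarrow> bool" where
  "spectral_measure E \<longleftrightarrow>
     (\<forall>B\<in>sets borel. is_projection (E B)) \<and> E UNIV = id \<and>
     (\<forall>B\<in>sets borel. \<forall>C\<in>sets borel. E (B \<inter> C) = E B \<circ> E C) \<and>
     (\<forall>B::nat \<Rightarrow> real set. range B \<subseteq> sets borel \<and> disjoint_family B \<longrightarrow>
        (\<forall>\<xi>. (\<lambda>n. E (B n) \<xi>) sums E (\<Union>n. B n) \<xi>))"

definition scalar_measure :: "(real set \<Rightarrow> 'a::chilbert_space \<Rightarrow> 'a) \<Rightarrow> 'a \<Rightarrow> real measure" where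
  "scalar_measure E \<xi> = measure_of UNIV (sets borel) (\<lambda>B. ennreal ((norm (E B \<xi>))\<^sup>2))"

text \<open>\<open>\<integral> f dE\<close> for \<open>E\<close>-essentially bounded \<open>f\<close>, determined by its quadratic form, and for
  arbitrary Borel \<open>f\<close>, by truncation.\<close>

definition spectral_int_bdd ::
    "(real set \<Rightarrow> 'a::chilbert_space \<Rightarrow> 'a) \<Rightarrow> (real \<Rightarrow> complex) \<Rightarrow> 'a \<Rightarrow> 'a" where
  "spectral_int_bdd E f =
     (THE T. bounded_clinear T \<and> (\<forall>\<xi>. cinner (T \<xi>) \<xi> = (\<integral>s. f s \<partial>scalar_measure E \<xi>)))"

definition spectral_int ::
    "(real set \<Rightarrow> 'a::chilbert_space \<Rightarrow> 'a) \<Rightarrow> (real \<Rightarrow> complex) \<Rightarrow> 'a uop" where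
  "spectral_int E f = {(\<xi>, \<eta>).
     (\<integral>\<^sup>+s. ennreal ((cmod (f s))\<^sup>2) \<partial>scalar_measure E \<xi>) < \<infinity> \<and>
     (\<lambda>n. spectral_int_bdd E (\<lambda>s. if cmod (f s) \<le> real n then f s else 0) \<xi>) \<longlonglongrightarrow> \<eta>}"

text \<open>The spectral resolution of a self-adjoint operator (unique on Borel sets).\<close>

definition spectral_resolution :: "'a::chilbert_space uop \<Rightarrow> real set \<Rightarrow> 'a \<Rightarrow> 'a" where
  "spectral_resolution T = (SOME E. spectral_measure E \<and> spectral_int E complex_of_real = T)"

definition fun_calc :: "'a::chilbert_space uop \<Rightarrow> (real \<Rightarrow> complex) \<Rightarrow> 'a uop" where
  "fun_calc T f = spectral_int (spectral_resolution T) f"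

definition fun_calc_bdd :: "'a::chilbert_space uop \<Rightarrow> (real \<Rightarrow> complex) \<Rightarrow> 'a \<Rightarrow> 'a" where
  "fun_calc_bdd T f = spectral_int_bdd (spectral_resolution T) f"

text \<open>\<open>T\<^sup>i\<^sup>t\<close> for \<open>T\<close> positive, self-adjoint and non-singular.\<close>

definition imag_power :: "'a::chilbert_space uop \<Rightarrow> real \<Rightarrow> 'a \<Rightarrow> 'a" where
  "imag_power T t = fun_calc_bdd T (\<lambda>s. complex_of_real s powr (\<i> * complex_of_real t))"

definition abs_op :: "'a::chilbert_space uop \<Rightarrow> 'a uop" where
  "abs_op x = fun_calc (x O graph_adj x) (\<lambda>s. complex_of_real (sqrt s))"


section \<open>The modular automorphism group\<close>

text \<open>\<open>\<Lambda>\<close> and \<open>\<rho>\<close> form a GNS representation of \<open>\<nu>\<close>: \<open>\<Lambda>\<close> identifies the space \<^typ>\<open>'g\<close> with the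
  completion of \<open>n_ideal M \<nu>\<close> in the norm \<open>\<nu>(x*x)\<^sup>1\<^sup>/\<^sup>2\<close>, and \<open>\<rho>\<close> is left multiplication.\<close>

definition gns_representation ::
    "('h::chilbert_space \<Rightarrow> 'h) set \<Rightarrow> (('h \<Rightarrow> 'h) \<Rightarrow> ennreal) \<Rightarrow>
     (('h \<Rightarrow> 'h) \<Rightarrow> 'g::chilbert_space) \<Rightarrow> (('h \<Rightarrow> 'h) \<Rightarrow> 'g \<Rightarrow> 'g) \<Rightarrow> bool" where
  "gns_representation M \<nu> \<Lambda> \<rho> \<longleftrightarrow>
     (\<forall>x\<in>n_ideal M \<nu>. \<forall>y\<in>n_ideal M \<nu>. \<Lambda> (\<lambda>\<xi>. x \<xi> + y \<xi>) = \<Lambda> x + \<Lambda> y) \<and>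
     (\<forall>x\<in>n_ideal M \<nu>. \<forall>c. \<Lambda> (\<lambda>\<xi>. c *\<^sub>C x \<xi>) = c *\<^sub>C \<Lambda> x) \<and>
     (\<forall>x\<in>n_ideal M \<nu>. ennreal ((norm (\<Lambda> x))\<^sup>2) = \<nu> (cadj x \<circ> x)) \<and>
     closure (\<Lambda> ` n_ideal M \<nu>) = UNIV \<and>
     (\<forall>a\<in>M. bounded_clinear (\<rho> a) \<and> (\<forall>x\<in>n_ideal M \<nu>. \<rho> a (\<Lambda> x) = \<Lambda> (a \<circ> x)))"

text \<open>The closure \<open>S\<close> of \<open>\<Lambda> x \<mapsto> \<Lambda> x*\<close>, its adjoint as an antilinear operator, and the modular
  operator \<open>\<Delta> = S* S\<close>.\<close>

definition tomita_op ::
    "('h::chilbert_space \<Rightarrow> 'h) set \<Rightarrow> (('h \<Rightarrow> 'h) \<Rightarrow> ennreal) \<Rightarrow>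
     (('h \<Rightarrow> 'h) \<Rightarrow> 'g::chilbert_space) \<Rightarrow> 'g uop" where
  "tomita_op M \<nu> \<Lambda> =
     closure {(\<Lambda> x, \<Lambda> (cadj x)) |x. x \<in> n_ideal M \<nu> \<and> cadj x \<in> n_ideal M \<nu>}"

definition antilinear_adj :: "'a::chilbert_space uop \<Rightarrow> 'a uop" where
  "antilinear_adj S = {(\<eta>, \<zeta>). \<forall>(\<xi>, \<omega>)\<in>S. cinner \<omega> \<eta> = cinner \<zeta> \<xi>}"

definition modular_op ::
    "('h::chilbert_space \<Rightarrow> 'h) set \<Rightarrow> (('h \<Rightarrow> 'h) \<Rightarrow> ennreal) \<Rightarrow>
     (('h \<Rightarrow> 'h) \<Rightarrow> 'g::chilbert_space) \<Rightarrow> 'g uop" where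
  "modular_op M \<nu> \<Lambda> = tomita_op M \<nu> \<Lambda> O antilinear_adj (tomita_op M \<nu> \<Lambda>)"

definition automorphism_group ::
    "('h::chilbert_space \<Rightarrow> 'h) set \<Rightarrow> (real \<Rightarrow> ('h \<Rightarrow> 'h) \<Rightarrow> 'h \<Rightarrow> 'h) \<Rightarrow> bool" where
  "automorphism_group M \<sigma> \<longleftrightarrow>
     (\<forall>t. bij_betw (\<sigma> t) M M) \<and>
     (\<forall>t. \<forall>x\<in>M. \<forall>y\<in>M. \<sigma> t (\<lambda>\<xi>. x \<xi> + y \<xi>) = (\<lambda>\<xi>. \<sigma> t x \<xi> + \<sigma> t y \<xi>) \<and>
        \<sigma> t (x \<circ> y) = \<sigma> t x \<circ> \<sigma> t y) \<and>
     (\<forall>t. \<forall>x\<in>M. \<sigma> t (cadj x) = cadj (\<sigma> t x) \<and>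
        (\<forall>c. \<sigma> t (\<lambda>\<xi>. c *\<^sub>C x \<xi>) = (\<lambda>\<xi>. c *\<^sub>C \<sigma> t x \<xi>))) \<and>
     (\<forall>x\<in>M. \<sigma> 0 x = x) \<and>
     (\<forall>s t. \<forall>x\<in>M. \<sigma> (s + t) x = \<sigma> s (\<sigma> t x)) \<and>
     (\<forall>x\<in>M. \<forall>\<xi>. continuous_on UNIV (\<lambda>t. \<sigma> t x \<xi>))"

text \<open>As \<open>\<rho>\<close> is injective on \<open>M\<close>, the last conjunct determines \<open>\<sigma>\<close>; that it defines an automorphism
  group of \<open>M\<close> is Tomita's theorem.\<close>

definition modular_group ::
    "('h::chilbert_space \<Rightarrow> 'h) set \<Rightarrow> (('h \<Rightarrow> 'h) \<Rightarrow> ennreal) \<Rightarrow>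
     (('h \<Rightarrow> 'h) \<Rightarrow> 'g::chilbert_space) \<Rightarrow> (('h \<Rightarrow> 'h) \<Rightarrow> 'g \<Rightarrow> 'g) \<Rightarrow>
     (real \<Rightarrow> ('h \<Rightarrow> 'h) \<Rightarrow> 'h \<Rightarrow> 'h) \<Rightarrow> bool" where
  "modular_group M \<nu> \<Lambda> \<rho> \<sigma> \<longleftrightarrow> automorphism_group M \<sigma> \<and>
     (\<forall>t. \<forall>x\<in>M. \<rho> (\<sigma> t x) =
        imag_power (modular_op M \<nu> \<Lambda>) t \<circ> \<rho> x \<circ> imag_power (modular_op M \<nu> \<Lambda>) (- t))"


section \<open>The crossed product\<close>

definition Cc :: "(real \<Rightarrow> 'h::chilbert_space) set" where
  "Cc = {f. continuous_on UNIV f \<and> bounded {t. f t \<noteq> 0}}"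

text \<open>\<open>\<iota>\<close> identifies the Hilbert space \<^typ>\<open>'k\<close> with \<open>L\<^sup>2(\<real>, 'h)\<close>, the completion of \<^const>\<open>Cc\<close>.
  Operators on it are specified by their action on the image of \<^const>\<open>Cc\<close>.\<close>

definition L2_space :: "((real \<Rightarrow> 'h::chilbert_space) \<Rightarrow> 'k::chilbert_space) \<Rightarrow> bool" where
  "L2_space \<iota> \<longleftrightarrow>
     (\<forall>f\<in>Cc. \<forall>g\<in>Cc. \<iota> (\<lambda>t. f t + g t) = \<iota> f + \<iota> g) \<and>
     (\<forall>f\<in>Cc. \<forall>c. \<iota> (\<lambda>t. c *\<^sub>C f t) = c *\<^sub>C \<iota> f) \<and>
     (\<forall>f\<in>Cc. \<forall>g\<in>Cc. cinner (\<iota> f) (\<iota> g) = (\<integral>t. cinner (f t) (g t) \<partial>lborel)) \<and>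
     closure (\<iota> ` Cc) = UNIV"

definition L2_op :: "((real \<Rightarrow> 'h::chilbert_space) \<Rightarrow> 'k::chilbert_space) \<Rightarrow>
    ((real \<Rightarrow> 'h) \<Rightarrow> real \<Rightarrow> 'h) \<Rightarrow> 'k \<Rightarrow> 'k" where
  "L2_op \<iota> \<Phi> = (THE T. bounded_clinear T \<and> (\<forall>f\<in>Cc. T (\<iota> f) = \<iota> (\<Phi> f)))"

definition cp_pi :: "((real \<Rightarrow> 'h::chilbert_space) \<Rightarrow> 'k::chilbert_space) \<Rightarrow>
    (real \<Rightarrow> ('h \<Rightarrow> 'h) \<Rightarrow> 'h \<Rightarrow> 'h) \<Rightarrow> ('h \<Rightarrow> 'h) \<Rightarrow> 'k \<Rightarrow> 'k" where
  "cp_pi \<iota> \<sigma> a = L2_op \<iota> (\<lambda>f t. \<sigma> (- t) a (f t))"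

definition cp_lambda ::
    "((real \<Rightarrow> 'h::chilbert_space) \<Rightarrow> 'k::chilbert_space) \<Rightarrow> real \<Rightarrow> 'k \<Rightarrow> 'k" where
  "cp_lambda \<iota> s = L2_op \<iota> (\<lambda>f t. f (t - s))"

definition crossed_product :: "('h::chilbert_space \<Rightarrow> 'h) set \<Rightarrow>
    (real \<Rightarrow> ('h \<Rightarrow> 'h) \<Rightarrow> 'h \<Rightarrow> 'h) \<Rightarrow> ((real \<Rightarrow> 'h) \<Rightarrow> 'k::chilbert_space) \<Rightarrow> ('k \<Rightarrow> 'k) set" where
  "crossed_product M \<sigma> \<iota> = commutant (commutant (cp_pi \<iota> \<sigma> ` M \<union> range (cp_lambda \<iota>)))"

text \<open>The dual action is implemented by the unitaries \<open>(w\<^sub>s f)(t) = e\<^sup>-\<^sup>i\<^sup>s\<^sup>t f(t)\<close>; conjugation by these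
  also gives its extension to unbounded operators.\<close>

definition cp_w :: "((real \<Rightarrow> 'h::chilbert_space) \<Rightarrow> 'k::chilbert_space) \<Rightarrow> real \<Rightarrow> 'k \<Rightarrow> 'k" where
  "cp_w \<iota> s = L2_op \<iota> (\<lambda>f t. cis (- (s * t)) *\<^sub>C f t)"

definition dual_action :: "((real \<Rightarrow> 'h::chilbert_space) \<Rightarrow> 'k::chilbert_space) \<Rightarrow> real \<Rightarrow>
    ('k \<Rightarrow> 'k) \<Rightarrow> 'k \<Rightarrow> 'k" where
  "dual_action \<iota> s x = cp_w \<iota> s \<circ> x \<circ> cp_w \<iota> (- s)"

definition dual_action_uop :: "((real \<Rightarrow> 'h::chilbert_space) \<Rightarrow> 'k::chilbert_space) \<Rightarrow> real \<Rightarrow>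
    'k uop \<Rightarrow> 'k uop" where
  "dual_action_uop \<iota> s x = {(cp_w \<iota> s \<xi>, cp_w \<iota> s \<eta>) |\<xi> \<eta>. (\<xi>, \<eta>) \<in> x}"

text \<open>The dual weight \<open>\<nu> \<circ> \<pi>\<inverse> \<circ> T\<close> with \<open>T x = \<integral> \<theta>\<^sub>s(x) ds\<close>.  Here \<open>T x\<close> lies in the extended
  positive part of \<open>\<pi>(M)\<close> and is given by its quadratic form with values in \<open>[0, \<infinity>]\<close>; the value of
  (the extension of) \<open>\<nu>\<close> at it is the supremum of \<open>\<nu>\<close> over the bounded elements below it.\<close>

definition dual_weight :: "('h::chilbert_space \<Rightarrow> 'h) set \<Rightarrow> (('h \<Rightarrow> 'h) \<Rightarrow> ennreal) \<Rightarrow>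
    (real \<Rightarrow> ('h \<Rightarrow> 'h) \<Rightarrow> 'h \<Rightarrow> 'h) \<Rightarrow> ((real \<Rightarrow> 'h) \<Rightarrow> 'k::chilbert_space) \<Rightarrow>
    ('k \<Rightarrow> 'k) \<Rightarrow> ennreal" where
  "dual_weight M \<nu> \<sigma> \<iota> x =
     (SUP y \<in> {y\<in>pos_part M. \<forall>\<xi>. ennreal (Re (cinner (cp_pi \<iota> \<sigma> y \<xi>) \<xi>)) \<le>
                 (\<integral>\<^sup>+s. ennreal (Re (cinner (dual_action \<iota> s x \<xi>) \<xi>)) \<partial>lborel)}. \<nu> y)"

text \<open>The weight \<open>\<tau>(h\<sqdot>)\<close>, i.e. \<open>x \<mapsto> lim \<tau>(h\<^sub>\<epsilon>\<^sup>1\<^sup>/\<^sup>2 x h\<^sub>\<epsilon>\<^sup>1\<^sup>/\<^sup>2)\<close> as \<open>\<epsilon>\<close> decreases to \<open>0\<close>, with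
  \<open>h\<^sub>\<epsilon> = h(1 + \<epsilon>h)\<inverse>\<close> (Pedersen--Takesaki).  The limit is increasing.\<close>

definition weight_density ::
    "(('k::chilbert_space \<Rightarrow> 'k) \<Rightarrow> ennreal) \<Rightarrow> 'k uop \<Rightarrow> ('k \<Rightarrow> 'k) \<Rightarrow> ennreal" where
  "weight_density \<tau> h x =
     (SUP \<epsilon>\<in>{0<..}. \<tau> (fun_calc_bdd h (\<lambda>s. complex_of_real (sqrt (s / (1 + \<epsilon> * s)))) \<circ> x \<circ>
                       fun_calc_bdd h (\<lambda>s. complex_of_real (sqrt (s / (1 + \<epsilon> * s))))))"

text \<open>\<open>\<tau>\<close> is the canonical trace of the crossed product and \<open>h\<close> the density of the dual weight with
  respect to it.  The condition \<open>h\<^sup>i\<^sup>t = \<lambda>(t)\<close>, i.e. that the Connes cocycle of the dual weight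
  relative to \<open>\<tau>\<close> is \<open>\<lambda>\<close>, singles out \<open>\<tau>\<close> among the traces scaled by the dual action.\<close>

definition canonical_trace_density :: "('h::chilbert_space \<Rightarrow> 'h) set \<Rightarrow> (('h \<Rightarrow> 'h) \<Rightarrow> ennreal) \<Rightarrow>
    (real \<Rightarrow> ('h \<Rightarrow> 'h) \<Rightarrow> 'h \<Rightarrow> 'h) \<Rightarrow> ((real \<Rightarrow> 'h) \<Rightarrow> 'k::chilbert_space) \<Rightarrow>
    (('k \<Rightarrow> 'k) \<Rightarrow> ennreal) \<Rightarrow> 'k uop \<Rightarrow> bool" where
  "canonical_trace_density M \<nu> \<sigma> \<iota> \<tau> h \<longleftrightarrow>
     fns_trace (crossed_product M \<sigma> \<iota>) \<tau> \<and>
     (\<forall>s. \<forall>x\<in>pos_part (crossed_product M \<sigma> \<iota>).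
        \<tau> (dual_action \<iota> s x) = ennreal (exp (- s)) * \<tau> x) \<and>
     positive_selfadjoint h \<and> nonsingular h \<and> affiliated (crossed_product M \<sigma> \<iota>) h \<and>
     (\<forall>s. dual_action_uop \<iota> s h = {(\<xi>, exp (- s) *\<^sub>R \<eta>) |\<xi> \<eta>. (\<xi>, \<eta>) \<in> h}) \<and>
     (\<forall>t. imag_power h t = cp_lambda \<iota> t) \<and>
     (\<forall>x\<in>pos_part (crossed_product M \<sigma> \<iota>). dual_weight M \<nu> \<sigma> \<iota> x = weight_density \<tau> h x)"


section \<open>Measurable operators and generalized singular values\<close>

definition measurable_ops ::
    "('k::chilbert_space \<Rightarrow> 'k) set \<Rightarrow> (('k \<Rightarrow> 'k) \<Rightarrow> ennreal) \<Rightarrow> 'k uop set" where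
  "measurable_ops A \<tau> = {x. closed_densely_defined x \<and> affiliated A x \<and>
     (\<forall>\<delta>>0. \<exists>p\<in>A. is_projection p \<and> range p \<subseteq> Domain x \<and> \<tau> (\<lambda>\<xi>. \<xi> - p \<xi>) \<le> ennreal \<delta>)}"

definition sing_val :: "(('k::chilbert_space \<Rightarrow> 'k) \<Rightarrow> ennreal) \<Rightarrow> real \<Rightarrow> 'k uop \<Rightarrow> real" where
  "sing_val \<tau> t x =
     Inf {s. 0 \<le> s \<and> \<tau> (spectral_resolution (abs_op x) {s<..}) \<le> ennreal t}"

definition haagerup_L1 :: "('h::chilbert_space \<Rightarrow> 'h) set \<Rightarrow>
    (real \<Rightarrow> ('h \<Rightarrow> 'h) \<Rightarrow> 'h \<Rightarrow> 'h) \<Rightarrow> ((real \<Rightarrow> 'h) \<Rightarrow> 'k::chilbert_space) \<Rightarrow>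
    (('k \<Rightarrow> 'k) \<Rightarrow> ennreal) \<Rightarrow> 'k uop set" where
  "haagerup_L1 M \<sigma> \<iota> \<tau> = {x \<in> measurable_ops (crossed_product M \<sigma> \<iota>) \<tau>.
     \<forall>s. dual_action_uop \<iota> s x = {(\<xi>, exp (- s) *\<^sub>R \<eta>) |\<xi> \<eta>. (\<xi>, \<eta>) \<in> x}}"


section \<open>Orlicz functions and Orlicz spaces\<close>

text \<open>Orlicz functions live on \<open>[0, \<infinity>)\<close>; their values at negative reals are irrelevant.\<close>

definition orlicz_function :: "(real \<Rightarrow> ereal) \<Rightarrow> bool" where
  "orlicz_function \<psi> \<longleftrightarrow>
     (\<forall>u\<ge>0. 0 \<le> \<psi> u) \<and> \<psi> 0 = 0 \<and>
     (\<forall>u\<ge>0. \<forall>v\<ge>0. \<forall>c\<in>{0..1}.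
        \<psi> ((1 - c) * u + c * v) \<le> ereal (1 - c) * \<psi> u + ereal c * \<psi> v) \<and>
     (\<psi> \<longlongrightarrow> \<infinity>) at_top \<and>
     (\<exists>u>0. \<psi> u \<noteq> 0) \<and> (\<exists>u>0. \<psi> u \<noteq> \<infinity>) \<and>
     (\<forall>b::real. ereal b = Sup {ereal u |u. 0 < u \<and> \<psi> u < \<infinity>} \<longrightarrow> (\<psi> \<longlongrightarrow> \<psi> b) (at_left b))"

definition conj_fun :: "(real \<Rightarrow> ereal) \<Rightarrow> real \<Rightarrow> ereal" where
  "conj_fun \<psi> u = (SUP v\<in>{0<..}. ereal (u * v) - \<psi> v)"

definition orlicz_inv :: "(real \<Rightarrow> ereal) \<Rightarrow> real \<Rightarrow> real" where
  "orlicz_inv \<psi> t = Sup {s. 0 \<le> s \<and> \<psi> s \<le> ereal t}"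

text \<open>Fundamental functions for the Luxemburg and the Orlicz norm, with value \<open>0\<close> at \<open>0\<close>.\<close>

definition fund_lux :: "(real \<Rightarrow> ereal) \<Rightarrow> real \<Rightarrow> real" where
  "fund_lux \<psi> t = (if 0 < t then 1 / orlicz_inv \<psi> (1 / t) else 0)"

definition fund_orl :: "(real \<Rightarrow> ereal) \<Rightarrow> real \<Rightarrow> real" where
  "fund_orl \<psi> t = (if 0 < t then t / fund_lux (conj_fun \<psi>) t else 0)"

text \<open>The \<open>a\<close> with \<open>[e \<phi>(h)\<^sup>1\<^sup>/\<^sup>2] a [\<phi>(h)\<^sup>1\<^sup>/\<^sup>2 f] \<in> L\<^sup>1\<close> for all projections \<open>e, f\<close> in
  \<^term>\<open>n_ideal M \<nu>\<close>.\<close>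

definition weighted_space :: "('h::chilbert_space \<Rightarrow> 'h) set \<Rightarrow> (('h \<Rightarrow> 'h) \<Rightarrow> ennreal) \<Rightarrow>
    (real \<Rightarrow> ('h \<Rightarrow> 'h) \<Rightarrow> 'h \<Rightarrow> 'h) \<Rightarrow> ((real \<Rightarrow> 'h) \<Rightarrow> 'k::chilbert_space) \<Rightarrow>
    (('k \<Rightarrow> 'k) \<Rightarrow> ennreal) \<Rightarrow> 'k uop \<Rightarrow> (real \<Rightarrow> real) \<Rightarrow> 'k uop set" where
  "weighted_space M \<nu> \<sigma> \<iota> \<tau> h \<phi> = {a \<in> measurable_ops (crossed_product M \<sigma> \<iota>) \<tau>.
     \<forall>e\<in>n_ideal M \<nu>. \<forall>f\<in>n_ideal M \<nu>. is_projection e \<and> is_projection f \<longrightarrow>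
       sprod
         (sprod
           (sprod (graph (cp_pi \<iota> \<sigma> e)) (fun_calc h (\<lambda>s. complex_of_real (sqrt (\<phi> s)))))
           a)
         (sprod (fun_calc h (\<lambda>s. complex_of_real (sqrt (\<phi> s)))) (graph (cp_pi \<iota> \<sigma> f)))
       \<in> haagerup_L1 M \<sigma> \<iota> \<tau>}"

definition orlicz_space_lux :: "('h::chilbert_space \<Rightarrow> 'h) set \<Rightarrow> (('h \<Rightarrow> 'h) \<Rightarrow> ennreal) \<Rightarrow>
    (real \<Rightarrow> ('h \<Rightarrow> 'h) \<Rightarrow> 'h \<Rightarrow> 'h) \<Rightarrow> ((real \<Rightarrow> 'h) \<Rightarrow> 'k::chilbert_space) \<Rightarrow>
    (('k \<Rightarrow> 'k) \<Rightarrow> ennreal) \<Rightarrow> 'k uop \<Rightarrow> (real \<Rightarrow> ereal) \<Rightarrow> 'k uop set" where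
  "orlicz_space_lux M \<nu> \<sigma> \<iota> \<tau> h \<psi> = weighted_space M \<nu> \<sigma> \<iota> \<tau> h (fund_orl (conj_fun \<psi>))"

definition orlicz_space_orl :: "('h::chilbert_space \<Rightarrow> 'h) set \<Rightarrow> (('h \<Rightarrow> 'h) \<Rightarrow> ennreal) \<Rightarrow>
    (real \<Rightarrow> ('h \<Rightarrow> 'h) \<Rightarrow> 'h \<Rightarrow> 'h) \<Rightarrow> ((real \<Rightarrow> 'h) \<Rightarrow> 'k::chilbert_space) \<Rightarrow>
    (('k \<Rightarrow> 'k) \<Rightarrow> ennreal) \<Rightarrow> 'k uop \<Rightarrow> (real \<Rightarrow> ereal) \<Rightarrow> 'k uop set" where
  "orlicz_space_orl M \<nu> \<sigma> \<iota> \<tau> h \<psi> = weighted_space M \<nu> \<sigma> \<iota> \<tau> h (fund_lux (conj_fun \<psi>))"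

end

theory Submission
  imports Defs "HOL-Probability.Probability"
begin

text \<open>Write \<open>\<phi>\<close> for the fundamental function that defines the space, \<open>k = \<phi>(h)\<^sup>1\<^sup>/\<^sup>2\<close> and \<open>t = e\<^sup>-\<^sup>s\<close>. As \<open>\<phi>\<close> is quasiconcave,
 \<open>\<theta>\<^sub>s(k) = k D\<close>, where \<open>D = (\<phi>(e\<^sup>-\<^sup>s h)/\<phi>(h))\<^sup>1\<^sup>/\<^sup>2\<close> is a contraction with bounded inverse. The operators \<open>[e k] a [k f]\<close>
 are scaled by \<open>e\<^sup>-\<^sup>s\<close> under \<open>\<theta>\<^sub>s\<close>, hence \<open>e\<^sup>s D \<theta>\<^sub>s(a) D\<close> and \<open>a\<close> agree between the vectors \<open>k f x\<close>. These
 are total, so the two operators agree where both are defined. Since \<open>D\<close> is a contraction, a vector in the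
 range of \<open>\<chi>\<^sub>(\<^sub>l\<^sub>,\<^sub>\<infinity>\<^sub>)(|a|)\<close> with \<open>l > e\<^sup>s \<mu>\<^sub>1(a)\<close> cannot be mapped by \<open>D\<close> into the kernel of
 \<open>\<theta>\<^sub>s(\<chi>\<^sub>(\<^sub>r\<^sub>,\<^sub>\<infinity>\<^sub>)(|a|))\<close>, \<open>r = l e\<^sup>-\<^sup>s\<close>, so the first projection has at most the trace of the second, which is at most \<open>e\<^sup>-\<^sup>s = t\<close>.

 The domain of \<open>e h\<^sup>1\<^sup>/\<^sup>2\<close> is large in trace because \<open>h\<close> is the density of the dual weight and \<open>\<nu>(e) < \<infinity>\<close>; as
 \<open>\<phi>(r) <= \<phi>(1) (1 + r)\<close>, the same holds for \<open>e k\<close>.\<close>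

text \<open>The obstacle is that strong products of unbounded operators cannot be manipulated
  freely. Two devices replace this. Subspaces are kept trace dense: they contain ranges of
  projections of the algebra whose complements have arbitrarily small trace. This survives
  intersections, suitable preimages and the dual action, and a trace-dense linear subspace is a core
  for every affiliated closed operator. And of the products in the definition of the spaces only one
  fact is used: the unclosed product lies in an operator of degree one. The comparison with the
  dilated operator sees values only through pairings with a total set, and only at special vectors.
  It is therefore made first for the adjoints and then for the operators themselves. Totality of
  these vectors needs projections of finite weight to be permuted by \<open>\<sigma>\<close>; this
  is read off from \<open>h^{it} = \<lambda>(t)\<close>, and Gaussian averages of
  \<open>h^{it}\<close> then lead into the domain of \<open>k\<close>. Spectral resolutions are
  picked by \<open>SOME\<close>, so the spectral theorem is proved to give them content.\<close>

abbreviation "cor \<equiv> complex_of_real"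
abbreviation "bcl \<equiv> bounded_clinear"
abbreviation "proj \<equiv> is_projection"
abbreviation "pos \<equiv> positive_op"
abbreviation "cdd \<equiv> closed_densely_defined"
abbreviation "psa \<equiv> positive_selfadjoint"
abbreviation "aff \<equiv> affiliated"
abbreviation "spm \<equiv> spectral_measure"
abbreviation "sib \<equiv> spectral_int_bdd"
abbreviation "sint \<equiv> spectral_int"
abbreviation "resol \<equiv> spectral_resolution"
abbreviation "scm \<equiv> scalar_measure"
abbreviation "BM \<equiv> borel_measurable borel"
abbreviation tends_seq (infix "---->" 60) where "X ----> L \<equiv> X \<longlonglongrightarrow> L"

section \<open>Hilbert space operators\<close>

subclass (in chilbert_space) banach ..

lemma cinner_add_right: "cinner x (y + z) = cinner x y + cinner x z"
 by (metis cinner_add_left cinner_commute complex_cnj_add)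

lemma cinner_scaleC_right: "cinner x (c *\<^sub>C y) = cnj c * cinner x y"
 by (metis cinner_commute cinner_scaleC_left complex_cnj_mult)

lemma cinner_scaleR_left: "cinner (r *\<^sub>R x) y = cor r * cinner x y"
 by (metis cinner_scaleC_left scaleC_of_real)

lemma cinner_scaleR_right: "cinner x (r *\<^sub>R y) = cor r * cinner x y"
 by (metis cinner_scaleC_right scaleC_of_real complex_cnj_complex_of_real)

lemma cinner_minus_left: "cinner (- x) y = - cinner x y"
 using cinner_scaleR_left[of "-1" x y] by simp

lemma cinner_minus_right: "cinner x (- y) = - cinner x y"
 using cinner_scaleR_right[of x "-1" y] by simp

lemma cinner_diff_left: "cinner (x - y) z = cinner x z - cinner y z"
 using cinner_add_left[of x "- y" z] by (simp add: cinner_minus_left)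

lemma cinner_diff_right: "cinner x (y - z) = cinner x y - cinner x z"
 using cinner_add_right[of x y "- z"] by (simp add: cinner_minus_right)

lemma cinner_zero_left [simp]: "cinner 0 y = 0"
 using cinner_diff_left[of 0 0 y] by simp

lemma cinner_zero_right [simp]: "cinner x 0 = 0"
 using cinner_diff_right[of x 0 0] by simp

lemmas cinner_simps = cinner_add_left cinner_add_right cinner_diff_left cinner_diff_right
 cinner_minus_left cinner_minus_right cinner_scaleC_left cinner_scaleC_right
 cinner_scaleR_left cinner_scaleR_right

lemma scaleC_one [simp]: "1 *\<^sub>C x = x"
 using scaleC_of_real[of 1 x] by simp

lemma scaleC_zero_left [simp]: "0 *\<^sub>C x = 0"
 using scaleC_of_real[of 0 x] by simp

lemma scaleC_minus_one: "(-1) *\<^sub>C x = - x"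
 using scaleC_of_real[of "-1" x] by simp

lemma scaleC_diff_right: "c *\<^sub>C (x - y) = c *\<^sub>C x - c *\<^sub>C y"
proof -
 have "c *\<^sub>C (x - y) + c *\<^sub>C y = c *\<^sub>C x"
  by (simp flip: scaleC_add_right)
 thus ?thesis by (simp add: eq_diff_eq)
qed

lemma scaleC_zero_right [simp]: "c *\<^sub>C 0 = 0"
 using scaleC_diff_right[of c 0 0] by simp

lemma scaleC_scaleR_commute: "c *\<^sub>C (r *\<^sub>R x) = r *\<^sub>R (c *\<^sub>C x)"
 by (simp add: scaleC_scaleC mult.commute flip: scaleC_of_real)

lemma cinner_eq: "cinner x y = Complex (inner x y) (inner x (\<i> *\<^sub>C y))"
 by (simp add: complex_eq_iff inner_eq_Re_cinner cinner_scaleC_right)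

lemma cinner_self: "cinner x x = cor ((norm x)^2)"
proof -
 have "Im (cinner x x) = 0"
  using cinner_commute[of x x] by (metis complex_cnj_cancel_iff Reals_cnj_iff complex_is_Real_iff)
 thus ?thesis
  by (simp add: complex_eq_iff power2_norm_eq_inner inner_eq_Re_cinner)
qed

lemma norm_scaleC: "norm (c *\<^sub>C x) = cmod c * norm x"
proof -
 have "cinner (c *\<^sub>C x) (c *\<^sub>C x) = (c * cnj c) * cinner x x" by (simp add: cinner_simps)
 hence "cor ((norm (c *\<^sub>C x))^2) = cor ((cmod c * norm x)^2)"
  unfolding cinner_self complex_norm_square[symmetric] by (simp add: power_mult_distrib)
 hence "(norm (c *\<^sub>C x))^2 = (cmod c * norm x)^2" using of_real_eq_iff by blast
 thus ?thesis by (simp add: power2_eq_iff_nonneg)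
qed

text \<open>Multiplying \<open>x\<close> by the phase that makes the inner product real and
  nonnegative reduces the claim to the real Cauchy-Schwarz inequality.\<close>

lemma cmod_cinner_le: "cmod (cinner x y) <= norm x * norm y"
proof (cases "cinner x y = 0")
 case False
 define z c where "z = cinner x y" and "c = cnj z / cor (cmod z)"
 have z: "z ~= 0" using False by (simp add: z_def)
 have c: "cmod c = 1" using z by (simp add: c_def norm_divide)
 have "c * z = cor (cmod z)"
  using z by (simp add: c_def field_simps complex_norm_square[symmetric] power2_eq_square
    mult.commute[of "cnj z"])
 hence "inner (c *\<^sub>C x) y = cmod z"
  by (simp add: inner_eq_Re_cinner cinner_simps flip: z_def)
 moreover have "inner (c *\<^sub>C x) y <= norm (c *\<^sub>C x) * norm y" by (rule norm_cauchy_schwarz)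
 ultimately show ?thesis by (simp add: norm_scaleC c z_def)
qed simp

lemma cinner_ext: "(!!z. cinner x z = cinner y z) ==> x = y"
 using cinner_self[of "x - y"] by (simp add: cinner_simps)

lemma cinner_ext_right: "(!!z. cinner z x = cinner z y) ==> x = y"
 using cinner_self[of "x - y"] by (simp add: cinner_simps)

lemma bounded_linear_scaleC: "bounded_linear (\<lambda>x. c *\<^sub>C x)"
 by (rule bounded_linear_intro[where K = "cmod c"])
   (simp_all add: scaleC_add_right scaleC_scaleR_commute norm_scaleC mult.commute)

lemmas tendsto_scaleC = bounded_linear.tendsto[OF bounded_linear_scaleC]

lemma tendsto_cinner:
 assumes "(f \<longlongrightarrow> a) F" "(g \<longlongrightarrow> b) F"
 shows "((\<lambda>x. cinner (f x) (g x)) \<longlongrightarrow> cinner a b) F"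
 unfolding cinner_eq by (intro tendsto_Complex tendsto_inner assms tendsto_scaleC)

lemma bclI:
 assumes "!!x y. T (x + y) = T x + T y" "!!c x. T (c *\<^sub>C x) = c *\<^sub>C T x" "!!x. norm (T x) <= norm x * K"
 shows "bcl T"
 unfolding bounded_clinear_def
 using assms by (auto intro!: bounded_linear_intro[where K = K] simp flip: scaleC_of_real)

lemma bcl_linear: "bcl T ==> bounded_linear T"
 by (simp add: bounded_clinear_def)

lemmas bcl_add = bounded_linear.linear[OF bcl_linear, THEN linear_add]
 and bcl_diff = bounded_linear.linear[OF bcl_linear, THEN linear_diff]
 and bcl_neg = bounded_linear.linear[OF bcl_linear, THEN linear_neg]
 and bcl_scaleR = bounded_linear.linear[OF bcl_linear, THEN linear_scale]
 and bcl_0 = bounded_linear.linear[OF bcl_linear, THEN linear_0]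
 and bcl_tendsto = bounded_linear.tendsto[OF bcl_linear]

lemma bcl_scaleC: "bcl T ==> T (c *\<^sub>C x) = c *\<^sub>C T x"
 by (simp add: bounded_clinear_def)

lemmas bcl_simps = bcl_add bcl_diff bcl_neg bcl_scaleR bcl_0 bcl_scaleC

lemma bcl_bound:
 assumes "bcl T" obtains K where "K > 0" "!!x. norm (T x) <= K * norm x"
 using bounded_linear.pos_bounded[OF bcl_linear[OF assms]] by (metis mult.commute)

lemma bcl_id: "bcl id" "bcl (\<lambda>x. x)"
 by (auto intro!: bclI[where K = 1])

lemma bcl_zero: "bcl (\<lambda>x. 0)"
 by (auto intro!: bclI[where K = 1])

lemma bcl_comp: "bcl S ==> bcl T ==> bcl (S o T)"
 unfolding bounded_clinear_def by (auto simp: o_def intro: bounded_linear_compose)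

lemma bcl_plus: "bcl S ==> bcl T ==> bcl (\<lambda>x. S x + T x)"
 unfolding bounded_clinear_def by (auto intro: bounded_linear_add simp: scaleC_add_right)

lemma bcl_minus: "bcl S ==> bcl T ==> bcl (\<lambda>x. S x - T x)"
 unfolding bounded_clinear_def by (auto intro: bounded_linear_sub simp: scaleC_diff_right)

lemma bcl_cmult: "bcl T ==> bcl (\<lambda>x. c *\<^sub>C T x)"
 unfolding bounded_clinear_def
 by (auto intro: bounded_linear_compose[OF bounded_linear_scaleC] simp: scaleC_scaleC mult.commute)

lemma bcl_rmult: "bcl T ==> bcl (\<lambda>x. c *\<^sub>R T x)"
 using bcl_cmult[of T "cor c"] by (simp add: scaleC_of_real)

lemma bcl_limit:
 assumes "!!n. bcl (T n)" "!!n x. norm (T n x) <= C * norm x"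
  and "!!x. (\<lambda>n. T n x) ----> S x"
 shows "bcl S"
proof (rule bclI[where K = C])
 show "S (x + y) = S x + S y" for x y
  using tendsto_add[OF assms(3)[of x] assms(3)[of y]] assms(3)[of "x + y"]
  by (simp add: bcl_simps[OF assms(1)] LIMSEQ_unique)
 show "S (c *\<^sub>C x) = c *\<^sub>C S x" for c x
  using tendsto_scaleC[OF assms(3)[of x], of c] assms(3)[of "c *\<^sub>C x"]
  by (simp add: bcl_simps[OF assms(1)] LIMSEQ_unique)
 show "norm (S x) <= norm x * C" for x
  using LIMSEQ_le_const2[OF tendsto_norm[OF assms(3)[of x]]] assms(2)[of _ x]
  by (auto simp: mult.commute)
qed

text \<open>A minimising sequence for the distance is Cauchy by the parallelogram identity.
  Optimality of its limit gives a one-sided inequality for the residual, and the sign change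
  available in a subspace turns it into orthogonality.\<close>

lemma orthogonal_decomposition:
 fixes S :: "'a::{real_inner,complete_space} set"
 assumes "closed S" "subspace S"
 shows "\<exists>y\<in>S. \<forall>z\<in>S. inner (x - y) z = 0"
proof -
 define d where "d = Inf ((\<lambda>y. (norm (x - y))^2) ` S)"
 have ne: "(\<lambda>y. (norm (x - y))^2) ` S ~= {}" using subspace_0[OF assms(2)] by auto
 have bdd: "bdd_below ((\<lambda>y. (norm (x - y))^2) ` S)" by (rule bdd_belowI[of _ 0]) auto
 have d_le: "d <= (norm (x - y))^2" if "y \<in> S" for y
  unfolding d_def using that bdd by (simp add: cInf_lower)
 have "\<exists>y\<in>S. (norm (x - y))^2 < d + 1 / real (Suc n)" for n
  using cInf_lessD[OF ne, of "d + 1 / real (Suc n)"] by (auto simp: d_def)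
 then obtain Y where Y: "!!n. Y n \<in> S" "!!n. (norm (x - Y n))^2 < d + 1 / real (Suc n)" by metis
 have par: "(norm (Y m - Y n))^2 <= 2 / real (Suc m) + 2 / real (Suc n)" for m n
 proof -
  have "(1/2) *\<^sub>R (Y m + Y n) \<in> S" using Y assms(2) by (simp add: subspace_add subspace_scale)
  from d_le[OF this] have "d <= (norm (x - (1/2) *\<^sub>R (Y m + Y n)))^2" .
  moreover have "(norm (Y m - Y n))^2 = 2 * (norm (x - Y m))^2 + 2 * (norm (x - Y n))^2
    - 4 * (norm (x - (1/2) *\<^sub>R (Y m + Y n)))^2"
   by (simp add: power2_norm_eq_inner inner_simps inner_commute algebra_simps)
  ultimately show ?thesis using Y(2)[of m] Y(2)[of n] by simp
 qed
 have "Cauchy Y"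
 proof (rule metric_CauchyI)
  fix e :: real assume e: "e > 0"
  obtain M where M: "1 / real (Suc M) < e\<^sup>2 / 4"
   using e by (meson nat_approx_posE zero_less_divide_iff zero_less_power zero_less_numeral)
  have "dist (Y m) (Y n) < e" if "m \<ge> M" "n \<ge> M" for m n
  proof -
   have "1 / real (Suc m) <= 1 / real (Suc M)" "1 / real (Suc n) <= 1 / real (Suc M)"
    using that by (auto intro!: divide_left_mono)
   hence "(norm (Y m - Y n))^2 < e\<^sup>2" using par[of m n] M by auto
   thus ?thesis using e by (simp add: dist_norm power_less_imp_less_base)
  qed
  thus "\<exists>M. \<forall>m\<ge>M. \<forall>n\<ge>M. dist (Y m) (Y n) < e" by blast
 qed
 then obtain y where y: "Y ----> y" using Cauchy_convergent convergent_def by blast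
 have yS: "y \<in> S" using closed_sequentially[OF assms(1)] Y(1) y by blast
 have "(\<lambda>n. (norm (x - Y n))^2) ----> (norm (x - y))\<^sup>2" by (intro tendsto_intros y)
 moreover have "(\<lambda>n. d + 1 / real (Suc n)) ----> d + 0"
  by (intro tendsto_intros LIMSEQ_Suc lim_1_over_n)
 ultimately have min: "(norm (x - y))^2 <= d"
  using LIMSEQ_le[of "\<lambda>n. (norm (x - Y n))^2" _ "\<lambda>n. d + 1 / real (Suc n)" "d + 0"]
   less_imp_le[OF Y(2)] by auto
 have "dist x y <= dist x z" if "z \<in> S" for z
  using power2_le_imp_le[OF order_trans[OF min d_le[OF that]]] by (simp add: dist_norm)
 hence le: "inner (x - y) z <= 0" if "z \<in> S" for z
  using any_closest_point_dot[OF subspace_imp_convex[OF assms(2)] assms(1) yS, of "y + z" x] that yS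
  by (simp add: subspace_add[OF assms(2)])
 have "inner (x - y) z = 0" if "z \<in> S" for z using le[OF that] le[OF subspace_neg[OF assms(2) that]] by simp
 with yS show ?thesis by blast
qed

text \<open>The kernel has codimension one, so the residual \<open>u\<close> of a vector outside it
  spans the orthogonal complement and represents \<open>f\<close> after scaling.\<close>

lemma riesz_representation:
 fixes f :: "'a::{real_inner,complete_space} => real"
 assumes "bounded_linear f"
 shows "\<exists>y. \<forall>x. f x = inner x y"
proof (cases "\<forall>x. f x = 0")
 case True thus ?thesis by (intro exI[of _ 0]) simp
next
 case False
 then obtain x where x: "f x ~= 0" by blast
 interpret f: bounded_linear f by fact
 define S where "S = {x. f x = 0}"
 have "closed S" unfolding S_def
  by (intro closed_Collect_eq continuous_on_const linear_continuous_on assms)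
 moreover have "subspace S" by (auto simp: S_def subspace_def f.add f.scale)
 ultimately obtain y where y: "y \<in> S" "!!z. z \<in> S ==> inner (x - y) z = 0"
  using orthogonal_decomposition by blast
 define u where "u = x - y"
 have fu: "f u ~= 0" using x y(1) by (simp add: u_def f.diff S_def)
 hence u: "u ~= 0" using f.zero by auto
 have "f z = inner z ((f u / (norm u)^2) *\<^sub>R u)" for z
 proof -
  have "z - (f z / f u) *\<^sub>R u \<in> S" using fu by (simp add: S_def f.diff f.scale)
  hence "inner u (z - (f z / f u) *\<^sub>R u) = 0" using y(2) u_def by blast
  hence "inner z u = (f z / f u) * (norm u)^2"
   by (simp add: inner_simps power2_norm_eq_inner inner_commute)
  thus ?thesis using fu u by (simp add: field_simps)
 qed
 thus ?thesis by blast
qed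

text \<open>The real Riesz theorem settles the real parts; replacing \<open>x\<close> by
  \<open>\<i> *\<^sub>C x\<close> and using complex linearity of \<open>T\<close> recovers the
  imaginary parts.\<close>

lemma cadj_exists:
 fixes T :: "'a::chilbert_space => 'a"
 assumes T: "bcl T"
 shows "\<exists>S. bcl S \<and> (\<forall>x y. cinner (T x) y = cinner x (S y))"
proof -
 have "\<exists>z. \<forall>x. inner (T x) y = inner x z" for y
  by (intro riesz_representation bounded_linear_inner_left_comp bcl_linear T)
 then obtain S where S: "!!x y. inner (T x) y = inner x (S y)" by metis
 have C: "cinner (T x) y = cinner x (S y)" for x y
 proof -
  have *: "Im (cinner u v) = - inner (\<i> *\<^sub>C u) v" for u v :: 'a
   by (simp add: inner_eq_Re_cinner cinner_simps)
  show ?thesis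
   using S[of x y] S[of "\<i> *\<^sub>C x" y]
   by (simp add: complex_eq_iff * bcl_simps[OF T]) (simp add: inner_eq_Re_cinner)
 qed
 obtain K where K: "K > 0" "!!x. norm (T x) <= K * norm x" using bcl_bound[OF T] by blast
 have "bcl S"
 proof (rule bclI[where K = K])
  fix x y :: 'a and c
  have "cinner z (S (x + y)) = cinner z (S x + S y)" for z
   by (simp flip: C add: cinner_simps)
  thus "S (x + y) = S x + S y" by (rule cinner_ext_right)
  have "cinner z (S (c *\<^sub>C x)) = cinner z (c *\<^sub>C S x)" for z
   by (simp flip: C add: cinner_simps)
  thus "S (c *\<^sub>C x) = c *\<^sub>C S x" by (rule cinner_ext_right)
  have "(norm (S x))^2 = inner (T (S x)) x" by (simp add: power2_norm_eq_inner S)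
  also have "... <= norm (T (S x)) * norm x" by (rule norm_cauchy_schwarz)
  also have "... <= K * norm (S x) * norm x" by (intro mult_right_mono K) simp
  finally show "norm (S x) <= norm x * K"
   using K(1) by (cases "norm (S x) = 0") (auto simp: power2_eq_square mult_ac)
 qed
 with C show ?thesis by blast
qed

lemma cadj_eqI:
 assumes "bcl S" "!!x y. cinner (T x) y = cinner x (S y)"
 shows "cadj T = S"
 unfolding cadj_def
proof (rule the_equality)
 fix S' assume "bcl S' \<and> (\<forall>x y. cinner (T x) y = cinner x (S' y))"
 hence "cinner z (S' y) = cinner z (S y)" for z y by (metis assms(2))
 hence "S' y = S y" for y by (rule cinner_ext_right)
 thus "S' = S" by blast
qed (use assms in auto)

lemma
 assumes "bcl T"
 shows bcl_cadj: "bcl (cadj T)"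
  and cadj_right: "cinner (T x) y = cinner x (cadj T y)"
  and cadj_left: "cinner x (T y) = cinner (cadj T x) y"
proof -
 obtain S where S: "bcl S" "!!x y. cinner (T x) y = cinner x (S y)"
  using cadj_exists[OF assms] by blast
 have "cadj T = S" by (rule cadj_eqI) (use S in auto)
 with S show "bcl (cadj T)" "cinner (T x) y = cinner x (cadj T y)" by auto
 thus "cinner x (T y) = cinner (cadj T x) y"
  using cinner_commute[of "T y" x] cinner_commute[of y "cadj T x"] S(2)[of y x] \<open>cadj T = S\<close> by simp
qed

lemma cadj_cadj: "bcl T ==> cadj (cadj T) = T"
 using cadj_left[of T] by (intro cadj_eqI) auto

lemma cadj_comp: "bcl S ==> bcl T ==> cadj (S o T) = cadj T o cadj S"
 using cadj_right[of S] cadj_right[of T] by (intro cadj_eqI) (auto intro: bcl_comp bcl_cadj)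

lemma cadj_id: "cadj id = id"
 by (rule cadj_eqI) (auto simp: bcl_id)

text \<open>Polarisation with \<open>y\<close> and with \<open>\<i> *\<^sub>C y\<close>, possible
  because the scalars are complex. This is the uniqueness behind the \<open>THE\<close> in
  \<open>spectral_int_bdd\<close>.\<close>

lemma quadratic_form_eq:
 assumes S: "bcl S" and T: "bcl T"
  and eq: "!!x. cinner (S x) x = cinner (T x) x"
 shows "S = T"
proof
 fix x
 have "cinner (S x) y = cinner (T x) y" for y
 proof -
  define B where "B u v = cinner (S u) v - cinner (T u) v" for u v
  have B0: "B u u = 0" for u by (simp add: B_def eq)
  have "B x y + B y x = 0"
   using B0[of "x + y"] B0[of x] B0[of y]
   by (simp add: B_def bcl_simps[OF S] bcl_simps[OF T] cinner_simps algebra_simps)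
  moreover have "- \<i> * B x y + \<i> * B y x = 0"
   using B0[of "x + \<i> *\<^sub>C y"] B0[of x] B0[of y]
   by (simp add: B_def bcl_simps[OF S] bcl_simps[OF T] cinner_simps algebra_simps)
  ultimately have "B x y = 0" by (simp add: complex_eq_iff)
  thus ?thesis by (simp add: B_def)
 qed
 thus "S x = T x" by (rule cinner_ext)
qed

section \<open>Self-adjoint and positive operators, monotone limits\<close>

definition self_adj :: "('a::chilbert_space => 'a) => bool" where
 "self_adj T \<longleftrightarrow> bcl T \<and> (\<forall>x y. cinner (T x) y = cinner x (T y))"

lemma self_adj_iff: "self_adj T \<longleftrightarrow> bcl T \<and> cadj T = T"
proof
 show "bcl T \<and> cadj T = T" if "self_adj T"
  using that cadj_eqI[of T T] by (auto simp: self_adj_def)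
 show "self_adj T" if "bcl T \<and> cadj T = T"
  using that cadj_right[of T] by (auto simp: self_adj_def)
qed

lemma self_adj_cinner: "self_adj T ==> cinner (T x) y = cinner x (T y)"
 and self_adj_inner: "self_adj T ==> inner (T x) y = inner x (T y)"
 and self_adj_bcl: "self_adj T ==> bcl T"
 by (auto simp: self_adj_def inner_eq_Re_cinner)

lemma self_adj_real: "self_adj T ==> cinner (T x) x = cor (inner (T x) x)"
proof -
 assume "self_adj T"
 hence "cnj (cinner (T x) x) = cinner (T x) x"
  using self_adj_cinner[of T x x] cinner_commute[of x "T x"] by simp
 thus ?thesis by (simp add: complex_eq_iff inner_eq_Re_cinner)
qed

text \<open>A real quadratic form is also the form of the adjoint, so over the complex numbers
  positivity already forces self-adjointness.\<close>

lemma pos_iff: "pos T \<longleftrightarrow> self_adj T \<and> (\<forall>x. 0 <= inner (T x) x)"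
proof
 assume T: "pos T"
 hence b: "bcl T" and r: "!!x. cinner (T x) x \<in> \<real>\<^sub>\<ge>\<^sub>0" by (auto simp: positive_op_def)
 have "cadj T = T"
 proof (rule quadratic_form_eq)
  fix x
  show "cinner (cadj T x) x = cinner (T x) x"
   using r[of x] cinner_commute[of "T x" x] cadj_left[OF b, of x x]
   by (simp add: complex_eq_iff complex_nonneg_Reals_iff)
 qed (auto intro: b bcl_cadj)
 thus "self_adj T \<and> (\<forall>x. 0 <= inner (T x) x)"
  using b r by (auto simp: self_adj_iff inner_eq_Re_cinner complex_nonneg_Reals_iff)
next
 assume "self_adj T \<and> (\<forall>x. 0 <= inner (T x) x)"
 thus "pos T"
  unfolding positive_op_def by (auto simp: self_adj_real self_adj_bcl complex_nonneg_Reals_iff)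
qed

lemma self_adj_eq:
 assumes "self_adj S" "self_adj T" "!!x. inner (S x) x = inner (T x) x"
 shows "S = T"
 using assms by (intro quadratic_form_eq) (auto simp: self_adj_real self_adj_bcl)

lemma self_adj_plus: "self_adj S ==> self_adj T ==> self_adj (\<lambda>x. S x + T x)"
 by (auto simp: self_adj_def cinner_simps intro: bcl_plus)

lemma self_adj_minus: "self_adj S ==> self_adj T ==> self_adj (\<lambda>x. S x - T x)"
 by (auto simp: self_adj_def cinner_simps intro: bcl_minus)

lemma self_adj_rmult: "self_adj T ==> self_adj (\<lambda>x. c *\<^sub>R T x)"
 by (auto simp: self_adj_def cinner_simps intro: bcl_rmult)

lemma self_adj_id: "self_adj id" "self_adj (\<lambda>x. x)"
 by (auto simp: self_adj_def bcl_id)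

lemma self_adj_zero: "self_adj (\<lambda>x. 0)"
 by (auto simp: self_adj_def bcl_zero)

lemma self_adj_comp: "self_adj S ==> self_adj T ==> S o T = T o S ==> self_adj (S o T)"
 unfolding self_adj_def by (auto simp: bcl_comp fun_eq_iff)

lemma positive_cadj_comp:
 assumes "bcl x" shows "pos (cadj x o x)"
proof -
 have "cinner (cadj x (x u)) v = cinner (x u) (x v)" "cinner u (cadj x (x v)) = cinner (x u) (x v)" for u v
  using cadj_left[OF assms, of "x u" v] cadj_right[OF assms, of u "x v"] by simp_all
 thus ?thesis
  by (simp add: pos_iff self_adj_def bcl_comp bcl_cadj assms inner_eq_Re_cinner cinner_self)
qed

lemma positive_sandwich:
 assumes "pos T" "bcl x"
 shows "pos (cadj x o T o x)"
proof -
 have "cinner (cadj x (T (x u))) v = cinner (T (x u)) (x v)"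
  "cinner u (cadj x (T (x v))) = cinner (x u) (T (x v))" for u v
  using cadj_left[OF assms(2), of "T (x u)" v] cadj_right[OF assms(2), of u "T (x v)"] by simp_all
 moreover have "0 <= Re (cinner (x u) (T (x u)))" for u
  using assms(1) by (metis inner_eq_Re_cinner pos_iff inner_commute)
 ultimately show ?thesis using assms
  by (simp add: pos_iff self_adj_def bcl_comp bcl_cadj inner_eq_Re_cinner)
qed

lemma op_le_iff:
 assumes "self_adj S" "self_adj T"
 shows "op_le S T \<longleftrightarrow> (\<forall>x. inner (S x) x <= inner (T x) x)"
 unfolding op_le_def pos_iff using assms by (auto simp: self_adj_minus inner_diff_left)

text \<open>Expand the nonnegative value of the form at \<open>x - (1/C) *\<^sub>R D x\<close>. The
  inequality converts smallness of a form into smallness of a norm.\<close>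

lemma norm_square_le_form:
 assumes D: "pos D" and C: "C > 0" "!!x. inner (D x) x <= C * (norm x)^2"
 shows "(norm (D x))^2 <= C * inner (D x) x"
proof -
 note sa = D[unfolded pos_iff]
 note l = bcl_simps[OF self_adj_bcl[OF conjunct1[OF sa]]]
 have "0 <= inner (D (x - (1/C) *\<^sub>R D x)) (x - (1/C) *\<^sub>R D x)" using sa by blast
 also have "... = inner (D x) x - (2/C) * inner (D x) (D x) + (1/C)^2 * inner (D (D x)) (D x)"
  using conjunct1[OF sa]
  by (simp add: l inner_simps self_adj_inner algebra_simps power2_eq_square)
 also have "... <= inner (D x) x - (2/C) * (norm (D x))^2 + (1/C)^2 * (C * (norm (D x))^2)"
  using C by (intro add_mono mult_left_mono) (auto simp: power2_norm_eq_inner)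
 also have "... = inner (D x) x - (norm (D x))^2 / C"
  using C by (simp add: field_simps power2_eq_square)
 finally show ?thesis using C by (simp add: field_simps)
qed

lemma positive_form_zero:
 assumes "pos D" "inner (D x) x = 0" shows "D x = 0"
proof -
 have b: "bcl D" using assms(1) by (simp add: positive_op_def)
 obtain K where K: "K > 0" "!!x. norm (D x) <= K * norm x" using bcl_bound[OF b] by blast
 have "inner (D x) x <= K * (norm x)^2" for x
  using order_trans[OF norm_cauchy_schwarz mult_right_mono[OF K(2)]]
  by (simp add: power2_eq_square mult.assoc)
 from norm_square_le_form[OF assms(1) K(1) this, of x] show ?thesis using assms(2) by simp
qed

text \<open>The forms converge as bounded increasing sequences. Applying
  \<open>norm_square_le_form\<close> to the positive differences \<open>T m - T n\<close> turns this
  into norm convergence at every vector.\<close>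

lemma monotone_operator_limit:
 assumes pos: "!!n. pos (T n)" and mono: "!!n. op_le (T n) (T (Suc n))"
  and bd: "!!n x. inner (T n x) x <= C * (norm x)^2"
 shows "\<exists>S. pos S \<and> (\<forall>x. (\<lambda>n. T n x) ----> S x)"
proof -
 define C' where "C' = max C 1"
 have C': "C' > 0" and bd': "inner (T n x) x <= C' * (norm x)^2" for n x
  using bd[of n x] by (auto simp: C'_def intro: order_trans[OF _ mult_right_mono])
 have sa: "self_adj (T n)" for n using pos pos_iff by blast
 have inc: "incseq (\<lambda>n. inner (T n x) x)" for x
  using mono by (intro incseq_SucI) (auto simp: op_le_iff sa)
 have key: "(norm (T m x - T n x))^2 <= C' * (inner (T m x) x - inner (T n x) x)" if "n <= m" for m n x
 proof -
  have "pos (\<lambda>x. T m x - T n x)"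
   using inc that by (auto simp: pos_iff self_adj_minus sa inner_diff_left incseq_def)
  moreover have "inner (T m x - T n x) x <= C' * (norm x)^2" for x
   using bd'[of m x] pos[of n] by (simp add: inner_diff_left pos_iff add_increasing2 diff_le_eq)
  ultimately show ?thesis
   using norm_square_le_form[of "\<lambda>x. T m x - T n x" C' x] C' by (simp add: inner_diff_left)
 qed
 have "\<exists>l. (\<lambda>n. T n x) ----> l" for x
 proof -
  have "convergent (\<lambda>n. inner (T n x) x)"
   using incseq_convergent[OF inc[of x]] bd'[of _ x] by (metis convergentI)
  hence ca: "Cauchy (\<lambda>n. inner (T n x) x)" by (rule convergent_Cauchy)
  have "Cauchy (\<lambda>n. T n x)"
  proof (rule metric_CauchyI)
   fix e :: real assume e: "e > 0"
   hence "e\<^sup>2 / C' > 0" using C' by simp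
   then obtain M where M: "!!m n. m \<ge> M ==> n \<ge> M ==> dist (inner (T m x) x) (inner (T n x) x) < e\<^sup>2 / C'"
    using metric_CauchyD[OF ca] by blast
   have *: "dist (T m x) (T n x) < e" if "m \<ge> M" "n \<ge> M" "n <= m" for m n
   proof -
    have "C' * (inner (T m x) x - inner (T n x) x) < e\<^sup>2"
    proof -
     have "inner (T m x) x - inner (T n x) x < e\<^sup>2 / C'"
      using M[OF that(1,2)] by (auto simp: dist_real_def)
     thus ?thesis using C' by (simp add: field_simps)
    qed
    hence "(norm (T m x - T n x))^2 < e\<^sup>2" using key[OF that(3), of x] by linarith
    thus ?thesis using e by (simp add: dist_norm power_less_imp_less_base)
   qed
   have "dist (T m x) (T n x) < e" if "m \<ge> M" "n \<ge> M" for m n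
    using *[of m n] *[of n m] that by (cases "n <= m") (auto simp: dist_commute)
   thus "\<exists>M. \<forall>m\<ge>M. \<forall>n\<ge>M. dist (T m x) (T n x) < e" by blast
  qed
  thus ?thesis using Cauchy_convergent convergent_def by blast
 qed
 then obtain S where S: "!!x. (\<lambda>n. T n x) ----> S x" by metis
 have nb: "norm (T n x) <= C' * norm x" for n x
 proof -
  have "(norm (T n x))^2 <= C' * inner (T n x) x" by (rule norm_square_le_form[OF pos C' bd'])
  also have "... <= C' * (C' * (norm x)^2)" using C' bd' by simp
  finally have "(norm (T n x))^2 <= (C' * norm x)^2" by (simp add: power2_eq_square mult_ac)
  thus ?thesis using C' by (simp add: power2_le_iff_abs_le)
 qed
 have "bcl S" by (rule bcl_limit[OF self_adj_bcl[OF sa] nb S])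
 moreover have "cinner (S x) y = cinner x (S y)" for x y
  using tendsto_cinner[OF S[of x] tendsto_const[of y]] tendsto_cinner[OF tendsto_const[of x] S[of y]]
  by (simp add: self_adj_cinner[OF sa] LIMSEQ_unique)
 moreover have "0 <= inner (S x) x" for x
  using LIMSEQ_le_const[OF tendsto_inner[OF S[of x] tendsto_const[of x]]] pos
  by (auto simp: pos_iff)
 ultimately show ?thesis using S by (auto simp: pos_iff self_adj_def)
qed

subsection \<open>Projections\<close>

lemma is_projection_iff: "proj p \<longleftrightarrow> self_adj p \<and> (\<forall>x. p (p x) = p x)"
 by (auto simp: is_projection_def self_adj_iff fun_eq_iff)

lemma
 assumes "proj p"
 shows proj_bcl: "bcl p" and proj_sa: "self_adj p" and proj_idem: "p (p x) = p x"
  and proj_inner: "inner (p x) x = (norm (p x))^2" and proj_pos: "pos p"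
  and proj_norm: "norm (p x) <= norm x"
  and proj_pythagoras: "(norm x)^2 = (norm (p x))^2 + (norm (x - p x))^2"
proof -
 have sa: "self_adj p" and i: "p (p x) = p x" for x using assms by (auto simp: is_projection_iff)
 show "bcl p" "self_adj p" "p (p x) = p x" using sa i by (auto simp: self_adj_bcl)
 have n: "inner (p x) x = (norm (p x))^2" for x
  by (metis i power2_norm_eq_inner sa self_adj_inner)
 thus "inner (p x) x = (norm (p x))^2" "pos p" using sa by (auto simp: pos_iff)
 have "inner x (p x) = (norm (p x))^2" using n[of x] by (simp add: inner_commute)
 thus py: "(norm x)^2 = (norm (p x))^2 + (norm (x - p x))^2"
  using n[of x] by (simp add: power2_norm_eq_inner[of "x - p x"] inner_diff_left inner_diff_right
    power2_norm_eq_inner[of x] power2_norm_eq_inner[of "p x", symmetric])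
 show "norm (p x) <= norm x" by (rule power2_le_imp_le) (use py in auto)
qed

lemma proj_compl: "proj p ==> proj (\<lambda>x. x - p x)"
 unfolding is_projection_iff by (auto simp: self_adj_minus self_adj_id bcl_simps self_adj_bcl)

lemma proj_le_iff:
 assumes "proj p" "proj q"
 shows "op_le p q \<longleftrightarrow> (\<forall>x. q (p x) = p x)"
proof
 assume "op_le p q"
 hence "inner (p x) x <= inner (q x) x" for x using op_le_iff assms proj_sa by blast
 hence "(norm (p x))^2 <= (norm (q x))^2" for x by (simp add: proj_inner assms)
 from this[of "p _"] have "(norm (p x - q (p x)))^2 <= 0" for x
  using proj_pythagoras[OF assms(2), of "p x"] by (metis proj_idem[OF assms(1)] add_le_same_cancel1)
 thus "\<forall>x. q (p x) = p x" by simp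
next
 assume h: "\<forall>x. q (p x) = p x"
 have "(norm (p x))^2 <= (norm (q x))^2" for x
 proof -
  have "cinner (p (q x)) y = cinner (p x) y" for y
   using h by (simp add: self_adj_cinner proj_sa assms)
  hence "p (q x) = p x" by (rule cinner_ext)
  thus ?thesis using proj_norm[OF assms(1), of "q x"] by simp
 qed
 thus "op_le p q" by (simp add: op_le_iff proj_sa assms proj_inner)
qed

section \<open>Complex subspaces and their orthogonal projections\<close>

definition csubspace :: "'a::chilbert_space set => bool" where
 "csubspace V \<longleftrightarrow> 0 \<in> V \<and> (\<forall>x\<in>V. \<forall>y\<in>V. x + y \<in> V) \<and> (\<forall>c. \<forall>x\<in>V. c *\<^sub>C x \<in> V)"

lemma csubspace_subspace: "csubspace V ==> subspace V"
 unfolding csubspace_def subspace_def by (metis scaleC_of_real)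

lemma subspace_closure:
 fixes S :: "'a::real_normed_vector set"
 assumes S: "subspace S" shows "subspace (closure S)"
 unfolding subspace_def
proof (intro conjI ballI allI)
 show "0 \<in> closure S" using subspace_0[OF S] closure_subset by blast
 fix x y assume "x \<in> closure S" "y \<in> closure S"
 then obtain X Y where "\<forall>n. X n \<in> S" "X ----> x" "\<forall>n. Y n \<in> S" "Y ----> y" by (auto simp: closure_sequential)
 hence "\<forall>n. X n + Y n \<in> S" "(\<lambda>n. X n + Y n) ----> x + y" by (auto intro: subspace_add[OF S] tendsto_add)
 thus "x + y \<in> closure S" unfolding closure_sequential by (intro exI conjI)
next
 fix c x assume "x \<in> closure S"
 then obtain X where "\<forall>n. X n \<in> S" "X ----> x" by (auto simp: closure_sequential)
 hence "\<forall>n. c *\<^sub>R X n \<in> S" "(\<lambda>n. c *\<^sub>R X n) ----> c *\<^sub>R x"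
  by (auto intro: subspace_scale[OF S] tendsto_scaleR)
 thus "c *\<^sub>R x \<in> closure S" unfolding closure_sequential by (intro exI conjI)
qed

lemma csubspace_closure:
 assumes V: "csubspace V" shows "csubspace (closure V)"
proof -
 note S = subspace_closure[OF csubspace_subspace[OF V]]
 have "c *\<^sub>C x \<in> closure V" if "x \<in> closure V" for c x
 proof -
  obtain X where "\<forall>n. X n \<in> V" "X ----> x" using \<open>x \<in> closure V\<close> by (auto simp: closure_sequential)
  hence "\<forall>n. c *\<^sub>C X n \<in> V" "(\<lambda>n. c *\<^sub>C X n) ----> c *\<^sub>C x"
   using V by (auto simp: csubspace_def intro: tendsto_scaleC)
  thus ?thesis unfolding closure_sequential by (intro exI conjI)
 qed
 thus ?thesis using subspace_0[OF S] subspace_add[OF S] by (simp add: csubspace_def)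
qed

lemma orthogonal_real_complex:
 assumes "csubspace V" "!!z. z \<in> V ==> inner x z = 0" "z \<in> V"
 shows "cinner x z = 0"
 using assms by (simp add: cinner_eq csubspace_def zero_complex.code)

lemma projection_onto:
 assumes V: "csubspace V" "closed V"
 obtains p where "proj p" "range p = V" "!!x. p x = x \<longleftrightarrow> x \<in> V"
  "!!x. p x = 0 \<longleftrightarrow> (\<forall>z\<in>V. cinner x z = 0)"
proof -
 have "\<exists>y. y \<in> V \<and> (\<forall>z\<in>V. cinner (x - y) z = 0)" for x
  using orthogonal_decomposition[OF V(2) csubspace_subspace[OF V(1)], of x]
   orthogonal_real_complex[OF V(1)] by blast
 then obtain p where p: "!!x. p x \<in> V" "!!x z. z \<in> V ==> cinner (x - p x) z = 0" by metis
 have u: "p x = y" if "y \<in> V" "\<forall>z\<in>V. cinner (x - y) z = 0" for x y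
 proof -
  have "p x - y \<in> V" using that p(1) csubspace_subspace[OF V(1)] by (simp add: subspace_diff)
  hence "cinner (x - y) (p x - y) - cinner (x - p x) (p x - y) = 0" using that p by simp
  hence "cinner (p x - y) (p x - y) = 0" by (simp flip: cinner_diff_left)
  thus ?thesis by (simp add: cinner_self)
 qed
 have fx: "p x = x \<longleftrightarrow> x \<in> V" for x using u[of x x] p(1)[of x] by auto
 have sc: "c *\<^sub>C p x \<in> V" "p x + p y \<in> V" for c x y using p(1) V(1) by (auto simp: csubspace_def)
 have orth: "cinner (x - p x) (p x) = 0" for x using p by blast
 have "norm (p x) <= norm x" for x
 proof -
  have "(norm x)^2 = (norm (p x))^2 + (norm (x - p x))^2"
  proof -
   have "inner (x - p x) (p x) = 0" using orth[of x] by (simp add: inner_eq_Re_cinner)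
   hence "inner x (p x) = inner (p x) (p x)" "inner (p x) x = inner (p x) (p x)"
    using inner_commute[of x "p x"] by (simp_all add: inner_diff_left)
   thus ?thesis by (simp add: power2_norm_eq_inner inner_diff_left inner_diff_right)
  qed
  thus ?thesis by (metis le_add_same_cancel1 norm_ge_zero power2_le_imp_le zero_le_power2)
 qed
 moreover have "p (x + y) = p x + p y" for x y
 proof (rule u[OF sc(2)], intro ballI)
  fix z assume "z \<in> V"
  hence "cinner (x - p x) z + cinner (y - p y) z = 0" using p(2) by simp
  thus "cinner (x + y - (p x + p y)) z = 0" by (simp add: cinner_simps algebra_simps)
 qed
 moreover have "p (c *\<^sub>C x) = c *\<^sub>C p x" for c x
 proof (rule u[OF sc(1)], intro ballI)
  fix z assume "z \<in> V"
  hence "c * cinner (x - p x) z = 0" using p(2) by simp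
  thus "cinner (c *\<^sub>C x - c *\<^sub>C p x) z = 0" by (simp add: cinner_simps algebra_simps)
 qed
 ultimately have b: "bcl p" by (intro bclI[where K = 1]) auto
 have "cinner (p x) y = cinner x (p y)" for x y
 proof -
  have "cinner (p x) (y - p y) = cnj (cinner (y - p y) (p x))" by (rule cinner_commute)
  hence "cinner (p x) (y - p y) = 0" using p by simp
  moreover have "cinner (x - p x) (p y) = 0" using p by blast
  ultimately show ?thesis by (simp add: cinner_simps)
 qed
 moreover have "range p = V" using fx p(1) by (metis image_subset_iff subset_antisym subsetI rangeI UNIV_I)
 moreover have "p x = 0 \<longleftrightarrow> (\<forall>z\<in>V. cinner x z = 0)" for x
  using u[of 0 x] p(2)[of _ x] V(1) by (auto simp: csubspace_def)
 ultimately show ?thesis using that[of p] b fx p(1)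
  by (auto simp: is_projection_iff self_adj_def)
qed

text \<open>Invariance of the range under \<open>u\<close> gives \<open>p u p = u p\<close>;
  invariance under the adjoint gives \<open>p u = p u p\<close>.\<close>

lemma proj_commute:
 assumes p: "proj p" and u: "bcl u"
  and i: "!!x. p x = x ==> p (u x) = u x" "!!x. p x = x ==> p (cadj u x) = cadj u x"
 shows "p (u x) = u (p x)"
proof -
 have a: "p (u (p x)) = u (p x)" for x using i(1) proj_idem[OF p] by blast
 have b: "p (cadj u (p x)) = cadj u (p x)" for x using i(2) proj_idem[OF p] by blast
 have "cinner (p (u x)) y = cinner (p (u (p x))) y" for y
  by (simp add: self_adj_cinner[OF proj_sa[OF p]] cadj_right[OF u] b)
 hence "p (u x) = p (u (p x))" by (rule cinner_ext)
 thus ?thesis using a by simp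
qed

section \<open>Integration against a spectral measure\<close>

lemma cinner_polarization:
 assumes "bcl T"
 shows "cinner (T x) y = (cinner (T (x + y)) (x + y) - cinner (T (x - y)) (x - y)
  + \<i> * cinner (T (x + \<i> *\<^sub>C y)) (x + \<i> *\<^sub>C y) - \<i> * cinner (T (x - \<i> *\<^sub>C y)) (x - \<i> *\<^sub>C y)) / 4"
 by (simp add: bcl_simps[OF assms] cinner_simps algebra_simps)

definition bdd_borel :: "(real => complex) => bool" where
 "bdd_borel f \<longleftrightarrow> f \<in> BM \<and> (\<exists>K. \<forall>s. cmod (f s) <= K)"

lemma borel_UNIV: "UNIV \<in> sets (borel :: real measure)"
 by simp

lemma bdd_borelI: "f \<in> BM ==> (!!s. cmod (f s) <= K) ==> bdd_borel f"
 by (auto simp: bdd_borel_def)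

lemma bdd_borelE:
 assumes "bdd_borel f" obtains K where "f \<in> BM" "K > 0" "!!s. cmod (f s) <= K"
proof -
 obtain K where K: "f \<in> BM" "!!s. cmod (f s) <= K" using assms by (auto simp: bdd_borel_def)
 hence "cmod (f s) <= max K 1" for s by (meson max.coboundedI1)
 thus ?thesis using that[of "max K 1"] K by auto
qed

lemma bdd_borel_meas: "bdd_borel f ==> f \<in> BM"
 by (simp add: bdd_borel_def)

lemma bdd_borel_add: assumes "bdd_borel f" "bdd_borel g" shows "bdd_borel (\<lambda>s. f s + g s)"
proof -
 obtain K L where "f \<in> BM" "!!s. cmod (f s) <= K" "g \<in> BM" "!!s. cmod (g s) <= L"
  using assms by (auto simp: bdd_borel_def)
 thus ?thesis by (intro bdd_borelI[where K = "K + L"]) (auto intro: norm_triangle_le add_mono)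
qed

lemma bdd_borel_mult: assumes "bdd_borel f" "bdd_borel g" shows "bdd_borel (\<lambda>s. f s * g s)"
proof -
 obtain K L where "f \<in> BM" "!!s. cmod (f s) <= K" "K > 0"
   "g \<in> BM" "!!s. cmod (g s) <= L" "L > 0"
  using assms by (metis bdd_borelE)
 thus ?thesis by (intro bdd_borelI[where K = "K * L"]) (auto simp: norm_mult intro!: mult_mono)
qed

lemma bdd_borel_const: "bdd_borel (\<lambda>s. c)"
 by (rule bdd_borelI[where K = "cmod c"]) auto

lemma bdd_borel_cmult: "bdd_borel f ==> bdd_borel (\<lambda>s. c * f s)"
 by (rule bdd_borel_mult[OF bdd_borel_const])

lemma bdd_borel_diff: "bdd_borel f ==> bdd_borel g ==> bdd_borel (\<lambda>s. f s - g s)"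
 using bdd_borel_add[of f "\<lambda>s. (-1) * g s"] bdd_borel_cmult[of g "-1"] by simp

lemma bdd_borel_indicator: "B \<in> sets borel ==> bdd_borel (indicator B)"
 by (rule bdd_borelI[where K = 1]) (auto simp: indicator_def)

lemma bdd_borel_cnj: "bdd_borel f ==> bdd_borel (\<lambda>s. cnj (f s))"
 unfolding bdd_borel_def
 using measurable_compose[OF _ borel_measurable_continuous_onI[OF continuous_on_cnj[OF continuous_on_id]], of f borel]
 by simp

lemma bdd_borel_of_real:
 "f \<in> BM ==> (!!s. \<bar>f s\<bar> <= K) ==> bdd_borel (\<lambda>s. cor (f s))"
 by (rule bdd_borelI[where K = K]) auto

text \<open>Monotone class principle, with a complex function split into four nonnegative parts. The
  uniform bound \<open>K\<close> is carried through the limit case so that dominated convergence and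
  monotone operator limits apply there.\<close>

lemma bdd_borel_induct [consumes 1, case_names set cmult add seq]:
 assumes f: "bdd_borel f"
  and set: "!!B. B \<in> sets borel ==> P (indicator B)"
  and cmult: "!!c f. bdd_borel f ==> P f ==> P (\<lambda>s. c * f s)"
  and add: "!!f g. bdd_borel f ==> bdd_borel g ==> P f ==> P g ==> P (\<lambda>s. f s + g s)"
  and seq: "!!U u K. \<lbrakk>!!i. U i \<in> BM; u \<in> BM; !!i s. 0 <= U i s;
   !!i s. U i s <= U (Suc i) s; !!i s. U i s <= K; !!s. u s <= K; !!s. (\<lambda>i. U i s) ----> u s; !!s. 0 <= u s;
   !!i. P (\<lambda>s. cor (U i s))\<rbrakk> \<Longrightarrow> P (\<lambda>s. cor (u s))"
 shows "P f"
proof -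
 have real: "P (\<lambda>s. cor (u s))"
  if "u \<in> BM" "!!s. 0 <= u s" "!!s. u s <= K" for u K
  using that
 proof (induction arbitrary: K rule: borel_measurable_induct_real)
  case (set A)
  have "(\<lambda>s. cor (indicator A s)) = indicator A" by (auto simp: indicator_def)
  thus ?case using assms(2)[of A] set by simp
 next
  case (mult u c)
  show ?case
  \<comment> \<open>For \<open>c = 0\<close> the bound on the multiple says nothing about
    \<open>u\<close>, so the zero function is obtained from the empty set instead of the induction
    hypothesis.\<close>
  proof (cases "c = 0")
   case True thus ?thesis using assms(3)[OF bdd_borel_indicator[of "{}"] assms(2)[of "{}"], of 0] by simp
  next
   case False
   hence b: "u s <= K / c" for s using mult.prems[of s] mult.hyps(1) by (simp add: field_simps)
   have "bdd_borel (\<lambda>s. cor (u s))"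
    by (rule bdd_borel_of_real[where K = "K / c"]) (use b mult.hyps in auto)
   from cmult[OF this mult.IH[OF b], of "cor c"] show ?thesis by simp
  qed
 next
  case (add u v)
  have b: "u s <= K" "v s <= K" for s
   using add.prems[of s] add.hyps(2)[of s] add.hyps(4)[of s] by linarith+
  have "bdd_borel (\<lambda>s. cor (u s))" "bdd_borel (\<lambda>s. cor (v s))"
   by (rule bdd_borel_of_real[where K = K]; use b add.hyps in auto)+
  from assms(4)[OF this(2,1) add.IH(2)[OF b(2)] add.IH(1)[OF b(1)]] show ?case by simp
 next
  case (seq U)
  have le: "U i s <= u s" for i s
   using seq.hyps by (intro incseq_le) (auto simp: incseq_def le_fun_def)
  have b: "U i s <= K" for i s using le[of i s] seq.prems[of s] by simp
  have lim: "(\<lambda>i. U i s) ----> u s" for s using seq.hyps by auto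
  have u: "u \<in> BM"
   by (rule borel_measurable_LIMSEQ_real[of borel U]) (use lim seq.hyps in auto)
  show ?case
  proof (rule assms(5)[where U = U and K = K])
   show "U i s <= U (Suc i) s" for i s using \<open>incseq U\<close> by (auto simp: incseq_def le_fun_def)
   show "0 <= u s" for s using order_trans[OF seq.hyps(2) le] .
   show "P (\<lambda>s. cor (U i s))" for i by (rule seq.IH[OF b])
  qed (use seq.hyps seq.prems lim b u in auto)
 qed
 obtain K where K: "f \<in> BM" "!!s. cmod (f s) <= K" using f by (auto simp: bdd_borel_def)
 have m [measurable]: "(\<lambda>s. Re (f s)) \<in> BM" "(\<lambda>s. Im (f s)) \<in> BM"
  using K(1) by auto
 define p where "p g = (\<lambda>s. cor (max 0 (g s)))" for g :: "real => real"
 have p: "P (p g)" "bdd_borel (p g)" if [measurable]: "g \<in> BM" and "!!s. \<bar>g s\<bar> <= K" for g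
 proof -
  have "max 0 (g s) <= K" for s using that(2)[of s] by auto
  thus "P (p g)" "bdd_borel (p g)" unfolding p_def by (auto intro!: real[where K = K] bdd_borel_of_real[where K = K])
 qed
 have Re: "\<bar>Re (f s)\<bar> <= K" "\<bar>Im (f s)\<bar> <= K" for s
  using K(2)[of s] abs_Re_le_cmod[of "f s"] abs_Im_le_cmod[of "f s"] by linarith+
 note pR = p[of "\<lambda>s. Re (f s)"] p[of "\<lambda>s. - Re (f s)"] p[of "\<lambda>s. Im (f s)"] p[of "\<lambda>s. - Im (f s)"]
 define F where "F = (\<lambda>s. (p (\<lambda>s. Re (f s)) s + (-1) * p (\<lambda>s. - Re (f s)) s)
   + (\<i> * p (\<lambda>s. Im (f s)) s + (-\<i>) * p (\<lambda>s. - Im (f s)) s))"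
 have "P F" unfolding F_def
  by (intro add cmult bdd_borel_add bdd_borel_cmult pR) (use Re m in auto)
 moreover have "F = f"
  unfolding F_def p_def fun_eq_iff complex_eq_iff by (auto simp: max_def)
 ultimately show ?thesis by simp
qed

section \<open>Spectral measures, their scalar measures and the bounded calculus\<close>

context
 fixes E :: "real set => 'a::chilbert_space => 'a"
 assumes E: "spm E"
begin

lemma sm_proj: "B \<in> sets borel ==> proj (E B)"
 using E by (simp add: spectral_measure_def)

lemma sm_UNIV: "E UNIV x = x"
 using E by (simp add: spectral_measure_def)

lemma sm_Int: "B \<in> sets borel ==> C \<in> sets borel ==> E B (E C x) = E (B \<inter> C) x"
 using E by (simp add: spectral_measure_def)

lemma sm_sums:
 assumes "!!n. B n \<in> sets borel" "disjoint_family B"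
 shows "(\<lambda>n::nat. E (B n) x) sums E (\<Union>n. B n) x"
 using E assms unfolding spectral_measure_def by (metis image_subset_iff)

lemma sm_empty [simp]: "E {} x = 0"
proof -
 have "(\<lambda>n::nat. E {} x) sums E (\<Union>n::nat. {}) x" by (rule sm_sums) (auto simp: disjoint_family_on_def)
 hence "(\<lambda>n::nat. E {} x) ----> 0" by (intro summable_LIMSEQ_zero) (auto simp: sums_iff)
 thus ?thesis by (simp add: LIMSEQ_const_iff)
qed

lemma sm_Un:
 assumes "B \<in> sets borel" "C \<in> sets borel" "B \<inter> C = {}"
 shows "E (B \<union> C) x = E B x + E C x"
proof -
 define F where "F = (\<lambda>n::nat. if n = 0 then B else if n = 1 then C else {})"
 have "disjoint_family F" using assms by (auto simp: disjoint_family_on_def F_def)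
 hence "(\<lambda>n. E (F n) x) sums E (\<Union>n. F n) x" using assms by (intro sm_sums) (auto simp: F_def)
 moreover have "(\<lambda>n. E (F n) x) sums (\<Sum>n\<in>{0,1}. E (F n) x)" by (rule sums_finite) (auto simp: F_def)
 ultimately have "E (\<Union>n. F n) x = E B x + E C x" using sums_unique2 by (fastforce simp: F_def)
 moreover have "(\<Union>n. F n) = B \<union> C" by (auto simp: F_def split: if_splits)
 ultimately show ?thesis by simp
qed

lemma sm_compl: "B \<in> sets borel ==> E (- B) x = x - E B x"
 using sm_Un[of B "- B" x] sm_UNIV[of x] by (simp add: algebra_simps)

lemma sm_mono: "B \<in> sets borel ==> C \<in> sets borel ==> B \<subseteq> C ==> E B x = x ==> E C x = x"
 by (metis inf.absorb2 sm_Int)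

lemma scalar_measure_space [simp]: "space (scm E x) = UNIV"
 and scalar_measure_sets [simp, measurable_cong]: "sets (scm E x) = sets borel"
proof -
 have "sigma_sets UNIV (sets borel :: real set set) = sets borel"
  using sets.sigma_sets_eq[of "borel :: real measure"] by simp
 thus "space (scm E x) = UNIV" "sets (scm E x) = sets borel"
  unfolding scalar_measure_def by (auto simp: space_measure_of sets_measure_of)
qed

lemma measurable_scalar [simp]: "borel_measurable (scm E x) = BM"
 by (rule measurable_cong_sets) simp_all

lemma emeasure_scalar: "B \<in> sets borel ==> emeasure (scm E x) B = ennreal ((norm (E B x))^2)"
 unfolding scalar_measure_def
proof (rule emeasure_measure_of_sigma)
 show "sigma_algebra UNIV (sets borel :: real set set)"
  using sets.sigma_algebra_axioms[of "borel :: real measure"] by simp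
 show "positive (sets borel) (\<lambda>B. ennreal ((norm (E B x))^2))" by (simp add: positive_def)
 show "countably_additive (sets borel) (\<lambda>B. ennreal ((norm (E B x))^2))"
  unfolding countably_additive_def
 proof (intro allI impI)
  fix F :: "nat => real set" assume F: "range F \<subseteq> sets borel" "disjoint_family F" "\<Union> (range F) \<in> sets borel"
  hence Fb: "F n \<in> sets borel" for n by auto
  have "(\<lambda>n. inner (E (F n) x) x) sums inner (E (\<Union>n. F n) x) x"
   using sm_sums[OF Fb F(2)] by (rule bounded_linear.sums[OF bounded_linear_inner_left])
  hence "(\<lambda>n. (norm (E (F n) x))^2) sums (norm (E (\<Union>n. F n) x))\<^sup>2"
   using F(3) by (simp add: proj_inner[OF sm_proj] Fb)
  thus "(\<Sum>i. ennreal ((norm (E (F i) x))^2)) = ennreal ((norm (E (\<Union> (range F)) x))^2)"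
   by (intro suminf_ennreal_eq) auto
 qed
qed

lemma finite_scalar: "finite_measure (scm E x)"
 by (rule finite_measureI) (simp add: emeasure_scalar)

lemma measure_scalar: "B \<in> sets borel ==> measure (scm E x) B = (norm (E B x))^2"
 by (simp add: measure_def emeasure_scalar)

lemma measure_scalar_UNIV: "measure (scm E x) UNIV = (norm x)^2"
 by (simp add: measure_scalar sm_UNIV)

lemma integrable_scalar:
 assumes "f \<in> BM" "!!s. norm (f s) <= K"
 shows "integrable (scm E x) (f :: real => 'b::{banach,second_countable_topology})"
 using assms by (intro finite_measure.integrable_const_bound[OF finite_scalar, of _ K]) auto

lemma integrable_scalar_bdd: "bdd_borel f ==> integrable (scm E x) f"
 by (auto simp: bdd_borel_def intro: integrable_scalar)

lemma integral_scalar_le: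
 fixes f :: "real => real"
 assumes "f \<in> BM" "!!s. 0 <= f s" "!!s. f s <= K"
 shows "(\<integral>s. f s \<partial>scm E x) <= K * (norm x)^2"
proof -
 have "(\<integral>s. f s \<partial>scm E x) <= (\<integral>s. K \<partial>scm E x)"
  using assms by (intro integral_mono integrable_scalar[where K = K] integrable_scalar[where K = "\<bar>K\<bar>"]) auto
 thus ?thesis by (simp add: measure_scalar_UNIV mult.commute)
qed

lemma scalar_E: "C \<in> sets borel ==> scm E (E C x) = density (scm E x) (indicator C)"
 by (rule measure_eqI) (simp_all add: emeasure_restricted emeasure_scalar sm_Int Int_commute)

lemma integral_scalar_E:
 fixes f :: "real => complex"
 assumes "C \<in> sets borel" "f \<in> BM"
 shows "(\<integral>s. f s \<partial>scm E (E C x)) = (\<integral>s. indicator C s * f s \<partial>scm E x)"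
proof -
 have "(\<integral>s. f s \<partial>density (scm E x) (\<lambda>s. ennreal (indicator C s))) =
   (\<integral>s. indicator C s *\<^sub>R f s \<partial>scm E x)"
  using assms by (intro integral_density) auto
 thus ?thesis using assms
  by (simp add: scalar_E ennreal_indicator scaleR_conv_of_real of_real_indicator)
qed

text \<open>The operator is otherwise known only through its form, from which commutation is awkward
  to read off; the commutation clause is therefore carried through the induction, where sums and
  strong limits preserve it.\<close>

lemma bounded_calculus_exists:
 assumes "bdd_borel f"
 shows "\<exists>T. bcl T \<and> (\<forall>x. cinner (T x) x = (\<integral>s. f s \<partial>scm E x)) \<and>
  (\<forall>u. bcl u --> (\<forall>B\<in>sets borel. \<forall>x. u (E B x) = E B (u x)) --> (\<forall>x. u (T x) = T (u x)))"
 using assms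
proof (induction rule: bdd_borel_induct)
 case (set B)
 show ?case
 proof (intro exI[of _ "E B"] conjI allI impI)
  fix x
  have "(\<integral>s. indicator B s \<partial>scm E x) = (\<integral>s. cor (indicator B s) \<partial>scm E x)"
   by (intro Bochner_Integration.integral_cong) (auto simp: indicator_def)
  also have "... = cor ((norm (E B x))^2)"
   using set by (simp add: measure_scalar)
  finally show "cinner (E B x) x = (\<integral>s. indicator B s \<partial>scm E x)"
   by (simp add: self_adj_real[OF proj_sa] sm_proj set proj_inner)
 qed (use set sm_proj proj_bcl in auto)
next
 case (cmult c f)
 then obtain T where T: "bcl T" "!!x. cinner (T x) x = (\<integral>s. f s \<partial>scm E x)"
  "!!u x. bcl u ==> (\<forall>B\<in>sets borel. \<forall>x. u (E B x) = E B (u x)) ==> u (T x) = T (u x)" by blast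
 show ?case
 proof (intro exI[of _ "\<lambda>x. c *\<^sub>C T x"] conjI allI impI)
  fix u x assume "bcl u" "\<forall>B\<in>sets borel. \<forall>x. u (E B x) = E B (u x)"
  thus "u (c *\<^sub>C T x) = c *\<^sub>C T (u x)" using T(3) by (simp add: bcl_scaleC)
 qed (use T in "auto simp: cinner_simps intro: bcl_cmult")
next
 case (add f g)
 from add.IH obtain S T where
  T: "bcl T" "!!x. cinner (T x) x = (\<integral>s. f s \<partial>scm E x)"
  "!!u x. bcl u ==> (\<forall>B\<in>sets borel. \<forall>x. u (E B x) = E B (u x)) ==> u (T x) = T (u x)" and
  S: "bcl S" "!!x. cinner (S x) x = (\<integral>s. g s \<partial>scm E x)"
  "!!u x. bcl u ==> (\<forall>B\<in>sets borel. \<forall>x. u (E B x) = E B (u x)) ==> u (S x) = S (u x)"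
  by blast
 show ?case
 proof (intro exI[of _ "\<lambda>x. T x + S x"] conjI allI impI)
  fix u x assume "bcl u" "\<forall>B\<in>sets borel. \<forall>x. u (E B x) = E B (u x)"
  thus "u (T x + S x) = T (u x) + S (u x)" using T(3) S(3) by (simp add: bcl_add)
 qed (use T S add.hyps in "auto simp: cinner_simps integrable_scalar_bdd intro: bcl_plus")
next
 case (seq U u K)
 from seq.IH have "\<exists>T. bcl T \<and> (\<forall>x. cinner (T x) x = (\<integral>s. cor (U i s) \<partial>scm E x)) \<and>
  (\<forall>u. bcl u --> (\<forall>B\<in>sets borel. \<forall>x. u (E B x) = E B (u x)) --> (\<forall>x. u (T x) = T (u x)))" for i .
 then obtain T where T: "!!i. bcl (T i)"
  "!!i x. cinner (T i x) x = (\<integral>s. cor (U i s) \<partial>scm E x)"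
  "!!i u x. bcl u ==> (\<forall>B\<in>sets borel. \<forall>x. u (E B x) = E B (u x)) ==> u (T i x) = T i (u x)"
  by metis
 have T2: "cinner (T i x) x = cor (\<integral>s. U i s \<partial>scm E x)" for i x
  using T(2) by simp
 have int: "integrable (scm E x) (U i)" for x i
  by (rule integrable_scalar[where K = K]) (use seq.hyps in auto)
 have Ti: "inner (T i x) x = (\<integral>s. U i s \<partial>scm E x)" for i x
  by (simp add: inner_eq_Re_cinner T2)
 have pos: "pos (T i)" for i
  unfolding positive_op_def T2 using T(1) seq.hyps by (auto simp: complex_nonneg_Reals_iff)
 have "\<exists>S. pos S \<and> (\<forall>x. (\<lambda>i. T i x) ----> S x)"
 proof (rule monotone_operator_limit[OF pos])
  show "op_le (T i) (T (Suc i))" for i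
   using pos by (subst op_le_iff) (auto simp: pos_iff Ti intro!: integral_mono int seq.hyps)
  show "inner (T i x) x <= K * (norm x)^2" for i x
   unfolding Ti by (rule integral_scalar_le) (use seq.hyps in auto)
 qed
 then obtain S where S: "pos S" "!!x. (\<lambda>i. T i x) ----> S x" by blast
 show ?case
 proof (intro exI[of _ S] conjI allI impI)
  show "bcl S" using S(1) by (simp add: positive_op_def)
  fix x
  have "(\<lambda>i. cinner (T i x) x) ----> cinner (S x) x" by (intro tendsto_cinner S tendsto_const)
  moreover have "(\<lambda>i. \<integral>s. U i s \<partial>scm E x) ----> (\<integral>s. u s \<partial>scm E x)"
   by (rule integral_dominated_convergence[where w = "\<lambda>s. K"])
     (use seq.hyps in \<open>auto intro: integrable_scalar[where K = "\<bar>K\<bar>"]\<close>)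
  hence "(\<lambda>i. cinner (T i x) x) ----> cor (\<integral>s. u s \<partial>scm E x)"
   unfolding T2 by (rule tendsto_of_real)
  ultimately show "cinner (S x) x = (\<integral>s. cor (u s) \<partial>scm E x)"
   using LIMSEQ_unique by fastforce
 next
  fix v x assume v: "bcl v" "\<forall>B\<in>sets borel. \<forall>x. v (E B x) = E B (v x)"
  have "(\<lambda>i. v (T i x)) ----> v (S x)" by (rule bcl_tendsto[OF v(1) S(2)])
  moreover have "(\<lambda>i. v (T i x)) ----> S (v x)" using S(2)[of "v x"] T(3)[OF v] by simp
  ultimately show "v (S x) = S (v x)" by (rule LIMSEQ_unique)
 qed
qed

lemma sib_eqI:
 assumes "bcl T" "!!x. cinner (T x) x = (\<integral>s. f s \<partial>scm E x)"
 shows "sib E f = T"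
 unfolding spectral_int_bdd_def
proof (rule the_equality)
 fix S assume "bcl S \<and> (\<forall>x. cinner (S x) x = (\<integral>s. f s \<partial>scm E x))"
 thus "S = T" using assms by (intro quadratic_form_eq) simp_all
qed (use assms in simp)

lemma
 assumes "bdd_borel f"
 shows sib_bcl: "bcl (sib E f)"
  and sib_form: "cinner (sib E f x) x = (\<integral>s. f s \<partial>scm E x)"
  and sib_commute: "\<lbrakk>bcl u; !!B x. B \<in> sets borel ==> u (E B x) = E B (u x)\<rbrakk>
   \<Longrightarrow> u (sib E f x) = sib E f (u x)"
proof -
 obtain T where T: "bcl T" "\<forall>x. cinner (T x) x = (\<integral>s. f s \<partial>scm E x)"
  "\<forall>u. bcl u --> (\<forall>B\<in>sets borel. \<forall>x. u (E B x) = E B (u x)) --> (\<forall>x. u (T x) = T (u x))"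
  using bounded_calculus_exists[OF assms] by blast
 have "sib E f = T" by (rule sib_eqI) (use T in auto)
 with T show "bcl (sib E f)"
  "cinner (sib E f x) x = (\<integral>s. f s \<partial>scm E x)"
  "\<lbrakk>bcl u; !!B x. B \<in> sets borel ==> u (E B x) = E B (u x)\<rbrakk>
   \<Longrightarrow> u (sib E f x) = sib E f (u x)" by auto
qed

lemma sib_add:
 assumes "bdd_borel f" "bdd_borel g"
 shows "sib E (\<lambda>s. f s + g s) x = sib E f x + sib E g x"
proof -
 have "sib E (\<lambda>s. f s + g s) = (\<lambda>x. sib E f x + sib E g x)"
  by (rule sib_eqI) (use assms in "simp_all add: cinner_simps sib_form integrable_scalar_bdd bcl_plus sib_bcl")
 thus ?thesis by simp
qed

lemma sib_cmult:
 assumes "bdd_borel f"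
 shows "sib E (\<lambda>s. c * f s) x = c *\<^sub>C sib E f x"
proof -
 have "sib E (\<lambda>s. c * f s) = (\<lambda>x. c *\<^sub>C sib E f x)"
  by (rule sib_eqI) (use assms in "simp_all add: cinner_simps sib_form bcl_cmult sib_bcl")
 thus ?thesis by simp
qed

lemma sib_diff:
 assumes "bdd_borel f" "bdd_borel g"
 shows "sib E (\<lambda>s. f s - g s) x = sib E f x - sib E g x"
 using sib_add[OF assms(1) bdd_borel_cmult[OF assms(2), of "-1"], of x] sib_cmult[OF assms(2), of "-1" x]
 by (simp add: scaleC_minus_one)

lemma sib_indicator:
 assumes "B \<in> sets borel" shows "sib E (indicator B) = E B"
proof (rule sib_eqI)
 fix x
 have "(\<integral>s. indicator B s \<partial>scm E x) = (\<integral>s. cor (indicator B s) \<partial>scm E x)"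
  by (intro Bochner_Integration.integral_cong) (auto simp: indicator_def)
 also have "... = cor ((norm (E B x))^2)" using assms by (simp add: measure_scalar)
 finally show "cinner (E B x) x = (\<integral>s. indicator B s \<partial>scm E x)"
  by (simp add: self_adj_real[OF proj_sa] sm_proj assms proj_inner)
qed (simp add: assms sm_proj proj_bcl)

lemma sib_const: "sib E (\<lambda>s. c) x = c *\<^sub>C x"
proof -
 have "sib E (\<lambda>s. c * indicator UNIV s) x = c *\<^sub>C x"
  using sib_cmult[OF bdd_borel_indicator[of UNIV], of c x] sib_indicator[of UNIV]
  by (simp only: sm_UNIV borel_UNIV)
 thus ?thesis by simp
qed

lemma E_commutes: "B \<in> sets borel ==> C \<in> sets borel ==> E B (E C x) = E C (E B x)"
 by (simp add: sm_Int Int_commute)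

lemma sib_E_commute: "bdd_borel f ==> B \<in> sets borel ==> E B (sib E f x) = sib E f (E B x)"
 by (rule sib_commute) (auto simp: proj_bcl sm_proj E_commutes)

lemma sib_E:
 assumes f: "bdd_borel f" and B: "B \<in> sets borel"
 shows "E B (sib E f x) = sib E (\<lambda>s. indicator B s * f s) x"
proof -
 have "sib E (\<lambda>s. indicator B s * f s) = (\<lambda>x. E B (sib E f x))"
 proof (rule sib_eqI)
  show "bcl (\<lambda>x. E B (sib E f x))"
   using bcl_comp[OF proj_bcl[OF sm_proj[OF B]] sib_bcl[OF f]] by (simp add: o_def)
  fix x
  have "cinner (E B (sib E f x)) x = cinner (E B (E B (sib E f x))) x"
   by (simp add: sm_Int B)
  also have "... = cinner (E B (sib E f x)) (E B x)"
   by (rule self_adj_cinner[OF proj_sa[OF sm_proj[OF B]]])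
  also have "... = cinner (sib E f (E B x)) (E B x)"
   by (simp only: sib_E_commute[OF f B])
  also have "... = (\<integral>s. indicator B s * f s \<partial>scm E x)"
   by (simp add: sib_form f integral_scalar_E B bdd_borel_meas)
  finally show "cinner (E B (sib E f x)) x = (\<integral>s. indicator B s * f s \<partial>scm E x)" .
 qed
 thus ?thesis by simp
qed

text \<open>Dominated convergence for the forms, followed by polarisation. Weak convergence suffices
  to prove multiplicativity \<open>sib_mult\<close>; the norm formula and the strong convergence
  \<open>sib_limit\<close> come out of that afterwards.\<close>

lemma sib_weak_limit:
 assumes F: "!!i. F i \<in> BM" "!!i s. cmod (F i s) <= K" and lim: "!!s. (\<lambda>i. F i s) ----> f s"
 shows "(\<lambda>i. cinner (sib E (F i) x) y) ----> cinner (sib E f x) y"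
proof -
 have fm: "f \<in> BM" by (rule borel_measurable_LIMSEQ_metric[OF F(1)]) (use lim in auto)
 have "cmod (f s) <= K" for s
  using LIMSEQ_le_const2[OF tendsto_norm[OF lim[of s]]] F(2) by auto
 hence f: "bdd_borel f" using fm bdd_borelI by blast
 have Fb: "bdd_borel (F i)" for i using F bdd_borelI by blast
 have lim2: "(\<lambda>i. \<integral>s. F i s \<partial>scm E z) ----> (\<integral>s. f s \<partial>scm E z)" for z
  by (rule integral_dominated_convergence[where w = "\<lambda>s. K"])
    (use F lim fm in \<open>auto intro: integrable_scalar[where K = "\<bar>K\<bar>"]\<close>)
 show ?thesis
  unfolding cinner_polarization[OF sib_bcl[OF f], of x y] cinner_polarization[OF sib_bcl[OF Fb], of _ x y]
   sib_form[OF f] sib_form[OF Fb]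
  by (intro tendsto_intros lim2) simp
qed

lemma sib_mult:
 assumes "bdd_borel g" and f: "bdd_borel f"
 shows "sib E g (sib E f x) = sib E (\<lambda>s. g s * f s) x"
 using assms(1)
proof (induction rule: bdd_borel_induct)
 case (set B) thus ?case by (simp add: sib_indicator sib_E f)
next
 case (cmult c g)
 thus ?case using sib_cmult[of "\<lambda>s. g s * f s" c x] by (simp add: sib_cmult bdd_borel_mult f mult.assoc)
next
 case (add g h)
 thus ?case using sib_add[of "\<lambda>s. g s * f s" "\<lambda>s. h s * f s" x]
  by (simp add: sib_add bdd_borel_mult f distrib_right)
next
 case (seq U u K)
 obtain L where L: "f \<in> BM" "L > 0" "!!s. cmod (f s) <= L" using f bdd_borelE by blast
 have K0: "0 <= K" using order_trans[OF seq.hyps(3) seq.hyps(5)] .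
 have "cinner (sib E (\<lambda>s. cor (u s)) (sib E f x)) y =
   cinner (sib E (\<lambda>s. cor (u s) * f s) x) y" for y
 proof (rule LIMSEQ_unique)
  show "(\<lambda>i. cinner (sib E (\<lambda>s. cor (U i s)) (sib E f x)) y) ---->
    cinner (sib E (\<lambda>s. cor (u s)) (sib E f x)) y"
   by (rule sib_weak_limit[where K = K]) (use seq.hyps in "auto intro: tendsto_of_real")
  show "(\<lambda>i. cinner (sib E (\<lambda>s. cor (U i s)) (sib E f x)) y) ---->
    cinner (sib E (\<lambda>s. cor (u s) * f s) x) y"
   unfolding seq.IH
   by (rule sib_weak_limit[where K = "K * L"])
     (use seq.hyps L K0 in "auto intro!: tendsto_intros mult_mono simp: norm_mult intro: order_trans")
 qed
 thus ?case by (rule cinner_ext)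
qed

lemma sib_adj:
 assumes "bdd_borel f"
 shows "cadj (sib E f) = sib E (\<lambda>s. cnj (f s))"
proof (rule sib_eqI[symmetric])
 show "bcl (cadj (sib E f))" using assms by (intro bcl_cadj sib_bcl)
 fix x
 have "cinner (cadj (sib E f) x) x = cnj (cinner (sib E f x) x)"
  using cadj_left[OF sib_bcl[OF assms], of x x] cinner_commute[of x "sib E f x"] by simp
 thus "cinner (cadj (sib E f) x) x = (\<integral>s. cnj (f s) \<partial>scm E x)"
  by (simp add: sib_form assms)
qed

lemma sib_self_adj:
 assumes "bdd_borel f" "!!s. cnj (f s) = f s" shows "self_adj (sib E f)"
 using assms sib_adj[OF assms(1)] by (simp add: self_adj_iff sib_bcl)

lemma sib_norm:
 assumes "bdd_borel f"
 shows "(norm (sib E f x))^2 = (\<integral>s. (cmod (f s))^2 \<partial>scm E x)"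
proof -
 have "cor ((norm (sib E f x))^2) =
   cinner (sib E (\<lambda>s. cnj (f s)) (sib E f x)) x"
  using cadj_left[OF bcl_cadj[OF sib_bcl[OF assms]], of x "sib E f x"]
   cadj_left[OF sib_bcl[OF assms], of "sib E f x" x]
  by (simp only: cinner_self[symmetric] sib_adj[OF assms])
 also have "... = (\<integral>s. cor ((cmod (f s))^2) \<partial>scm E x)"
  by (simp add: sib_mult sib_form bdd_borel_mult bdd_borel_cnj assms complex_norm_square mult.commute del: of_real_power)
 also have "... = cor (\<integral>s. (cmod (f s))^2 \<partial>scm E x)" by (simp del: of_real_power)
 finally show ?thesis using of_real_eq_iff by blast
qed

lemma sib_norm_le:
 assumes "bdd_borel f" "!!s. cmod (f s) <= K"
 shows "norm (sib E f x) <= K * norm x"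
proof (rule power2_le_imp_le)
 have K: "0 <= K" using order_trans[OF norm_ge_zero assms(2)] .
 show "0 <= K * norm x" using K by simp
 show "(norm (sib E f x))^2 <= (K * norm x)^2"
  unfolding sib_norm[OF assms(1)] power_mult_distrib
  by (rule integral_scalar_le) (use assms bdd_borel_meas[OF assms(1)] in "auto intro: power_mono")
qed

text \<open>By the norm formula the squared distance is the integral of
  \<open>(cmod (F i s - f s))\<^sup>2\<close> against the scalar measure, which tends to zero by
  dominated convergence.\<close>

lemma sib_limit:
 assumes F: "!!i. F i \<in> BM" "!!i s. cmod (F i s) <= K" and lim: "!!s. (\<lambda>i. F i s) ----> f s"
 shows "(\<lambda>i. sib E (F i) x) ----> sib E f x"
proof -
 have fm: "f \<in> BM" by (rule borel_measurable_LIMSEQ_metric[OF F(1)]) (use lim in auto)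
 have fK: "cmod (f s) <= K" for s
  using LIMSEQ_le_const2[OF tendsto_norm[OF lim[of s]]] F(2) by auto
 hence f: "bdd_borel f" using fm bdd_borelI by blast
 have Fb: "bdd_borel (F i)" for i using F bdd_borelI by blast
 have "cmod (F i s - f s) <= 2 * K" for i s
  using F(2)[of i s] fK[of s] norm_triangle_ineq4[of "F i s" "f s"] by linarith
 hence b: "(cmod (F i s - f s))^2 <= (2 * K)^2" for i s by (intro power_mono) auto
 have "(\<lambda>i. \<integral>s. (cmod (F i s - f s))^2 \<partial>scm E x) ----> (\<integral>s. 0 \<partial>scm E x)"
 proof (rule integral_dominated_convergence[where w = "\<lambda>s. (2 * K)^2"])
  show "AE s in scm E x. (\<lambda>i. (cmod (F i s - f s))^2) ----> 0"
  proof (rule AE_I2)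
   fix s
   have "(\<lambda>i. (cmod (F i s - f s))^2) ----> (cmod (f s - f s))\<^sup>2" by (intro tendsto_intros lim)
   thus "(\<lambda>i. (cmod (F i s - f s))^2) ----> 0" by simp
  qed
  show "AE s in scm E x. norm ((cmod (F i s - f s))^2) <= (2 * K)^2" for i using b by auto
 qed (use F fm in "auto intro: finite_measure.integrable_const[OF finite_scalar]")
 hence "(\<lambda>i. (norm (sib E (F i) x - sib E f x))^2) ----> 0"
  by (simp add: sib_norm bdd_borel_diff Fb f flip: sib_diff)
 hence "(\<lambda>i. norm (sib E (F i) x - sib E f x)) ----> 0"
  using tendsto_real_sqrt[of "\<lambda>i. (norm (sib E (F i) x - sib E f x))^2" 0] by simp
 thus ?thesis using LIM_zero_cancel tendsto_norm_zero_iff by blast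
qed

end

subsection \<open>Unbounded integrands\<close>

definition cutoff :: "(real => complex) => nat => real => complex" where
 "cutoff f n = (\<lambda>s. if cmod (f s) <= real n then f s else 0)"

lemma cutoff_set [measurable]: "f \<in> BM ==> {s. cmod (f s) <= real n} \<in> sets borel"
 by measurable

lemma cutoff_eq: "cutoff f n s = indicator {s. cmod (f s) <= real n} s * f s"
 by (simp add: cutoff_def indicator_def)

lemma bdd_borel_cutoff:
 assumes [measurable]: "f \<in> BM" shows "bdd_borel (cutoff f n)"
 by (rule bdd_borelI[where K = "real n"]) (auto simp: cutoff_def)

lemma cutoff_tendsto: "(\<lambda>n. g s * cutoff f n s) ----> g s * f s"
proof (rule tendsto_eventually, rule eventually_sequentiallyI[of "nat \<lceil>cmod (f s)\<rceil>"])
 fix n assume "nat \<lceil>cmod (f s)\<rceil> <= n"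
 hence "cmod (f s) <= real n" by linarith
 thus "g s * cutoff f n s = g s * f s" by (simp add: cutoff_def)
qed

lemma tendsto_indicator:
 assumes "!!n. B n \<subseteq> B (Suc n)"
 shows "(\<lambda>n. indicator (B n) s :: complex) ----> indicator (\<Union>n. B n) s"
 using LIMSEQ_indicator_incseq[of B s] assms by (simp add: incseq_Suc_iff)

text \<open>The squared norms increase and are bounded, hence form a Cauchy sequence, and by
  hypothesis they control the increments of \<open>v\<close>.\<close>

lemma convergent_orthogonal_increments:
 fixes v :: "nat => 'a::banach"
 assumes orth: "!!m n. n <= m ==> (norm (v m - v n))\<^sup>2 = (norm (v m))^2 - (norm (v n))^2"
  and bd: "!!n. norm (v n) <= C"
 shows "convergent v"
proof -
 have le: "(norm (v n))^2 <= (norm (v m))^2" if "n <= m" for m n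
  using orth[OF that] zero_le_power2[of "norm (v m - v n)"] by linarith
 have "(norm (v n))^2 <= C\<^sup>2" for n using bd by (intro power_mono) auto
 hence "Bseq (\<lambda>n. (norm (v n))^2)" by (intro BseqI'[where K = "C\<^sup>2"]) auto
 moreover have "incseq (\<lambda>n. (norm (v n))^2)" using le by (simp add: incseq_def)
 ultimately have "convergent (\<lambda>n. (norm (v n))^2)"
  by (intro Bseq_monoseq_convergent incseq_imp_monoseq)
 hence ca: "Cauchy (\<lambda>n. (norm (v n))^2)" by (rule convergent_Cauchy)
 have "Cauchy v"
 proof (rule metric_CauchyI)
  fix e :: real assume e: "e > 0"
  then obtain M where M: "!!m n. m \<ge> M ==> n \<ge> M ==> dist ((norm (v m))^2) ((norm (v n))^2) < e\<^sup>2"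
   using metric_CauchyD[OF ca, of "e\<^sup>2"] by auto
  have *: "dist (v m) (v n) < e" if "m \<ge> M" "n \<ge> M" "n <= m" for m n
  proof -
   have "(norm (v m))^2 - (norm (v n))^2 < e\<^sup>2" using M[OF that(1,2)] by (auto simp: dist_real_def)
   hence "(norm (v m - v n))^2 < e\<^sup>2" using orth[OF that(3)] by simp
   thus ?thesis using e by (simp add: dist_norm power_less_imp_less_base)
  qed
  have "dist (v m) (v n) < e" if "m \<ge> M" "n \<ge> M" for m n
   using *[of m n] *[of n m] that by (cases "n <= m") (auto simp: dist_commute)
  thus "\<exists>M. \<forall>m\<ge>M. \<forall>n\<ge>M. dist (v m) (v n) < e" by blast
 qed
 thus ?thesis by (rule Cauchy_convergent)
qed

lemma id_meas: "cor \<in> BM"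
 by (rule borel_measurable_continuous_onI) (intro continuous_intros)

lemma bdd_borel_indicator_mult:
 assumes f: "f \<in> BM" and B: "B \<in> sets borel" and K: "!!s. s \<in> B ==> cmod (f s) <= K"
 shows "bdd_borel (\<lambda>s. indicator B s * f s)"
proof (rule bdd_borelI[where K = "max K 0"])
 show "(\<lambda>s. indicator B s * f s) \<in> BM" using f B by measurable
qed (use K in "auto simp: indicator_def le_max_iff_disj")

context
 fixes E :: "real set => 'a::chilbert_space => 'a"
 assumes E: "spm E"
begin

lemmas [simp] = sm_empty[OF E]

lemma sm_limit:
 assumes "!!n. B n \<in> sets borel" "!!n. B n \<subseteq> B (Suc n)"
 shows "(\<lambda>n. E (B n) x) ----> E (\<Union>n. B n) x"
proof -
 have "(\<lambda>n. sib E (indicator (B n)) x) ----> sib E (indicator (\<Union>n. B n)) x"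
 proof (rule sib_limit[OF E, where K = 1])
  show "(\<lambda>i. indicator (B i) s :: complex) ----> indicator (\<Union>n. B n) s" for s
   by (rule tendsto_indicator) (rule assms(2))
 qed (use assms(1) in "auto simp: indicator_def")
 thus ?thesis using assms by (simp add: sib_indicator[OF E])
qed

lemma si_D: "(x, y) \<in> sint E f ==> (\<lambda>n. sib E (cutoff f n) x) ----> y"
 by (simp add: spectral_int_def cutoff_def)

text \<open>The truncations of \<open>f\<close>, multiplied by \<open>g\<close>, stay uniformly
  bounded, so the strong limit may be taken on both sides. This is the way to compute with an
  unbounded integral: a bounded factor that tames \<open>f\<close> leads back to bounded
  operators.\<close>

lemma si_apply:
 assumes xy: "(x, y) \<in> sint E f" and f: "f \<in> BM"
  and g: "bdd_borel g" and gf: "bdd_borel (\<lambda>s. g s * f s)"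
 shows "sib E g y = sib E (\<lambda>s. g s * f s) x"
proof (rule LIMSEQ_unique)
 show "(\<lambda>n. sib E g (sib E (cutoff f n) x)) ----> sib E g y"
  by (rule bcl_tendsto[OF sib_bcl[OF E g] si_D[OF xy]])
 obtain K where K: "!!s. cmod (g s * f s) <= K" using gf by (auto simp: bdd_borel_def)
 have "cmod (g s * cutoff f n s) <= K" for n s
  using K[of s] order_trans[OF norm_ge_zero K[of s]] by (auto simp: cutoff_def)
 hence "(\<lambda>n. sib E (\<lambda>s. g s * cutoff f n s) x) ----> sib E (\<lambda>s. g s * f s) x"
  using bdd_borel_meas[OF bdd_borel_mult[OF g bdd_borel_cutoff[OF f]]] cutoff_tendsto
  by (intro sib_limit[OF E, where K = K])
 thus "(\<lambda>n. sib E g (sib E (cutoff f n) x)) ----> sib E (\<lambda>s. g s * f s) x"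
  by (simp add: sib_mult[OF E g bdd_borel_cutoff[OF f]])
qed

lemma si_E:
 assumes xy: "(x, y) \<in> sint E f" and f: "f \<in> BM" and B: "B \<in> sets borel"
  and bf: "bdd_borel (\<lambda>s. indicator B s * f s)"
 shows "E B y = sib E (\<lambda>s. indicator B s * f s) x"
 using si_apply[OF xy f bdd_borel_indicator[OF B] bf] by (simp add: sib_indicator[OF E B])

lemma E_cutoff_limit:
 assumes f: "f \<in> BM"
 shows "(\<lambda>n. E {s. cmod (f s) <= real n} x) ----> x"
proof -
 have "(\<lambda>n. E {s. cmod (f s) <= real n} x) ----> E (\<Union>n. {s. cmod (f s) <= real n}) x"
  by (rule sm_limit) (use cutoff_set[OF f] in auto)
 moreover have "(\<Union>n. {s. cmod (f s) <= real n}) = UNIV"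
  by (auto intro: real_arch_simple)
 ultimately show ?thesis using sm_UNIV[OF E] by simp
qed

lemma cutoff_E:
 assumes f: "f \<in> BM" and "n <= m"
 shows "E {s. cmod (f s) <= real n} (sib E (cutoff f m) x) = sib E (cutoff f n) x"
proof -
 have "(\<lambda>s. indicator {s. cmod (f s) <= real n} s * cutoff f m s) = cutoff f n"
  using assms(2) by (auto simp: cutoff_def indicator_def fun_eq_iff)
 thus ?thesis using sib_E[OF E bdd_borel_cutoff[OF f] cutoff_set[OF f], of n m x] by simp
qed

text \<open>Reduces membership to identities between bounded operators. The square-integrability
  clause comes for free, because every truncated integral is bounded by the squared norm of
  \<open>y\<close>.\<close>

lemma si_iff:
 assumes f: "f \<in> BM"
 shows "(x, y) \<in> sint E f \<longleftrightarrow>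
  (\<forall>n. E {s. cmod (f s) <= real n} y = sib E (cutoff f n) x)"
proof
 assume xy: "(x, y) \<in> sint E f"
 have eq: "(\<lambda>s. indicator {s. cmod (f s) <= real n} s * f s) = cutoff f n" for n
  by (auto simp: cutoff_eq)
 show "\<forall>n. E {s. cmod (f s) <= real n} y = sib E (cutoff f n) x"
  using si_E[OF xy f cutoff_set[OF f]] bdd_borel_cutoff[OF f] unfolding eq by blast
next
 assume *: "\<forall>n. E {s. cmod (f s) <= real n} y = sib E (cutoff f n) x"
 have lim: "(\<lambda>n. sib E (cutoff f n) x) ----> y"
  using E_cutoff_limit[OF f, of y] * by simp
 have "(\<lambda>n. \<integral>\<^sup>+s. ennreal ((cmod (cutoff f n s))^2) \<partial>scm E x) ---->
   (\<integral>\<^sup>+s. ennreal ((cmod (f s))^2) \<partial>scm E x)"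
 proof (rule nn_integral_LIMSEQ)
  show "incseq (\<lambda>n s. ennreal ((cmod (cutoff f n s))^2))"
   by (auto simp: incseq_def le_fun_def cutoff_def)
  show "(\<lambda>s. ennreal ((cmod (cutoff f n s))^2)) \<in> borel_measurable (scm E x)" for n
   using bdd_borel_meas[OF bdd_borel_cutoff[OF f, of n]] by (simp add: measurable_scalar[OF E])
  show "(\<lambda>n. ennreal ((cmod (cutoff f n s))^2)) ----> ennreal ((cmod (f s))^2)" for s
   using cutoff_tendsto[of "\<lambda>s. 1" s f] by (intro tendsto_ennrealI tendsto_intros) simp
 qed
 moreover have "(\<integral>\<^sup>+s. ennreal ((cmod (cutoff f n s))^2) \<partial>scm E x) <= ennreal ((norm y)^2)" for n
 proof -
  have "integrable (scm E x) (\<lambda>s. (cmod (cutoff f n s))^2)"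
   by (rule integrable_scalar[OF E, where K = "(real n)^2"])
     (use bdd_borel_meas[OF bdd_borel_cutoff[OF f, of n]] in "auto simp: cutoff_def intro: power_mono")
  hence "(\<integral>\<^sup>+s. ennreal ((cmod (cutoff f n s))^2) \<partial>scm E x) =
    ennreal ((norm (sib E (cutoff f n) x))^2)"
   by (subst nn_integral_eq_integral) (auto simp: sib_norm[OF E bdd_borel_cutoff[OF f]])
  also have "sib E (cutoff f n) x = E {s. cmod (f s) <= real n} y" using * by simp
  finally show ?thesis
   using proj_norm[OF sm_proj[OF E cutoff_set[OF f]], of n y] by (simp add: ennreal_leI power_mono)
 qed
 ultimately have "(\<integral>\<^sup>+s. ennreal ((cmod (f s))^2) \<partial>scm E x) <= ennreal ((norm y)^2)"
  by (intro LIMSEQ_le_const2) auto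
 hence "(\<integral>\<^sup>+s. ennreal ((cmod (f s))^2) \<partial>scm E x) < \<infinity>"
  using le_less_trans ennreal_less_top by fastforce
 thus "(x, y) \<in> sint E f" using lim by (simp add: spectral_int_def cutoff_def)
qed

lemma si_exists:
 assumes f: "f \<in> BM"
  and bd: "!!n. norm (sib E (cutoff f n) x) <= C"
 shows "\<exists>y. (x, y) \<in> sint E f"
proof -
 define v where "v n = sib E (cutoff f n) x" for n
 have "convergent v"
 proof (rule convergent_orthogonal_increments[where C = C])
  fix m n :: nat assume "n <= m"
  thus "(norm (v m - v n))^2 = (norm (v m))^2 - (norm (v n))^2"
   using proj_pythagoras[OF sm_proj[OF E cutoff_set[OF f]], of "v m" n]
   by (simp add: cutoff_E[OF f] v_def)
 qed (use bd v_def in simp)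
 then obtain y where y: "v ----> y" by (auto simp: convergent_def)
 have "E {s. cmod (f s) <= real n} y = v n" for n
 proof (rule LIMSEQ_unique)
  show "(\<lambda>m. E {s. cmod (f s) <= real n} (v m)) ----> E {s. cmod (f s) <= real n} y"
   by (rule bcl_tendsto[OF proj_bcl[OF sm_proj[OF E cutoff_set[OF f]]] y])
  show "(\<lambda>m. E {s. cmod (f s) <= real n} (v m)) ----> v n"
   by (rule tendsto_eventually, rule eventually_sequentiallyI[of n]) (simp add: v_def cutoff_E[OF f])
 qed
 hence "(x, y) \<in> sint E f" by (simp add: si_iff[OF f] v_def)
 thus ?thesis by blast
qed

lemma si_norm_cutoff:
 assumes f: "f \<in> BM" and "(x, y) \<in> sint E f"
 shows "norm (sib E (cutoff f n) x) <= norm y"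
 using assms proj_norm[OF sm_proj[OF E cutoff_set[OF f]], of n y] si_iff[OF f, of x y] by simp

lemma si_clinear: 
 assumes f: "f \<in> BM" shows "clinear_graph (sint E f)"
proof -
 note b = bcl_simps[OF sib_bcl[OF E bdd_borel_cutoff[OF f]]]
  bcl_simps[OF proj_bcl[OF sm_proj[OF E cutoff_set[OF f]]]]
 have "single_valued (sint E f)"
  by (auto simp: single_valued_def intro: LIMSEQ_unique dest!: si_D)
 thus ?thesis unfolding clinear_graph_def by (auto simp: si_iff[OF f] b)
qed

lemma si_closed:
 assumes f: "f \<in> BM" shows "closed (sint E f)"
 unfolding closed_sequential_limits
proof (intro allI impI)
 fix X l assume "(\<forall>n. X n \<in> sint E f) \<and> X ----> l"
 hence X: "!!n. (fst (X n), snd (X n)) \<in> sint E f" and lim: "(\<lambda>n. fst (X n)) ----> fst l" "(\<lambda>n. snd (X n)) ----> snd l"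
  by (auto intro: tendsto_fst tendsto_snd)
 have "E {s. cmod (f s) <= real n} (snd l) = sib E (cutoff f n) (fst l)" for n
 proof (rule LIMSEQ_unique)
  show "(\<lambda>m. E {s. cmod (f s) <= real n} (snd (X m))) ----> E {s. cmod (f s) <= real n} (snd l)"
   by (rule bcl_tendsto[OF proj_bcl[OF sm_proj[OF E cutoff_set[OF f]]] lim(2)])
  show "(\<lambda>m. E {s. cmod (f s) <= real n} (snd (X m))) ----> sib E (cutoff f n) (fst l)"
  proof -
   have "E {s. cmod (f s) <= real n} (snd (X m)) = sib E (cutoff f n) (fst (X m))" for m
    using X[of m] unfolding si_iff[OF f] by blast
   thus ?thesis
    using bcl_tendsto[OF sib_bcl[OF E bdd_borel_cutoff[OF f]] lim(1), of n] by (simp only:)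
  qed
 qed
 hence "(fst l, snd l) \<in> sint E f" unfolding si_iff[OF f] by blast
 thus "l \<in> sint E f" by simp
qed

lemma si_bdd:
 assumes f: "bdd_borel f" shows "sint E f = graph (sib E f)"
proof -
 have fm: "f \<in> BM" using f bdd_borel_meas by blast
 have in1: "(x, sib E f x) \<in> sint E f" for x
 proof -
  have "cutoff f n = (\<lambda>s. indicator {s. cmod (f s) <= real n} s * f s)" for n by (auto simp: cutoff_eq)
  thus ?thesis by (simp add: si_iff fm sib_E[OF E f cutoff_set[OF fm]])
 qed
 moreover have "y = sib E f x" if "(x, y) \<in> sint E f" for x y
  using si_clinear[OF fm] in1 that unfolding clinear_graph_def single_valued_def by blast
 ultimately show ?thesis by (auto simp: graph_def)
qed

lemma si_left:
 assumes f: "f \<in> BM" and g: "bdd_borel g" and xy: "(x, y) \<in> sint E f"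
 shows "(x, sib E g y) \<in> sint E (\<lambda>s. g s * f s)"
proof -
 have m [measurable]: "g \<in> BM" "f \<in> BM"
  using f g bdd_borel_meas by auto
 have "E {s. cmod (g s * f s) <= real n} (sib E g y) =
   sib E (cutoff (\<lambda>s. g s * f s) n) x" for n
 proof -
  let ?B = "{s. cmod (g s * f s) <= real n}"
  have B: "?B \<in> sets borel" by measurable
  have eq: "(\<lambda>s. indicator ?B s * g s * f s) = cutoff (\<lambda>s. g s * f s) n" by (auto simp: cutoff_eq)
  have b: "bdd_borel (\<lambda>s. indicator ?B s * g s)" by (rule bdd_borel_mult[OF bdd_borel_indicator[OF B] g])
  show ?thesis
   unfolding sib_E[OF E g B] using si_apply[OF xy f b] bdd_borel_cutoff[of "\<lambda>s. g s * f s" n]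
   unfolding eq by simp
 qed
 thus ?thesis by (subst si_iff) auto
qed

lemma si_right:
 assumes f: "f \<in> BM" and g: "bdd_borel g" and xy: "(x, y) \<in> sint E (\<lambda>s. f s * g s)"
 shows "(sib E g x, y) \<in> sint E f"
proof -
 have [measurable]: "g \<in> BM" "f \<in> BM"
  using f g bdd_borel_meas by auto
 have eq: "(\<lambda>s. indicator {s. cmod (f s) <= real n} s * (f s * g s)) = (\<lambda>s. cutoff f n s * g s)" for n
  by (auto simp: cutoff_eq)
 have "E {s. cmod (f s) <= real n} y = sib E (cutoff f n) (sib E g x)" for n
  using si_E[OF xy _ cutoff_set[OF f, of n]]
   bdd_borel_mult[OF bdd_borel_cutoff[OF f, of n] g] unfolding eq
  by (simp add: sib_mult[OF E bdd_borel_cutoff[OF f] g])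
 thus ?thesis by (simp add: si_iff f)
qed

text \<open>Source of vectors in the domain of an unbounded integral: the range of a bounded
  function that compensates the growth of \<open>f\<close>.\<close>

lemma si_bounded_range:
 assumes "f \<in> BM" "bdd_borel g" "bdd_borel (\<lambda>s. f s * g s)"
 shows "(sib E g x, sib E (\<lambda>s. f s * g s) x) \<in> sint E f"
 by (rule si_right[OF assms(1,2)]) (simp add: si_bdd[OF assms(3)] graph_def)

end

text \<open>Covers commutation, with \<open>\<phi>\<close> the identity, as well as covariance under
  the dual action, where \<open>\<phi>\<close> is a dilation of the spectrum.\<close>

lemma sib_intertwine:
 assumes E: "spm E" and F: "spm F" and w: "bcl w"
  and [measurable]: "\<phi> \<in> BM"
  and wE: "!!B x. B \<in> sets borel ==> w (E B x) = F (\<phi> -` B) (w x)" and f: "bdd_borel f"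
 shows "w (sib E f x) = sib F (\<lambda>s. f (\<phi> s)) (w x)"
 using f
proof (induction rule: bdd_borel_induct)
 have comp: "bdd_borel (\<lambda>s. g (\<phi> s))" if "bdd_borel g" for g
  using that by (auto simp: bdd_borel_def)
 {
  case (set B)
  have "\<phi> -` B \<in> sets borel" using measurable_sets[OF assms(4) set] by simp
  moreover have "(\<lambda>s. indicator B (\<phi> s) :: complex) = indicator (\<phi> -` B)" by (auto simp: indicator_def)
  ultimately show ?case using wE[OF set] by (simp only: sib_indicator[OF E set] sib_indicator[OF F])
 next
  case (cmult c f) thus ?case by (simp add: sib_cmult E F comp bcl_scaleC[OF w])
 next
  case (add f g) thus ?case by (simp add: sib_add E F comp bcl_add[OF w])
 next
  case (seq U u K)
  have "(\<lambda>i. w (sib E (\<lambda>s. cor (U i s)) x)) ----> w (sib E (\<lambda>s. cor (u s)) x)"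
   by (rule bcl_tendsto[OF w], rule sib_limit[OF E, where K = K]) (use seq.hyps in "auto intro: tendsto_of_real")
  moreover have "(\<lambda>i. w (sib E (\<lambda>s. cor (U i s)) x)) ---->
    sib F (\<lambda>s. cor (u (\<phi> s))) (w x)"
   unfolding seq.IH
   by (rule sib_limit[OF F, where K = K]) (use seq.hyps in "auto intro: tendsto_of_real")
  ultimately show ?case by (rule LIMSEQ_unique)
 }
qed

lemma si_intertwine:
 assumes E: "spm E" and F: "spm F" and w: "bcl w"
  and [measurable]: "\<phi> \<in> BM"
  and wE: "!!B x. B \<in> sets borel ==> w (E B x) = F (\<phi> -` B) (w x)"
  and f [measurable]: "f \<in> BM" and xy: "(x, y) \<in> sint E f"
 shows "(w x, w y) \<in> sint F (\<lambda>s. f (\<phi> s))"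
proof -
 have "F {s. cmod (f (\<phi> s)) <= real n} (w y) = sib F (cutoff (\<lambda>s. f (\<phi> s)) n) (w x)" for n
 proof -
  have "{s. cmod (f (\<phi> s)) <= real n} = \<phi> -` {s. cmod (f s) <= real n}" by auto
  hence "F {s. cmod (f (\<phi> s)) <= real n} (w y) = w (E {s. cmod (f s) <= real n} y)"
   by (simp only: wE[OF cutoff_set[OF f]])
  also have "... = w (sib E (cutoff f n) x)"
   using xy by (simp add: si_iff[OF E f])
  also have "... = sib F (\<lambda>s. cutoff f n (\<phi> s)) (w x)"
   by (rule sib_intertwine[where \<phi> = \<phi> and f = "cutoff f n", OF E F w assms(4) _ bdd_borel_cutoff[OF f]])
     (rule wE)
  finally show ?thesis by (simp add: cutoff_def)
 qed
 thus ?thesis by (subst si_iff[OF F]) auto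
qed

lemma intertwine_halflines:
 assumes E: "spm E" and F: "spm F" and w: "bcl w"
  and \<phi>: "\<phi> \<in> BM"
  and wE: "!!l x. w (E {..l} x) = F (\<phi> -` {..l}) (w x)" and B: "B \<in> sets borel"
 shows "w (E B x) = F (\<phi> -` B) (w x)"
proof -
 have v: "\<phi> -` B \<in> sets borel" if "B \<in> sets borel" for B using measurable_sets[OF \<phi> that] by simp
 let ?G = "range (\<lambda>a::real. {..a})"
 have "B \<in> sigma_sets UNIV ?G"
  using B unfolding borel_eq_atMost by (simp add: sets_measure_of)
 have "Int_stable ?G" by (auto simp: Int_stable_def)
 moreover have "?G \<subseteq> Pow UNIV" by simp
 ultimately show ?thesis using \<open>B \<in> sigma_sets UNIV ?G\<close>
 proof (induction rule: sigma_sets_induct_disjoint)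
  case (compl A)
  hence "A \<in> sets borel" unfolding borel_eq_atMost by (simp add: sets_measure_of)
  thus ?case using compl v[of A]
   by (simp add: Compl_eq_Diff_UNIV[symmetric] sm_compl[OF E] sm_compl[OF F] vimage_Compl bcl_diff[OF w])
 next
  case (union A)
  hence A: "A i \<in> sets borel" for i unfolding borel_eq_atMost by (auto simp: sets_measure_of)
  have "(\<lambda>n. w (E (A n) x)) sums w (E (\<Union>n. A n) x)"
   by (rule bounded_linear.sums[OF bcl_linear[OF w]], rule sm_sums[OF E A]) (use union in auto)
  moreover have "(\<lambda>n. F (\<phi> -` A n) (w x)) sums F (\<Union>n. \<phi> -` A n) (w x)"
   by (rule sm_sums[OF F]) (use union v[OF A] in "auto simp: disjoint_family_on_def")
  ultimately show ?case using union.IH by (simp add: vimage_UN sums_iff)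
 qed (auto simp: wE bcl_0[OF w] sm_empty[OF E] sm_empty[OF F])
qed

text \<open>The image of a spectral measure. Taken along the square root it shows that the modulus
  of an operator possesses a spectral resolution.\<close>

lemma spectral_measure_vimage:
 assumes E: "spm E" and \<phi>: "\<phi> \<in> BM"
 shows "spm (\<lambda>B. E (\<phi> -` B))"
proof -
 have v: "\<phi> -` B \<in> sets borel" if "B \<in> sets borel" for B using measurable_sets[OF \<phi> that] by simp
 show ?thesis
  unfolding spectral_measure_def
 proof (intro conjI allI ballI impI)
  fix B :: "nat => real set" and x assume "range B \<subseteq> sets borel \<and> disjoint_family B"
  thus "(\<lambda>n. E (\<phi> -` B n) x) sums E (\<phi> -` (\<Union>n. B n)) x"
   unfolding vimage_UN by (intro sm_sums[OF E]) (auto intro!: v simp: disjoint_family_on_def)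
 qed (use v sm_proj[OF E] sm_UNIV[OF E] sm_Int[OF E] in "auto simp: fun_eq_iff vimage_Int")
qed

lemma si_vimage:
 assumes E: "spm E" and \<phi>: "\<phi> \<in> BM" and f: "f \<in> BM"
 shows "sint (\<lambda>B. E (\<phi> -` B)) f = sint E (\<lambda>s. f (\<phi> s))"
proof -
 note V = spectral_measure_vimage[OF E \<phi>]
 have [measurable]: "f \<in> BM" "\<phi> \<in> BM" using f \<phi> by auto
 have "sib (\<lambda>B. E (\<phi> -` B)) (cutoff f n) x = sib E (cutoff (\<lambda>s. f (\<phi> s)) n) x" for n x
  using sib_intertwine[OF V E bcl_id(2) \<phi> _ bdd_borel_cutoff[OF f]] by (simp add: cutoff_def)
 note S = this
 have fm: "(\<lambda>s. f (\<phi> s)) \<in> BM" by measurable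
 have "{s. cmod (f (\<phi> s)) <= real n} = \<phi> -` {s. cmod (f s) <= real n}" for n by auto
 hence "(x, y) \<in> sint (\<lambda>B. E (\<phi> -` B)) f \<longleftrightarrow> (x, y) \<in> sint E (\<lambda>s. f (\<phi> s))" for x y
  unfolding si_iff[OF V f] si_iff[OF E fm] S by (simp only:)
 thus ?thesis by auto
qed

subsection \<open>Spectral subspaces of positive operators\<close>

context
 fixes E :: "real set => 'a::chilbert_space => 'a"
 assumes E: "spm E"
begin

text \<open>On a set \<open>B n\<close> that is bounded and stays at distance
  \<open>1 / real (Suc n)\<close> below zero, the form is nonnegative by hypothesis but at most
  minus that distance times the squared norm, so the component vanishes. The sets \<open>B n\<close>
  exhaust the negative half-line.\<close>

lemma spectral_nonneg:
 assumes pos: "!!x y. (x, y) \<in> sint E cor ==> 0 <= inner y x"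
 shows "E {..<0} x = 0"
proof -
 define B where "B n = {- real n..- (1 / real (Suc n))}" for n
 have "E (B n) x = 0" for n
 proof -
  have B: "B n \<in> sets borel" by (simp add: B_def)
  have bd: "bdd_borel (\<lambda>s. indicator (B n) s * cor s)"
  proof (rule bdd_borel_indicator_mult[OF id_meas B, where K = "real n"])
   fix s assume s: "s \<in> B n"
   hence "s <= - (1 / real (Suc n))" by (simp add: B_def)
   also have "... <= 0" by simp
   finally show "cmod (cor s) <= real n" using s by (simp add: B_def)
  qed
  let ?y = "sib E (\<lambda>s. indicator (B n) s * cor s) x"
  have "(E (B n) x, ?y) \<in> sint E cor"
   using si_bounded_range[OF E id_meas bdd_borel_indicator[OF B], of x] bd
   by (simp add: sib_indicator[OF E B] mult.commute)
  hence "0 <= inner ?y (E (B n) x)" by (rule pos)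
  also have "inner ?y (E (B n) x) = inner (E (B n) ?y) x"
   by (simp add: self_adj_inner[OF proj_sa[OF sm_proj[OF E B]]])
  also have "E (B n) ?y = ?y"
   using sib_E[OF E bd B, of x] by (simp add: mult.assoc[symmetric] flip: indicator_inter_arith)
  also have "inner ?y x = Re (\<integral>s. indicator (B n) s * cor s \<partial>scm E x)"
   by (simp add: inner_eq_Re_cinner sib_form[OF E bd])
  also have "... = (\<integral>s. Re (indicator (B n) s * cor s) \<partial>scm E x)"
   by (intro integral_Re[symmetric] integrable_scalar_bdd[OF E bd])
  also have "... <= (\<integral>s. - (1 / real (Suc n)) * indicator (B n) s \<partial>scm E x)"
  proof (rule integral_mono)
   show "integrable (scm E x) (\<lambda>s. Re (indicator (B n) s * cor s))"
    by (intro integrable_Re integrable_scalar_bdd[OF E bd])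
   show "integrable (scm E x) (\<lambda>s. - (1 / real (Suc n)) * indicator (B n) s)"
    by (rule integrable_scalar[OF E, where K = 1]) (use B in "auto simp: indicator_def")
  qed (auto simp: indicator_def B_def)
  also have "... = - (1 / real (Suc n)) * (norm (E (B n) x))^2"
   using B by (simp add: measure_scalar[OF E] scalar_measure_space[OF E] scalar_measure_sets[OF E])
  finally show ?thesis by (simp add: divide_le_0_iff zero_le_mult_iff)
 qed
 moreover have "(\<lambda>n. E (B n) x) ----> E (\<Union>n. B n) x"
  by (rule sm_limit[OF E]) (auto simp: B_def field_simps)
 moreover have "(\<Union>n. B n) = {..<0}"
 proof (intro set_eqI iffI)
  fix s :: real assume "s \<in> {..<0}"
  hence s: "0 < - s" by simp
  obtain n where n: "1 / real (Suc n) < - s" using nat_approx_posE[OF s] by blast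
  obtain m where m: "- s <= real m" using real_arch_simple by blast
  have "1 / real (Suc (max m n)) <= 1 / real (Suc n)" by (intro divide_left_mono) auto
  hence "s \<in> B (max m n)" using n m by (auto simp: B_def)
  thus "s \<in> (\<Union>n. B n)" by blast
 next
  fix s assume "s \<in> (\<Union>n. B n)"
  then obtain n where "s <= - (1 / real (Suc n))" by (auto simp: B_def)
  moreover have "1 / real (Suc n) > 0" by simp
  ultimately show "s \<in> {..<0}" unfolding lessThan_iff by linarith
 qed
 ultimately have "(\<lambda>n. 0) ----> E {..<0} x" by (simp only:)
 thus ?thesis by (simp add: LIMSEQ_const_iff)
qed

lemma spectral_nonsingular:
 assumes "nonsingular (sint E cor)" shows "E {0} x = 0"
proof -
 have z: "(\<lambda>s. cor s * indicator {0} s) = (\<lambda>s. 0)" by (auto simp: indicator_def)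
 have "(E {0} x, 0) \<in> sint E cor"
  using si_bounded_range[OF E id_meas bdd_borel_indicator, of "{0}" x] bdd_borel_const[of 0]
  by (simp add: z sib_indicator[OF E] sib_const[OF E])
 thus ?thesis using assms by (simp add: nonsingular_def)
qed

text \<open>This description of spectral subspaces in terms of the operator alone makes them equivariant
 without any appeal to the uniqueness of spectral measures.\<close>

lemma spectral_subspace_iff:
 assumes neg: "!!x. E {..<0} x = 0" and l: "0 <= l"
 shows "E {..l} x = x \<longleftrightarrow> (\<exists>X C. X 0 = x \<and>
  (\<forall>n. (X n, X (Suc n)) \<in> sint E cor \<and> norm (X n) <= C * l ^ n))"
proof
 assume x: "E {..l} x = x"
 define g where "g n s = indicator {0..l} s * cor s ^ n" for n s
 have pm: "(\<lambda>s. cor s ^ n) \<in> BM" for n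
  by (rule borel_measurable_continuous_onI) (intro continuous_intros)
 have g: "bdd_borel (g n)" for n
  unfolding g_def by (rule bdd_borel_indicator_mult[OF pm, where K = "l ^ n"]) (auto simp: norm_power intro: power_mono)
 have gl: "cmod (g n s) <= l ^ n" for n s
  using l by (auto simp: g_def indicator_def norm_power intro: power_mono)
 have gS: "(\<lambda>s. cor s * g n s) = g (Suc n)" for n by (auto simp: g_def)
 define X where "X n = sib E (g n) x" for n
 have "X 0 = E {0..l} x" unfolding X_def g_def by (simp add: sib_indicator[OF E])
 also have "... = E ({..l} - {..<0}) x" by (rule arg_cong[where f = "\<lambda>B. E B x"]) auto
 also have "... = E (- {..<0}) (E {..l} x)" by (subst sm_Int[OF E]) (auto intro!: arg_cong[where f = "\<lambda>B. E B x"])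
 also have "... = x" using sm_compl[OF E, of "{..<0}" "E {..l} x"] by (simp only: neg x lessThan_borel) simp
 finally have "X 0 = x" .
 moreover have "(X n, X (Suc n)) \<in> sint E cor" for n
  using si_bounded_range[OF E id_meas g, of n x] g[of "Suc n"] by (simp add: gS X_def)
 moreover have "norm (X n) <= norm x * l ^ n" for n
  using sib_norm_le[OF E g gl, of n x] by (simp add: X_def mult.commute)
 ultimately show "\<exists>X C. X 0 = x \<and>
  (\<forall>n. (X n, X (Suc n)) \<in> sint E cor \<and> norm (X n) <= C * l ^ n)" by blast
next
 assume "\<exists>X C. X 0 = x \<and>
  (\<forall>n. (X n, X (Suc n)) \<in> sint E cor \<and> norm (X n) <= C * l ^ n)"
 then obtain X C where X: "X 0 = x" "!!n. (X n, X (Suc n)) \<in> sint E cor"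
  "!!n. norm (X n) <= C * l ^ n" by blast
 \<comment> \<open>On the bounded set above \<open>a\<close> the operator is bounded below by
   \<open>a\<close>, so the component of \<open>X n\<close> there grows at least like
   \<open>a ^ n\<close>. Growth of order \<open>l ^ n\<close> with \<open>l < a\<close> forces it to
   be zero.\<close>
 have EK: "E {a<..b} x = 0" if a: "l < a" for a b
 proof -
  let ?K = "{a<..b}"
  have a0: "a > 0" using l a by simp
  have K: "?K \<in> sets borel" by simp
  have "norm (E ?K x) <= C * (l / a) ^ n" for n
  proof -
   have b1: "bdd_borel (\<lambda>s. indicator ?K s * cor s)"
    by (rule bdd_borel_indicator_mult[OF id_meas K, where K = "\<bar>a\<bar> + \<bar>b\<bar>"]) auto
   define r where "r s = indicator ?K s * cor (1 / s)" for s
   have rm: "(\<lambda>s. cor (1 / s)) \<in> BM" by measurable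
   have r: "bdd_borel r" unfolding r_def
    by (rule bdd_borel_indicator_mult[OF rm K, where K = "1/a"])
      (use a0 in "auto simp: norm_divide field_simps")
   have rl: "cmod (r s) <= 1 / a" for s using a0 by (auto simp: r_def indicator_def norm_divide field_simps)
   have r1: "(\<lambda>s. r s * (indicator ?K s * cor s)) = indicator ?K"
    using a0 by (auto simp: r_def indicator_def fun_eq_iff)
   have step: "E ?K (X m) = sib E r (E ?K (X (Suc m)))" for m
    using si_E[OF E X(2) id_meas K b1, of m]
    by (simp add: sib_mult[OF E r b1] r1 sib_indicator[OF E K])
   have "norm (E ?K x) <= (1 / a) ^ n * norm (E ?K (X n))"
   proof (induction n)
    case (Suc n)
    have "norm (E ?K (X n)) <= (1 / a) * norm (E ?K (X (Suc n)))"
     unfolding step[of n] by (rule sib_norm_le[OF E r rl])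
    hence "(1 / a) ^ n * norm (E ?K (X n)) <= (1 / a) ^ n * ((1 / a) * norm (E ?K (X (Suc n))))"
     using a0 by (intro mult_left_mono) auto
    thus ?case using Suc by (simp add: mult_ac)
   qed (simp add: X)
   also have "... <= (1 / a) ^ n * (C * l ^ n)"
    using a0 X(3)[of n] proj_norm[OF sm_proj[OF E K], of "X n"] by (intro mult_left_mono) auto
   finally show ?thesis by (simp add: power_divide mult_ac)
  qed
  moreover have "(\<lambda>n. C * (l / a) ^ n) ----> C * 0"
   using a l by (intro tendsto_mult LIMSEQ_realpow_zero tendsto_const) auto
  ultimately have "norm (E ?K x) <= C * 0" by (intro LIMSEQ_le_const) auto
  thus ?thesis by simp
 qed
 define B where "B n = {l + 1 / real (Suc n)<..real n}" for n
 have "E (B n) x = 0" for n unfolding B_def by (rule EK) simp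
 moreover have "B n \<subseteq> B (Suc n)" for n
 proof
  fix s assume "s \<in> B n"
  hence "l + 1 / real (Suc n) < s" "s <= real n" by (auto simp: B_def)
  moreover have "1 / real (Suc (Suc n)) <= 1 / real (Suc n)" by (intro divide_left_mono) auto
  ultimately have "l + 1 / real (Suc (Suc n)) < s" "s <= real (Suc n)" by (linarith, simp)
  thus "s \<in> B (Suc n)" by (simp add: B_def)
 qed
 hence "(\<lambda>n. E (B n) x) ----> E (\<Union>n. B n) x"
  by (intro sm_limit[OF E]) (auto simp: B_def)
 moreover have "(\<Union>n. B n) = {l<..}"
 proof (intro set_eqI iffI)
  fix s :: real assume "s \<in> {l<..}"
  hence s: "0 < s - l" by simp
  obtain n where n: "1 / real (Suc n) < s - l" using nat_approx_posE[OF s] by blast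
  obtain m where m: "s <= real m" using real_arch_simple by blast
  have "1 / real (Suc (max m n)) <= 1 / real (Suc n)" by (intro divide_left_mono) auto
  hence "s \<in> B (max m n)" using n m by (auto simp: B_def)
  thus "s \<in> (\<Union>n. B n)" by blast
 next
  fix s assume "s \<in> (\<Union>n. B n)"
  then obtain n where "l + 1 / real (Suc n) < s" by (auto simp: B_def)
  moreover have "1 / real (Suc n) > 0" by simp
  ultimately show "s \<in> {l<..}" unfolding greaterThan_iff by linarith
 qed
 ultimately have "(\<lambda>n. 0) ----> E {l<..} x" by (simp only:)
 hence "E {l<..} x = 0" by (simp add: LIMSEQ_const_iff)
 thus "E {..l} x = x" using sm_compl[OF E, of "{..l}" x] by simp
qed

text \<open>The case \<open>l = 0\<close> of the growth criterion: as \<open>0 ^ 0 = 1\<close>, the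
  bound leaves \<open>X 0\<close> free and forces \<open>X 1 = 0\<close>.\<close>

lemma spectral_kernel:
 assumes neg: "!!x. E {..<0} x = 0"
 shows "E {0<..} x = 0 \<longleftrightarrow> (x, 0) \<in> sint E cor"
proof -
 have "E {..0} x = x - E {0<..} x" using sm_compl[OF E, of "{0<..}" x] by simp
 hence "E {0<..} x = 0 \<longleftrightarrow> E {..0} x = x" by auto
 also have "... \<longleftrightarrow> (x, 0) \<in> sint E cor"
  unfolding spectral_subspace_iff[OF neg order_refl]
 proof
  assume "\<exists>X C. X 0 = x \<and> (\<forall>n. (X n, X (Suc n)) \<in> sint E cor \<and> norm (X n) <= C * 0 ^ n)"
  then obtain X C where X: "X 0 = x" "!!n. (X n, X (Suc n)) \<in> sint E cor"
   "!!n. norm (X n) <= C * 0 ^ n" by blast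
  show "(x, 0) \<in> sint E cor" using X(1) X(2)[of 0] X(3)[of 1] by simp
 next
  assume "(x, 0) \<in> sint E cor"
  moreover have "(0, 0) \<in> sint E cor" using si_clinear[OF E id_meas] by (simp add: clinear_graph_def)
  ultimately show "\<exists>X C. X 0 = x \<and> (\<forall>n. (X n, X (Suc n)) \<in> sint E cor \<and> norm (X n) <= C * 0 ^ n)"
   by (intro exI[of _ "\<lambda>n. if n = 0 then x else 0"] exI[of _ "norm x"]) auto
 qed
 finally show ?thesis .
qed

lemma halfline_neg:
 assumes neg: "!!x. E {..<0} x = 0" and "l < 0" shows "E {..l} x = 0"
proof -
 have "{..l} \<inter> {..<0} = {..l}" using assms by auto
 thus ?thesis using sm_Int[OF E, of "{..l}" "{..<0}" x] by (simp add: neg bcl_0[OF proj_bcl[OF sm_proj[OF E]]])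
qed

end

text \<open>Applying \<open>w\<close> multiplies growth rates by \<open>c\<close>, hence maps the
  spectral subspace below \<open>l\<close> into the one below \<open>c * l\<close>. The same
  argument for the adjoint in the other direction upgrades this inclusion to an intertwining
  relation, first on half-lines and then on Borel sets.\<close>

lemma spectral_measure_equivariant:
 assumes E: "spm E" and F: "spm F" and w: "bcl w" and c: "c > 0"
  and negE: "!!x. E {..<0} x = 0" and negF: "!!x. F {..<0} x = 0"
  and wE: "!!x y. (x, y) \<in> sint E cor ==> (w x, c *\<^sub>R w y) \<in> sint F cor"
  and wF: "!!x y. (x, y) \<in> sint F cor ==>
   (cadj w x, (1 / c) *\<^sub>R cadj w y) \<in> sint E cor"
  and B: "B \<in> sets borel"
 shows "w (E B x) = F ((\<lambda>s. s / c) -` B) (w x)"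
proof (rule intertwine_halflines[OF E F w _ _ B])
 show "(\<lambda>s. s / c) \<in> BM" by measurable
 have gen: "F {..c * l} (w x) = w x"
  if E: "spm E" and F: "spm F" and w: "bcl w" and c: "c > 0" and l: "0 <= l"
   and negE: "!!x. E {..<0} x = 0" and negF: "!!x. F {..<0} x = 0"
   and wE: "!!x y. (x, y) \<in> sint E cor ==> (w x, c *\<^sub>R w y) \<in> sint F cor"
   and x: "E {..l} x = x" for E F :: "real set => 'a => 'a" and w :: "'a => 'a" and c l :: real and x
 proof -
  obtain X C where X: "X 0 = x" "!!n. (X n, X (Suc n)) \<in> sint E cor"
   "!!n. norm (X n) <= C * l ^ n" using spectral_subspace_iff[OF E negE l] x by blast
  obtain K where K: "K > 0" "!!x. norm (w x) <= K * norm x" using bcl_bound[OF w] by blast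
  note cl = si_clinear[OF F id_meas]
  have sc: "(r *\<^sub>R u, r *\<^sub>R v) \<in> sint F cor" if "(u, v) \<in> sint F cor" for u v r
   using cl that unfolding clinear_graph_def by (auto simp flip: scaleC_of_real)
  show ?thesis
  proof (subst spectral_subspace_iff[OF F negF], use c l in simp,
    intro exI[of _ "\<lambda>n. c ^ n *\<^sub>R w (X n)"] exI[of _ "K * C"] conjI allI)
   show "(c ^ n *\<^sub>R w (X n), c ^ Suc n *\<^sub>R w (X (Suc n))) \<in> sint F cor" for n
    using sc[OF wE[OF X(2)[of n]], of "c ^ n"] by (simp add: mult.commute)
   show "norm (c ^ n *\<^sub>R w (X n)) <= K * C * (c * l) ^ n" for n
   proof -
    have "norm (w (X n)) <= K * (C * l ^ n)"
     using K(2)[of "X n"] mult_left_mono[OF X(3)[of n], of K] K(1) by linarith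
    from mult_left_mono[OF this, of "c ^ n"] show ?thesis
     using c by (simp add: power_mult_distrib mult_ac)
   qed
  qed (simp add: X)
 qed
 fix l x
 have v: "(\<lambda>s. s / c) -` {..l} = {..c * l}" using c by (auto simp: field_simps)
 show "w (E {..l} x) = F ((\<lambda>s. s / c) -` {..l}) (w x)"
 proof (cases "l < 0")
  case True
  hence "c * l < 0" using c by (simp add: mult_pos_neg)
  thus ?thesis unfolding v using True
   by (simp add: halfline_neg[OF E negE] halfline_neg[OF F negF] bcl_0[OF w])
 next
  case False
  hence l: "0 <= l" by simp
  let ?P = "E {..l}" and ?Q = "F {..c * l}"
  have P: "proj ?P" and Q: "proj ?Q" by (simp_all add: sm_proj E F)
  have 1: "?Q (w (?P x)) = w (?P x)" for x
   by (rule gen[OF E F w c l negE negF wE]) (simp_all add: proj_idem[OF P])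
  have "?P (cadj w (?Q x)) = cadj w (?Q x)" for x
   using gen[OF F E bcl_cadj[OF w], of "1/c" "c * l" "?Q x"] c l
   by (simp add: negE negF wF proj_idem[OF Q])
  note 2 = this
  have "cinner (?Q (w x)) y = cinner (?Q (w (?P x))) y" for y
   by (simp add: self_adj_cinner[OF proj_sa[OF Q]] self_adj_cinner[OF proj_sa[OF P]] cadj_right[OF w] 2)
  hence "?Q (w x) = ?Q (w (?P x))" by (rule cinner_ext)
  thus ?thesis by (simp add: 1 v)
 qed
qed

section \<open>The spectral theorem for positive self-adjoint operators\<close>

subsection \<open>The modulus of a bounded self-adjoint operator\<close>

text \<open>Polynomials in \<open>B\<close> with nonnegative coefficients. They are positive when
  \<open>B\<close> is, which gives the monotonicity of the square root iteration before any
  functional calculus for \<open>B\<close> is available.\<close>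

inductive_set nonneg_polys :: "('a::chilbert_space => 'a) => ('a => 'a) set" for B where
 id: "id \<in> nonneg_polys B"
| zero: "(\<lambda>x. 0) \<in> nonneg_polys B"
| mult: "T \<in> nonneg_polys B ==> B o T \<in> nonneg_polys B"
| add: "S \<in> nonneg_polys B ==> T \<in> nonneg_polys B ==> (\<lambda>x. S x + T x) \<in> nonneg_polys B"
| scale: "T \<in> nonneg_polys B ==> 0 <= c ==> (\<lambda>x. c *\<^sub>R T x) \<in> nonneg_polys B"

lemma nonneg_polys_commute:
 assumes "T \<in> nonneg_polys B" "bcl u" "!!x. u (B x) = B (u x)"
 shows "u (T x) = T (u x)"
 using assms(1) by (induction arbitrary: x) (simp_all add: assms(3) bcl_simps[OF assms(2)])

lemma nonneg_polys_bcl: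
 assumes "T \<in> nonneg_polys B" "bcl B" shows "bcl T"
 using assms(1)
proof induction
 case (mult T) show ?case by (rule bcl_comp[OF assms(2) mult.IH])
qed (auto intro: bcl_id bcl_zero bcl_plus bcl_rmult)

lemma nonneg_polys_comp:
 assumes "S \<in> nonneg_polys B" "T \<in> nonneg_polys B" "bcl B"
 shows "S o T \<in> nonneg_polys B"
 using assms(1)
proof induction
 case (mult S) show ?case using nonneg_polys.mult[OF mult.IH] by (simp add: o_def)
next
 case (add S1 S2) thus ?case using nonneg_polys.add[of "S1 o T" B "S2 o T"] by (simp add: o_def)
next
 case (scale S c) thus ?case using nonneg_polys.scale[of "S o T" B c] by (simp add: o_def)
qed (use assms in "auto simp: o_def intro: nonneg_polys.zero")

text \<open>Even powers of \<open>B\<close> are squares and odd powers are squares sandwiching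
  \<open>B\<close>. The induction on \<open>T\<close> is run for \<open>B ^^ k o T\<close> with all
  \<open>k\<close> at once, so that the rule \<open>mult\<close> is absorbed into the
  exponent.\<close>

lemma nonneg_polys_positive:
 assumes B: "pos B" and T: "T \<in> nonneg_polys B"
 shows "pos T"
proof -
 have sB: "self_adj B" and pB: "!!x. 0 <= inner (B x) x" using B by (auto simp: pos_iff)
 have pw: "self_adj (B ^^ k) \<and> (\<forall>x. 0 <= inner ((B ^^ k) x) x) \<and> (\<forall>x. 0 <= inner ((B ^^ Suc k) x) x)" for k
 proof (induction k)
  case 0 show ?case using pB by (simp add: self_adj_id)
 next
  case (Suc k)
  have "self_adj (B o B ^^ k)"
   using Suc by (intro self_adj_comp sB) (auto simp: fun_eq_iff funpow_swap1)
  moreover have "inner ((B ^^ Suc (Suc k)) x) x = inner ((B ^^ k) (B x)) (B x)" for x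
  proof -
   have "(B ^^ Suc (Suc k)) x = B ((B ^^ k) (B x))" by (simp add: funpow_swap1)
   thus ?thesis by (simp only: self_adj_inner[OF sB, of "(B ^^ k) (B x)" x])
  qed
  ultimately show ?case using Suc by (simp add: o_def)
 qed
 have bk: "bcl (B ^^ k)" for k using pw[of k] self_adj_bcl by blast
 have "self_adj (B ^^ k o T) \<and> (\<forall>x. 0 <= inner ((B ^^ k o T) x) x)" for k
  using T
 proof (induction arbitrary: k)
  case (mult T)
  have "B ^^ k o (B o T) = B ^^ Suc k o T" by (simp add: fun_eq_iff funpow_swap1)
  thus ?case using mult.IH[of "Suc k"] by metis
 next
  case (add S T)
  have "B ^^ k o (\<lambda>x. S x + T x) = (\<lambda>x. (B ^^ k o S) x + (B ^^ k o T) x)"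
   by (simp add: fun_eq_iff bcl_add[OF bk])
  thus ?case using add.IH[of k] by (simp add: self_adj_plus[of "\<lambda>x. (B ^^ k) (S x)" "\<lambda>x. (B ^^ k) (T x)"] o_def inner_add_left)
 next
  case (scale T c)
  have "B ^^ k o (\<lambda>x. c *\<^sub>R T x) = (\<lambda>x. c *\<^sub>R (B ^^ k o T) x)"
   by (simp add: fun_eq_iff bcl_scaleR[OF bk])
  thus ?case using scale self_adj_rmult[of "\<lambda>x. (B ^^ k) (T x)" c] by (simp add: o_def)
 next
  case zero
  have e: "B ^^ k o (\<lambda>x. 0) = (\<lambda>x. 0)" by (simp add: fun_eq_iff bcl_0[OF bk])
  show ?case unfolding e by (simp add: self_adj_zero)
 qed (use pw in auto)
 from this[of 0] show ?thesis by (simp add: pos_iff)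
qed

lemma positive_le_one_norm:
 assumes "pos T" "!!x. inner (T x) x <= (norm x)^2" shows "norm (T x) <= norm x"
proof (rule power2_le_imp_le)
 have "(norm (T x))^2 <= 1 * inner (T x) x" by (rule norm_square_le_form) (use assms in auto)
 thus "(norm (T x))^2 <= (norm x)^2" using assms(2)[of x] by linarith
qed simp

text \<open>With \<open>B = 1 - S\<close> the iteration sends \<open>Y\<close> to half of
  \<open>B\<close> plus the square of \<open>Y\<close>. It increases, because the differences are
  again polynomials in \<open>B\<close> with nonnegative coefficients. The limit \<open>Z\<close>
  satisfies the fixed point equation, which says that the square of \<open>1 - Z\<close> is
  \<open>S\<close>.\<close>

lemma positive_sqrt_contraction:
 assumes S: "pos S" and le: "!!x. inner (S x) x <= (norm x)^2"
 shows "\<exists>P. pos P \<and> (\<forall>x. P (P x) = S x) \<and>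
  (\<forall>u. bcl u --> (\<forall>x. u (S x) = S (u x)) --> (\<forall>x. u (P x) = P (u x)))"
proof -
 have sS: "self_adj S" using S pos_iff by blast
 define B where "B = (\<lambda>x. x - S x)"
 have sB: "self_adj B" unfolding B_def by (intro self_adj_minus self_adj_id sS)
 have fB: "inner (B x) x = (norm x)^2 - inner (S x) x" for x
  by (simp add: B_def inner_diff_left power2_norm_eq_inner)
 have pB: "pos B" using sB le by (simp add: pos_iff fB)
 have nB: "norm (B x) <= norm x" for x
  by (rule positive_le_one_norm[OF pB]) (use S in "auto simp: fB pos_iff")
 define Y where "Y n = ((\<lambda>Y x. (1/2) *\<^sub>R (B x + Y (Y x))) ^^ n) (\<lambda>x. 0)" for n
 have Y0: "Y 0 = (\<lambda>x. 0)" and YS: "Y (Suc n) = (\<lambda>x. (1/2) *\<^sub>R (B x + Y n (Y n x)))" for n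
  by (simp_all add: Y_def)
 note np = nonneg_polys.intros
 have Bnp: "B \<in> nonneg_polys B" using np(3)[OF np(1)] by simp
 have Ynp: "Y n \<in> nonneg_polys B" for n
 proof (induction n)
  case (Suc n)
  have "Y n o Y n \<in> nonneg_polys B" by (intro nonneg_polys_comp Suc self_adj_bcl sB)
  from np(5)[OF np(4)[OF Bnp this], of "1/2"] show ?case by (simp add: YS)
 qed (simp add: Y0 np)
 have Yb: "bcl (Y n)" for n by (rule nonneg_polys_bcl[OF Ynp self_adj_bcl[OF sB]])
 have Ycom: "Y m (Y n x) = Y n (Y m x)" for m n x
  by (rule nonneg_polys_commute[OF Ynp Yb])
    (rule nonneg_polys_commute[OF Ynp self_adj_bcl[OF sB], symmetric], rule refl)
 have Ydiff: "(\<lambda>x. Y (Suc n) x - Y n x) \<in> nonneg_polys B" for n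
 proof (induction n)
  case 0
  show ?case using np(5)[OF Bnp, of "1/2"] by (simp add: YS Y0)
 next
  case (Suc n)
  have "(\<lambda>x. Y (Suc n) x + Y n x) o (\<lambda>x. Y (Suc n) x - Y n x) \<in> nonneg_polys B"
   by (intro nonneg_polys_comp np(4) Ynp Suc self_adj_bcl sB)
  from np(5)[OF this, of "1/2"]
  have "(\<lambda>x. (1/2) *\<^sub>R (Y (Suc n) (Y (Suc n) x) - Y n (Y n x))) \<in> nonneg_polys B"
   by (simp add: o_def bcl_diff[OF Yb] Ycom[of n "Suc n"])
  thus ?case by (simp add: YS[of "Suc n"] YS[of n] scaleR_diff_right[symmetric])
 qed
 have Ypos: "pos (Y n)" for n by (rule nonneg_polys_positive[OF pB Ynp])
 have Yn: "norm (Y n x) <= norm x" for n x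
 proof (induction n arbitrary: x)
  case (Suc n)
  have "norm (B x + Y n (Y n x)) <= norm x + norm x"
   using nB[of x] Suc[of "Y n x"] Suc[of x] by (intro norm_triangle_le) linarith
  thus ?case by (simp add: YS)
 qed (simp add: Y0)
 have "\<exists>Z. pos Z \<and> (\<forall>x. (\<lambda>n. Y n x) ----> Z x)"
 proof (rule monotone_operator_limit[OF Ypos, where C = 1])
  show "op_le (Y n) (Y (Suc n))" for n
   unfolding op_le_def by (rule nonneg_polys_positive[OF pB Ydiff])
  show "inner (Y n x) x <= 1 * (norm x)^2" for n x
   using order_trans[OF norm_cauchy_schwarz mult_right_mono[OF Yn]] by (simp add: power2_eq_square)
 qed
 then obtain Z where Z: "pos Z" "!!x. (\<lambda>n. Y n x) ----> Z x" by blast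
 have Zb: "bcl Z" using Z by (simp add: positive_op_def)
 have YYZ: "(\<lambda>n. Y n (Y n x)) ----> Z (Z x)" for x
 proof -
  have "norm (Y n (Y n x - Z x)) <= norm (Y n x - Z x)" for n by (rule Yn)
  hence "eventually (\<lambda>n. norm (Y n (Y n x - Z x)) <= norm (Y n x - Z x)) sequentially" by simp
  moreover have "(\<lambda>n. norm (Y n x - Z x)) ----> 0"
   using Z(2)[of x] by (simp add: LIM_zero tendsto_norm_zero)
  ultimately have "(\<lambda>n. Y n (Y n x - Z x)) ----> 0" by (rule Lim_null_comparison)
  from tendsto_add[OF this Z(2)[of "Z x"]] show ?thesis by (simp add: bcl_diff[OF Yb])
 qed
 have Zeq: "Z x = (1/2) *\<^sub>R (B x + Z (Z x))" for x
 proof (rule LIMSEQ_unique)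
  show "(\<lambda>n. Y (Suc n) x) ----> Z x" by (rule LIMSEQ_Suc[OF Z(2)])
  show "(\<lambda>n. Y (Suc n) x) ----> (1/2) *\<^sub>R (B x + Z (Z x))" unfolding YS
   by (rule tendsto_scaleR[OF tendsto_const tendsto_add[OF tendsto_const YYZ]])
 qed
 define P where "P = (\<lambda>x. x - Z x)"
 have sP: "self_adj P" unfolding P_def using Z by (intro self_adj_minus self_adj_id) (simp add: pos_iff)
 have "inner (Z x) x <= (norm x)^2" for x
  by (rule LIMSEQ_le_const2[OF tendsto_inner[OF Z(2)[of x] tendsto_const[of x]]])
    (use order_trans[OF norm_cauchy_schwarz mult_right_mono[OF Yn]] in "auto simp: power2_eq_square")
 hence "pos P" using sP by (simp add: pos_iff P_def inner_diff_left power2_norm_eq_inner)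
 moreover have "P (P x) = S x" for x
 proof -
  have "2 *\<^sub>R Z x = B x + Z (Z x)" by (subst Zeq[of x]) simp
  thus ?thesis by (simp add: P_def B_def bcl_diff[OF Zb] scaleR_2 algebra_simps)
 qed
 moreover have "u (P x) = P (u x)" if u: "bcl u" "\<forall>x. u (S x) = S (u x)" for u x
 proof -
  have "u (Y n x) = Y n (u x)" for n x
   by (rule nonneg_polys_commute[OF Ynp u(1)]) (use u in "simp add: B_def bcl_diff")
  hence "(\<lambda>n. u (Y n x)) ----> Z (u x)" using Z(2) by simp
  hence "u (Z x) = Z (u x)" by (rule LIMSEQ_unique[OF bcl_tendsto[OF u(1) Z(2)]])
  thus ?thesis by (simp add: P_def bcl_diff u)
 qed
 ultimately show ?thesis by blast
qed

lemma operator_modulus: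
 assumes A: "self_adj A"
 shows "\<exists>P. pos P \<and> (\<forall>x. P (P x) = A (A x)) \<and>
  (\<forall>u. bcl u --> (\<forall>x. u (A x) = A (u x)) --> (\<forall>x. u (P x) = P (u x)))"
proof -
 note bA = self_adj_bcl[OF A]
 obtain K where K: "K > 0" "!!x. norm (A x) <= K * norm x" using bcl_bound[OF bA] by blast
 define C where "C = (\<lambda>x. (1 / K) *\<^sub>R A x)"
 have sC: "self_adj C" unfolding C_def by (rule self_adj_rmult[OF A])
 have C: "inner (C (C x)) x = (norm (C x))^2" for x
  by (simp add: self_adj_inner[OF sC] power2_norm_eq_inner)
 have nC: "norm (C x) <= norm x" for x using K by (simp add: C_def field_simps)
 have "pos (C o C)" using self_adj_comp[OF sC sC] by (simp add: pos_iff C)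
 moreover have "inner ((C o C) x) x <= (norm x)^2" for x using nC[of x] by (simp add: C power_mono)
 ultimately obtain P where P: "pos P" "!!x. P (P x) = C (C x)"
  "!!u x. bcl u ==> \<forall>x. u (C (C x)) = C (C (u x)) ==> u (P x) = P (u x)"
  using positive_sqrt_contraction[of "C o C"] by (auto simp: o_def)
 have bP: "bcl P" using P(1) by (simp add: positive_op_def)
 show ?thesis
 proof (intro exI[of _ "\<lambda>x. K *\<^sub>R P x"] conjI allI impI)
  show "pos (\<lambda>x. K *\<^sub>R P x)"
   using P(1) K(1) by (auto simp: pos_iff self_adj_rmult)
  show "K *\<^sub>R P (K *\<^sub>R P x) = A (A x)" for x
   using K(1) by (simp add: bcl_scaleR[OF bP] P(2)) (simp add: C_def bcl_scaleR[OF bA])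
  fix u x assume u: "bcl u" "\<forall>x. u (A x) = A (u x)"
  thus "u (K *\<^sub>R P x) = K *\<^sub>R P (u x)"
   using P(3)[of u x] by (simp add: bcl_scaleR C_def)
 qed
qed

text \<open>Projects onto the kernel of \<open>P - A\<close>, with \<open>P\<close> the modulus of
  \<open>A\<close>. As \<open>P + A\<close> maps into that kernel, \<open>A = - P\<close> on the
  complement. The kernel of \<open>A\<close> is assigned to the nonnegative side; this convention
  later yields right-continuity of the spectral family.\<close>

lemma sign_projection:
 assumes A: "self_adj A"
 shows "\<exists>q. proj q \<and>
  (\<forall>u. bcl u --> (\<forall>x. u (A x) = A (u x)) --> (\<forall>x. cadj u (A x) = A (cadj u x)) --> (\<forall>x. u (q x) = q (u x))) \<and>
  (\<forall>x. q x = x --> 0 <= inner (A x) x) \<and> (\<forall>x. q x = 0 --> inner (A x) x <= 0) \<and> (\<forall>x. A x = 0 --> q x = x)"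
proof -
 note bA = self_adj_bcl[OF A]
 obtain P where P: "pos P" "!!x. P (P x) = A (A x)"
  "!!u x. bcl u ==> \<forall>x. u (A x) = A (u x) ==> u (P x) = P (u x)"
  using operator_modulus[OF A] by blast
 have sP: "self_adj P" and bP: "bcl P" using P(1) by (auto simp: pos_iff self_adj_bcl)
 have AP: "A (P x) = P (A x)" for x using P(3)[OF bA] by simp
 define V where "V = {x. P x = A x}"
 have V: "csubspace V" by (simp add: csubspace_def V_def bcl_simps[OF bP] bcl_simps[OF bA])
 have "closed V" unfolding V_def
  by (intro closed_Collect_eq linear_continuous_on bcl_linear bP bA)
 then obtain q where q: "proj q" "!!x. q x = x \<longleftrightarrow> x \<in> V" using projection_onto[OF V] by metis
 have com: "u (q x) = q (u x)" if u: "bcl u" "\<forall>x. u (A x) = A (u x)" "\<forall>x. cadj u (A x) = A (cadj u x)" for u x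
 proof (rule proj_commute[OF q(1) u(1), symmetric])
  fix x assume "q x = x"
  hence x: "P x = A x" by (simp add: q V_def)
  have "P (u x) = u (P x)" using P(3)[OF u(1,2)] by simp
  thus "q (u x) = u x" using u(2) by (simp add: q V_def x)
  have "P (cadj u x) = cadj u (P x)" using P(3)[OF bcl_cadj[OF u(1)] u(3)] by simp
  thus "q (cadj u x) = cadj u x" using u(3) by (simp add: q V_def x)
 qed
 have "inner (A x) x <= 0" if x: "q x = 0" for x
 proof -
  let ?y = "P x + A x"
  have "q ?y = ?y" by (simp add: q V_def bcl_simps[OF bP] bcl_simps[OF bA] P(2) AP add.commute)
  moreover have "q ?y = P (q x) + A (q x)"
  proof -
   have c: "cadj A = A" "cadj P = P" using A sP by (simp_all add: self_adj_iff)
   have "q (A x) = A (q x)" by (rule com[symmetric]) (simp_all add: bA c)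
   moreover have "q (P x) = P (q x)"
    by (rule com[symmetric]) (simp_all add: bP c AP)
   ultimately show ?thesis by (simp add: bcl_add[OF proj_bcl[OF q(1)]])
  qed
  ultimately have "A x = - P x" using x by (simp add: bcl_simps[OF bP] bcl_simps[OF bA] eq_neg_iff_add_eq_0 add.commute)
  thus ?thesis using P(1) by (simp add: pos_iff)
 qed
 moreover have "0 <= inner (A x) x" if "q x = x" for x
 proof -
  have "P x = A x" using that by (simp add: q V_def)
  moreover have "0 <= inner (P x) x" using P(1) by (simp add: pos_iff)
  ultimately show ?thesis by (simp only:)
 qed
 moreover have "q x = x" if "A x = 0" for x
 proof -
  have "inner (P x) (P x) = inner (A (A x)) x" by (simp add: P(2)[symmetric] self_adj_inner[OF sP, of "P x"])
  hence "P x = 0" using that by (simp add: bcl_0[OF bA])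
  thus ?thesis using that by (simp add: q V_def)
 qed
 ultimately show ?thesis using q(1) com by blast
qed

subsection \<open>The resolution of the identity\<close>

context
 fixes R :: "'a::chilbert_space => 'a"
 assumes R: "pos R" and R1: "!!x. inner (R x) x <= (norm x)^2" and Rinj: "!!x. R x = 0 ==> x = 0"
begin

lemma spectral_family_exists:
 "\<exists>q. \<forall>l. proj (q l) \<and>
  (\<forall>u. bcl u --> (\<forall>x. u (R x) = R (u x)) --> (\<forall>x. cadj u (R x) = R (cadj u x)) --> (\<forall>x. u (q l x) = q l (u x))) \<and>
  (\<forall>x. q l x = x --> (norm x)\<^sup>2 <= (1 + l) * inner (R x) x) \<and>
  (\<forall>x. q l x = 0 --> x ~= 0 --> (1 + l) * inner (R x) x < (norm x)^2)"
proof (rule choice, rule allI)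
 fix l :: real
 have sR: "self_adj R" and bR: "bcl R" using R by (auto simp: pos_iff self_adj_bcl)
 \<comment> \<open>For \<open>R\<close> the resolvent of \<open>H\<close> at \<open>-1\<close> this
   is \<open>(l - H) R\<close>, so its nonnegative part is the spectral subspace of \<open>H\<close>
   below \<open>l\<close>.\<close>
 define A where "A = (\<lambda>x. (1 + l) *\<^sub>R R x - x)"
 have sA: "self_adj A" unfolding A_def by (intro self_adj_minus self_adj_rmult self_adj_id sR)
 have fA: "inner (A x) x = (1 + l) * inner (R x) x - (norm x)^2" for x
  by (simp add: A_def inner_diff_left power2_norm_eq_inner)
 obtain q where q: "proj q"
  "\<forall>u. bcl u --> (\<forall>x. u (A x) = A (u x)) --> (\<forall>x. cadj u (A x) = A (cadj u x)) --> (\<forall>x. u (q x) = q (u x))"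
  "\<forall>x. q x = x --> 0 <= inner (A x) x" "\<forall>x. q x = 0 --> inner (A x) x <= 0" "\<forall>x. A x = 0 --> q x = x"
  using sign_projection[OF sA] by blast
 have comq: "A (q x) = q (A x)" for x
 proof -
  have "cadj A = A" using sA by (simp add: self_adj_iff)
  thus ?thesis using q(2) self_adj_bcl[OF sA] by simp
 qed
 have strict: "(1 + l) * inner (R x) x < (norm x)^2" if x: "q x = 0" "x ~= 0" for x
 proof (rule ccontr)
  assume "\<not> ?thesis"
  hence z: "inner (A x) x = 0" using q(4) x fA[of x] by force
  \<comment> \<open>Equality would make the form of the positive operator \<open>D\<close>, which is
    minus \<open>A\<close> on the complement of \<open>q\<close>, vanish at \<open>x\<close>. Then
    \<open>A x = 0\<close>, and the kernel of \<open>A\<close> belongs to the range of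
    \<open>q\<close>.\<close>
  define D where "D = (\<lambda>x. A (q x) - A x)"
  have D: "D y = - A (y - q y)" for y by (simp add: D_def bcl_diff[OF self_adj_bcl[OF sA]])
  have "self_adj D" unfolding D_def
   using self_adj_comp[OF sA proj_sa[OF q(1)]] comq by (intro self_adj_minus sA) (auto simp: o_def)
  moreover have "0 <= inner (D y) y" for y
  proof -
   have "inner (A (y - q y)) (q y) = inner (q (A (y - q y))) y"
    by (simp add: self_adj_inner[OF proj_sa[OF q(1)]])
   also have "... = 0" by (simp add: comq[symmetric] bcl_diff[OF proj_bcl[OF q(1)]] proj_idem[OF q(1)] bcl_0[OF self_adj_bcl[OF sA]])
   finally have "inner (D y) y = - inner (A (y - q y)) (y - q y)" by (simp add: D inner_diff_right)
   moreover have "q (y - q y) = 0" by (simp add: bcl_diff[OF proj_bcl[OF q(1)]] proj_idem[OF q(1)])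
   ultimately show ?thesis using q(4) by simp
  qed
  ultimately have "pos D" by (simp add: pos_iff)
  moreover have "inner (D x) x = 0" using z x by (simp add: D)
  ultimately have "D x = 0" by (rule positive_form_zero)
  hence "A x = 0" using x by (simp add: D)
  hence "q x = x" using q(5) by blast
  thus False using x by simp
 qed
 have com: "u (q x) = q (u x)"
  if u: "bcl u" "\<forall>x. u (R x) = R (u x)" "\<forall>x. cadj u (R x) = R (cadj u x)" for u x
  using q(2) u bcl_cadj[OF u(1)] by (simp add: A_def bcl_simps)
 show "\<exists>q. proj q \<and>
  (\<forall>u. bcl u --> (\<forall>x. u (R x) = R (u x)) --> (\<forall>x. cadj u (R x) = R (cadj u x)) --> (\<forall>x. u (q x) = q (u x))) \<and>
  (\<forall>x. q x = x --> (norm x)\<^sup>2 <= (1 + l) * inner (R x) x) \<and>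
  (\<forall>x. q x = 0 --> x ~= 0 --> (1 + l) * inner (R x) x < (norm x)^2)"
  using q(1,3) strict com fA by (intro exI[of _ q]) auto
qed

definition sfam :: "real => 'a => 'a" where
 "sfam = (SOME q. \<forall>l. proj (q l) \<and>
  (\<forall>u. bcl u --> (\<forall>x. u (R x) = R (u x)) --> (\<forall>x. cadj u (R x) = R (cadj u x)) --> (\<forall>x. u (q l x) = q l (u x))) \<and>
  (\<forall>x. q l x = x --> (norm x)\<^sup>2 <= (1 + l) * inner (R x) x) \<and>
  (\<forall>x. q l x = 0 --> x ~= 0 --> (1 + l) * inner (R x) x < (norm x)^2))"

lemma
 shows sfam_proj: "proj (sfam l)"
  and sfam_commute: "\<lbrakk>bcl u; !!x. u (R x) = R (u x); !!x. cadj u (R x) = R (cadj u x)\<rbrakk> \<Longrightarrow>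
   u (sfam l x) = sfam l (u x)"
  and sfam_in: "sfam l x = x ==> (norm x)\<^sup>2 <= (1 + l) * inner (R x) x"
  and sfam_out: "sfam l x = 0 ==> x ~= 0 ==> (1 + l) * inner (R x) x < (norm x)^2"
 using someI_ex[OF spectral_family_exists] unfolding sfam_def[symmetric] by blast+

lemma R_bcl: "bcl R" and R_sa: "self_adj R" and R_nonneg: "0 <= inner (R x) x"
 using R by (auto simp: pos_iff self_adj_bcl)

lemma sfam_R: "R (sfam l x) = sfam l (R x)"
 using R_sa by (intro sfam_commute) (simp_all add: R_bcl self_adj_iff)

lemma sfam_sfam_commute: "sfam l (sfam m x) = sfam m (sfam l x)"
proof (rule sfam_commute)
 show "bcl (sfam l)" by (rule proj_bcl[OF sfam_proj])
 show "sfam l (R x) = R (sfam l x)" for x by (rule sfam_R[symmetric])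
 show "cadj (sfam l) (R x) = R (cadj (sfam l) x)" for x
  using proj_sa[OF sfam_proj, of l] by (simp add: self_adj_iff sfam_R)
qed

lemma sfam_mono: assumes "l <= m" shows "sfam m (sfam l x) = sfam l x"
proof (rule ccontr)
 define z where "z = sfam l x - sfam m (sfam l x)"
 note d = bcl_diff[OF proj_bcl[OF sfam_proj]] and i = proj_idem[OF sfam_proj]
 assume "\<not> ?thesis"
 hence "z ~= 0" by (simp add: z_def)
 moreover have "sfam m z = 0" by (simp add: z_def d i)
 ultimately have "(1 + m) * inner (R z) z < (norm z)^2" by (rule sfam_out[rotated])
 moreover have "sfam l z = z" by (simp add: z_def d i sfam_sfam_commute[of l m])
 hence "(norm z)^2 <= (1 + l) * inner (R z) z" by (rule sfam_in)
 ultimately have "(1 + m) * inner (R z) z < (1 + l) * inner (R z) z" by linarith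
 moreover have "(1 + l) * inner (R z) z <= (1 + m) * inner (R z) z"
  by (rule mult_right_mono) (use assms R_nonneg in auto)
 ultimately show False by linarith
qed

lemma sfam_mono': assumes "l <= m" shows "sfam l (sfam m x) = sfam l x"
 unfolding sfam_sfam_commute[of l m x] by (rule sfam_mono[OF assms])

lemma sfam_neg: assumes "l < 0" shows "sfam l x = 0"
proof (rule ccontr)
 define z where "z = sfam l x"
 assume "sfam l x ~= 0"
 hence z0: "(norm z)^2 > 0" by (simp add: z_def)
 have "(norm z)^2 <= (1 + l) * inner (R z) z" by (rule sfam_in) (simp add: z_def proj_idem[OF sfam_proj])
 also have "... < (norm z)^2"
 proof (cases "1 + l <= 0")
  case True
  hence "(1 + l) * inner (R z) z <= 0" using R_nonneg by (simp add: mult_nonpos_nonneg)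
  thus ?thesis using z0 by linarith
 next
  case False
  hence "(1 + l) * inner (R z) z <= (1 + l) * (norm z)^2" by (intro mult_left_mono R1) auto
  also have "... < 1 * (norm z)^2" using assms z0 by (intro mult_strict_right_mono) auto
  finally show ?thesis by simp
 qed
 finally show False by simp
qed

lemma sfam_pythagoras:
 assumes "l <= m" shows "(norm (sfam m x - sfam l x))^2 = (norm (sfam m x))^2 - (norm (sfam l x))^2"
 using proj_pythagoras[OF sfam_proj, of "sfam m x" l] by (simp add: sfam_mono'[OF assms])

text \<open>Let \<open>z\<close> be the excess of the limit from the right over
  \<open>sfam a x\<close>. The weak bounds \<open>sfam_in\<close> at points above \<open>a\<close>
  pass to the limit at \<open>a\<close>, where they contradict the strict bound
  \<open>sfam_out\<close> unless \<open>z = 0\<close>.\<close>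

lemma sfam_right_continuous: "((\<lambda>l. sfam l x) \<longlongrightarrow> sfam a x) (at_right a)"
proof -
 have *: "(\<lambda>n. sfam (S n) x) ----> sfam a x"
  if S: "!!n. a < S n" "decseq S" "S ----> a" for S :: "nat => real"
 proof -
 have S': "S m <= S n" if "n <= m" for m n using S(2) that by (simp add: decseq_def)
 have "convergent (\<lambda>n. - sfam (S n) x + x)"
 proof (rule convergent_orthogonal_increments[where C = "norm x + norm x"])
  fix m n :: nat assume mn: "n <= m"
  have "(norm (x - sfam l x))^2 = (norm x)^2 - (norm (sfam l x))^2" for l
   using proj_pythagoras[OF sfam_proj, of x l] by simp
  thus "(norm (- sfam (S m) x + x - (- sfam (S n) x + x)))^2 =
    (norm (- sfam (S m) x + x))^2 - (norm (- sfam (S n) x + x))^2"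
   using sfam_pythagoras[OF S'[OF mn], of x] by simp
 next
  fix n
  show "norm (- sfam (S n) x + x) <= norm x + norm x"
   using proj_norm[OF sfam_proj, of "S n" x] by (intro norm_triangle_le) simp
 qed
 then obtain y' where "(\<lambda>n. - sfam (S n) x + x) ----> y'" by (auto simp: convergent_def)
 from tendsto_diff[OF tendsto_const[of x] this] obtain y where y: "(\<lambda>n. sfam (S n) x) ----> y" by auto
 have yS: "sfam (S m) y = y" for m
 proof (rule LIMSEQ_unique)
  show "(\<lambda>n. sfam (S m) (sfam (S n) x)) ----> sfam (S m) y" by (rule bcl_tendsto[OF proj_bcl[OF sfam_proj] y])
  have "eventually (\<lambda>n. sfam (S n) x = sfam (S m) (sfam (S n) x)) sequentially"
   by (rule eventually_sequentiallyI[of m]) (simp add: sfam_mono S')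
  with y show "(\<lambda>n. sfam (S m) (sfam (S n) x)) ----> y" by (rule Lim_transform_eventually)
 qed
 have ya: "sfam a y = sfam a x"
 proof (rule LIMSEQ_unique)
  show "(\<lambda>n. sfam a (sfam (S n) x)) ----> sfam a y" by (rule bcl_tendsto[OF proj_bcl[OF sfam_proj] y])
  show "(\<lambda>n. sfam a (sfam (S n) x)) ----> sfam a x" using S(1) by (simp add: sfam_mono' less_imp_le)
 qed
 define z where "z = y - sfam a y"
 note d = bcl_diff[OF proj_bcl[OF sfam_proj]]
 have "sfam (S m) z = z" for m using S(1)[of m] by (simp add: z_def d yS sfam_mono)
 hence "(norm z)^2 <= (1 + S m) * inner (R z) z" for m by (rule sfam_in)
 moreover have "(\<lambda>m. (1 + S m) * inner (R z) z) ----> (1 + a) * inner (R z) z" by (intro tendsto_intros S(3))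
 ultimately have "(norm z)^2 <= (1 + a) * inner (R z) z" by (intro LIMSEQ_le_const) auto
 moreover have "sfam a z = 0" by (simp add: z_def d proj_idem[OF sfam_proj])
 ultimately have "z = 0" using sfam_out[of a z] by force
 thus ?thesis using y ya by (simp add: z_def)
 qed
 show ?thesis
  by (rule tendsto_at_right_sequentially[of a "a + 1"]) (auto intro: *)
qed

lemma sfam_at_top: "(\<lambda>n. sfam (real n) x) ----> x"
proof -
 have "convergent (\<lambda>n. sfam (real n) x)"
  by (rule convergent_orthogonal_increments[where C = "norm x"])
    (auto simp: sfam_pythagoras proj_norm[OF sfam_proj])
 then obtain y where y: "(\<lambda>n. sfam (real n) x) ----> y" by (auto simp: convergent_def)
 define z where "z = x - y"
 have yn: "sfam (real m) y = sfam (real m) x" for m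
 proof (rule LIMSEQ_unique)
  show "(\<lambda>n. sfam (real m) (sfam (real n) x)) ----> sfam (real m) y"
   by (rule bcl_tendsto[OF proj_bcl[OF sfam_proj] y])
  have "eventually (\<lambda>n. sfam (real m) x = sfam (real m) (sfam (real n) x)) sequentially"
   by (rule eventually_sequentiallyI[of m]) (simp add: sfam_mono')
  with tendsto_const show "(\<lambda>n. sfam (real m) (sfam (real n) x)) ----> sfam (real m) x"
   by (rule Lim_transform_eventually)
 qed
 have "sfam (real m) z = 0" for m by (simp add: z_def bcl_diff[OF proj_bcl[OF sfam_proj]] yn)
 hence le: "(1 + real m) * inner (R z) z <= (norm z)^2" for m
  using sfam_out[of "real m" z] by (cases "z = 0") (auto simp: bcl_0[OF R_bcl])
 have "inner (R z) z = 0"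
 proof (rule ccontr)
  assume "inner (R z) z ~= 0"
  hence p: "inner (R z) z > 0" using R_nonneg[of z] by simp
  obtain m :: nat where "(norm z)^2 / inner (R z) z < real m" using reals_Archimedean2 by blast
  hence "(norm z)^2 < real m * inner (R z) z" using p by (simp add: field_simps)
  thus False using le[of m] p by (simp add: algebra_simps)
 qed
 hence "z = 0" using positive_form_zero[OF R] Rinj by blast
 thus ?thesis using y by (simp add: z_def)
qed

definition smeas :: "'a => real measure" where
 "smeas x = interval_measure (\<lambda>l. (norm (sfam l x))^2)"

lemma sfam_norm_mono: "l <= m ==> (norm (sfam l x))\<^sup>2 <= (norm (sfam m x))^2"
 using sfam_pythagoras[of l m x] zero_le_power2[of "norm (sfam m x - sfam l x)"] by linarith

lemma sfam_norm_cont: "continuous (at_right a) (\<lambda>l. (norm (sfam l x))^2)"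
 unfolding continuous_within by (intro tendsto_power tendsto_norm sfam_right_continuous)

lemma smeas_sets [simp, measurable_cong]: "sets (smeas x) = sets borel" and smeas_space [simp]: "space (smeas x) = UNIV"
 by (simp_all add: smeas_def)

lemma smeas_UNIV: "emeasure (smeas x) UNIV = ennreal ((norm x)^2)"
 unfolding smeas_def
proof (rule interval_measure_UNIV)
 show "((\<lambda>l. (norm (sfam l x))^2) \<longlongrightarrow> 0) at_bot"
  by (rule tendsto_eventually) (auto simp: eventually_at_bot_linorder intro!: exI[of _ "-1"] sfam_neg)
 show "((\<lambda>l. (norm (sfam l x))^2) \<longlongrightarrow> (norm x)\<^sup>2) at_top"
 proof (rule tendsto_at_topI_sequentially_real)
  show "mono (\<lambda>l. (norm (sfam l x))^2)" by (rule monoI) (rule sfam_norm_mono)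
  show "(\<lambda>n. (norm (sfam (real n) x))^2) ----> (norm x)\<^sup>2" by (intro tendsto_intros sfam_at_top)
 qed
qed (simp_all only: sfam_norm_mono sfam_norm_cont zero_le_power2)

lemma smeas_finite: "finite_measure (smeas x)"
 by (rule finite_measureI) (simp add: smeas_UNIV)

lemma smeas_Iic: "measure (smeas x) {..b} = (norm (sfam b x))^2"
proof -
 have Ioc: "emeasure (smeas x) {a<..b} = ennreal ((norm (sfam b x))^2 - (norm (sfam a x))^2)" if "a <= b" for a b
  unfolding smeas_def by (rule emeasure_interval_measure_Ioc[OF that sfam_norm_mono sfam_norm_cont])
 have neg: "emeasure (smeas x) {..a} = 0" if "a < 0" for a
 proof -
  have "{..a} \<subseteq> (\<Union>n. {a - real (Suc n)<..a})"
  proof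
   fix s assume "s \<in> {..a}"
   moreover obtain n where "a - s < real n" using reals_Archimedean2 by blast
   ultimately have "s \<in> {a - real (Suc n)<..a}" by auto
   thus "s \<in> (\<Union>n. {a - real (Suc n)<..a})" by blast
  qed
  moreover have "emeasure (smeas x) (\<Union>n. {a - real (Suc n)<..a}) = 0"
   by (rule emeasure_UN_eq_0) (use that in "auto simp: Ioc sfam_neg")
  ultimately show ?thesis using emeasure_mono[of "{..a}" "\<Union>n. {a - real (Suc n)<..a}" "smeas x"] by auto
 qed
 show ?thesis
 proof (cases "b < 0")
  case True thus ?thesis by (simp add: measure_def neg sfam_neg)
 next
  case False
  hence "{..b} = {..-1} \<union> {-1<..b}" by auto
  hence "emeasure (smeas x) {..b} = emeasure (smeas x) {..-1} + emeasure (smeas x) {-1<..b}"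
   using plus_emeasure[of "{..-1}" "smeas x" "{-1<..b}"] by (simp add: disjoint_iff)
  also have "... = ennreal ((norm (sfam b x))^2)" using False by (simp add: neg Ioc sfam_neg)
  finally show ?thesis by (simp add: measure_def)
 qed
qed

lemma borel_Dynkin [consumes 1, case_names basic empty compl union]:
 assumes "B \<in> sets (borel :: real measure)" "!!l. P {..l}" "P {}"
  "!!A. A \<in> sets borel ==> P A ==> P (- A)"
  "!!A. disjoint_family A ==> (!!i::nat. A i \<in> sets borel) ==> (!!i. P (A i)) ==> P (\<Union>i. A i)"
 shows "P B"
proof -
 let ?G = "range (\<lambda>a::real. {..a})"
 have G: "A \<in> sets borel \<longleftrightarrow> A \<in> sigma_sets UNIV ?G" for A
  unfolding borel_eq_atMost by (simp add: sets_measure_of)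
 have "Int_stable ?G" by (auto simp: Int_stable_def)
 moreover have "?G \<subseteq> Pow UNIV" by simp
 ultimately show ?thesis using assms(1) unfolding G
 proof (induction rule: sigma_sets_induct_disjoint)
  case (union A)
  thus ?case using assms(5)[of A] G by auto
 qed (use assms(2-4) G in "auto simp: Compl_eq_Diff_UNIV")
qed

lemma smeas_sum_op:
 assumes A: "!!i::nat. A i \<in> sets borel" "disjoint_family A"
  and T: "!!i. pos (T i)" "!!i x. inner (T i x) x = measure (smeas x) (A i)"
 shows "\<exists>Z. pos Z \<and> (\<forall>x. (\<lambda>i. T i x) sums Z x) \<and> (\<forall>x. inner (Z x) x = measure (smeas x) (\<Union>i. A i))"
proof -
 define S where "S n x = (\<Sum>i<n. T i x)" for n x
 have S: "self_adj (S n)" "inner (S n x) x = (\<Sum>i<n. measure (smeas x) (A i))" for n x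
 proof -
  show "self_adj (S n)"
  proof (induction n)
   case 0 show ?case using self_adj_zero by (simp add: S_def)
  next
   case (Suc n)
   have "S (Suc n) = (\<lambda>x. S n x + T n x)" by (simp add: S_def fun_eq_iff)
   thus ?case using T(1)[of n] self_adj_plus[OF Suc, of "T n"] by (simp only: pos_iff simp_thms)
  qed
  show "inner (S n x) x = (\<Sum>i<n. measure (smeas x) (A i))" by (simp add: S_def inner_sum_left T)
 qed
 have sums: "(\<lambda>i. measure (smeas x) (A i)) sums measure (smeas x) (\<Union>i. A i)" for x
  using finite_measure.finite_measure_UNION[OF smeas_finite, of A x] A by auto
 have "\<exists>Z. pos Z \<and> (\<forall>x. (\<lambda>n. S n x) ----> Z x)"
 proof (rule monotone_operator_limit[where C = 1])
  show "pos (S n)" for n by (auto simp: pos_iff S intro: sum_nonneg)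
  show "op_le (S n) (S (Suc n))" for n by (simp add: op_le_iff S)
  fix n x
  have "inner (S n x) x <= measure (smeas x) (\<Union>i. A i)"
   unfolding S sums_unique[OF sums] by (intro sum_le_suminf sums_summable[OF sums]) auto
  also have "... <= measure (smeas x) (space (smeas x))" by (rule finite_measure.bounded_measure[OF smeas_finite])
  finally show "inner (S n x) x <= 1 * (norm x)^2" by (simp add: measure_def smeas_UNIV)
 qed
 then obtain Z where Z: "pos Z" "!!x. (\<lambda>n. S n x) ----> Z x" by blast
 have "inner (Z x) x = measure (smeas x) (\<Union>i. A i)" for x
  using tendsto_inner[OF Z(2)[of x] tendsto_const[of x]] sums[of x] unfolding sums_def S by (rule LIMSEQ_unique)
 thus ?thesis using Z by (auto simp: sums_def S_def)
qed

text \<open>Set operations lift to positive operators: a complement to the identity minus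
  \<open>T\<close>, a disjoint union to a monotone limit of partial sums. Commutation is carried
  along because the resulting projections must commute with each other.\<close>

lemma smeas_op_exists:
 assumes "B \<in> sets borel"
 shows "\<exists>T. pos T \<and> (\<forall>x. inner (T x) x = measure (smeas x) B) \<and>
  (\<forall>u. bcl u --> (\<forall>x. u (R x) = R (u x)) --> (\<forall>x. cadj u (R x) = R (cadj u x)) --> (\<forall>x. u (T x) = T (u x)))"
 using assms
proof (induction rule: borel_Dynkin)
 case (basic l)
 show ?case
  by (intro exI[of _ "sfam l"])
    (auto simp: proj_pos[OF sfam_proj] proj_inner[OF sfam_proj] smeas_Iic sfam_commute)
next
 case empty
 show ?case by (intro exI[of _ "\<lambda>x. 0"]) (auto simp: pos_iff self_adj_zero bcl_0)
next
 case (compl A)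
 then obtain T where T: "pos T" "!!x. inner (T x) x = measure (smeas x) A"
  "!!u x. bcl u ==> \<forall>x. u (R x) = R (u x) ==> \<forall>x. cadj u (R x) = R (cadj u x) ==> u (T x) = T (u x)"
  by blast
 have m: "measure (smeas x) (- A) = (norm x)^2 - measure (smeas x) A" for x
  using finite_measure.finite_measure_compl[OF smeas_finite, of A x] compl
  by (simp add: Compl_eq_Diff_UNIV measure_def[of _ UNIV] smeas_UNIV)
 show ?case
 proof (intro exI[of _ "\<lambda>x. x - T x"] conjI allI impI)
  show "inner (x - T x) x = measure (smeas x) (- A)" for x
   by (simp add: m inner_diff_left T power2_norm_eq_inner)
  show "pos (\<lambda>x. x - T x)"
   unfolding pos_iff
   using T(1) by (auto simp: self_adj_minus self_adj_id pos_iff inner_diff_left T m[symmetric]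
     simp flip: power2_norm_eq_inner)
 qed (use T in "auto simp: bcl_diff")
next
 case (union A)
 from union.IH obtain T where T: "!!i. pos (T i)" "!!i x. inner (T i x) x = measure (smeas x) (A i)"
  "!!i u x. bcl u ==> \<forall>x. u (R x) = R (u x) ==> \<forall>x. cadj u (R x) = R (cadj u x) ==> u (T i x) = T i (u x)"
  by metis
 obtain Z where Z: "pos Z" "!!x. (\<lambda>i. T i x) sums Z x" "!!x. inner (Z x) x = measure (smeas x) (\<Union>i. A i)"
  using smeas_sum_op[of A T] union T(1,2) by blast
 show ?case
 proof (intro exI[of _ Z] conjI allI impI)
  fix u x assume u: "bcl u" "\<forall>x. u (R x) = R (u x)" "\<forall>x. cadj u (R x) = R (cadj u x)"
  have "(\<lambda>i. T i (u x)) sums u (Z x)" using bounded_linear.sums[OF bcl_linear[OF u(1)] Z(2)] by (simp only: T(3)[OF u])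
  thus "u (Z x) = Z (u x)" by (rule sums_unique2[OF _ Z(2)])
 qed (rule Z)+
qed

definition sproj :: "real set => 'a => 'a" where
 "sproj B = (SOME T. pos T \<and> (\<forall>x. inner (T x) x = measure (smeas x) B) \<and>
  (\<forall>u. bcl u --> (\<forall>x. u (R x) = R (u x)) --> (\<forall>x. cadj u (R x) = R (cadj u x)) --> (\<forall>x. u (T x) = T (u x))))"

lemma
 assumes "B \<in> sets borel"
 shows sproj_pos: "pos (sproj B)" and sproj_form: "inner (sproj B x) x = measure (smeas x) B"
  and sproj_commute: "\<lbrakk>bcl u; !!x. u (R x) = R (u x); !!x. cadj u (R x) = R (cadj u x)\<rbrakk> \<Longrightarrow>
   u (sproj B x) = sproj B (u x)"
 using someI_ex[OF smeas_op_exists[OF assms]] unfolding sproj_def[symmetric] by blast+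

lemma sproj_sa: "B \<in> sets borel ==> self_adj (sproj B)"
 and sproj_bcl: "B \<in> sets borel ==> bcl (sproj B)"
 using sproj_pos pos_iff self_adj_bcl by blast+

lemma sproj_eqI:
 "B \<in> sets borel ==> self_adj T ==> (!!x. inner (T x) x = measure (smeas x) B) ==> sproj B = T"
 by (rule self_adj_eq) (auto simp: sproj_sa sproj_form)

lemma sproj_Iic: "sproj {..l} = sfam l"
 by (rule sproj_eqI) (auto simp: proj_sa[OF sfam_proj] proj_inner[OF sfam_proj] smeas_Iic)

lemma sproj_compl:
 assumes "B \<in> sets borel" shows "sproj (- B) = (\<lambda>x. x - sproj B x)"
proof (rule sproj_eqI)
 fix x
 have "measure (smeas x) (- B) = (norm x)^2 - measure (smeas x) B"
  using finite_measure.finite_measure_compl[OF smeas_finite, of B x] assms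
  by (simp add: Compl_eq_Diff_UNIV measure_def[of _ UNIV] smeas_UNIV)
 thus "inner (x - sproj B x) x = measure (smeas x) (- B)"
  using assms by (simp add: inner_diff_left sproj_form power2_norm_eq_inner)
qed (use assms in "auto intro: self_adj_minus self_adj_id sproj_sa")

lemma sproj_empty: "sproj {} = (\<lambda>x. 0)"
 by (rule sproj_eqI) (auto simp: self_adj_zero)

lemma sproj_sums:
 assumes A: "!!i. A i \<in> sets borel" "disjoint_family A"
 shows "(\<lambda>i. sproj (A i) x) sums sproj (\<Union>i. A i) x"
proof -
 have U: "(\<Union>i. A i) \<in> sets borel" using A by auto
 obtain Z where Z: "pos Z" "!!x. (\<lambda>i. sproj (A i) x) sums Z x" "!!x. inner (Z x) x = measure (smeas x) (\<Union>i. A i)"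
  using smeas_sum_op[of A "\<lambda>i. sproj (A i)"] A sproj_pos[OF A(1)] sproj_form[OF A(1)] by blast
 have "sproj (\<Union>i. A i) = Z" by (rule sproj_eqI[OF U _ Z(3)]) (use Z(1) in "simp add: pos_iff")
 thus ?thesis using Z(2) by simp
qed

lemma sproj_sfam: "B \<in> sets borel ==> sfam l (sproj B x) = sproj B (sfam l x)"
proof (rule sproj_commute)
 show "bcl (sfam l)" by (rule proj_bcl[OF sfam_proj])
 show "sfam l (R x) = R (sfam l x)" for x by (rule sfam_R[symmetric])
 show "cadj (sfam l) (R x) = R (cadj (sfam l) x)" for x
  using proj_sa[OF sfam_proj, of l] by (simp add: self_adj_iff sfam_R)
qed

text \<open>Extends multiplicativity in one argument only; \<open>sproj_Int\<close> applies it
  twice, first with a half-line and then with an arbitrary Borel set in the fixed slot.\<close>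

lemma sproj_Int_induct:
 assumes B: "B \<in> sets borel" and basic: "!!l x. sproj (B \<inter> {..l}) x = sproj B (sproj {..l} x)"
  and C: "C \<in> sets borel"
 shows "sproj (B \<inter> C) x = sproj B (sproj C x)"
 using C
proof (induction arbitrary: x rule: borel_Dynkin)
 case (basic l) thus ?case by (rule assms(2))
next
 case empty thus ?case by (simp add: sproj_empty bcl_0[OF sproj_bcl[OF B]])
next
 case (compl A)
 define F where "F = (\<lambda>n::nat. if n = 0 then B \<inter> A else if n = 1 then B \<inter> - A else {})"
 have "disjoint_family F" by (auto simp: disjoint_family_on_def F_def)
 moreover have "F n \<in> sets borel" for n using B compl by (auto simp: F_def)
 ultimately have "(\<lambda>n. sproj (F n) x) sums sproj (\<Union>n. F n) x" by (intro sproj_sums)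
 moreover have "(\<lambda>n. sproj (F n) x) sums (\<Sum>n\<in>{0,1}. sproj (F n) x)"
  by (rule sums_finite) (auto simp: F_def sproj_empty)
 ultimately have "sproj (\<Union>n. F n) x = sproj (B \<inter> A) x + sproj (B \<inter> - A) x"
  using sums_unique2 by (fastforce simp: F_def)
 moreover have "(\<Union>n. F n) = B" by (auto simp: F_def split: if_splits)
 ultimately show ?case using compl by (simp add: sproj_compl bcl_diff[OF sproj_bcl[OF B]] algebra_simps)
next
 case (union A)
 have "(\<lambda>n. sproj B (sproj (A n) x)) sums sproj B (sproj (\<Union>n. A n) x)"
  by (rule bounded_linear.sums[OF bcl_linear[OF sproj_bcl[OF B]] sproj_sums]) (use union in auto)
 moreover have "(\<lambda>n. sproj (B \<inter> A n) x) sums sproj (\<Union>n. B \<inter> A n) x"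
  by (rule sproj_sums) (use union B in "auto simp: disjoint_family_on_def")
 ultimately show ?case using union.IH by (simp add: sums_iff)
qed

lemma sproj_Int:
 assumes B: "B \<in> sets borel" and C: "C \<in> sets borel"
 shows "sproj (B \<inter> C) x = sproj B (sproj C x)"
proof (rule sproj_Int_induct[OF B _ C])
 fix l x
 have "sproj ({..l} \<inter> B) x = sproj {..l} (sproj B x)"
 proof (rule sproj_Int_induct[OF _ _ B])
  fix m x
  show "sproj ({..l} \<inter> {..m}) x = sproj {..l} (sproj {..m} x)"
   unfolding sproj_Iic Int_atMost
   by (cases "l <= m") (auto simp: sproj_Iic min_def sfam_mono sfam_mono')
 qed simp
 thus "sproj (B \<inter> {..l}) x = sproj B (sproj {..l} x)"
  by (simp add: Int_commute sproj_Iic sproj_sfam[OF B])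
qed

lemma sproj_spectral: "spm sproj"
 unfolding spectral_measure_def
proof (intro conjI ballI allI impI)
 show "proj (sproj B)" if "B \<in> sets borel" for B
  using sproj_Int[OF that that] sproj_sa[OF that] by (simp add: is_projection_iff)
 show "sproj UNIV = id"
  using sproj_compl[of "{}"] by (simp add: sproj_empty fun_eq_iff)
 show "sproj (B \<inter> C) = sproj B o sproj C" if "B \<in> sets borel" "C \<in> sets borel" for B C
  using sproj_Int[OF that] by auto
 fix B :: "nat => real set" and x assume "range B \<subseteq> sets borel \<and> disjoint_family B"
 thus "(\<lambda>n. sproj (B n) x) sums sproj (\<Union>n. B n) x" by (intro sproj_sums) auto
qed

lemma sproj_neg: "sproj {..<0} x = 0"
proof -
 have e: "{..<0::real} = (\<Union>n. {..- (1 / real (Suc n))})"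
 proof (intro set_eqI iffI)
  fix s :: real assume "s \<in> {..<0}"
  then obtain n where "1 / real (Suc n) < - s" using nat_approx_posE[of "- s"] by auto
  thus "s \<in> (\<Union>n. {..- (1 / real (Suc n))})" by (auto intro!: exI[of _ n] simp del: of_nat_Suc)
 qed (auto intro: le_less_trans simp del: of_nat_Suc)
 have "emeasure (smeas x) (\<Union>n. {..- (1 / real (Suc n))}) = 0"
 proof (rule emeasure_UN_eq_0)
  show "emeasure (smeas x) {..- (1 / real (Suc n))} = 0" for n
   by (simp add: finite_measure.emeasure_eq_measure[OF smeas_finite] smeas_Iic sfam_neg del: of_nat_Suc)
 qed auto
 hence "inner (sproj {..<0} x) x = 0" by (simp only: sproj_form lessThan_borel) (simp only: e measure_def enn2real_0)
 thus ?thesis by (rule positive_form_zero[OF sproj_pos, rotated]) simp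
qed

text \<open>On the spectral subspace where \<open>i/N <= 1/(1 + s) < (i + 1)/N\<close> both operators have quadratic forms
 within \<open>1/N\<close> of \<open>i/N\<close>.\<close>

lemma sproj_resolvent:
 defines "\<rho> \<equiv> \<lambda>s::real. indicator {0..} s * (1 / (1 + s))"
 shows "bdd_borel (\<lambda>s. cor (\<rho> s))" and "sib sproj (\<lambda>s. cor (\<rho> s)) = R"
proof -
 note E = sproj_spectral
 have \<rho>m: "\<rho> \<in> BM" unfolding \<rho>_def by measurable
 have \<rho>b: "\<bar>\<rho> s\<bar> <= 1" for s by (auto simp: \<rho>_def indicator_def field_simps)
 show r: "bdd_borel (\<lambda>s. cor (\<rho> s))" by (rule bdd_borel_of_real[OF \<rho>m \<rho>b])
 define R' where "R' = sib sproj (\<lambda>s. cor (\<rho> s))"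
 have sR': "self_adj R'" unfolding R'_def by (rule sib_self_adj[OF E r]) simp
 define D where "D = (\<lambda>x. R x - R' x)"
 have sD: "self_adj D" unfolding D_def by (intro self_adj_minus R_sa sR')
 note pB = sm_proj[OF E]
 have "inner (D x) x = 0" for x
 proof -
  have main: "\<bar>inner (D x) x\<bar> <= (norm x)^2 / real (Suc n)" for n
  proof -
   define N where "N = Suc n"
   have N: "real N > 0" by (simp add: N_def)
   define C where "C i = {s. 0 <= s \<and> nat \<lfloor>real N / (1 + s)\<rfloor> = i}" for i
   have "{s. nat \<lfloor>real N / (1 + s)\<rfloor> = i} \<in> sets borel" for i by measurable
   hence C: "C i \<in> sets borel" for i unfolding C_def by (simp add: Collect_conj_eq)
   have Cb: "0 <= s" "real i * (1 + s) <= real N" "real N < (real i + 1) * (1 + s)" if "s \<in> C i" for s i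
   proof -
    have s: "0 <= s" "0 <= real N / (1 + s)" "nat \<lfloor>real N / (1 + s)\<rfloor> = i" using that N by (auto simp: C_def)
    hence "real i <= real N / (1 + s)" "real N / (1 + s) < real i + 1" by linarith+
    thus "0 <= s" "real i * (1 + s) <= real N" "real N < (real i + 1) * (1 + s)"
     using s(1) by (simp_all add: le_divide_eq divide_less_eq)
   qed
   have Cfin: "C i = {}" if "i > N" for i
   proof -
    have "i <= N" if "s \<in> C i" for s
     using Cb(2)[OF that] mult_left_mono[of 1 "1 + s" "real i"] Cb(1)[OF that] by simp
    thus ?thesis using that by force
   qed
   define y where "y i = sproj (C i) x" for i
   have "(\<lambda>i. y i) sums sproj (\<Union>i. C i) x"
    unfolding y_def by (rule sm_sums[OF E C]) (auto simp: disjoint_family_on_def C_def)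
   moreover have "(\<Union>i. C i) = - {..<0}" by (auto simp: C_def)
   ultimately have "(\<lambda>i. y i) sums x" using sproj_compl[of "{..<0}"] by (simp add: sproj_neg)
   moreover have "(\<lambda>i. y i) sums (\<Sum>i\<le>N. y i)"
    by (rule sums_finite) (auto simp: y_def Cfin sproj_empty not_le)
   ultimately have x: "x = (\<Sum>i\<le>N. y i)" by (rule sums_unique2)
   have yC: "sproj (C i) (y i) = y i" for i by (simp add: y_def proj_idem[OF pB[OF C]])
   have yx: "inner (T (y i)) x = inner (T (y i)) (y i)" if "!!z. T (sproj (C i) z) = sproj (C i) (T z)" for T i
   proof -
    have "T (y i) = sproj (C i) (T (y i))" using that[of "y i"] by (simp only: yC)
    hence "inner (T (y i)) x = inner (sproj (C i) (T (y i))) x" by (rule arg_cong)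
    thus ?thesis by (simp only: self_adj_inner[OF proj_sa[OF pB[OF C]]] y_def)
   qed
   have "sproj (C i) (D z) = D (sproj (C i) z)" for i z
    using sproj_commute[OF C R_bcl, of i z] R_sa sib_E_commute[OF E r C, of i z]
    by (simp add: D_def bcl_diff[OF proj_bcl[OF pB[OF C]]] R'_def self_adj_iff)
   hence "inner (D x) x = (\<Sum>i\<le>N. inner (D (y i)) (y i))"
    by (subst (1) x) (simp add: linear_sum[OF bounded_linear.linear[OF bcl_linear[OF self_adj_bcl[OF sD]]]] inner_sum_left yx)
   also have "\<bar>...\<bar> <= (\<Sum>i\<le>N. (norm (y i))^2 / N)"
   proof (rule order_trans[OF sum_abs], rule sum_mono)
    fix i
    have Rl: "real i / N * (norm (y i))^2 <= inner (R (y i)) (y i)"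
    proof (cases "i = 0")
     case False
     have "C i \<subseteq> {..N / real i - 1}"
      using Cb(2)[of _ i] False by (auto simp: field_simps)
     hence "sfam (N / real i - 1) (y i) = y i"
      using sm_mono[OF E C[of i], of "{..N / real i - 1}" "y i"] yC by (simp add: sproj_Iic)
     from sfam_in[OF this] show ?thesis using False N by (simp add: field_simps)
    qed (use R_nonneg in simp)
    have "{..N / (real i + 1) - 1} \<inter> C i = {}"
     using Cb(3)[of _ i] by (force simp: field_simps)
    hence "sfam (N / (real i + 1) - 1) (y i) = 0"
     using sm_Int[OF E, of "{..N / (real i + 1) - 1}" "C i" x] C by (simp add: sproj_Iic y_def sproj_empty)
    hence Ru: "inner (R (y i)) (y i) <= (real i + 1) / N * (norm (y i))^2"
     using sfam_out[of "N / (real i + 1) - 1" "y i"] N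
     by (cases "y i = 0") (auto simp: field_simps bcl_0[OF R_bcl])
    define \<mu> where "\<mu> = scm sproj (y i)"
    have AE: "AE s in \<mu>. s \<in> C i"
    proof (rule AE_I[where N = "- C i"])
     show "emeasure \<mu> (- C i) = 0"
      using C[of i] by (simp add: \<mu>_def emeasure_scalar[OF E] sproj_compl yC)
    qed (use C[of i] in "auto simp: \<mu>_def scalar_measure_sets[OF E]")
    have int: "integrable \<mu> f" if "f \<in> BM" "!!s. \<bar>f s\<bar> <= K" for f :: "real => real" and K
     unfolding \<mu>_def by (rule integrable_scalar[OF E]) (use that in auto)
    have "cor (\<integral>s. \<rho> s \<partial>\<mu>) = cinner (R' (y i)) (y i)"
     unfolding R'_def \<mu>_def sib_form[OF E r] by simp
    hence R': "inner (R' (y i)) (y i) = (\<integral>s. \<rho> s \<partial>\<mu>)" by (metis Re_complex_of_real inner_eq_Re_cinner)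
    have c: "(\<integral>s. c \<partial>\<mu>) = c * (norm (y i))^2" for c :: real
     by (simp add: \<mu>_def scalar_measure_space[OF E] measure_scalar_UNIV[OF E])
    have "real i / N * (norm (y i))^2 <= inner (R' (y i)) (y i)"
     unfolding R' c[symmetric]
    proof (rule integral_mono_AE[OF int int[OF \<rho>m \<rho>b] AE_mp[OF AE]])
     show "AE s in \<mu>. s \<in> C i --> real i / N <= \<rho> s"
     proof (intro AE_I2 impI)
      fix s assume "s \<in> C i"
      from Cb(1)[OF this] Cb(2)[OF this] N this show "real i / N <= \<rho> s"
       by (simp add: \<rho>_def pos_divide_le_eq pos_le_divide_eq mult.commute)
     qed
    qed auto
    moreover have "inner (R' (y i)) (y i) <= (real i + 1) / N * (norm (y i))^2"
     unfolding R' c[symmetric]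
    proof (rule integral_mono_AE[OF int[OF \<rho>m \<rho>b] int AE_mp[OF AE]])
     show "AE s in \<mu>. s \<in> C i --> \<rho> s <= (real i + 1) / N"
     proof (intro AE_I2 impI)
      fix s assume "s \<in> C i"
      from Cb(1)[OF this] Cb(3)[OF this] N this show "\<rho> s <= (real i + 1) / N"
       by (simp add: \<rho>_def field_simps)
     qed
    qed auto
    ultimately show "\<bar>inner (D (y i)) (y i)\<bar> <= (norm (y i))^2 / N"
     using Rl Ru by (simp add: D_def inner_diff_left abs_le_iff add_divide_distrib distrib_right)
   qed
   also have "... = (norm x)^2 / N"
   proof -
    have "inner x x = (\<Sum>i\<le>N. inner (y i) (y i))"
     by (subst (1) x) (simp add: inner_sum_left yx[of "\<lambda>z. z"])
    thus ?thesis by (simp add: power2_norm_eq_inner sum_divide_distrib)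
   qed
   finally show ?thesis by (simp add: N_def)
  qed
  have "(\<lambda>n. (norm x)^2 * (1 / real (Suc n))) ----> (norm x)\<^sup>2 * 0"
   by (intro tendsto_mult tendsto_const LIMSEQ_Suc lim_1_over_n)
  hence "\<bar>inner (D x) x\<bar> <= (norm x)^2 * 0" by (rule LIMSEQ_le_const) (use main in auto)
  thus ?thesis by simp
 qed
 hence "inner (R' x) x = inner (R x) x" for x by (simp add: D_def inner_diff_left)
 thus "sib sproj (\<lambda>s. cor (\<rho> s)) = R" unfolding R'_def[symmetric] by (intro self_adj_eq sR' R_sa)
qed

end

subsection \<open>Graphs and adjoints\<close>

text \<open>Single-valuedness is left out, so that adjoints, composites and closures can be handled
  before they are known to be operators.\<close>

definition linear_rel :: "'a::chilbert_space uop => bool" where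
 "linear_rel S \<longleftrightarrow> (0, 0) \<in> S \<and> (\<forall>(x, y)\<in>S. \<forall>(x', y')\<in>S. (x + x', y + y') \<in> S) \<and>
   (\<forall>c. \<forall>(x, y)\<in>S. (c *\<^sub>C x, c *\<^sub>C y) \<in> S)"

lemma linear_rel_zero: "linear_rel S ==> (0, 0) \<in> S"
 and linear_rel_add: "linear_rel S ==> (x, y) \<in> S ==> (x', y') \<in> S ==> (x + x', y + y') \<in> S"
 and linear_rel_scaleC: "linear_rel S ==> (x, y) \<in> S ==> (c *\<^sub>C x, c *\<^sub>C y) \<in> S"
 by (auto simp: linear_rel_def)

lemma linear_rel_scaleR: "linear_rel S ==> (x, y) \<in> S ==> (r *\<^sub>R x, r *\<^sub>R y) \<in> S"
 using linear_rel_scaleC[of S x y "cor r"] by (simp add: scaleC_of_real)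

lemma linear_rel_diff: "linear_rel S ==> (x, y) \<in> S ==> (x', y') \<in> S ==> (x - x', y - y') \<in> S"
 using linear_rel_add[of S x y "- x'" "- y'"] linear_rel_scaleR[of S x' y' "-1"] by simp

lemma clinear_graph_iff: "clinear_graph T \<longleftrightarrow> single_valued T \<and> linear_rel T"
 by (auto simp: clinear_graph_def linear_rel_def)

lemma clinear_graph_unique: "clinear_graph T ==> (x, y) \<in> T ==> (x, z) \<in> T ==> y = z"
 by (auto simp: clinear_graph_def single_valued_def)

lemma linear_rel_Domain: "linear_rel S ==> csubspace (Domain S)"
 unfolding csubspace_def by (auto intro: linear_rel_zero linear_rel_add linear_rel_scaleC)

lemma linear_rel_comp:
 assumes S: "linear_rel S" and T: "linear_rel T" shows "linear_rel (S O T)"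
 unfolding linear_rel_def
proof (intro conjI allI ballI)
 show "(0, 0) \<in> S O T" by (rule relcompI[OF linear_rel_zero[OF S] linear_rel_zero[OF T]])
 show "case p of (x, y) => \<forall>(x', y')\<in>S O T. (x + x', y + y') \<in> S O T" if "p \<in> S O T" for p
  using that by (auto intro: relcompI linear_rel_add[OF S] linear_rel_add[OF T])
 show "case p of (x, y) => (c *\<^sub>C x, c *\<^sub>C y) \<in> S O T" if "p \<in> S O T" for p c
  using that by (auto intro: relcompI linear_rel_scaleC[OF S] linear_rel_scaleC[OF T])
qed

lemma linear_rel_graph: "bcl T ==> linear_rel (graph T)"
 by (auto simp: linear_rel_def graph_def bcl_simps)

lemma csubspace_dense:
 assumes V: "csubspace V" and orth: "!!z. (!!x. x \<in> V ==> cinner z x = 0) ==> z = 0"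
 shows "closure V = UNIV"
proof -
 obtain p where p: "proj p" "!!x. p x = x \<longleftrightarrow> x \<in> closure V" "!!x. p x = 0 \<longleftrightarrow> (\<forall>z\<in>closure V. cinner x z = 0)"
  using projection_onto[OF csubspace_closure[OF V] closed_closure] by metis
 have "p x = x" for x
 proof -
  have "p (x - p x) = 0" by (simp add: bcl_diff[OF proj_bcl[OF p(1)]] proj_idem[OF p(1)])
  hence "x - p x = 0" using p(3) closure_subset by (intro orth) blast
  thus ?thesis by simp
 qed
 thus ?thesis using p(2) by auto
qed

lemma dense_orthogonal:
 assumes "closure V = UNIV" "!!x. x \<in> V ==> cinner z x = 0" shows "z = 0"
proof -
 have "z \<in> closure V" using assms(1) by simp
 then obtain X where X: "!!n. X n \<in> V" "X ----> z" by (auto simp: closure_sequential)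
 have "(\<lambda>n. cinner z (X n)) ----> cinner z z" by (intro tendsto_cinner tendsto_const X)
 hence "cinner z z = 0" using assms(2) X(1) by (simp add: LIMSEQ_const_iff)
 thus ?thesis by (simp add: cinner_self)
qed

text \<open>Orthogonal projection onto the closed graph in the product space, von Neumann's device:
  it yields both the double adjoint theorem and the surjectivity of the identity plus the square of
  the modulus.\<close>

lemma linear_rel_decomposition:
 assumes S: "linear_rel S"
 obtains u v where "(u, v) \<in> closure S" "!!x y. (x, y) \<in> S ==> cinner x (a - u) + cinner y (b - v) = 0"
proof -
 have "subspace S"
  unfolding subspace_def using linear_rel_zero[OF S] linear_rel_add[OF S] linear_rel_scaleR[OF S]
  by (auto simp: zero_prod_def)
 then obtain z where z: "z \<in> closure S" "!!w. w \<in> closure S ==> inner ((a, b) - z) w = 0"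
  using orthogonal_decomposition[OF closed_closure, of S "(a, b)"] subspace_closure by blast
 obtain u v where uv: "z = (u, v)" by (cases z)
 have re: "inner x (a - u) + inner y (b - v) = 0" if "(x, y) \<in> S" for x y
  using z(2)[of "(x, y)"] that closure_subset uv by (auto simp: inner_commute)
 have "cinner x (a - u) + cinner y (b - v) = 0" if xy: "(x, y) \<in> S" for x y
 proof -
  have "Re (\<i> * (cinner x (a - u) + cinner y (b - v))) = 0"
   using re[OF linear_rel_scaleC[OF S xy, of \<i>]]
   by (simp add: inner_eq_Re_cinner cinner_scaleC_left)
  moreover have "Re (cinner x (a - u) + cinner y (b - v)) = 0"
   using re[OF xy] by (simp add: inner_eq_Re_cinner)
  ultimately show ?thesis by (simp add: complex_eq_iff)
 qed
 thus ?thesis using that z(1) uv by blast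
qed

lemma graph_adjI: "(!!x w. (x, w) \<in> T ==> cinner w y = cinner x z) ==> (y, z) \<in> graph_adj T"
 and graph_adjD: "(y, z) \<in> graph_adj T ==> (x, w) \<in> T ==> cinner w y = cinner x z"
 by (auto simp: graph_adj_def)

lemma graph_adj_linear: "linear_rel (graph_adj T)"
 unfolding linear_rel_def
proof (intro conjI allI ballI)
 show "(0, 0) \<in> graph_adj T" by (rule graph_adjI) simp
 show "case p of (x, y) => \<forall>(x', y')\<in>graph_adj T. (x + x', y + y') \<in> graph_adj T" if "p \<in> graph_adj T" for p
  using that by (auto intro!: graph_adjI simp: cinner_add_right dest: graph_adjD) (metis graph_adjD)
 show "case p of (x, y) => (c *\<^sub>C x, c *\<^sub>C y) \<in> graph_adj T" if "p \<in> graph_adj T" for c p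
  using that by (auto intro!: graph_adjI simp: cinner_scaleC_right dest: graph_adjD)
qed

lemma graph_adj_closed: "closed (graph_adj T)"
 unfolding closed_sequential_limits
proof (intro allI impI)
 fix X l assume "(\<forall>n. X n \<in> graph_adj T) \<and> X ----> l"
 hence X: "!!n. (fst (X n), snd (X n)) \<in> graph_adj T"
  and lim: "(\<lambda>n. fst (X n)) ----> fst l" "(\<lambda>n. snd (X n)) ----> snd l"
  by (auto intro: tendsto_fst tendsto_snd)
 have "(fst l, snd l) \<in> graph_adj T"
 proof (rule graph_adjI)
  fix x w assume xw: "(x, w) \<in> T"
  have "(\<lambda>n. cinner w (fst (X n))) ----> cinner w (fst l)" "(\<lambda>n. cinner x (snd (X n))) ----> cinner x (snd l)"
   by (intro tendsto_cinner tendsto_const lim)+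
  thus "cinner w (fst l) = cinner x (snd l)"
   unfolding graph_adjD[OF X xw] by (rule LIMSEQ_unique)
 qed
 thus "l \<in> graph_adj T" by simp
qed

lemma graph_adj_single_valued: "closure (Domain T) = UNIV ==> single_valued (graph_adj T)"
proof (rule single_valuedI)
 fix y z z' assume d: "closure (Domain T) = UNIV" and z: "(y, z) \<in> graph_adj T" "(y, z') \<in> graph_adj T"
 have "cinner (z - z') x = 0" if x: "x \<in> Domain T" for x
 proof -
  obtain w where "(x, w) \<in> T" using x by blast
  hence "cinner x (z - z') = 0" using z by (simp add: cinner_diff_right graph_adjD[symmetric])
  thus ?thesis using cinner_commute[of "z - z'" x] by simp
 qed
 thus "z = z'" using dense_orthogonal[OF d, of "z - z'"] by simp
qed

lemma closure_subset_graph_adj2: "closure S \<subseteq> graph_adj (graph_adj S)"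
proof (rule closure_minimal[OF _ graph_adj_closed], clarify, rule graph_adjI)
 fix x y z w assume "(x, y) \<in> S" "(z, w) \<in> graph_adj S"
 thus "cinner w x = cinner z y" using graph_adjD[of z w S x y] cinner_commute[of w x] cinner_commute[of z y] by simp
qed

text \<open>The residual of a pair in the double adjoint is orthogonal to the graph, so its rotation
  lies in the adjoint. Pairing the residual with its own rotation makes a sum of two squared norms
  vanish.\<close>

lemma graph_adj2:
 assumes S: "linear_rel S" shows "graph_adj (graph_adj S) = closure S"
proof (intro equalityI closure_subset_graph_adj2 subsetI)
 fix p assume "p \<in> graph_adj (graph_adj S)"
 then obtain x y where p: "p = (x, y)" "(x, y) \<in> graph_adj (graph_adj S)" by (cases p) auto
 obtain u v where uv: "(u, v) \<in> closure S" "!!x' y'. (x', y') \<in> S ==> cinner x' (x - u) + cinner y' (y - v) = 0"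
  using linear_rel_decomposition[OF S, of x y] by blast
 have "(y - v, - (x - u)) \<in> graph_adj S"
 proof (rule graph_adjI)
  fix a w assume "(a, w) \<in> S"
  from uv(2)[OF this] show "cinner w (y - v) = cinner a (- (x - u))"
   unfolding cinner_minus_right eq_neg_iff_add_eq_0 by (simp only: add.commute)
 qed
 moreover have "(x - u, y - v) \<in> graph_adj (graph_adj S)"
  using closure_subset_graph_adj2 uv(1) by (intro linear_rel_diff graph_adj_linear p(2)) blast
 ultimately have "cinner (- (x - u)) (x - u) = cinner (y - v) (y - v)" by (rule graph_adjD[rotated])
 hence "cor (- (norm (x - u))\<^sup>2) = cor ((norm (y - v))^2)"
  by (simp only: cinner_minus_left cinner_self of_real_minus)
 hence "- (norm (x - u))\<^sup>2 = (norm (y - v))^2" using of_real_eq_iff by blast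
 hence "(norm (x - u))^2 + (norm (y - v))^2 = 0" by linarith
 hence "x = u" "y = v" by (simp_all add: sum_power2_eq_zero_iff)
 thus "p \<in> closure S" using uv(1) p by simp
qed

subsection \<open>Resolvents and the spectral theorem\<close>

text \<open>Surjectivity of the identity plus \<open>H\<close> supplies everything else: solving
  twice shows that the adjoint is no larger than \<open>H\<close>, and solving for a vector
  orthogonal to the domain shows that this vector is zero.\<close>

lemma positive_selfadjointI:
 assumes H: "clinear_graph H"
  and sym: "!!x y x' y'. (x, y) \<in> H ==> (x', y') \<in> H ==> cinner y x' = cinner x y'"
  and pos: "!!x y. (x, y) \<in> H ==> 0 <= inner y x"
  and surj: "!!z. \<exists>x. (x, z - x) \<in> H"
 shows "psa H"
proof -
 have lin: "linear_rel H" and sv: "single_valued H" using H by (auto simp: clinear_graph_iff)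
 have adj: "graph_adj H = H"
 proof (intro equalityI subsetI)
  fix p assume "p \<in> H"
  thus "p \<in> graph_adj H" using sym by (cases p) (auto intro!: graph_adjI)
 next
  fix p assume "p \<in> graph_adj H"
  then obtain x y where p: "p = (x, y)" "(x, y) \<in> graph_adj H" by (cases p) auto
  obtain u where u: "(u, x + y - u) \<in> H" using surj by blast
  obtain w where w: "(w, (x - u) - w) \<in> H" using surj by blast
  have "cinner ((x - u) - w) x = cinner w y" using graph_adjD[OF p(2) w] .
  moreover have "cinner ((x - u) - w) u = cinner w (x + y - u)" using sym[OF w u] .
  ultimately have "cinner (x - u) (x - u) = 0" by (simp add: cinner_simps algebra_simps)
  hence "x = u" by (simp add: cinner_self)
  thus "p \<in> H" using u p by simp
 qed
 have "closure (Domain H) = UNIV"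
 proof (rule csubspace_dense[OF linear_rel_Domain[OF lin]])
  fix z assume z: "!!x. x \<in> Domain H ==> cinner z x = 0"
  obtain u where u: "(u, z - u) \<in> H" using surj by blast
  hence "cinner z u = 0" using z by blast
  hence "inner z u = 0" by (simp add: inner_eq_Re_cinner)
  hence "inner u u <= 0" using pos[OF u] by (simp add: inner_diff_left)
  hence "u = 0" by (metis inner_gt_zero_iff not_le)
  thus "z = 0" using u clinear_graph_unique[OF H u] linear_rel_zero[OF lin] by simp
 qed
 moreover have "closed H" using graph_adj_closed[of H] adj by simp
 moreover have "cinner y x \<in> \<real>\<^sub>\<ge>\<^sub>0" if "(x, y) \<in> H" for x y
 proof -
  have "cnj (cinner y x) = cinner y x" using sym[OF that that] cinner_commute[of x y] by simp
  hence "Im (cinner y x) = 0" by (simp add: complex_eq_iff)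
  thus ?thesis using pos[OF that] by (simp add: complex_nonneg_Reals_iff inner_eq_Re_cinner)
 qed
 ultimately show ?thesis using H adj by (auto simp: positive_selfadjoint_def closed_densely_defined_def)
qed

lemma
 assumes "psa H"
 shows psa_clinear: "clinear_graph H" and psa_linear: "linear_rel H" and psa_closed: "closed H"
  and psa_adj: "graph_adj H = H"
  and psa_pos: "(x, y) \<in> H ==> 0 <= inner y x"
  and psa_sym: "(x, y) \<in> H ==> (x', y') \<in> H ==> cinner y x' = cinner x y'"
proof -
 show "clinear_graph H" "closed H" "graph_adj H = H"
  using assms by (auto simp: positive_selfadjoint_def closed_densely_defined_def)
 thus "linear_rel H" by (simp add: clinear_graph_iff)
 show "0 <= inner y x" if "(x, y) \<in> H"
  using assms that by (auto simp: positive_selfadjoint_def complex_nonneg_Reals_iff inner_eq_Re_cinner)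
 show "cinner y x' = cinner x y'" if "(x, y) \<in> H" "(x', y') \<in> H"
  using that \<open>graph_adj H = H\<close> graph_adjD by metis
qed

text \<open>The range of the identity plus \<open>H\<close> is dense, since a vector orthogonal to
  it would be an eigenvector for \<open>-1\<close>. It is closed because positivity gives
  \<open>norm x <= norm (x + y)\<close> on the graph.\<close>

lemma resolvent_exists:
 assumes H: "psa H"
 shows "\<exists>u. (u, z - u) \<in> H"
proof -
 define V where "V = (\<lambda>(x, y). x + y) ` H"
 have V: "csubspace V"
  unfolding csubspace_def V_def
 proof (intro conjI ballI allI)
  show "0 \<in> (\<lambda>(x, y). x + y) ` H" using imageI[OF linear_rel_zero[OF psa_linear[OF H]], of "\<lambda>(x, y). x + y"] by simp
  show "a + b \<in> (\<lambda>(x, y). x + y) ` H" if ab: "a \<in> (\<lambda>(x, y). x + y) ` H" "b \<in> (\<lambda>(x, y). x + y) ` H" for a b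
  proof -
   obtain x y x' y' where "(x, y) \<in> H" "(x', y') \<in> H" "a = x + y" "b = x' + y'" using ab by auto
   thus ?thesis using imageI[OF linear_rel_add[OF psa_linear[OF H], of x y x' y'], of "\<lambda>(x, y). x + y"]
    by (simp add: algebra_simps)
  qed
  show "c *\<^sub>C a \<in> (\<lambda>(x, y). x + y) ` H" if a: "a \<in> (\<lambda>(x, y). x + y) ` H" for a c
  proof -
   obtain x y where "(x, y) \<in> H" "a = x + y" using a by auto
   thus ?thesis using imageI[OF linear_rel_scaleC[OF psa_linear[OF H], of x y c], of "\<lambda>(x, y). x + y"]
    by (simp add: scaleC_add_right)
  qed
 qed
 have dense: "closure V = UNIV"
 proof (rule csubspace_dense[OF V])
  fix z assume z: "!!x. x \<in> V ==> cinner z x = 0"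
  have "(z, - z) \<in> graph_adj H"
  proof (rule graph_adjI)
   fix x w assume "(x, w) \<in> H"
   hence "x + w \<in> V" by (force simp: V_def)
   hence "cinner z (x + w) = 0" by (rule z)
   hence "cinner (x + w) z = 0" using cinner_commute[of "x + w" z] by simp
   thus "cinner w z = cinner x (- z)"
    by (simp add: cinner_add_left cinner_minus_right eq_neg_iff_add_eq_0 add.commute)
  qed
  hence "0 <= inner (- z) z" using psa_adj[OF H] psa_pos[OF H, of z "- z"] by (simp only:)
  hence "inner z z <= 0" by simp
  thus "z = 0" by (metis inner_gt_zero_iff not_le)
 qed
 have bound: "norm x <= norm (x + y)" "norm y <= norm (x + y)" if "(x, y) \<in> H" for x y
 proof -
  have "(norm (x + y))^2 = (norm x)^2 + (norm y)^2 + 2 * inner y x"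
   by (simp add: power2_norm_eq_inner inner_add_left inner_add_right inner_commute)
  hence "(norm x)^2 <= (norm (x + y))^2" "(norm y)^2 <= (norm (x + y))^2" using psa_pos[OF H that] by auto
  thus "norm x <= norm (x + y)" "norm y <= norm (x + y)" by (auto intro: power2_le_imp_le)
 qed
 have "z \<in> closure V" using dense by simp
 then obtain Z where Z: "!!n. Z n \<in> V" "Z ----> z" by (auto simp: closure_sequential)
 then have "\<forall>n. \<exists>x y. (x, y) \<in> H \<and> Z n = x + y" by (force simp: V_def)
 then obtain X Y where XY: "!!n. (X n, Y n) \<in> H" "!!n. Z n = X n + Y n" by metis
 have "norm (X m - X n) <= norm (Z m - Z n)" for m n
  using bound(1)[OF linear_rel_diff[OF psa_linear[OF H] XY(1)[of m] XY(1)[of n]]]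
  by (simp add: XY(2) algebra_simps)
 hence "dist (X m) (X n) <= dist (Z m) (Z n)" for m n by (simp add: dist_norm)
 moreover have "Cauchy Z" using Z(2) by (rule LIMSEQ_imp_Cauchy)
 ultimately have "Cauchy X" unfolding Cauchy_def by (meson le_less_trans)
 then obtain x where x: "X ----> x" using Cauchy_convergent convergent_def by blast
 have "Y ----> z - x" using tendsto_diff[OF Z(2) x] by (simp add: XY(2))
 hence "(\<lambda>n. (X n, Y n)) ----> (x, z - x)" using x by (intro tendsto_Pair)
 hence "(x, z - x) \<in> H" by (rule closed_sequentially[OF psa_closed[OF H], rotated]) (rule XY)
 thus ?thesis by blast
qed

lemma psa_resolvent:
 assumes H: "psa H"
 obtains R where "!!z. (R z, z - R z) \<in> H" "!!u z. (u, z - u) \<in> H ==> u = R z"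
  "pos R" "!!z. inner (R z) z <= (norm z)^2"
proof -
 obtain R where R: "!!z. (R z, z - R z) \<in> H" using resolvent_exists[OF H] by metis
 have uniq: "u = R z" if "(u, z - u) \<in> H" for u z
 proof -
  have "(u - R z, - (u - R z)) \<in> H" using linear_rel_diff[OF psa_linear[OF H] that R[of z]] by simp
  hence "inner (u - R z) (u - R z) <= 0"
   using psa_pos[OF H] by (metis inner_minus_left neg_0_le_iff_le)
  thus ?thesis by (simp add: power2_norm_eq_inner[symmetric])
 qed
 have form: "inner (R z) z = (norm (R z))^2 + inner (z - R z) (R z)" for z
  by (simp add: inner_diff_left power2_norm_eq_inner inner_commute[of z "R z"])
 have n: "norm (R z) <= norm z" for z
 proof -
  have "(norm (R z))^2 <= inner (R z) z" using form[of z] psa_pos[OF H R[of z]] by simp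
  also have "... <= norm (R z) * norm z" by (rule norm_cauchy_schwarz)
  finally show ?thesis by (cases "norm (R z) = 0") (auto simp: power2_eq_square)
 qed
 have b: "bcl R"
 proof (rule bclI[where K = 1])
  show "R (x + y) = R x + R y" for x y
   using linear_rel_add[OF psa_linear[OF H] R[of x] R[of y]]
   by (intro uniq[symmetric]) (simp add: algebra_simps)
  show "R (c *\<^sub>C x) = c *\<^sub>C R x" for c x
   using linear_rel_scaleC[OF psa_linear[OF H] R[of x], of c]
   by (intro uniq[symmetric]) (simp add: scaleC_diff_right)
 qed (use n in auto)
 have sa: "self_adj R"
  unfolding self_adj_def using b psa_sym[OF H R R] by (simp add: cinner_diff_left cinner_diff_right)
 have pos: "pos R" using sa form psa_pos[OF H R] by (simp add: pos_iff)
 have R1: "inner (R z) z <= (norm z)^2" for z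
 proof -
  have "inner (R z) z <= norm (R z) * norm z" by (rule norm_cauchy_schwarz)
  also have "... <= norm z * norm z" by (intro mult_right_mono n) auto
  finally show ?thesis by (simp add: power2_eq_square)
 qed
 show thesis by (rule that[OF R uniq pos R1])
qed

text \<open>The measure is built from the resolvent \<open>R\<close>, which it represents by
  \<open>1 / (1 + s)\<close>. The graph of \<open>H\<close> and that of the integral of
  \<open>s\<close> then coincide, both consisting of the pairs
  \<open>(R z, z - R z)\<close>.\<close>

theorem spectral_theorem:
 assumes H: "psa H"
 shows "\<exists>E. spm E \<and> sint E cor = H"
proof -
 obtain R where R: "!!z. (R z, z - R z) \<in> H" and uniq: "!!u z. (u, z - u) \<in> H ==> u = R z"
  and pos: "pos R" and R1: "!!z. inner (R z) z <= (norm z)^2" using psa_resolvent[OF H] by blast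
 have b: "bcl R" using pos by (simp add: pos_iff self_adj_bcl)
 have inj: "z = 0" if "R z = 0" for z
  using R[of z] clinear_graph_unique[OF psa_clinear[OF H] R[of z], of 0] linear_rel_zero[OF psa_linear[OF H]] that by simp
 define E where "E = sproj R"
 have E: "spm E" unfolding E_def by (rule sproj_spectral[OF pos R1 inj])
 define r where "r = (\<lambda>s. cor (indicator {0..} s * (1 / (1 + s))))"
 have r: "bdd_borel r" "sib E r = R"
  unfolding r_def E_def using sproj_resolvent(1)[OF pos R1 inj] sproj_resolvent(2)[OF pos R1 inj] by auto

 have rs: "(\<lambda>s. cor s * r s) = (\<lambda>s. indicator {0..} s - r s)"
 proof
  fix s :: real
  show "cor s * r s = indicator {0..} s - r s"
  proof (cases "0 <= s")
   case True
   hence e: "s * (1 / (1 + s)) = 1 - 1 / (1 + s)" by (simp add: field_simps)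
   have "cor s * r s = cor (s * (1 / (1 + s)))" using True by (simp add: r_def)
   also have "... = cor (1 - 1 / (1 + s))" by (simp only: e)
   also have "... = indicator {0..} s - r s" using True by (simp add: r_def)
   finally show ?thesis .
  qed (simp add: r_def)
 qed
 have rsb: "bdd_borel (\<lambda>s. cor s * r s)"
  unfolding rs by (intro bdd_borel_diff bdd_borel_indicator r) simp
 have E0: "E {0..} x = x" for x using sm_compl[OF E, of "{..<0}" x] sproj_neg[OF pos R1 inj, of x] by (simp add: E_def)
 have Rin: "(R z, z - R z) \<in> sint E cor" for z
 proof -
  have "sib E (\<lambda>s. cor s * r s) z = z - R z"
   unfolding rs using sib_diff[OF E bdd_borel_indicator[of "{0..}"] r(1), of z]
   by (simp add: sib_indicator[OF E] E0 r(2))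
  thus ?thesis using si_bounded_range[OF E id_meas r(1) rsb, of z] by (simp add: r(2))
 qed
 have lin: "linear_rel (sint E cor)"
  using si_clinear[OF E id_meas] by (simp add: clinear_graph_iff)
 have "sint E cor = H"
 proof (intro equalityI subsetI)
  fix p assume "p \<in> H"
  then obtain x y where p: "p = (x, y)" "(x, y) \<in> H" by (cases p) auto
  have "x = R (x + y)" by (rule uniq) (use p in simp)
  thus "p \<in> sint E cor" using Rin[of "x + y"] p(1) by simp
 next
  fix p assume "p \<in> sint E cor"
  then obtain x y where p: "p = (x, y)" "(x, y) \<in> sint E cor" by (cases p) auto
  define z where "z = x - R (x + y)"
  have "(z, - z) \<in> sint E cor"
   using linear_rel_diff[OF lin p(2) Rin[of "x + y"]] by (simp add: z_def)
  from si_apply[OF E this id_meas r(1)] rsb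
  have "R (- z) = sib E (\<lambda>s. cor s * r s) z" by (simp add: r(2) mult.commute)
  also have "... = z - R z"
   unfolding rs using sib_diff[OF E bdd_borel_indicator[of "{0..}"] r(1), of z]
   by (simp add: sib_indicator[OF E] E0 r(2))
  finally have "z = 0" by (simp add: bcl_neg[OF b])
  thus "p \<in> H" using R[of "x + y"] p(1) by (simp add: z_def)
 qed
 with E show ?thesis by blast
qed

lemma spectral_resolution_spec:
 assumes "\<exists>E. spm E \<and> sint E cor = H"
 shows "spm (resol H)" "sint (resol H) cor = H"
 using someI_ex[OF assms] unfolding spectral_resolution_def by blast+

lemma psa_resolution:
 assumes "psa H"
 shows "spm (resol H)" "sint (resol H) cor = H"
  "resol H {..<0} x = 0"
proof -
 show *: "spm (resol H)" "sint (resol H) cor = H"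
  by (rule spectral_resolution_spec[OF spectral_theorem[OF assms]])+
 show "resol H {..<0} x = 0"
  by (rule spectral_nonneg[OF *(1)]) (use * psa_pos[OF assms] in simp)
qed

section \<open>The modulus of a closed operator\<close>

context
 fixes T :: "'a::chilbert_space uop"
 assumes T: "cdd T"
begin

lemma cdd_clinear: "clinear_graph T" and cdd_linear: "linear_rel T" and cdd_closed: "closed T"
 and cdd_dense: "closure (Domain T) = UNIV"
 using T by (auto simp: closed_densely_defined_def clinear_graph_iff)

text \<open>Von Neumann's theorem on an adjoint times the operator: projecting \<open>(z, 0)\<close>
  onto the closed graph of \<open>T\<close> solves \<open>x\<close> plus the square of the modulus
  at \<open>x\<close> equals \<open>z\<close>, the surjectivity demanded by
  \<open>positive_selfadjointI\<close>.\<close>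

lemma psa_square: "psa (T O graph_adj T)"
proof (rule positive_selfadjointI)
 show "clinear_graph (T O graph_adj T)"
  using single_valued_relcomp[OF _ graph_adj_single_valued[OF cdd_dense]] cdd_clinear
   linear_rel_comp[OF cdd_linear graph_adj_linear] by (auto simp: clinear_graph_iff)
 have *: "cinner y x' = cinner a b" if "(a, y) \<in> graph_adj T" "(x', b) \<in> T" for a b y x'
  using graph_adjD[OF that] cinner_commute[of a b] cinner_commute[of y x'] by simp
 show "cinner y x' = cinner x y'" if xy: "(x, y) \<in> T O graph_adj T" and xy': "(x', y') \<in> T O graph_adj T" for x y x' y'
 proof -
  obtain a b where "(x, a) \<in> T" "(a, y) \<in> graph_adj T" "(x', b) \<in> T" "(b, y') \<in> graph_adj T" using xy xy' by blast
  thus ?thesis using *[of a y x' b] graph_adjD[of b y' T x a] by simp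
 qed
 show "0 <= inner y x" if xy: "(x, y) \<in> T O graph_adj T" for x y
 proof -
  obtain a where "(x, a) \<in> T" "(a, y) \<in> graph_adj T" using xy by blast
  thus ?thesis using *[of a y x a] by (simp add: inner_eq_Re_cinner cinner_self)
 qed
 show "\<exists>x. (x, z - x) \<in> T O graph_adj T" for z
 proof -
  obtain u v where uv: "(u, v) \<in> closure T" "!!x y. (x, y) \<in> T ==> cinner x (z - u) + cinner y (0 - v) = 0"
   using linear_rel_decomposition[OF cdd_linear, of z 0] by blast
  have "(v, z - u) \<in> graph_adj T"
   using uv(2) by (intro graph_adjI) (auto simp: cinner_minus_right)
  moreover have "(u, v) \<in> T" using uv(1) cdd_closed by simp
  ultimately show ?thesis by blast
 qed
qed

lemma abs_op_eq: "abs_op T = sint (resol (T O graph_adj T)) (\<lambda>s. cor (sqrt s))"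
 by (simp add: abs_op_def fun_calc_def)

lemma sqrt_meas: "(\<lambda>s. cor (sqrt s)) \<in> BM"
 by (rule borel_measurable_continuous_onI) (intro continuous_intros)

lemma abs_op_resolution:
 "spm (resol (abs_op T))"
 "sint (resol (abs_op T)) cor = abs_op T"
proof -
 have "sqrt \<in> BM" by (rule borel_measurable_continuous_onI) (intro continuous_intros)
 note * = spectral_measure_vimage[OF psa_resolution(1)[OF psa_square] this]
  si_vimage[OF psa_resolution(1)[OF psa_square] this id_meas]
 show "spm (resol (abs_op T))"
  "sint (resol (abs_op T)) cor = abs_op T"
  by (rule spectral_resolution_spec, intro exI conjI, rule *(1), simp only: *(2) abs_op_eq)+
qed

text \<open>On the spectral subspace for \<open>[0, n]\<close> both \<open>T\<close> and the
  truncated root \<open>g n\<close> have the form of the bounded operator \<open>?h\<close> as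
  squared norm. The bound by \<open>norm y\<close> follows from Cauchy-Schwarz, since
  \<open>(norm a)\<^sup>2 = inner y a\<close>.\<close>

lemma abs_op_aux:
 defines "E \<equiv> resol (T O graph_adj T)"
 defines "g \<equiv> \<lambda>n s. indicator {0..real n} s * cor (sqrt s)"
 shows "bdd_borel (g n)"
  and "(E {0..real n} x, a) \<in> T ==> norm a = norm (sib E (g n) x)"
  and "\<exists>a. (E {0..real n} x, a) \<in> T \<and> (\<forall>y. (x, y) \<in> T --> norm a <= norm y)"
  and "(x, z) \<in> abs_op T ==> sib E (g n) x = E {0..real n} z"
  and "E {..<0} x = 0"
proof -
 let ?Q = "{0..real n}"
 let ?h = "\<lambda>s. indicator ?Q s * cor s"
 note H = psa_square
 have E: "spm E" and EH: "sint E cor = T O graph_adj T"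
  and neg: "!!x. E {..<0} x = 0"
  unfolding E_def by (rule psa_resolution[OF H])+
 show "E {..<0} x = 0" by (rule neg)
 have Q: "?Q \<in> sets borel" by simp
 have h: "bdd_borel ?h"
  by (rule bdd_borel_indicator_mult[OF id_meas Q, where K = "real n"]) auto
 show g: "bdd_borel (g n)" unfolding g_def
  by (rule bdd_borel_indicator_mult[OF sqrt_meas Q, where K = "sqrt (real n)"]) auto
 have inH: "(E ?Q x, sib E ?h x) \<in> T O graph_adj T"
  using si_bounded_range[OF E id_meas bdd_borel_indicator[OF Q], of x] h
  by (simp add: EH sib_indicator[OF E Q] mult.commute)
 have Eh: "E ?Q (sib E ?h x) = sib E ?h x"
  using sib_E[OF E h Q, of x] by (simp add: mult.assoc[symmetric] flip: indicator_inter_arith)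
 have "cinner (sib E ?h x) x = (\<integral>s. ?h s \<partial>scm E x)" by (rule sib_form[OF E h])
 also have "... = (\<integral>s. cor ((cmod (g n s))^2) \<partial>scm E x)"
  by (intro Bochner_Integration.integral_cong) (auto simp: g_def indicator_def norm_mult simp del: of_real_power)
 also have "... = cor (\<integral>s. (cmod (g n s))^2 \<partial>scm E x)" by (simp del: of_real_power)
 finally have form: "inner (sib E ?h x) x = (norm (sib E (g n) x))^2"
  by (simp add: inner_eq_Re_cinner sib_norm[OF E g] del: of_real_power)
 have form2: "inner (sib E ?h x) (E ?Q x) = inner (sib E ?h x) x"
  using self_adj_inner[OF proj_sa[OF sm_proj[OF E Q]], of "sib E ?h x" x] by (simp add: Eh)
 have norm_a: "norm a = norm (sib E (g n) x)"
  if a: "(E ?Q x, a) \<in> T" "(a, sib E ?h x) \<in> graph_adj T" for a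
 proof -
  have "cinner a a = cinner (E ?Q x) (sib E ?h x)" by (rule graph_adjD[OF a(2,1)])
  hence "(norm a)^2 = inner (E ?Q x) (sib E ?h x)"
   by (simp add: power2_norm_eq_inner inner_eq_Re_cinner)
  hence "(norm a)^2 = (norm (sib E (g n) x))^2" using form form2 by (simp add: inner_commute)
  thus ?thesis by (simp add: power2_eq_iff_nonneg)
 qed
 obtain a0 where a0: "(E ?Q x, a0) \<in> T" "(a0, sib E ?h x) \<in> graph_adj T" using inH by blast
 show "norm a = norm (sib E (g n) x)" if "(E ?Q x, a) \<in> T"
  using norm_a[OF a0] clinear_graph_unique[OF cdd_clinear that a0(1)] by simp
 have "norm a0 <= norm y" if y: "(x, y) \<in> T" for y
 proof -
  have "cinner y a0 = cinner x (sib E ?h x)" by (rule graph_adjD[OF a0(2) y])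
  hence "inner y a0 = inner (sib E ?h x) x" by (metis inner_eq_Re_cinner inner_commute)
  hence "(norm a0)^2 = inner y a0" using form norm_a[OF a0] by simp
  also have "... <= norm y * norm a0" by (rule norm_cauchy_schwarz)
  finally show ?thesis by (cases "norm a0 = 0") (auto simp: power2_eq_square)
 qed
 thus "\<exists>a. (E ?Q x, a) \<in> T \<and> (\<forall>y. (x, y) \<in> T --> norm a <= norm y)" using a0(1) by blast
 show "sib E (g n) x = E ?Q z" if "(x, z) \<in> abs_op T"
  using si_E[OF E _ sqrt_meas Q, of x z] that g unfolding abs_op_eq E_def g_def by simp
qed

text \<open>The truncated images under \<open>T\<close> have the same mutual distances as
  truncations of \<open>z\<close>, so they converge, and the graph of \<open>T\<close> is closed.
  Together with \<open>abs_op_exists\<close>, this equality of domains and norms stands in for the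
  polar decomposition.\<close>

lemma abs_op_imp:
 assumes xz: "(x, z) \<in> abs_op T"
 shows "\<exists>y. (x, y) \<in> T \<and> norm y = norm z" and "0 <= inner z x"
proof -
 define E where "E = resol (T O graph_adj T)"
 define g where "g n = (\<lambda>s. indicator {0..real n} s * cor (sqrt s))" for n
 note aux = abs_op_aux[folded E_def g_def]
 have E: "spm E" unfolding E_def by (rule psa_resolution[OF psa_square])
 have Q: "{0..real n} \<in> sets borel" for n by simp
 have lim: "(\<lambda>n. E {0..real n} x) ----> x" for x
 proof -
  have "(\<lambda>n. E {0..real n} x) ----> E (\<Union>n. {0..real n}) x" by (rule sm_limit[OF E]) auto
  moreover have "(\<Union>n. {0..real n}) = - {..<0}" by (auto intro: real_arch_simple)
  ultimately show ?thesis using sm_compl[OF E, of "{..<0}" x] aux(5)[of x] by (simp only: diff_zero) simp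
 qed
 have "\<forall>n. \<exists>a. (E {0..real n} x, a) \<in> T" using aux(3) by blast
 then obtain a where a: "!!n. (E {0..real n} x, a n) \<in> T" by metis
 have "norm (a m - a n) = norm (E {0..real m} z - E {0..real n} z)" if mn: "n <= m" for m n
 proof -
  have sub: "{0..real m} \<inter> {0..real n} = {0..real n}" using mn by auto
  have "E {0..real m} (x - E {0..real n} x) = E {0..real m} x - E {0..real n} x"
   by (simp only: bcl_diff[OF proj_bcl[OF sm_proj[OF E Q]]] sm_Int[OF E Q Q] sub)
  hence "(E {0..real m} (x - E {0..real n} x), a m - a n) \<in> T"
   using linear_rel_diff[OF cdd_linear a[of m] a[of n]] by simp
  from aux(2)[OF this] have "norm (a m - a n) = norm (sib E (g m) (x - E {0..real n} x))" .
  also have "sib E (g m) (x - E {0..real n} x) = E {0..real m} z - E {0..real n} z"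
   by (simp only: bcl_diff[OF sib_bcl[OF E aux(1)]] sib_E_commute[OF E aux(1) Q, symmetric] aux(4)[OF xz]
     sm_Int[OF E Q Q] Int_commute[of "{0..real n}"] sub)
  finally show ?thesis .
 qed
 hence d: "dist (a m) (a n) = dist (E {0..real m} z) (E {0..real n} z)" for m n
  by (metis dist_commute dist_norm nat_le_linear)
 have "Cauchy (\<lambda>n. E {0..real n} z)" using lim by (rule LIMSEQ_imp_Cauchy)
 hence "Cauchy a" unfolding Cauchy_def d .
 then obtain y where y: "a ----> y" using Cauchy_convergent convergent_def by blast
 have "(\<lambda>n. (E {0..real n} x, a n)) ----> (x, y)" by (intro tendsto_Pair lim y)
 hence "(x, y) \<in> T" by (rule closed_sequentially[OF cdd_closed, rotated]) (rule a)
 moreover have "norm (a n) = norm (E {0..real n} z)" for n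
  using aux(2)[OF a] aux(4)[OF xz] by simp
 hence "norm y = norm z"
  using LIMSEQ_unique[OF tendsto_norm[OF y]] tendsto_norm[OF lim[of z]] by simp
 ultimately show "\<exists>y. (x, y) \<in> T \<and> norm y = norm z" by blast
 have "0 <= inner (E {0..real n} z) x" for n
 proof -
  have "cinner (sib E (g n) x) x = (\<integral>s. cor (indicator {0..real n} s * sqrt s) \<partial>scm E x)"
   unfolding sib_form[OF E aux(1)]
   by (intro Bochner_Integration.integral_cong) (auto simp: g_def indicator_def)
  hence "inner (sib E (g n) x) x = (\<integral>s. indicator {0..real n} s * sqrt s \<partial>scm E x)"
   by (simp only: inner_eq_Re_cinner integral_complex_of_real Re_complex_of_real)
  also have "... \<ge> 0" by (intro integral_nonneg_AE) (auto simp: indicator_def)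
  finally show ?thesis by (simp add: aux(4)[OF xz])
 qed
 moreover have "(\<lambda>n. inner (E {0..real n} z) x) ----> inner z x" by (intro tendsto_inner lim tendsto_const)
 ultimately show "0 <= inner z x" by (intro LIMSEQ_le_const) auto
qed

lemma abs_op_exists:
 assumes xy: "(x, y) \<in> T" shows "\<exists>z. (x, z) \<in> abs_op T \<and> norm z = norm y"
proof -
 define E where "E = resol (T O graph_adj T)"
 define g where "g n = (\<lambda>s. indicator {0..real n} s * cor (sqrt s))" for n
 note aux = abs_op_aux[folded E_def g_def]
 have E: "spm E" unfolding E_def by (rule psa_resolution[OF psa_square])
 have gb: "norm (sib E (g n) x) <= norm y" for n
 proof -
  obtain a where "(E {0..real n} x, a) \<in> T" "norm a <= norm y" using aux(3) xy by blast
  thus ?thesis using aux(2) by simp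
 qed
 have "norm (sib E (cutoff (\<lambda>s. cor (sqrt s)) n) x) <= norm y" for n
 proof -
  let ?c = "cutoff (\<lambda>s. cor (sqrt s)) n"
  have c: "bdd_borel ?c" by (rule bdd_borel_cutoff[OF sqrt_meas])
  \<comment> \<open>Cutting the root off at the value \<open>n\<close> is cutting the variable off
    at \<open>n^2\<close>; the negative half-line is a null set.\<close>
  have eq: "(\<lambda>s. indicator {0..} s * ?c s) = g (n^2)"
  proof
   fix s :: real
   have "sqrt s <= real n \<longleftrightarrow> s <= real (n^2)" if "0 <= s"
   proof
    assume "sqrt s <= real n"
    hence "(sqrt s)^2 <= (real n)^2" using that by (intro power_mono) auto
    thus "s <= real (n^2)" using that by simp
   next
    assume "s <= real (n^2)"
    hence "sqrt s <= sqrt ((real n)^2)" by (intro real_sqrt_le_mono) simp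
    thus "sqrt s <= real n" by simp
   qed
   thus "indicator {0..} s * ?c s = g (n^2) s" by (auto simp: g_def cutoff_def indicator_def)
  qed
  have "E {0..} (sib E ?c x) = sib E ?c x"
   using sm_compl[OF E, of "{..<0}"] aux(5) by simp
  hence "sib E ?c x = sib E (g (n^2)) x"
   using sib_E[OF E c, of "{0..}" x] by (simp only: eq) simp
  thus ?thesis using gb by simp
 qed
 then obtain z where z: "(x, z) \<in> abs_op T"
  using si_exists[OF E sqrt_meas] unfolding abs_op_eq E_def by blast
 thus ?thesis using abs_op_imp(1)[OF z] clinear_graph_unique[OF cdd_clinear xy] by metis
qed

lemma modulus_negative: "resol (abs_op T) {..<0} x = 0"
 by (rule spectral_nonneg[OF abs_op_resolution(1)]) (simp only: abs_op_resolution(2) abs_op_imp(2))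

lemma modulus_commute:
 assumes u: "bcl u" and uT: "!!x y. (x, y) \<in> T ==> (u x, u y) \<in> T"
  and u'T: "!!x y. (x, y) \<in> T ==> (cadj u x, cadj u y) \<in> T" and B: "B \<in> sets borel"
 shows "u (resol (abs_op T) B x) = resol (abs_op T) B (u x)"
proof -
 define E where "E = resol (T O graph_adj T)"
 have E: "spm E" "sint E cor = T O graph_adj T" "!!x. E {..<0} x = 0"
  unfolding E_def by (rule psa_resolution[OF psa_square])+
 have H: "(u x, u y) \<in> T O graph_adj T" if u: "bcl u" and uT: "!!x y. (x, y) \<in> T ==> (u x, u y) \<in> T"
  and u'T: "!!x y. (x, y) \<in> T ==> (cadj u x, cadj u y) \<in> T" and xy: "(x, y) \<in> T O graph_adj T" for x y u
 proof -
  obtain a where a: "(x, a) \<in> T" "(a, y) \<in> graph_adj T" using xy by blast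
  have "(u a, u y) \<in> graph_adj T"
  proof (rule graph_adjI)
   fix p q assume "(p, q) \<in> T"
   thus "cinner q (u a) = cinner p (u y)"
    using graph_adjD[OF a(2) u'T] by (simp add: cadj_left[OF u])
  qed
  thus ?thesis using uT[OF a(1)] by blast
 qed
 note u' = bcl_cadj[OF u] and uu = cadj_cadj[OF u]
 have EB: "u (E B x) = E B (u x)" if "B \<in> sets borel" and u: "bcl u"
  and uT: "!!x y. (x, y) \<in> T ==> (u x, u y) \<in> T" and u'T: "!!x y. (x, y) \<in> T ==> (cadj u x, cadj u y) \<in> T" for u B x
  using spectral_measure_equivariant[OF E(1) E(1) u, of 1 B x] that(1) H[OF u uT u'T]
   H[OF bcl_cadj[OF u] u'T] E(2,3) uT by (simp add: cadj_cadj[OF u])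
 have abs: "(u x, u y) \<in> abs_op T" if xy: "(x, y) \<in> abs_op T" and u: "bcl u"
  and uT: "!!x y. (x, y) \<in> T ==> (u x, u y) \<in> T" and u'T: "!!x y. (x, y) \<in> T ==> (cadj u x, cadj u y) \<in> T" for u x y
  using si_intertwine[OF E(1) E(1) u, of "\<lambda>s. s" "\<lambda>s. cor (sqrt s)" x y] EB[OF _ u uT u'T] xy sqrt_meas
  by (simp add: abs_op_eq E_def)
 show ?thesis
  using spectral_measure_equivariant[OF abs_op_resolution(1) abs_op_resolution(1) u, of 1 B x] B
   abs[OF _ u uT u'T] abs[OF _ u' u'T] uT abs_op_resolution(2) modulus_negative by (simp add: uu)
qed

lemma modulus_low:
 assumes l: "0 <= l" and x: "resol (abs_op T) {..l} x = x"
 shows "\<exists>y. (x, y) \<in> T \<and> norm y <= l * norm x"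
proof -
 define F where "F = resol (abs_op T)"
 have F: "spm F" "sint F cor = abs_op T" "!!x. F {..<0} x = 0"
  unfolding F_def by (rule abs_op_resolution modulus_negative)+
 let ?Q = "{0..l}"
 have Q: "?Q \<in> sets borel" by simp
 have "F ?Q x = F (- {..<0}) (F {..l} x)" by (subst sm_Int[OF F(1)]) (auto intro!: arg_cong[where f = "\<lambda>B. F B x"])
 also have "... = x" using sm_compl[OF F(1), of "{..<0}" x] F(3)[of x] x by (simp add: F_def)
 finally have FQ: "F ?Q x = x" .
 have h: "bdd_borel (\<lambda>s. indicator ?Q s * cor s)"
  by (rule bdd_borel_indicator_mult[OF id_meas Q, where K = l]) auto
 have hl: "cmod (indicator ?Q s * cor s) <= l" for s using l by (auto simp: indicator_def)
 have "(x, sib F (\<lambda>s. indicator ?Q s * cor s) x) \<in> abs_op T"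
  using si_bounded_range[OF F(1) id_meas bdd_borel_indicator[OF Q], of x] h
  by (simp add: F(2) sib_indicator[OF F(1) Q] FQ mult.commute)
 from abs_op_imp(1)[OF this] show ?thesis using sib_norm_le[OF F(1) h hl, of x] by auto
qed

lemma modulus_high:
 assumes l: "0 < l" and x: "resol (abs_op T) {l<..} x = x" and xy: "(x, y) \<in> T"
 shows "l * norm x <= norm y"
proof -
 define F where "F = resol (abs_op T)"
 have F: "spm F" "sint F cor = abs_op T"
  unfolding F_def by (rule abs_op_resolution)+
 obtain z where z: "(x, z) \<in> abs_op T" "norm z = norm y" using abs_op_exists[OF xy] by blast
 have Q: "{l<..} \<in> sets borel" by simp
 define r where "r = (\<lambda>s. indicator {l<..} s * cor (1 / s))"
 have rm: "(\<lambda>s. cor (1 / s)) \<in> BM" by measurable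
 have r: "bdd_borel r" unfolding r_def
  by (rule bdd_borel_indicator_mult[OF rm Q, where K = "1/l"]) (use l in "auto simp: norm_divide field_simps")
 have rl: "cmod (r s) <= 1 / l" for s using l by (auto simp: r_def indicator_def norm_divide field_simps)
 have r1: "(\<lambda>s. r s * cor s) = indicator {l<..}"
  using l by (auto simp: r_def indicator_def fun_eq_iff)
 have "sib F r z = F {l<..} x"
  using si_apply[OF F(1), of x z cor r] z(1) id_meas r bdd_borel_indicator[OF Q]
  unfolding r1 by (simp add: F(2) sib_indicator[OF F(1) Q])
 hence "norm x <= (1 / l) * norm z" using sib_norm_le[OF F(1) r rl, of z] x by (simp add: F_def)
 thus ?thesis using l z(2) by (simp add: field_simps)
qed

text \<open>The spectral projections of the modulus converge in the graph norm of the modulus, and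
  differences have equal norms under \<open>T\<close> and under the modulus.\<close>

lemma modulus_core:
 assumes xy: "(x, y) \<in> T"
 shows "\<exists>a. (\<forall>n. (resol (abs_op T) {..real n} x, a n) \<in> T) \<and> a ----> y"
proof -
 define F where "F = resol (abs_op T)"
 have F: "spm F" "sint F cor = abs_op T"
  unfolding F_def by (rule abs_op_resolution)+
 obtain z where z: "(x, z) \<in> abs_op T" using abs_op_exists[OF xy] by blast
 have lim: "(\<lambda>n. F {..real n} x) ----> x" for x
 proof -
  have "(\<lambda>n. F {..real n} x) ----> F (\<Union>n. {..real n}) x" by (rule sm_limit[OF F(1)]) auto
  moreover have "(\<Union>n. {..real n}) = UNIV" by (auto intro: real_arch_simple)
  ultimately show ?thesis using sm_UNIV[OF F(1)] by simp
 qed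
 have lin: "linear_rel (abs_op T)"
  using si_clinear[OF F(1) id_meas] F(2) by (simp add: clinear_graph_iff)
 have Fz: "(F {..real n} x, F {..real n} z) \<in> abs_op T" for n
  using si_intertwine[OF F(1) F(1) proj_bcl[OF sm_proj[OF F(1), of "{..real n}"]], of "\<lambda>s. s" cor x z]
   z F(2) id_meas by (simp add: E_commutes[OF F(1)])
 have "\<exists>a. (F {..real n} x, a) \<in> T \<and> norm (y - a) = norm (z - F {..real n} z)" for n
 proof -
  obtain b where b: "(x - F {..real n} x, b) \<in> T" "norm b = norm (z - F {..real n} z)"
   using abs_op_imp(1)[OF linear_rel_diff[OF lin z Fz]] by blast
  have "(F {..real n} x, y - b) \<in> T" using linear_rel_diff[OF cdd_linear xy b(1)] by simp
  thus ?thesis using b(2) by (intro exI[of _ "y - b"]) simp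
 qed
 then obtain a where a: "!!n. (F {..real n} x, a n) \<in> T" "!!n. norm (y - a n) = norm (z - F {..real n} z)" by metis
 have "(\<lambda>n. norm (z - F {..real n} z)) ----> norm (z - z)" by (intro tendsto_intros lim)
 hence "(\<lambda>n. norm (y - a n)) ----> 0" using a(2) by simp
 hence "(\<lambda>n. y - (y - a n)) ----> y - 0"    by (rule tendsto_diff[OF tendsto_const tendsto_norm_zero_cancel])
 hence "a ----> y" by simp
 with a(1) show ?thesis unfolding F_def by blast
qed

text \<open>A uniform boundedness argument: the bounded cutoffs of the modulus, composed with
  \<open>p\<close>, are pointwise bounded because the range of \<open>p\<close> lies in the domain,
  and Baire's theorem makes the bound uniform.\<close>

lemma bounded_on_projection:
 assumes p: "proj p" "range p \<subseteq> Domain T"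
 shows "\<exists>C>0. \<forall>x y. p x = x --> (x, y) \<in> T --> norm y <= C * norm x"
proof -
 define F where "F = resol (abs_op T)"
 have F: "spm F" "sint F cor = abs_op T"
  unfolding F_def by (rule abs_op_resolution)+
 define S where "S m = sib F (cutoff cor m)" for m
 have S: "bcl (S m)" for m
  unfolding S_def by (rule sib_bcl[OF F(1) bdd_borel_cutoff[OF id_meas]])
 have Sp: "bcl (S m o p)" for m by (rule bcl_comp[OF S proj_bcl[OF p(1)]])
 define A where "A n = {x. \<forall>m. norm (S m (p x)) <= real n}" for n
 have clA: "closed (A n)" for n
 proof -
  have "A n = (\<Inter>m. {x. norm ((S m o p) x) <= real n})" by (auto simp: A_def)
  moreover have "closed {x. norm ((S m o p) x) <= real n}" for m
   by (intro closed_Collect_le continuous_on_norm linear_continuous_on bcl_linear Sp continuous_on_const)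
  ultimately show ?thesis by auto
 qed
 have "\<exists>n. x \<in> A n" for x
 proof -
  have "p x \<in> Domain T" using p(2) by blast
  then obtain y where "(p x, y) \<in> T" by blast
  then obtain z where z: "(p x, z) \<in> abs_op T" using abs_op_exists by blast
  obtain n :: nat where "norm z <= real n" using real_arch_simple by blast
  hence "x \<in> A n" unfolding A_def S_def
   using si_norm_cutoff[OF F(1) id_meas, of "p x" z] z F(2) by (auto intro: order_trans)
  thus ?thesis by blast
 qed
 hence UA: "(\<Union>n. A n) = UNIV" by blast
 have "\<exists>n. interior (A n) ~= {}"
 proof (rule ccontr)
  assume "\<nexists>n. interior (A n) ~= {}"
  hence "Met_TC.mtopology interior_of \<Union> (range A) = {}"
   using complete_UNIV clA
   by (intro Met_TC.metric_Baire_category_alt) (auto simp: mcomplete_iff_complete)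
  thus False by (simp add: UA)
 qed
 then obtain n x0 where "x0 \<in> interior (A n)" by blast
 then obtain e where e: "e > 0" "ball x0 e \<subseteq> A n" by (meson mem_interior)
 \<comment> \<open>A vector of norm \<open>e / 2\<close> is a difference of two points of the ball
   where the bound is \<open>n\<close>, so its image has norm at most \<open>2 * n\<close>; scaling
   gives \<open>4 * n / e\<close>. The added 1 keeps the constant positive.\<close>
 have bound: "norm (S m (p x)) <= (4 * real n / e + 1) * norm x" for m x
 proof (cases "x = 0")
  case False
  define w where "w = (e / (2 * norm x)) *\<^sub>R x"
  have w: "norm w = e / 2" using False e(1) by (simp add: w_def)
  have "x0 + w \<in> A n" "x0 \<in> A n" using e w by (auto intro!: subsetD[OF e(2)] simp: dist_norm)
  hence "norm (S m (p (x0 + w))) <= real n" "norm (S m (p x0)) <= real n" by (auto simp: A_def)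
  moreover have "S m (p w) = S m (p (x0 + w)) - S m (p x0)"
   using bcl_add[OF Sp[of m], of x0 w] by simp
  ultimately have "norm (S m (p w)) <= 2 * real n" by (metis norm_triangle_ineq4 add_mono mult_2 order_trans)
  moreover have "S m (p w) = (e / (2 * norm x)) *\<^sub>R S m (p x)"
   using bcl_scaleR[OF Sp[of m], of "e / (2 * norm x)" x] by (simp add: w_def)
  ultimately have "e / (2 * norm x) * norm (S m (p x)) <= 2 * real n" using e(1) by simp
  hence "norm (S m (p x)) <= 4 * real n / e * norm x" using e(1) False by (simp add: field_simps)
  thus ?thesis using norm_ge_zero[of x] unfolding distrib_right by linarith
 qed (simp add: bcl_0[OF S] bcl_0[OF proj_bcl[OF p(1)]])
 show ?thesis
 proof (intro exI[of _ "4 * real n / e + 1"] conjI allI impI)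
  show "4 * real n / e + 1 > 0" using e(1) by (simp add: add_nonneg_pos)
  fix x y assume px: "p x = x" and xy: "(x, y) \<in> T"
  obtain z where z: "(x, z) \<in> abs_op T" "norm z = norm y" using abs_op_exists[OF xy] by blast
  have "(\<lambda>m. S m x) ----> z" unfolding S_def using si_D[OF F(1)] z(1) F(2) by simp
  from tendsto_norm[OF this] have "norm z <= (4 * real n / e + 1) * norm x"
   by (rule LIMSEQ_le_const2) (use bound[of _ x] px in auto)
  thus "norm y <= (4 * real n / e + 1) * norm x" by (simp add: z(2))
 qed
qed

end

lemma cdd_graph:
 assumes "bcl x" shows "cdd (graph x)"
proof -
 have "closed (graph x)"
  unfolding closed_sequential_limits
 proof (intro allI impI)
  fix X l assume "(\<forall>n. X n \<in> graph x) \<and> X ----> l"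
  hence X0: "!!n. X n \<in> graph x" and lim: "(\<lambda>n. fst (X n)) ----> fst l" "(\<lambda>n. snd (X n)) ----> snd l"
   by (auto intro: tendsto_fst tendsto_snd)
  have X: "snd (X n) = x (fst (X n))" for n using X0[of n] by (auto simp: graph_def)
  have "snd l = x (fst l)" using bcl_tendsto[OF assms lim(1)] lim(2) unfolding X by (rule LIMSEQ_unique[rotated])
  thus "l \<in> graph x" by (cases l) (simp add: graph_def)
 qed
 moreover have "single_valued (graph x)" by (auto simp: graph_def single_valued_def)
 moreover have "Domain (graph x) = UNIV" by (auto simp: graph_def)
 ultimately show ?thesis
  using linear_rel_graph[OF assms] by (simp add: closed_densely_defined_def clinear_graph_iff)
qed

section \<open>Semifinite von Neumann algebras\<close>

lemma graph_mem [simp]: "(x, y) \<in> graph T \<longleftrightarrow> y = T x"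
 by (auto simp: graph_def)

lemma psa_graph:
 assumes D: "pos D" shows "psa (graph D)"
proof -
 have b: "bcl D" and sa: "self_adj D" using D by (auto simp: pos_iff self_adj_bcl)
 have "graph_adj (graph D) = graph D"
 proof (intro set_eqI)
  fix p show "p \<in> graph_adj (graph D) \<longleftrightarrow> p \<in> graph D"
  proof (cases p)
   case (Pair y z)
   have "(y, z) \<in> graph_adj (graph D) \<longleftrightarrow> (\<forall>x. cinner x (D y) = cinner x z)"
    by (auto simp: graph_adj_def graph_def self_adj_cinner[OF sa])
   also have "... \<longleftrightarrow> z = D y" using cinner_ext_right by metis
   finally show ?thesis using Pair by simp
  qed
 qed
 thus ?thesis using cdd_graph[OF b] D by (auto simp: positive_selfadjoint_def positive_op_def)
qed

text \<open>For the inverse \<open>K\<close> of the identity plus \<open>D\<close>, the last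
  inequality holds because \<open>D\<close> exceeds the identity minus \<open>K\<close> by the
  positive operator \<open>D K D\<close>.\<close>

lemma positive_resolvent:
 assumes D: "pos D"
 obtains K where "pos K" "!!x. K x + D (K x) = x" "!!x. inner (K x) x <= (norm x)^2"
  "!!u x. bcl u ==> (!!x. u (D x) = D (u x)) ==> u (K x) = K (u x)"
  "!!x. inner (x - K x) x <= inner (D x) x"
proof -
 have b: "bcl D" and sa: "self_adj D" using D by (auto simp: pos_iff self_adj_bcl)
 obtain K where K0: "!!z. (K z, z - K z) \<in> graph D" and uniq: "!!u z. (u, z - u) \<in> graph D ==> u = K z"
  and pos: "pos K" and K1: "!!z. inner (K z) z <= (norm z)^2"
  using psa_resolvent[OF psa_graph[OF D]] by blast
 have K: "D (K z) = z - K z" for z using K0[of z] by simp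
 have com: "u (K x) = K (u x)" if u: "bcl u" "!!x. u (D x) = D (u x)" for u x
  by (rule uniq) (simp only: graph_mem u(2)[symmetric] K bcl_diff[OF u(1)])
 show thesis
 proof (rule that[OF pos _ K1 com])
  show "K x + D (K x) = x" for x by (simp add: K)
  have "D x - (x - K x) = D (K (D x))" for x
   using com[OF b, of x] by (simp add: bcl_diff[OF b] flip: K)
  moreover have "inner (D (K (D x))) x \<ge> 0" for x
   using pos by (simp add: self_adj_inner[OF sa] pos_iff)
  ultimately show "inner (x - K x) x <= inner (D x) x" for x by (metis inner_diff_left diff_ge_0_iff_ge)
 qed
qed

lemma commutant_cadj:
 assumes S: "!!x. x \<in> S ==> bcl x" "!!x. x \<in> S ==> cadj x \<in> S" and u: "u \<in> commutant S"
 shows "cadj u \<in> commutant S"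
proof -
 have ub: "bcl u" and ue: "!!x xi. x \<in> S ==> u (x xi) = x (u xi)"
  using u by (auto simp: commutant_def fun_eq_iff)
 have "cadj u (x xi) = x (cadj u xi)" if x: "x \<in> S" for x xi
 proof (rule cinner_ext_right)
  fix z
  have "cinner z (cadj u (x xi)) = cinner (cadj x (u z)) xi"
   using cadj_right[OF ub, of z "x xi"] cadj_left[OF S(1)[OF x], of "u z" xi] by simp
  also have "... = cinner (u (cadj x z)) xi" by (simp add: ue[OF S(2)[OF x]])
  also have "... = cinner z (x (cadj u xi))"
   using cadj_right[OF ub, of "cadj x z" xi] cadj_left[OF S(1)[OF x], of z "cadj u xi"] by simp
  finally show "cinner z (cadj u (x xi)) = cinner z (x (cadj u xi))" .
 qed
 thus ?thesis using bcl_cadj[OF ub] by (auto simp: commutant_def fun_eq_iff)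
qed

section \<open>Von Neumann algebras: closure properties and projections\<close>

locale vn_alg =
 fixes A :: "('a::chilbert_space => 'a) set"
 assumes vna: "von_neumann_algebra A"
begin

lemma A_bcl: "x \<in> A ==> bcl x" and A_cadj: "x \<in> A ==> cadj x \<in> A"
 using vna by (auto simp: von_neumann_algebra_def)

lemma comm_bcl: "u \<in> commutant A ==> bcl u"
 by (simp add: commutant_def)

lemma comm_eq: "x \<in> A ==> u \<in> commutant A ==> u (x xi) = x (u xi)"
 by (auto simp: commutant_def fun_eq_iff)

lemma A_I:
 assumes "bcl x" "!!u xi. u \<in> commutant A ==> u (x xi) = x (u xi)" shows "x \<in> A"
proof -
 have "x \<in> commutant (commutant A)" using assms by (auto simp: commutant_def[of "commutant A"] fun_eq_iff)
 thus ?thesis using vna by (simp add: von_neumann_algebra_def)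
qed

lemma comm_cadj: "u \<in> commutant A ==> cadj u \<in> commutant A"
 by (rule commutant_cadj[OF A_bcl A_cadj])

lemma A_id: "(\<lambda>x. x) \<in> A"
 by (rule A_I) (auto simp: bcl_id)

lemma A_comp: assumes x: "x \<in> A" and y: "y \<in> A" shows "x o y \<in> A"
 by (rule A_I[OF bcl_comp[OF A_bcl[OF x] A_bcl[OF y]]]) (simp add: comm_eq[OF x] comm_eq[OF y])

lemma A_plus: assumes x: "x \<in> A" and y: "y \<in> A" shows "(\<lambda>xi. x xi + y xi) \<in> A"
 by (rule A_I[OF bcl_plus[OF A_bcl[OF x] A_bcl[OF y]]])
  (simp add: comm_eq[OF x] comm_eq[OF y] bcl_add[OF comm_bcl])

lemma A_minus: assumes x: "x \<in> A" and y: "y \<in> A" shows "(\<lambda>xi. x xi - y xi) \<in> A"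
 by (rule A_I[OF bcl_minus[OF A_bcl[OF x] A_bcl[OF y]]])
  (simp add: comm_eq[OF x] comm_eq[OF y] bcl_diff[OF comm_bcl])

lemma A_rmult: assumes x: "x \<in> A" shows "(\<lambda>xi. c *\<^sub>R x xi) \<in> A"
 by (rule A_I[OF bcl_rmult[OF A_bcl[OF x]]]) (simp add: comm_eq[OF x] bcl_scaleR[OF comm_bcl])

lemma A_cmult: assumes x: "x \<in> A" shows "(\<lambda>xi. c *\<^sub>C x xi) \<in> A"
 by (rule A_I[OF bcl_cmult[OF A_bcl[OF x]]]) (simp add: comm_eq[OF x] bcl_scaleC[OF comm_bcl])

lemma A_limit:
 assumes "bcl S" "!!n. T n \<in> A" "!!x. (\<lambda>n. T n x) ----> S x" shows "S \<in> A"
proof (rule A_I[OF assms(1)])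
 fix u xi assume u: "u \<in> commutant A"
 have "(\<lambda>n. u (T n xi)) ----> S (u xi)" using assms(3) by (simp add: comm_eq[OF assms(2) u])
 thus "u (S xi) = S (u xi)" by (rule LIMSEQ_unique[OF bcl_tendsto[OF comm_bcl[OF u] assms(3)]])
qed

text \<open>The commutant is closed under adjoints, so invariance of \<open>V\<close> makes the
  projection commute with the whole commutant and places it in the double commutant.\<close>

lemma A_projection:
 assumes V: "csubspace V" "closed V" and inv: "!!u x. u \<in> commutant A ==> x \<in> V ==> u x \<in> V"
 obtains p where "p \<in> A" "proj p" "!!x. p x = x \<longleftrightarrow> x \<in> V" "!!x. p x = 0 \<longleftrightarrow> (\<forall>z\<in>V. cinner x z = 0)"
proof -
 obtain p where p: "proj p" "!!x. p x = x \<longleftrightarrow> x \<in> V" "!!x. p x = 0 \<longleftrightarrow> (\<forall>z\<in>V. cinner x z = 0)"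
  using projection_onto[OF V] by metis
 have "p \<in> A"
 proof (rule A_I[OF proj_bcl[OF p(1)]])
  fix u x assume "u \<in> commutant A"
  thus "u (p x) = p (u x)"
   by (intro proj_commute[OF p(1), symmetric]) (auto simp: p(2) inv comm_bcl comm_cadj)
 qed
 with p show thesis using that by blast
qed

lemma A_zero: "(\<lambda>x. 0) \<in> A"
 using A_rmult[OF A_id, of 0] by simp

text \<open>One construction for all the lattice operations on projections that occur: meets, common
  kernels and common fixed spaces are subspaces where given elements of the algebra agree.\<close>

lemma A_equalizer:
 assumes X: "!!S T. (S, T) \<in> X ==> S \<in> A \<and> T \<in> A"
 obtains m where "m \<in> A" "proj m" "!!x. m x = x \<longleftrightarrow> (\<forall>(S, T)\<in>X. S x = T x)"
proof (rule A_projection)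
 let ?V = "{x. \<forall>(S, T)\<in>X. S x = T x}"
 have V: "?V = {x. \<forall>r\<in>X. fst r x = snd r x}" by auto
 have b: "bcl (fst r)" "bcl (snd r)" if "r \<in> X" for r using X[of "fst r" "snd r"] that A_bcl by auto
 show "csubspace ?V" by (auto simp: V csubspace_def bcl_simps[OF b(1)] bcl_simps[OF b(2)])
 have "?V = (\<Inter>r\<in>X. {x. fst r x = snd r x})" unfolding V by blast
 thus "closed ?V"
  by (simp add: closed_INT closed_Collect_eq linear_continuous_on[OF bcl_linear[OF b(1)]] linear_continuous_on[OF bcl_linear[OF b(2)]])
 show "u x \<in> ?V" if u: "u \<in> commutant A" and x: "x \<in> ?V" for u x
  using x X by (force simp: V comm_eq[OF _ u, symmetric])
qed (use that in auto)

lemma affiliated_comm: "aff A T ==> u \<in> commutant A ==> (x, y) \<in> T ==> (u x, u y) \<in> T"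
 by (auto simp: affiliated_def)

lemma affiliated_graph: "x \<in> A ==> aff A (graph x)"
 using comm_eq[of x] by (auto simp: affiliated_def graph_def)

lemma affiliated_adj: "aff A T ==> aff A (graph_adj T)"
proof -
 assume T: "aff A T"
 have "(u y, u z) \<in> graph_adj T" if u: "u \<in> commutant A" and yz: "(y, z) \<in> graph_adj T" for u y z
 proof (rule graph_adjI)
  fix x w assume "(x, w) \<in> T"
  from graph_adjD[OF yz affiliated_comm[OF T comm_cadj[OF u] this]]
  show "cinner w (u y) = cinner x (u z)" by (simp add: cadj_left[OF comm_bcl[OF u]])
 qed
 thus ?thesis by (auto simp: affiliated_def)
qed

lemma modulus_A:
 assumes T: "cdd T" "aff A T" and B: "B \<in> sets borel"
 shows "resol (abs_op T) B \<in> A"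
proof (rule A_I)
 show "bcl (resol (abs_op T) B)"
  by (rule proj_bcl[OF sm_proj[OF abs_op_resolution(1)[OF T(1)] B]])
 fix u xi assume u: "u \<in> commutant A"
 show "u (resol (abs_op T) B xi) = resol (abs_op T) B (u xi)"
  by (rule modulus_commute[OF T(1) comm_bcl[OF u] _ _ B]) (auto intro: affiliated_comm[OF T(2)] u comm_cadj)
qed

lemma resolution_A:
 assumes H: "psa H" "aff A H" and B: "B \<in> sets borel"
 shows "resol H B \<in> A"
proof (rule A_I)
 note E = psa_resolution[OF H(1)]
 show "bcl (resol H B)" by (rule proj_bcl[OF sm_proj[OF E(1) B]])
 fix u xi assume u: "u \<in> commutant A"
 show "u (resol H B xi) = resol H B (u xi)"
  using spectral_measure_equivariant[OF E(1) E(1) comm_bcl[OF u], of 1 B xi] E(2,3) B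
   affiliated_comm[OF H(2) u] affiliated_comm[OF H(2) comm_cadj[OF u]] by simp
qed

lemma sib_A:
 assumes H: "psa H" "aff A H" and f: "bdd_borel f"
 shows "sib (resol H) f \<in> A"
proof (rule A_I)
 note E = psa_resolution(1)[OF H(1)]
 show "bcl (sib (resol H) f)" by (rule sib_bcl[OF E f])
 fix u xi assume u: "u \<in> commutant A"
 show "u (sib (resol H) f xi) = sib (resol H) f (u xi)"
  by (rule sib_commute[OF E f comm_bcl[OF u]]) (rule comm_eq[OF resolution_A[OF H] u])
qed

lemma pos_part_iff: "x \<in> pos_part A \<longleftrightarrow> x \<in> A \<and> pos x"
 by (simp add: pos_part_def)

lemma proj_pos_part: "p \<in> A ==> proj p ==> p \<in> pos_part A"
 by (simp add: pos_part_iff proj_pos)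

lemma positive_sqrt:
 assumes x: "x \<in> pos_part A" obtains y where "y \<in> pos_part A" "y o y = x"
proof -
 have xA: "x \<in> A" and xp: "pos x" and xb: "bcl x" using x A_bcl by (auto simp: pos_part_iff)
 obtain K where K: "K > 0" "!!xi. norm (x xi) <= K * norm xi" using bcl_bound[OF xb] by blast
 define S where "S = (\<lambda>xi. (1 / K) *\<^sub>R x xi)"
 have S: "pos S" using xp K(1) by (simp add: S_def pos_iff self_adj_rmult)
 have "inner (S xi) xi <= (norm xi)^2" for xi
 proof -
  have "inner (x xi) xi <= K * norm xi * norm xi"
   by (rule order_trans[OF norm_cauchy_schwarz mult_right_mono[OF K(2)]]) simp
  thus ?thesis using K(1) by (simp add: S_def field_simps power2_eq_square)
 qed
 hence "\<exists>P. pos P \<and> (\<forall>xi. P (P xi) = S xi) \<and>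
  (\<forall>u. bcl u --> (\<forall>xi. u (S xi) = S (u xi)) --> (\<forall>xi. u (P xi) = P (u xi)))"
  by (rule positive_sqrt_contraction[OF S])
 then obtain P where P: "pos P" "!!xi. P (P xi) = S xi"
  "!!u xi. bcl u ==> \<forall>xi. u (S xi) = S (u xi) ==> u (P xi) = P (u xi)"
  by blast
 have Pb: "bcl P" using P(1) by (simp add: positive_op_def)
 have PA: "P \<in> A"
 proof (rule A_I[OF Pb])
  fix u xi assume u: "u \<in> commutant A"
  show "u (P xi) = P (u xi)"
   by (rule P(3)[OF comm_bcl[OF u]]) (simp add: S_def comm_eq[OF xA u] bcl_scaleR[OF comm_bcl[OF u]])
 qed
 show thesis
 proof
  show "(\<lambda>xi. sqrt K *\<^sub>R P xi) \<in> pos_part A"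
   using A_rmult[OF PA, of "sqrt K"] P(1) K(1) by (simp add: pos_part_iff pos_iff self_adj_rmult)
  show "(\<lambda>xi. sqrt K *\<^sub>R P xi) o (\<lambda>xi. sqrt K *\<^sub>R P xi) = x"
   using K(1) by (simp add: fun_eq_iff bcl_scaleR[OF Pb] P(2) S_def)
 qed
qed

end

subsection \<open>Weights and traces\<close>

locale vn_weight = vn_alg A for A :: "('a::chilbert_space => 'a) set" +
 fixes \<tau> :: "('a => 'a) => ennreal"
 assumes weight: "fns_weight A \<tau>"
begin

lemma tr_add: "x \<in> pos_part A ==> y \<in> pos_part A ==> \<tau> (\<lambda>xi. x xi + y xi) = \<tau> x + \<tau> y"
 and tr_scale: "x \<in> pos_part A ==> 0 <= c ==> \<tau> (\<lambda>xi. c *\<^sub>R x xi) = ennreal c * \<tau> x"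
 and tr_faithful: "x \<in> pos_part A ==> \<tau> x = 0 ==> x = (\<lambda>xi. 0)"
 using weight by (auto simp: fns_weight_def is_weight_def faithful_weight_def)

lemma tr_mono:
 assumes x: "x \<in> pos_part A" and y: "y \<in> pos_part A" and le: "op_le x y" shows "\<tau> x <= \<tau> y"
proof -
 have "(\<lambda>xi. y xi - x xi) \<in> pos_part A"
  using x y le by (auto simp: pos_part_iff op_le_def intro: A_minus)
 from tr_add[OF x this] have "\<tau> y = \<tau> x + \<tau> (\<lambda>xi. y xi - x xi)" by simp
 thus ?thesis by simp
qed

lemma tr_zero: "\<tau> (\<lambda>xi. 0) = 0"
proof -
 have "(\<lambda>xi. xi) \<in> pos_part A" by (simp add: pos_part_iff A_id pos_iff self_adj_id)
 from tr_scale[OF this, of 0] show ?thesis by simp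
qed

lemma tr_normal:
 assumes x: "!!n::nat. x n \<in> pos_part A" and mono: "!!n. op_le (x n) (x (Suc n))"
  and y: "pos y" and lim: "!!xi. (\<lambda>n. x n xi) ----> y xi"
 shows "y \<in> pos_part A" "\<tau> y = (SUP n. \<tau> (x n))"
proof -
 show yA: "y \<in> pos_part A"
  using A_limit[OF _ _ lim] x y by (auto simp: pos_part_iff positive_op_def)
 have sa: "self_adj (x n)" "self_adj y" for n using x y by (auto simp: pos_part_iff pos_iff)
 have inc: "incseq (\<lambda>n. inner (x n xi) xi)" for xi
  using mono by (intro incseq_SucI) (auto simp: op_le_iff sa)
 have ilim: "(\<lambda>n. inner (x n xi) xi) ----> inner (y xi) xi" for xi by (intro tendsto_inner lim tendsto_const)
 have le: "op_le (x m) (x n)" if "m <= n" for m n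
  using inc that by (auto simp: op_le_iff sa incseq_def)
 have up: "op_le (x n) y" for n using incseq_le[OF inc ilim] by (auto simp: op_le_iff sa)
 have "normal_weight A \<tau>" using weight by (simp add: fns_weight_def)
 moreover have "\<forall>a\<in>range x. \<forall>b\<in>range x. \<exists>c\<in>range x. op_le a c \<and> op_le b c"
  by (auto intro: le[OF max.cobounded1] le[OF max.cobounded2])
 moreover have "op_le y z" if "z \<in> pos_part A" "\<forall>a\<in>range x. op_le a z" for z
 proof -
  have "self_adj z" using that(1) by (auto simp: pos_part_iff pos_iff)
  moreover have "inner (x n xi) xi <= inner (z xi) xi" for n xi using that(2) calculation by (auto simp: op_le_iff sa)
  ultimately show ?thesis using LIMSEQ_le_const2[OF ilim] by (auto simp: op_le_iff sa)
 qed
 ultimately have "\<tau> y = (SUP a\<in>range x. \<tau> a)"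
  unfolding normal_weight_def
  apply (elim allE[of _ "range x"] allE[of _ y] mp) using x yA up by auto
 thus "\<tau> y = (SUP n. \<tau> (x n))" by (simp add: image_image)
qed

end

locale vn_trace = vn_weight A \<tau> for A :: "('a::chilbert_space => 'a) set" and \<tau> +
 assumes tr_cyclic: "x \<in> A ==> \<tau> (cadj x o x) = \<tau> (x o cadj x)"

lemma proj_diff:
 assumes "proj p" "proj q" "!!x. p (q x) = q x"
 shows "proj (\<lambda>x. p x - q x)"
proof -
 have "q (p x) = q x" for x
 proof (rule cinner_ext)
  fix z show "cinner (q (p x)) z = cinner (q x) z"
   by (simp add: self_adj_cinner[OF proj_sa] assms)
 qed
 thus ?thesis
  unfolding is_projection_iff using assms
  by (auto simp: self_adj_minus proj_sa bcl_diff[OF proj_bcl] proj_idem)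
qed

context vn_trace
begin

text \<open>Murray--von Neumann comparison of the supports of \<open>x\<close>: truncated, \<open>x (x*x)\<^sup>-\<^sup>1\<^sup>/\<^sup>2\<close> is a partial isometry.\<close>

lemma comparison:
 assumes x: "x \<in> A" and F: "F \<in> A" "proj F" and P: "P \<in> A" "proj P"
  and ker: "!!xi. x xi = 0 ==> F xi = 0" and ran: "!!xi. P (x xi) = x xi"
 shows "\<tau> F <= \<tau> P"
proof -
 note xb = A_bcl[OF x]
 let ?S = "cadj x o x"
 let ?E = "resol (graph ?S)"
 have H: "psa (graph ?S)" by (rule psa_graph[OF positive_cadj_comp[OF xb]])
 have Ha: "aff A (graph ?S)" by (intro affiliated_graph A_comp A_cadj x)
 note E = psa_resolution[OF H]
 note EA = resolution_A[OF H Ha] and Ep = sm_proj[OF E(1)]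
 \<comment> \<open>On \<open>B n\<close> the square root and its reciprocal are both bounded. The
   sets exhaust the spectrum off the kernel, and normality of \<open>\<tau>\<close> removes the
   truncation.\<close>
 define B where "B n = {1 / real (Suc n)..real n}" for n
 have B: "B n \<in> sets borel" for n by (simp add: B_def)
 have EB: "\<tau> (?E (B n)) <= \<tau> P" for n
 proof -
  let ?g = "\<lambda>r. indicator (B n) r * cor (1 / sqrt r)"
  have g: "bdd_borel ?g"
  proof (rule bdd_borel_indicator_mult[OF _ B, where K = "sqrt (real (Suc n))"])
   show "cmod (cor (1 / sqrt r)) <= sqrt (real (Suc n))" if "r \<in> B n" for r
   proof -
    have r: "1 / real (Suc n) <= r" using that by (simp add: B_def)
    hence "0 < r" by (rule less_le_trans[rotated]) simp
    thus ?thesis using r by (simp add: norm_divide field_simps flip: real_sqrt_mult)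
   qed
  qed measurable
  let ?f = "\<lambda>r. indicator (B n) r * cor (sqrt r)"
  have pos: "0 < r" if "r \<in> B n" for r
   using that less_le_trans[of 0 "1 / real (Suc n)" r] by (simp add: B_def)
  have f: "bdd_borel ?f"
  proof (rule bdd_borel_indicator_mult[OF _ B, where K = "sqrt (real n)"])
   show "cmod (cor (sqrt r)) <= sqrt (real n)" if "r \<in> B n" for r
    using pos[OF that] that by (simp add: B_def)
  qed measurable
  have fg: "(\<lambda>r. cor r * ?g r) = ?f"
  proof
   fix r show "cor r * ?g r = ?f r"
   proof (cases "r \<in> B n")
    case True
    have "r * (1 / sqrt r) = sqrt r" using pos[OF True] real_div_sqrt[of r] by simp
    thus ?thesis using True by (simp only: indicator_simps mult_1 of_real_mult[symmetric])
   qed simp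
  qed
  have gf: "(\<lambda>r. ?g r * ?f r) = indicator (B n)"
  proof
   fix r show "?g r * ?f r = indicator (B n) r" using pos[of r] by (cases "r \<in> B n") simp_all
  qed
  define G where "G = sib ?E ?g"
  have GA: "G \<in> A" and Gb: "bcl G" unfolding G_def by (rule sib_A[OF H Ha g], rule sib_bcl[OF E(1) g])
  have "self_adj G" unfolding G_def by (rule sib_self_adj[OF E(1) g]) (simp add: indicator_def)
  hence Gc: "cadj G = G" by (simp add: self_adj_iff)
  have "(G xi, sib ?E ?f xi) \<in> graph ?S" for xi
   using si_bounded_range[OF E(1) id_meas g, of xi] f by (simp only: fg E(2) G_def)
  hence SG: "sib ?E ?f xi = ?S (G xi)" for xi by (simp only: graph_mem)
  have GSG: "G (?S (G xi)) = ?E (B n) xi" for xi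
   unfolding SG[symmetric] unfolding G_def sib_mult[OF E(1) g f] gf sib_indicator[OF E(1) B] by (rule refl)
  \<comment> \<open>\<open>G\<close> is the truncated inverse square root of
    \<open>cadj x o x\<close>, so \<open>y\<close> is a partial isometry with initial projection
    \<open>?E (B n)\<close> and range under \<open>P\<close>; cyclicity of the trace then compares
    the two.\<close>
  define y where "y = x o G"
  have yA: "y \<in> A" and yb: "bcl y" unfolding y_def by (intro A_comp x GA, intro bcl_comp xb Gb)
  have yy: "cadj y o y = ?E (B n)"
   using GSG by (simp add: y_def cadj_comp xb Gb Gc fun_eq_iff)
  have yn: "norm (y xi) <= norm xi" for xi
  proof -
   have "cinner (y xi) (y xi) = cinner (?E (B n) xi) xi"
    using cadj_left[OF yb, of "y xi" xi] by (simp flip: yy)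
   hence "(norm (y xi))^2 = (norm (?E (B n) xi))^2"
    by (simp add: proj_inner[OF Ep[OF B]] cinner_self inner_eq_Re_cinner[symmetric] complex_eq_iff)
   thus ?thesis using proj_norm[OF Ep[OF B], of n xi] by simp
  qed
  have f': "inner ((y o cadj y) xi) xi = (norm (cadj y xi))^2" for xi
   using cadj_right[OF yb, of "cadj y xi" xi] by (simp add: inner_eq_Re_cinner cinner_self del: of_real_power)
  have y'n: "norm (cadj y xi) <= norm xi" for xi
  proof -
   have "(norm (cadj y xi))^2 <= norm (cadj y xi) * norm xi"
    using order_trans[OF norm_cauchy_schwarz mult_right_mono[OF yn[of "cadj y xi"] norm_ge_zero], of xi] f'[of xi] by simp
   thus ?thesis by (cases "norm (cadj y xi) = 0") (auto simp: power2_eq_square)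
  qed
  have y'P: "cadj y (P xi) = cadj y xi" for xi
  proof (rule cinner_ext_right)
   fix z show "cinner z (cadj y (P xi)) = cinner z (cadj y xi)"
    by (simp add: cadj_right[OF yb, symmetric] self_adj_cinner[OF proj_sa[OF P(2)], symmetric]) (simp add: y_def ran)
  qed
  have pc: "pos (y o cadj y)" using positive_cadj_comp[OF bcl_cadj[OF yb]] by (simp add: cadj_cadj[OF yb])
  have "inner ((y o cadj y) xi) xi <= inner (P xi) xi" for xi
   unfolding f' proj_inner[OF P(2)] using power_mono[OF y'n[of "P xi"], of 2] by (simp add: y'P)
  hence le: "op_le (y o cadj y) P" using pc by (simp add: op_le_iff proj_sa[OF P(2)] pos_iff)
  have "y o cadj y \<in> pos_part A" by (simp add: pos_part_iff pc A_comp yA A_cadj)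
  hence "\<tau> (y o cadj y) <= \<tau> P" by (rule tr_mono[OF _ proj_pos_part[OF P] le])
  thus ?thesis using tr_cyclic[OF yA] by (simp add: yy)
 qed
 have B': "B n \<subseteq> B (Suc n)" for n by (auto simp: B_def field_simps intro: order_trans[rotated])
 have "(\<Union>n. B n) = {0<..}"
 proof (intro subset_antisym subsetI)
  fix r :: real assume "r \<in> (\<Union>n. B n)"
  then obtain n where "1 / real (Suc n) <= r" by (auto simp: B_def)
  thus "r \<in> {0<..}" using less_le_trans[of 0 "1 / real (Suc n)" r] by simp
 next
  fix r :: real assume r: "r \<in> {0<..}"
  then obtain m where m: "1 / real (Suc m) < r" using nat_approx_posE[of r] by auto
  obtain n where n: "r <= real n" using real_arch_simple by blast
  have "1 / real (Suc (max m n)) <= 1 / real (Suc m)" by (intro divide_left_mono) auto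
  hence "r \<in> B (max m n)" using m n by (simp add: B_def)
  thus "r \<in> (\<Union>n. B n)" by blast
 qed
 hence lim: "(\<lambda>n. ?E (B n) xi) ----> ?E {0<..} xi" for xi using sm_limit[where B = B, OF E(1) B B', of xi] by simp
 have "op_le (?E (B n)) (?E (B (Suc n)))" for n
  using sm_Int[OF E(1) B B, of "Suc n" n] B'[of n] by (simp add: proj_le_iff Ep B Int_absorb1)
 hence "\<tau> (?E {0<..}) = (SUP n. \<tau> (?E (B n)))"
  by (intro tr_normal(2) proj_pos_part EA Ep B proj_pos lim) auto
 hence \<tau>: "\<tau> (?E {0<..}) <= \<tau> P" using EB by (auto intro: SUP_least)
 have G: "proj (?E {0<..})" by (rule Ep) simp
 have FG: "F (?E {0<..} xi) = F xi" for xi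
 proof -
  let ?d = "xi - ?E {0<..} xi"
  have "?E {0<..} ?d = 0" by (simp add: bcl_diff[OF proj_bcl[OF G]] proj_idem[OF G])
  hence "(?d, 0) \<in> graph ?S" unfolding spectral_kernel[OF E(1,3)] E(2) .
  hence "?S ?d = 0" by (simp only: graph_mem)
  hence "cinner (x ?d) (x ?d) = 0" using cadj_left[OF xb, of "x ?d" ?d] by simp
  hence "F ?d = 0" by (intro ker) (simp add: cinner_self)
  thus ?thesis by (simp add: bcl_diff[OF proj_bcl[OF F(2)]])
 qed
 have "?E {0<..} (F xi) = F xi" for xi
 proof (rule cinner_ext)
  fix z show "cinner (?E {0<..} (F xi)) z = cinner (F xi) z"
   by (simp only: self_adj_cinner[OF proj_sa[OF G]] self_adj_cinner[OF proj_sa[OF F(2)]] FG)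
 qed
 hence "op_le F (?E {0<..})" by (simp add: proj_le_iff F G)
 hence "\<tau> F <= \<tau> (?E {0<..})" by (intro tr_mono proj_pos_part F G EA) simp
 thus ?thesis using \<tau> by (rule order_trans)
qed

lemma tr_compl_le:
 assumes p: "p \<in> A" "proj p" and m: "m \<in> A" "proj m" and d: "proj (\<lambda>xi. p xi - m xi)"
 shows "\<tau> (\<lambda>xi. xi - m xi) = \<tau> (\<lambda>xi. xi - p xi) + \<tau> (\<lambda>xi. p xi - m xi)"
proof -
 have "\<tau> (\<lambda>xi. (xi - p xi) + (p xi - m xi)) = \<tau> (\<lambda>xi. xi - p xi) + \<tau> (\<lambda>xi. p xi - m xi)"
  by (rule tr_add) (auto intro!: proj_pos_part A_minus A_id p m d proj_compl)
 thus ?thesis by simp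
qed

text \<open>On the range of \<open>p - m\<close> the element \<open>(1 - q) c\<close> is injective,
  since its kernel in \<open>p\<close> is exactly \<open>m\<close>; \<open>comparison\<close> then
  bounds the trace of \<open>p - m\<close> by that of \<open>1 - q\<close>. The identity as
  \<open>c\<close> gives intersections, a general \<open>c\<close> gives preimages.\<close>

lemma meet:
 assumes p: "p \<in> A" "proj p" and q: "q \<in> A" "proj q" and c: "c \<in> A"
 obtains m where "m \<in> A" "proj m" "!!x. m x = x \<longleftrightarrow> p x = x \<and> q (c x) = c x"
  "\<tau> (\<lambda>xi. p xi - m xi) <= \<tau> (\<lambda>xi. xi - q xi)" "(\<lambda>xi. p xi - m xi) \<in> A" "proj (\<lambda>xi. p xi - m xi)"
  "\<tau> (\<lambda>xi. xi - m xi) <= \<tau> (\<lambda>xi. xi - p xi) + \<tau> (\<lambda>xi. xi - q xi)"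
proof -
 note pb = proj_bcl[OF p(2)] and qb = proj_bcl[OF q(2)]
 obtain m where m: "m \<in> A" "proj m" "!!x. m x = x \<longleftrightarrow> p x = x \<and> q (c x) = c x"
  by (rule A_equalizer[of "{(p, \<lambda>x. x), (q o c, c)}"]) (use p q c that in "auto simp: A_id A_comp")
 note mb = proj_bcl[OF m(2)]
 have pm: "p (m x) = m x" for x using m(3)[of "m x"] proj_idem[OF m(2)] by simp
 have d: "(\<lambda>xi. p xi - m xi) \<in> A" "proj (\<lambda>xi. p xi - m xi)"
  by (rule A_minus[OF p(1) m(1)], rule proj_diff[OF p(2) m(2) pm])
 have mp: "m (p x) = m x" for x
 proof (rule cinner_ext)
  fix z show "cinner (m (p x)) z = cinner (m x) z"
   by (simp add: self_adj_cinner[OF proj_sa[OF m(2)]] self_adj_cinner[OF proj_sa[OF p(2)]] pm)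
 qed
 have le: "\<tau> (\<lambda>xi. p xi - m xi) <= \<tau> (\<lambda>xi. xi - q xi)"
 proof (rule comparison[where x = "(\<lambda>xi. xi - q xi) o (c o (\<lambda>xi. p xi - m xi))"])
  show "(\<lambda>xi. xi - q xi) o (c o (\<lambda>xi. p xi - m xi)) \<in> A" by (intro A_comp A_minus A_id q c d(1))
  show "p xi - m xi = 0" if "((\<lambda>xi. xi - q xi) o (c o (\<lambda>xi. p xi - m xi))) xi = 0" for xi
  proof -
   let ?z = "p xi - m xi"
   have "q (c ?z) = c ?z" using that by simp
   moreover have "p ?z = ?z" by (simp add: bcl_diff[OF pb] proj_idem[OF p(2)] pm)
   ultimately have "m ?z = ?z" using m(3) by simp
   moreover have "m ?z = 0" by (simp add: bcl_diff[OF mb] proj_idem[OF m(2)] mp)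
   ultimately show ?thesis by simp
  qed
 qed (auto intro: d A_minus A_id q proj_compl simp: bcl_diff[OF qb] proj_idem[OF q(2)])
 have "\<tau> (\<lambda>xi. xi - m xi) <= \<tau> (\<lambda>xi. xi - p xi) + \<tau> (\<lambda>xi. xi - q xi)"
  unfolding tr_compl_le[OF p m(1,2) d(2)] by (intro add_left_mono le)
 with le m d show thesis using that by blast
qed

lemma tr_small_zero:
 assumes x: "x \<in> pos_part A" and le: "!!k. \<tau> x <= ennreal (C / real (Suc k))"
 shows "x = (\<lambda>xi. 0)"
proof -
 have "(\<lambda>k. ennreal (C * (1 / real (Suc k)))) ----> ennreal (C * 0)"
  by (intro tendsto_ennrealI tendsto_mult tendsto_const LIMSEQ_Suc lim_1_over_n)
 hence "\<tau> x <= ennreal (C * 0)" using le by (intro LIMSEQ_le_const) auto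
 thus ?thesis using tr_faithful[OF x] by simp
qed

end

lemma vn_traceI: "von_neumann_algebra A ==> fns_trace A \<tau> ==> vn_trace A \<tau>"
 by unfold_locales (auto simp: fns_trace_def)

subsection \<open>Trace-dense subspaces\<close>

lemma csubspace_preimage:
 assumes T: "linear_rel T" and W: "csubspace W" shows "csubspace {x. \<exists>y. (x, y) \<in> T \<and> y \<in> W}"
 unfolding csubspace_def
proof (intro conjI ballI allI)
 show "0 \<in> {x. \<exists>y. (x, y) \<in> T \<and> y \<in> W}"
  using linear_rel_zero[OF T] W by (auto simp: csubspace_def)
 fix x x' assume "x \<in> {x. \<exists>y. (x, y) \<in> T \<and> y \<in> W}"
 then obtain y where y: "(x, y) \<in> T" "y \<in> W" by blast
 show "c *\<^sub>C x \<in> {x. \<exists>y. (x, y) \<in> T \<and> y \<in> W}" for c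
  using linear_rel_scaleC[OF T y(1), of c] y(2) W by (auto simp: csubspace_def)
 assume "x' \<in> {x. \<exists>y. (x, y) \<in> T \<and> y \<in> W}"
 then obtain y' where y': "(x', y') \<in> T" "y' \<in> W" by blast
 show "x + x' \<in> {x. \<exists>y. (x, y) \<in> T \<and> y \<in> W}"
  using linear_rel_add[OF T y(1) y'(1)] y(2) y'(2) W by (auto simp: csubspace_def)
qed

context vn_trace
begin

text \<open>The \<tau>-dense subspaces of the theory of measurable operators. They are stable under
  finite intersections and under preimages, which makes products of unbounded operators
  manageable.\<close>

definition trace_dense :: "'a set => bool" where
 "trace_dense V \<longleftrightarrow> (\<forall>\<delta>>0. \<exists>p\<in>A. proj p \<and> (\<forall>x. p x = x --> x \<in> V) \<and> \<tau> (\<lambda>xi. xi - p xi) <= ennreal \<delta>)"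

lemma trace_denseE:
 assumes "trace_dense V" "\<delta> > 0"
 obtains p where "p \<in> A" "proj p" "!!x. p x = x ==> x \<in> V" "\<tau> (\<lambda>xi. xi - p xi) <= ennreal \<delta>"
 using assms unfolding trace_dense_def by blast

lemma trace_dense_mono: "trace_dense V ==> V \<subseteq> W ==> trace_dense W"
 unfolding trace_dense_def by (meson subsetD)

lemma trace_dense_Int:
 assumes V: "trace_dense V" and W: "trace_dense W" shows "trace_dense (V \<inter> W)"
 unfolding trace_dense_def
proof (intro allI impI)
 fix \<delta> :: real assume "\<delta> > 0"
 hence d: "\<delta> / 2 > 0" by simp
 obtain p where p: "p \<in> A" "proj p" "!!x. p x = x ==> x \<in> V" "\<tau> (\<lambda>xi. xi - p xi) <= ennreal (\<delta> / 2)"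
  using trace_denseE[OF V d] by blast
 obtain q where q: "q \<in> A" "proj q" "!!x. q x = x ==> x \<in> W" "\<tau> (\<lambda>xi. xi - q xi) <= ennreal (\<delta> / 2)"
  using trace_denseE[OF W d] by blast
 obtain m where m: "m \<in> A" "proj m" "!!x. m x = x \<longleftrightarrow> p x = x \<and> q x = x"
  "\<tau> (\<lambda>xi. xi - m xi) <= \<tau> (\<lambda>xi. xi - p xi) + \<tau> (\<lambda>xi. xi - q xi)"
  using meet[OF p(1,2) q(1,2) A_id] by blast
 have "\<tau> (\<lambda>xi. xi - m xi) <= ennreal (\<delta> / 2) + ennreal (\<delta> / 2)"
  by (rule order_trans[OF m(4) add_mono[OF p(4) q(4)]])
 also have "... = ennreal \<delta>" using d by (simp flip: ennreal_plus)
 finally show "\<exists>p\<in>A. proj p \<and> (\<forall>x. p x = x --> x \<in> V \<inter> W) \<and> \<tau> (\<lambda>xi. xi - p xi) <= ennreal \<delta>"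
  using m(1,2,3) p(3) q(3) by blast
qed

lemma restriction_to_projection:
 assumes T: "cdd T" "aff A T" and p: "p \<in> A" "proj p"
  and dom: "!!x. p x = x ==> x \<in> Domain T"
 obtains c where "c \<in> A" "!!x. (p x, c x) \<in> T"
proof -
 note uniq = clinear_graph_unique[OF cdd_clinear[OF T(1)]] and lin = cdd_linear[OF T(1)]
 note pb = proj_bcl[OF p(2)]
 have r: "range p \<subseteq> Domain T" using dom proj_idem[OF p(2)] by blast
 have "\<exists>y. (p x, y) \<in> T" for x using r by blast
 then obtain c where c: "!!x. (p x, c x) \<in> T" by metis
 obtain C where C: "C > 0" "!!x y. p x = x ==> (x, y) \<in> T ==> norm y <= C * norm x"
  using bounded_on_projection[OF T(1) p(2) r] by blast
 have "bcl c"
 proof (rule bclI[where K = C])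
  show "c (x + y) = c x + c y" for x y
   using linear_rel_add[OF lin c[of x] c[of y]] by (intro uniq[OF c]) (simp add: bcl_add[OF pb])
  show "c (a *\<^sub>C x) = a *\<^sub>C c x" for a x
   using linear_rel_scaleC[OF lin c[of x], of a] by (intro uniq[OF c]) (simp add: bcl_scaleC[OF pb])
  show "norm (c x) <= norm x * C" for x
  proof -
   have "norm (c x) <= C * norm (p x)" by (rule C(2)[OF proj_idem[OF p(2)] c[of x]])
   also have "... <= C * norm x" using proj_norm[OF p(2), of x] C(1) by (intro mult_left_mono) auto
   finally show ?thesis by (simp only: mult.commute)
  qed
 qed
 moreover have "u (c x) = c (u x)" if "u \<in> commutant A" for u x
  using affiliated_comm[OF T(2) that c[of x]] comm_eq[OF p(1) that, of x] c[of "u x"] uniq by metis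
 ultimately have "c \<in> A" by (rule A_I)
 thus thesis using that c by blast
qed

text \<open>Cut down by a projection inside its domain, \<open>T\<close> becomes a bounded element
  \<open>c\<close> of the algebra, and \<open>meet\<close> pulls a projection under \<open>W\<close>
  back along \<open>c\<close>.\<close>

lemma trace_dense_preimage:
 assumes T: "cdd T" "aff A T" and dom: "trace_dense (Domain T)" and W: "trace_dense W"
 shows "trace_dense {x. \<exists>y. (x, y) \<in> T \<and> y \<in> W}"
 unfolding trace_dense_def
proof (intro allI impI)
 fix \<delta> :: real assume "\<delta> > 0"
 hence d: "\<delta> / 2 > 0" by simp
 obtain p where p: "p \<in> A" "proj p" "!!x. p x = x ==> x \<in> Domain T" "\<tau> (\<lambda>xi. xi - p xi) <= ennreal (\<delta> / 2)"
  using trace_denseE[OF dom d] by blast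
 obtain q where q: "q \<in> A" "proj q" "!!x. q x = x ==> x \<in> W" "\<tau> (\<lambda>xi. xi - q xi) <= ennreal (\<delta> / 2)"
  using trace_denseE[OF W d] by blast
 obtain c where c: "c \<in> A" "!!x. (p x, c x) \<in> T" using restriction_to_projection[OF T p(1,2,3)] by blast
 obtain m where m: "m \<in> A" "proj m" "!!x. m x = x \<longleftrightarrow> p x = x \<and> q (c x) = c x"
  "\<tau> (\<lambda>xi. xi - m xi) <= \<tau> (\<lambda>xi. xi - p xi) + \<tau> (\<lambda>xi. xi - q xi)"
  using meet[OF p(1,2) q(1,2) c(1)] by blast
 have "\<tau> (\<lambda>xi. xi - m xi) <= ennreal (\<delta> / 2) + ennreal (\<delta> / 2)"
  by (rule order_trans[OF m(4) add_mono[OF p(4) q(4)]])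
 also have "... = ennreal \<delta>" using d by (simp flip: ennreal_plus)
 finally have "\<tau> (\<lambda>xi. xi - m xi) <= ennreal \<delta>" .
 moreover have "x \<in> {x. \<exists>y. (x, y) \<in> T \<and> y \<in> W}" if "m x = x" for x
 proof -
  have "p x = x" "q (c x) = c x" using that m(3) by auto
  thus ?thesis using c(2)[of x] q(3) by auto
 qed
 ultimately show "\<exists>p\<in>A. proj p \<and> (\<forall>x. p x = x --> x \<in> {x. \<exists>y. (x, y) \<in> T \<and> y \<in> W}) \<and> \<tau> (\<lambda>xi. xi - p xi) <= ennreal \<delta>"
  using m(1,2) by blast
qed

text \<open>\<open>T\<close> is bounded by \<open>C\<close> on the range of \<open>p\<close> and at
  least \<open>C + 1\<close> above that spectral value, so the two ranges meet only in zero and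
  \<open>1 - p\<close> is injective on the spectral subspace.\<close>

lemma modulus_tail:
 assumes T: "cdd T" "aff A T" and dom: "trace_dense (Domain T)" and d: "\<delta> > 0"
 shows "\<exists>l>0. \<tau> (resol (abs_op T) {l<..}) <= ennreal \<delta>"
proof -
 obtain p where p: "p \<in> A" "proj p" "!!x. p x = x ==> x \<in> Domain T" "\<tau> (\<lambda>xi. xi - p xi) <= ennreal \<delta>"
  using trace_denseE[OF dom d] by blast
 note pb = proj_bcl[OF p(2)]
 have "range p \<subseteq> Domain T" using p(3) proj_idem[OF p(2)] by blast
 then obtain C where C: "C > 0" "!!x y. p x = x ==> (x, y) \<in> T ==> norm y <= C * norm x"
  using bounded_on_projection[OF T(1) p(2)] by blast
 define F where "F = resol (abs_op T) {C + 1<..}"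
 have F: "F \<in> A" "proj F"
  unfolding F_def by (rule modulus_A[OF T], simp, rule sm_proj[OF abs_op_resolution(1)[OF T(1)]], simp)
 have "\<tau> F <= \<tau> (\<lambda>xi. xi - p xi)"
 proof (rule comparison[where x = "(\<lambda>xi. xi - p xi) o F"])
  show "(\<lambda>xi. xi - p xi) o F \<in> A" by (intro A_comp A_minus A_id p F)
  show "F xi = 0" if "((\<lambda>xi. xi - p xi) o F) xi = 0" for xi
  proof -
   have pF: "p (F xi) = F xi" using that by simp
   then obtain y where y: "(F xi, y) \<in> T" using p(3) by blast
   have "norm y <= C * norm (F xi)" by (rule C(2)[OF pF y])
   moreover have "(C + 1) * norm (F xi) <= norm y"
    by (rule modulus_high[OF T(1) _ _ y]) (use C(1) proj_idem[OF F(2)] in "auto simp: F_def")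
   ultimately have "norm (F xi) <= 0" unfolding distrib_right by linarith
   thus ?thesis by simp
  qed
 qed (auto intro: F p A_minus A_id proj_compl simp: bcl_diff[OF pb] proj_idem[OF p(2)])
 hence "\<tau> F <= ennreal \<delta>" using p(4) by (rule order_trans)
 thus ?thesis unfolding F_def using C(1) by (intro exI[of _ "C + 1"]) auto
qed

lemma cdd_adj:
 assumes T: "cdd T" shows "cdd (graph_adj T)" "graph_adj (graph_adj T) = T"
proof -
 show TT: "graph_adj (graph_adj T) = T" using graph_adj2[OF cdd_linear[OF T]] cdd_closed[OF T] by simp
 have "closure (Domain (graph_adj T)) = UNIV"
 proof (rule csubspace_dense[OF linear_rel_Domain[OF graph_adj_linear]])
  fix z assume z: "!!x. x \<in> Domain (graph_adj T) ==> cinner z x = 0"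
  have "(0, z) \<in> graph_adj (graph_adj T)"
  proof (rule graph_adjI)
   fix x w assume "(x, w) \<in> graph_adj T"
   hence "cinner z x = 0" using z by blast
   thus "cinner w 0 = cinner x z" using cinner_commute[of x z] by simp
  qed
  hence "(0, z) \<in> T" by (simp only: TT)
  thus "z = 0" using clinear_graph_unique[OF cdd_clinear[OF T] _ linear_rel_zero[OF cdd_linear[OF T]]] by blast
 qed
 thus "cdd (graph_adj T)"
  using graph_adj_closed[of T] graph_adj_linear[of T] graph_adj_single_valued[OF cdd_dense[OF T]]
  by (simp add: closed_densely_defined_def clinear_graph_iff)
qed

text \<open>On the spectral subspace of \<open>|T*|\<close> above \<open>l\<close>, \<open>T*\<close> followed by the spectral projection of \<open>|T|\<close> above
 \<open>l/2\<close> is injective, since \<open>\<parallel>T*x\<parallel>\<^sup>2 = \<langle>TT*x, x\<rangle>\<close>.\<close>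

lemma trace_dense_adj:
 assumes T: "cdd T" "aff A T" and dom: "trace_dense (Domain T)"
 shows "trace_dense (Domain (graph_adj T))"
 unfolding trace_dense_def
proof (intro allI impI)
 fix \<delta> :: real assume "\<delta> > 0"
 then obtain l where l: "l > 0" "\<tau> (resol (abs_op T) {l<..}) <= ennreal \<delta>"
  using modulus_tail[OF T dom] by blast
 note T' = cdd_adj(1)[OF T(1)] affiliated_adj[OF T(2)]
 let ?F = "resol (abs_op T)" and ?G = "resol (abs_op (graph_adj T))"
 note F = abs_op_resolution(1)[OF T(1)] and G = abs_op_resolution(1)[OF T'(1)]
 note GA = modulus_A[OF T'] and Gp = sm_proj[OF G]
 have P: "?F {l<..} \<in> A" "proj (?F {l<..})" by (rule modulus_A[OF T], simp, rule sm_proj[OF F], simp)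
 \<comment> \<open>The upper cut \<open>n\<close> places the subspace in the domain of the adjoint,
   where its restriction is bounded; the factor 2 separates the lower bound \<open>2 * l\<close>
   from the upper bound \<open>l\<close> that comes out of \<open>modulus_low\<close>.\<close>
 define B where "B n = {2 * l<..real n}" for n
 have B: "B n \<in> sets borel" for n by (simp add: B_def)
 have "\<tau> (?G (B n)) <= \<tau> (?F {l<..})" for n
 proof -
  have low: "?G {..real n} x = x" and high: "?G {2 * l<..} x = x" if "?G (B n) x = x" for x
   by (rule sm_mono[OF G B _ _ that], simp, force simp: B_def)+
  have "x \<in> Domain (graph_adj T)" if "?G (B n) x = x" for x
   using modulus_low[OF T'(1) _ low[OF that]] by auto
  then obtain c where c: "c \<in> A" "!!x. (?G (B n) x, c x) \<in> graph_adj T"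
   using restriction_to_projection[OF T' GA[OF B] Gp[OF B]] by metis
  show ?thesis
  proof (rule comparison[OF A_comp[OF P(1) c(1)] GA[OF B] Gp[OF B] P])
   fix xi assume 0: "(?F {l<..} o c) xi = 0"
   let ?x = "?G (B n) xi"
   have "?F {..l} (c xi) = c xi" using 0 sm_compl[OF F, of "{l<..}" "c xi"] by simp
   then obtain y where y: "(c xi, y) \<in> T" "norm y <= l * norm (c xi)" using modulus_low[OF T(1), of l] l(1) by auto
   have "(norm (c xi))^2 = inner y ?x"
    using graph_adjD[OF c(2) y(1), of xi] by (simp add: inner_eq_Re_cinner cinner_self del: of_real_power)
   also have "... <= norm y * norm ?x" by (rule norm_cauchy_schwarz)
   also have "... <= l * norm (c xi) * norm ?x" by (intro mult_right_mono y(2)) simp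
   finally have "norm (c xi) * norm (c xi) <= (l * norm ?x) * norm (c xi)" by (simp add: power2_eq_square mult_ac)
   hence "norm (c xi) <= l * norm ?x" using l(1) by (cases "norm (c xi) = 0") auto
   moreover have "2 * l * norm ?x <= norm (c xi)"
    using modulus_high[OF T'(1) _ high[OF proj_idem[OF Gp[OF B]]] c(2)] l(1) by simp
   ultimately have "l * norm ?x <= 0" by linarith
   thus "?x = 0" using l(1) by (simp add: mult_le_0_iff)
  qed (simp add: proj_idem[OF P(2)])
 qed
 moreover have "\<tau> (?G {2 * l<..}) = (SUP n. \<tau> (?G (B n)))"
 proof (rule tr_normal(2))
  have B': "B n \<subseteq> B (Suc n)" for n by (auto simp: B_def)
  have "(\<Union>n. B n) = {2 * l<..}" by (auto simp: B_def intro: real_arch_simple)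
  thus "(\<lambda>n. ?G (B n) xi) ----> ?G {2 * l<..} xi" for xi using sm_limit[where B = B, OF G B B', of xi] by simp
  show "op_le (?G (B n)) (?G (B (Suc n)))" for n
   using sm_Int[OF G B B, of "Suc n" n] B'[of n] by (simp add: proj_le_iff Gp B Int_absorb1)
  show "pos (?G {2 * l<..})" by (rule proj_pos[OF Gp]) simp
 qed (auto intro: proj_pos_part GA Gp B)
 ultimately have "\<tau> (?G {2 * l<..}) <= ennreal \<delta>" using l(2) by (auto intro!: SUP_least intro: order_trans)
 moreover have "(\<lambda>x. x - ?G {..2 * l} x) = ?G {2 * l<..}" using sm_compl[OF G, of "{..2 * l}"] by auto
 ultimately have "\<tau> (\<lambda>x. x - ?G {..2 * l} x) <= ennreal \<delta>" by simp
 moreover have "x \<in> Domain (graph_adj T)" if "?G {..2 * l} x = x" for x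
  using modulus_low[OF T'(1) _ that] l(1) by auto
 ultimately show "\<exists>p\<in>A. proj p \<and> (\<forall>x. p x = x --> x \<in> Domain (graph_adj T)) \<and> \<tau> (\<lambda>xi. xi - p xi) <= ennreal \<delta>"
  using GA[of "{..2 * l}"] Gp[of "{..2 * l}"] by auto
qed

text \<open>A vector orthogonal to \<open>V\<close> is killed by projections whose complements have
  trace tending to zero. The projection onto their common kernel then has trace zero and vanishes by
  faithfulness.\<close>

lemma trace_dense_closure:
 assumes V: "trace_dense V" "csubspace V" shows "closure V = UNIV"
proof (rule csubspace_dense[OF V(2)])
 fix z assume z: "!!x. x \<in> V ==> cinner z x = 0"
 have "1 / real (Suc k) > 0" for k by simp
 hence "\<exists>p. p \<in> A \<and> proj p \<and> (\<forall>x. p x = x --> x \<in> V) \<and> \<tau> (\<lambda>xi. xi - p xi) <= ennreal (1 / real (Suc k))" for k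
  using V(1) unfolding trace_dense_def by meson
 then obtain p where p: "!!k. p k \<in> A" "!!k. proj (p k)" "!!k x. p k x = x ==> x \<in> V"
  "!!k. \<tau> (\<lambda>xi. xi - p k xi) <= ennreal (1 / real (Suc k))" by metis
 note pb = proj_bcl[OF p(2)]
 obtain g where g: "g \<in> A" "proj g" "!!x. g x = x \<longleftrightarrow> (\<forall>k. p k x = 0)"
  by (rule A_equalizer[of "range (\<lambda>k. (p k, \<lambda>x. 0))"]) (use p(1) A_zero that in auto)
 have le: "\<tau> g <= ennreal (1 / real (Suc k))" for k
 proof -
  have "g x - p k (g x) = g x" for x using g(3)[of "g x"] proj_idem[OF g(2)] by simp
  hence "op_le g (\<lambda>xi. xi - p k xi)" by (simp add: proj_le_iff g p proj_compl)
  hence "\<tau> g <= \<tau> (\<lambda>xi. xi - p k xi)" by (intro tr_mono proj_pos_part g p proj_compl A_minus A_id)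
  thus ?thesis using p(4)[of k] by (rule order_trans)
 qed
 have "g z = 0" using tr_small_zero[OF proj_pos_part[OF g(1,2)] le] by simp
 moreover have "p k z = 0" for k
 proof (rule cinner_ext[of "p k z" 0, simplified])
  fix a show "cinner (p k z) a = 0"
   using z[OF p(3)[OF proj_idem[OF p(2)]], of k a] by (simp add: self_adj_cinner[OF proj_sa[OF p(2)]])
 qed
 hence "g z = z" by (simp add: g(3))
 ultimately show "z = 0" by simp
qed

text \<open>On a spectral subspace of the modulus \<open>T\<close> is bounded, so it is enough to
  approximate \<open>x\<close> by vectors whose projection lies in \<open>V\<close>; these are dense
  because the preimage of \<open>V\<close> is again trace dense. \<open>modulus_core\<close> removes
  the spectral cut.\<close>

lemma trace_dense_core:
 assumes T: "cdd T" "aff A T" and V: "trace_dense V" "csubspace V"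
  and xy: "(x, y) \<in> T"
 shows "(x, y) \<in> closure {(a, b). (a, b) \<in> T \<and> a \<in> V}"
proof -
 let ?C = "closure {(a, b). (a, b) \<in> T \<and> a \<in> V}"
 note F = abs_op_resolution(1)[OF T(1)]
 define Q where "Q n = resol (abs_op T) {..real n}" for n
 have Q: "Q n \<in> A" "proj (Q n)" for n
  unfolding Q_def by (auto intro: modulus_A[OF T] sm_proj[OF F])
 note Qb = proj_bcl[OF Q(2)]
 obtain a where a: "!!n. (Q n x, a n) \<in> T" "a ----> y" using modulus_core[OF T(1) xy] by (auto simp: Q_def)
 have "(Q n x, a n) \<in> ?C" for n
 proof -
  have "z \<in> Domain T" if "Q n z = z" for z
   using modulus_low[OF T(1), of "real n" z] that by (auto simp: Q_def)
  then obtain c where c: "c \<in> A" "!!z. (Q n z, c z) \<in> T" using restriction_to_projection[OF T Q] by metis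
  have "trace_dense (Domain (graph (Q n)))"
   by (rule trace_dense_mono[OF V(1)]) (auto simp: graph_def)
  from trace_dense_preimage[OF cdd_graph[OF Qb] affiliated_graph[OF Q(1)] this V(1)]
  have "closure {z. \<exists>y. (z, y) \<in> graph (Q n) \<and> y \<in> V} = UNIV"
   by (rule trace_dense_closure) (rule csubspace_preimage[OF linear_rel_graph[OF Qb] V(2)])
  hence "x \<in> closure {z. Q n z \<in> V}" by simp
  then obtain X where X: "!!k. Q n (X k) \<in> V" "X ----> x" by (auto simp: closure_sequential)
  have "a n = c x" by (rule clinear_graph_unique[OF cdd_clinear[OF T(1)] a(1) c(2)])
  hence "(\<lambda>k. (Q n (X k), c (X k))) ----> (Q n x, a n)"
   using tendsto_Pair[OF bcl_tendsto[OF Qb X(2)] bcl_tendsto[OF A_bcl[OF c(1)] X(2)]] by simp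
  thus ?thesis unfolding closure_sequential using X(1) c(2) by (intro exI[of _ "\<lambda>k. (Q n (X k), c (X k))"]) auto
 qed
 moreover have "(\<lambda>n. (Q n x, a n)) ----> (x, y)"
 proof (rule tendsto_Pair[OF _ a(2)])
  have "(\<lambda>n. Q n x) ----> resol (abs_op T) (\<Union>n. {..real n}) x"
   unfolding Q_def by (rule sm_limit[OF F]) auto
  moreover have "(\<Union>n. {..real n}) = UNIV" by (auto intro: real_arch_simple)
  ultimately show "(\<lambda>n. Q n x) ----> x" using sm_UNIV[OF F] by simp
 qed
 ultimately show ?thesis by (rule closed_sequentially[OF closed_closure])
qed

text \<open>An increasing sequence of bounded trace has a densely defined limit form: the resolvents decrease
 to a limit whose kernel has arbitrarily small trace.\<close>

lemma bounded_trace_dense: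
 assumes B: "!!n::nat. B n \<in> pos_part A" and mono: "!!n. op_le (B n) (B (Suc n))"
  and C: "!!n. \<tau> (B n) <= ennreal C" and z: "!!x c. (!!n. inner (B n x) x <= c) ==> cinner z x = 0"
 shows "z = 0"
proof -
 have pos: "pos (B n)" and BA: "B n \<in> A" and sa: "self_adj (B n)" for n
  using B by (auto simp: pos_part_iff pos_iff)
 have inc: "inner (B n x) x <= inner (B m x) x" if "n <= m" for n m x
  using that
 proof (induction rule: dec_induct)
  case (step k) thus ?case using mono[of k] by (auto simp: op_le_iff sa intro: order_trans)
 qed simp
 have C0: "ennreal C \<ge> 0" by simp
 have main: "\<exists>J. J \<in> pos_part A \<and> \<tau> J <= ennreal (\<bar>C\<bar> / real (Suc k)) \<and> (\<forall>x. \<exists>c. \<forall>n. inner (B n (x - J x)) (x - J x) <= c)" for k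
 proof -
  define r where "r = 1 / real (Suc k)"
  have r: "r > 0" by (simp add: r_def)
  define D where "D n = (\<lambda>x. r *\<^sub>R B n x)" for n
  have D: "pos (D n)" for n
   using pos[of n] r by (auto simp: D_def pos_iff self_adj_rmult)
  have "\<exists>K. pos K \<and> (\<forall>x. K x + D n (K x) = x) \<and> (\<forall>x. inner (K x) x <= (norm x)^2) \<and>
   (\<forall>u x. bcl u --> (\<forall>x. u (D n x) = D n (u x)) --> u (K x) = K (u x)) \<and>
   (\<forall>x. inner (x - K x) x <= inner (D n x) x)" for n
   by (rule positive_resolvent[OF D[of n]]) blast
  then obtain K where K: "!!n. pos (K n)" "!!n x. K n x + D n (K n x) = x"
   "!!n x. inner (K n x) x <= (norm x)^2"
   "!!n u x. bcl u ==> (\<forall>x. u (D n x) = D n (u x)) ==> u (K n x) = K n (u x)"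
   "!!n x. inner (x - K n x) x <= inner (D n x) x" by metis
  have saK: "self_adj (K n)" and bK: "bcl (K n)" and bD: "bcl (D n)" and saD: "self_adj (D n)" for n
   using K(1) D by (auto simp: pos_iff self_adj_bcl)
  have incD: "inner (D n x) x <= inner (D m x) x" if "n <= m" for n m x
   using inc[OF that] r by (simp add: D_def)
  have KA: "K n \<in> A" for n
  proof (rule A_I[OF bK])
   fix u xi assume u: "u \<in> commutant A"
   show "u (K n xi) = K n (u xi)"
    by (rule K(4)[OF comm_bcl[OF u]]) (simp add: D_def bcl_scaleR[OF comm_bcl[OF u]] comm_eq[OF BA u])
  qed
  define J where "J n = (\<lambda>x. x - K n x)" for n
  have saJ: "self_adj (J n)" for n unfolding J_def by (intro self_adj_minus self_adj_id saK)
  have Jf: "inner (J n x) x = (norm x)^2 - inner (K n x) x" for n x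
   by (simp add: J_def inner_diff_left power2_norm_eq_inner)
  have Jpos: "pos (J n)" for n using saJ K(3) by (simp add: pos_iff Jf)
  have JA: "J n \<in> pos_part A" for n using Jpos by (simp add: pos_part_iff J_def A_minus A_id KA)
  have Jmono: "op_le (J n) (J (Suc n))" for n
  proof -
   have "inner (K (Suc n) x) x <= inner (K n x) x" for x
   proof -
    define a b where "a = K (Suc n) x" and "b = K n x"
    have xb: "b + D n b = x" and xa: "a + D (Suc n) a = x" by (simp_all add: a_def b_def K)
    \<comment> \<open>Positivity of the identity plus \<open>D n\<close> is tested on the difference
      of two resolvent vectors; together with \<open>D n <= D (Suc n)\<close> this shows that the
      resolvents decrease.\<close>
    have "0 <= inner ((a - b) + D n (a - b)) (a - b)"
     using D[of n] by (simp add: inner_add_left pos_iff)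
    also have "(a - b) + D n (a - b) = (a + D n a) - x"
     by (subst xb[symmetric]) (simp add: bcl_diff[OF bD] algebra_simps)
    finally have "inner x (a - b) <= inner (a + D n a) (a - b)" by (simp add: inner_diff_left)
    also have "... = inner (a + D n a) a - inner (a + D n a) b" by (simp add: inner_diff_right)
    also have "inner (a + D n a) b = inner a (b + D n b)"
     by (simp add: inner_add_left inner_add_right self_adj_inner[OF saD])
    also have "inner a (b + D n b) = inner a x" by (simp only: xb)
    also have "inner (a + D n a) a <= inner (a + D (Suc n) a) a" using incD[of n "Suc n" a] by (simp add: inner_add_left)
    also have "... = inner x a" by (simp only: xa)
    finally have "inner x (a - b) <= inner x a - inner a x" by simp
    thus ?thesis by (simp add: inner_diff_right inner_commute a_def[symmetric] b_def[symmetric])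
   qed
   thus ?thesis by (simp add: op_le_iff saJ Jf)
  qed
  obtain L where L: "pos L" "!!x. (\<lambda>n. J n x) ----> L x"
  proof -
   have "\<exists>L. pos L \<and> (\<forall>x. (\<lambda>n. J n x) ----> L x)"
    using monotone_operator_limit[where T = J and C = 1] Jpos Jmono K(1) by (auto simp: Jf pos_iff)
   thus thesis using that by blast
  qed
  have "\<tau> (J n) <= ennreal (\<bar>C\<bar> / real (Suc k))" for n
  proof -
   have "op_le (J n) (D n)" using K(5) by (simp add: op_le_iff saJ saD) (simp add: J_def)
   moreover have "D n \<in> pos_part A" using D[of n] by (simp add: pos_part_iff D_def A_rmult BA)
   ultimately have "\<tau> (J n) <= \<tau> (D n)" by (intro tr_mono JA)
   also have "... = ennreal r * \<tau> (B n)" unfolding D_def by (rule tr_scale[OF B]) (use r in simp)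
   also have "... <= ennreal r * ennreal \<bar>C\<bar>"
    by (intro mult_left_mono order_trans[OF C] ennreal_leI) auto
   also have "... = ennreal (\<bar>C\<bar> / real (Suc k))" using r by (simp add: r_def mult.commute flip: ennreal_mult)
   finally show ?thesis .
  qed
  hence "\<tau> L <= ennreal (\<bar>C\<bar> / real (Suc k))"
   using tr_normal(2)[where x = J, OF JA Jmono L] by (auto intro: SUP_least)
  moreover have "inner (B n (x - L x)) (x - L x) <= (norm x)^2 / r" for n x
  proof -
   have Km: "inner (D n (K m x)) (K m x) <= (norm x)^2" if "n <= m" for m
   proof -
    have "inner (D n (K m x)) (K m x) <= inner (D m (K m x)) (K m x)" by (rule incD[OF that])
    also have "... <= inner (K m x + D m (K m x)) (K m x)" by (simp add: inner_add_left)
    also have "... = inner x (K m x)" by (simp only: K)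
    also have "... <= (norm x)^2" using K(3)[of m x] by (simp add: inner_commute)
    finally show ?thesis .
   qed
   have Klim: "(\<lambda>m. K m x) ----> x - L x"
    using tendsto_diff[OF tendsto_const[of x] L(2)[of x]] by (simp add: J_def)
   have "inner (D n (x - L x)) (x - L x) <= (norm x)^2"
    by (rule LIMSEQ_le_const2[OF tendsto_inner[OF bcl_tendsto[OF bD Klim] Klim]]) (use Km in blast)
   thus ?thesis using r by (simp add: D_def field_simps)
  qed
  ultimately show ?thesis using tr_normal(1)[where x = J, OF JA Jmono L] by blast
 qed
 then obtain J where J: "!!k. J k \<in> pos_part A" "!!k. \<tau> (J k) <= ennreal (\<bar>C\<bar> / real (Suc k))"
  "!!k x. \<exists>c. \<forall>n. inner (B n (x - J k x)) (x - J k x) <= c" by metis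
 have sJ: "self_adj (J k)" and JA: "J k \<in> A" and Jp: "!!x. 0 <= inner (J k x) x" for k
  using J(1) by (auto simp: pos_part_iff pos_iff)
 note Jb = self_adj_bcl[OF sJ]
 \<comment> \<open>The limit form is finite on the range of each \<open>1 - J k\<close>, so
   \<open>z\<close> is orthogonal to it and fixed by every \<open>J k\<close>, while the traces of
   the \<open>J k\<close> tend to zero.\<close>
 have "J k z = z" for k
 proof -
  have "cinner (z - J k z) x = 0" for x
  proof -
   obtain c where "!!n. inner (B n (x - J k x)) (x - J k x) <= c" using J(3) by blast
   hence "cinner z (x - J k x) = 0" by (rule z)
   thus ?thesis by (simp add: cinner_diff_left cinner_diff_right self_adj_cinner[OF sJ])
  qed
  thus ?thesis using cinner_ext[of "z - J k z" 0] by simp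
 qed
 note Jz = this
 obtain g where g: "g \<in> A" "proj g" "!!x. g x = x \<longleftrightarrow> (\<forall>k. J k x = x)"
  by (rule A_equalizer[of "range (\<lambda>k. (J k, \<lambda>x. x))"]) (use JA A_id that in auto)
 have "\<tau> g <= ennreal (\<bar>C\<bar> / real (Suc k))" for k
 proof -
  have Jg: "J k (g x) = g x" for x using g(3)[of "g x"] proj_idem[OF g(2)] by simp
  have "inner (g x) x <= inner (J k x) x" for x
  proof -
   define w where "w = x - g x"
   have gw: "inner (g x) w = 0"
    using proj_inner[OF g(2), of x] by (simp add: w_def inner_diff_right power2_norm_eq_inner)
   have "inner (J k (g x + w)) (g x + w) = inner (g x) (g x) + inner (J k w) w"
    using gw self_adj_inner[OF sJ[of k], of w "g x"]
    by (simp add: bcl_add[OF Jb] Jg inner_add_left inner_add_right inner_commute)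
   moreover have "g x + w = x" by (simp add: w_def)
   moreover have "0 <= inner (J k w) w" by (rule Jp)
   ultimately show ?thesis by (simp add: proj_inner[OF g(2)] power2_norm_eq_inner)
  qed
  hence "op_le g (J k)" by (simp add: op_le_iff proj_sa[OF g(2)] sJ)
  thus ?thesis using tr_mono[OF proj_pos_part[OF g(1,2)] J(1)[of k]] J(2)[of k] by (meson order_trans)
 qed
 hence "g = (\<lambda>xi. 0)" by (rule tr_small_zero[OF proj_pos_part[OF g(1,2)]])
 moreover have "g z = z" using g(3) Jz by simp
 ultimately show ?thesis by simp
qed

end

section \<open>The crossed product\<close>

lemma bounded_bilinear_scaleC: "bounded_bilinear (\<lambda>c (x::'a::chilbert_space). c *\<^sub>C x)"
proof
 show "\<exists>K. \<forall>c (x::'a). norm (c *\<^sub>C x) <= norm c * norm x * K" by (rule exI[of _ 1]) (simp add: norm_scaleC)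
 show "(r *\<^sub>R c) *\<^sub>C x = r *\<^sub>R (c *\<^sub>C x)" for r c and x :: 'a
  by (simp add: scaleR_conv_of_real flip: scaleC_scaleC scaleC_of_real)
qed (simp_all add: scaleC_add_left scaleC_add_right scaleC_scaleR_commute)

lemma bounded_bilinear_cinner: "bounded_bilinear (cinner :: 'a::chilbert_space => _)"
proof
 show "\<exists>K. \<forall>x (y::'a). norm (cinner x y) <= norm x * norm y * K" by (rule exI[of _ 1]) (simp add: cmod_cinner_le)
qed (simp_all add: cinner_simps cinner_scaleR_left cinner_scaleR_right scaleR_conv_of_real)

lemmas continuous_on_scaleC = bounded_bilinear.continuous_on[OF bounded_bilinear_scaleC]
 and continuous_on_cinner = bounded_bilinear.continuous_on[OF bounded_bilinear_cinner]

lemma bcl_continuous_on: "bcl T ==> continuous_on S T"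
 by (intro linear_continuous_on bcl_linear)

lemma bcl_dense_eq:
 assumes V: "closure V = UNIV" and S: "bcl S" and T: "bcl T" and eq: "!!v. v \<in> V ==> S v = T v"
 shows "S = T"
proof
 fix x
 have "closure V \<subseteq> {x. S x = T x}"
  using eq by (intro closure_minimal closed_Collect_eq bcl_continuous_on S T) auto
 thus "S x = T x" using V by auto
qed

lemma double_commutant_vna:
 assumes S: "!!x. x \<in> S ==> bcl x" "!!x. x \<in> S ==> cadj x \<in> S"
 shows "von_neumann_algebra (commutant (commutant S))"
proof -
 have b: "!!T x. x \<in> commutant T ==> bcl x" by (simp add: commutant_def)
 have c: "cadj x \<in> commutant S" if "x \<in> commutant S" for x by (rule commutant_cadj[OF S that])
 have c2: "cadj x \<in> commutant (commutant S)" if "x \<in> commutant (commutant S)" for x by (rule commutant_cadj[OF b c that])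
 have sub: "T \<subseteq> commutant (commutant T)" if "!!x. x \<in> T ==> bcl x" for T :: "('a => 'a) set"
  using that by (auto simp: commutant_def)
 have "commutant (commutant (commutant S)) = commutant S"
 proof
  show "commutant (commutant (commutant S)) \<subseteq> commutant S"
  proof
   fix x assume x: "x \<in> commutant (commutant (commutant S))"
   have "x o a = a o x" if "a \<in> S" for a
    using x subsetD[OF sub[OF S(1)] that] unfolding commutant_def[of "commutant (commutant S)"] by blast
   thus "x \<in> commutant S" using b[OF x] by (simp add: commutant_def)
  qed
 qed (rule sub[OF b])
 thus ?thesis using c2 by (auto simp: von_neumann_algebra_def b)
qed

section \<open>Operators on the space of square-integrable functions\<close>

locale L2 =
 fixes \<iota> :: "(real => 'h::chilbert_space) => 'k::chilbert_space"
 assumes L2: "L2_space \<iota>"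
begin

abbreviation "wt \<equiv> cp_w \<iota>"
abbreviation "lm \<equiv> cp_lambda \<iota>"
abbreviation "\<theta> \<equiv> dual_action \<iota>"

lemma iota_add: "f \<in> Cc ==> g \<in> Cc ==> \<iota> (\<lambda>t. f t + g t) = \<iota> f + \<iota> g"
 and iota_scaleC: "f \<in> Cc ==> \<iota> (\<lambda>t. c *\<^sub>C f t) = c *\<^sub>C \<iota> f"
 and iota_cinner: "f \<in> Cc ==> g \<in> Cc ==> cinner (\<iota> f) (\<iota> g) = (\<integral>t. cinner (f t) (g t) \<partial>lborel)"
 and iota_dense: "closure (\<iota> ` Cc) = UNIV"
 using L2 by (auto simp: L2_space_def)

lemma CcD: "f \<in> Cc ==> continuous_on UNIV f"
 by (simp add: Cc_def)

lemma Cc_support: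
 assumes "f \<in> Cc" obtains C where "!!t. f t ~= 0 ==> \<bar>t\<bar> <= C"
 using assms unfolding Cc_def bounded_iff by auto

lemma CcI: "continuous_on UNIV f ==> (!!t. f t ~= 0 ==> \<bar>t\<bar> <= C) ==> f \<in> Cc"
 unfolding Cc_def bounded_iff by auto

lemma Cc_add: assumes f: "f \<in> Cc" and g: "g \<in> Cc" shows "(\<lambda>t. f t + g t) \<in> Cc"
proof -
 obtain C D where CD: "!!t. f t ~= 0 ==> \<bar>t\<bar> <= C" "!!t. g t ~= 0 ==> \<bar>t\<bar> <= D" using Cc_support f g by metis
 show ?thesis
 proof (rule CcI[where C = "max C D"])
  fix t assume "f t + g t ~= 0"
  hence "f t ~= 0 \<or> g t ~= 0" by auto
  thus "\<bar>t\<bar> <= max C D" using CD by (auto simp: le_max_iff_disj)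
 qed (intro continuous_on_add CcD f g)
qed

lemma Cc_scaleC_fun:
 assumes f: "f \<in> Cc" and c: "continuous_on UNIV c" shows "(\<lambda>t. c t *\<^sub>C f t) \<in> Cc"
proof -
 obtain C where "!!t. f t ~= 0 ==> \<bar>t\<bar> <= C" using Cc_support f by metis
 moreover have "f t ~= 0" if "c t *\<^sub>C f t ~= 0" for t using that by (metis scaleC_zero_right)
 ultimately show ?thesis by (intro CcI[OF continuous_on_scaleC[OF c CcD[OF f]], where C = C]) blast
qed

lemma Cc_scaleC: "f \<in> Cc ==> (\<lambda>t. c *\<^sub>C f t) \<in> Cc"
 by (rule Cc_scaleC_fun) auto

lemma Cc_shift: assumes f: "f \<in> Cc" shows "(\<lambda>t. f (t - s)) \<in> Cc"
proof -
 obtain C where C: "!!t. f t ~= 0 ==> \<bar>t\<bar> <= C" using Cc_support f by metis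
 show ?thesis
  by (rule CcI[where C = "C + \<bar>s\<bar>"])
   (auto intro!: continuous_on_compose2[OF CcD[OF f]] continuous_intros dest: C)
qed

lemma Cc_op:
 assumes f: "f \<in> Cc" and X: "!!xi. continuous_on UNIV (\<lambda>t. X t xi)" "!!t. bcl (X t)"
  "!!t xi. norm (X t xi) <= K * norm xi"
 shows "(\<lambda>t. X t (f t)) \<in> Cc"
proof -
 obtain C where C: "!!t. f t ~= 0 ==> \<bar>t\<bar> <= C" using Cc_support f by metis
 have "((\<lambda>t. X t (f t)) \<longlongrightarrow> X r (f r)) (at r)" for r
 proof -
  have f0: "((\<lambda>t. f t) \<longlongrightarrow> f r) (at r)" using CcD[OF f] by (auto simp: continuous_on_def)
  have "((\<lambda>t. norm (f t - f r)) \<longlongrightarrow> 0) (at r)" using f0 by (simp only: tendsto_norm_zero_iff LIM_zero_iff)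
  hence "((\<lambda>t. K * norm (f t - f r)) \<longlongrightarrow> K * 0) (at r)" by (rule tendsto_mult_left)
  hence d: "((\<lambda>t. K * norm (f t - f r)) \<longlongrightarrow> 0) (at r)" by simp
  have "((\<lambda>t. X t (f t - f r)) \<longlongrightarrow> 0) (at r)"
   by (rule Lim_null_comparison[OF _ d]) (simp add: X(3))
  moreover have "((\<lambda>t. X t (f r)) \<longlongrightarrow> X r (f r)) (at r)" using X(1)[of "f r"] by (auto simp: continuous_on_def)
  ultimately have "((\<lambda>t. X t (f t - f r) + X t (f r)) \<longlongrightarrow> 0 + X r (f r)) (at r)" by (rule tendsto_add)
  thus ?thesis by (simp add: bcl_diff[OF X(2)])
 qed
 hence "continuous_on UNIV (\<lambda>t. X t (f t))" by (simp add: continuous_on_def)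
 thus ?thesis
 proof (rule CcI[where C = C])
  fix t assume "X t (f t) ~= 0"
  hence "f t ~= 0" using bcl_0[OF X(2)[of t]] by metis
  thus "\<bar>t\<bar> <= C" by (rule C)
 qed
qed

lemma Cc_integrable:
 fixes \<phi> :: "real => 'b::euclidean_space"
 assumes f: "f \<in> Cc" and c: "continuous_on UNIV \<phi>" and z: "!!t. f t = 0 ==> \<phi> t = 0"
 shows "integrable lborel \<phi>"
proof -
 obtain C where C: "!!t. f t ~= 0 ==> \<bar>t\<bar> <= C" using Cc_support f by metis
 have "integrable lborel (\<lambda>t. indicator {-C..C} t *\<^sub>R \<phi> t)"
  by (intro borel_integrable_compact continuous_on_subset[OF c]) auto
 moreover have "indicator {-C..C} t *\<^sub>R \<phi> t = \<phi> t" for t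
  using C[of t] z[of t] by (cases "f t = 0") (auto simp: indicator_def)
 ultimately show ?thesis by simp
qed

lemma iota_norm: assumes f: "f \<in> Cc" shows "(norm (\<iota> f))^2 = (\<integral>t. (norm (f t))^2 \<partial>lborel)"
proof -
 have "cor ((norm (\<iota> f))^2) = (\<integral>t. cor ((norm (f t))^2) \<partial>lborel)"
  using iota_cinner[OF f f] by (simp only: cinner_self)
 thus ?thesis by (simp only: integral_complex_of_real of_real_eq_iff)
qed

lemma Cc_norm_integrable: "f \<in> Cc ==> integrable lborel (\<lambda>t. (norm (f t))^2)"
 by (rule Cc_integrable) (auto intro!: continuous_intros CcD)

lemma iota_norm_le:
 assumes f: "f \<in> Cc" and g: "g \<in> Cc" and K: "0 <= K" and le: "!!t. norm (g t) <= K * norm (f t)"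
 shows "norm (\<iota> g) <= K * norm (\<iota> f)"
proof (rule power2_le_imp_le)
 have "(\<integral>t. (norm (g t))^2 \<partial>lborel) <= (\<integral>t. K\<^sup>2 * (norm (f t))^2 \<partial>lborel)"
 proof (rule integral_mono)
  show "(norm (g t))^2 <= K\<^sup>2 * (norm (f t))^2" for t
   unfolding power_mult_distrib[symmetric] by (rule power_mono[OF le]) simp
 qed (intro integrable_mult_right Cc_norm_integrable f g)+
 thus "(norm (\<iota> g))^2 <= (K * norm (\<iota> f))^2" by (simp add: iota_norm f g power_mult_distrib)
 show "0 <= K * norm (\<iota> f)" using K by simp
qed

lemma iota_eq: assumes "bcl S" "bcl T" "!!f. f \<in> Cc ==> S (\<iota> f) = T (\<iota> f)" shows "S = T"
 by (rule bcl_dense_eq[OF iota_dense assms(1,2)]) (use assms(3) in auto)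

text \<open>Extension by continuity from the dense image of \<open>Cc\<close>. The estimate for
  differences also shows that the value does not depend on the representative picked by
  \<open>SOME\<close>, as injectivity of \<open>\<iota>\<close> is not presupposed.\<close>

lemma
 assumes \<Phi>: "!!f. f \<in> Cc ==> \<Phi> f \<in> Cc"
  and add: "!!f g. f \<in> Cc ==> g \<in> Cc ==> \<Phi> (\<lambda>t. f t + g t) = (\<lambda>t. \<Phi> f t + \<Phi> g t)"
  and scale: "!!f c. f \<in> Cc ==> \<Phi> (\<lambda>t. c *\<^sub>C f t) = (\<lambda>t. c *\<^sub>C \<Phi> f t)"
  and K: "0 <= K" and bd: "!!f. f \<in> Cc ==> norm (\<iota> (\<Phi> f)) <= K * norm (\<iota> f)"
 shows L2_op_bcl: "bcl (L2_op \<iota> \<Phi>)"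
  and L2_op_iota: "f \<in> Cc ==> L2_op \<iota> \<Phi> (\<iota> f) = \<iota> (\<Phi> f)"
proof -
 let ?V = "\<iota> ` Cc"
 have d: "norm (\<iota> (\<Phi> f) - \<iota> (\<Phi> f')) <= K * norm (\<iota> f - \<iota> f')" if f: "f \<in> Cc" "f' \<in> Cc" for f f'
 proof -
  let ?g = "\<lambda>t. f t + (-1) *\<^sub>C f' t"
  have g: "?g \<in> Cc" by (intro Cc_add Cc_scaleC f)
  have "\<iota> ?g = \<iota> f + (-1) *\<^sub>C \<iota> f'" by (simp only: iota_add[OF f(1) Cc_scaleC[OF f(2)]] iota_scaleC[OF f(2)])
  moreover have "\<Phi> ?g = (\<lambda>t. \<Phi> f t + (-1) *\<^sub>C \<Phi> f' t)"
   by (simp only: add[OF f(1) Cc_scaleC[OF f(2)]] scale[OF f(2)])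
  hence "\<iota> (\<Phi> ?g) = \<iota> (\<Phi> f) + (-1) *\<^sub>C \<iota> (\<Phi> f')"
   by (simp only: iota_add[OF \<Phi>[OF f(1)] Cc_scaleC[OF \<Phi>[OF f(2)]]] iota_scaleC[OF \<Phi>[OF f(2)]])
  ultimately have "norm (\<iota> (\<Phi> f) + (-1) *\<^sub>C \<iota> (\<Phi> f')) <= K * norm (\<iota> f + (-1) *\<^sub>C \<iota> f')"
   using bd[OF g] by (simp only:)
  thus ?thesis by (simp add: scaleC_minus_one)
 qed
 define G where "G v = \<iota> (\<Phi> (SOME f. f \<in> Cc \<and> \<iota> f = v))" for v
 have G: "G (\<iota> f) = \<iota> (\<Phi> f)" if f: "f \<in> Cc" for f
 proof -
  define f' where "f' = (SOME g. g \<in> Cc \<and> \<iota> g = \<iota> f)"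
  have "f' \<in> Cc \<and> \<iota> f' = \<iota> f" unfolding f'_def by (rule someI[of "\<lambda>g. g \<in> Cc \<and> \<iota> g = \<iota> f" f]) (use f in simp)
  hence "norm (\<iota> (\<Phi> f') - \<iota> (\<Phi> f)) <= 0" using d[of f' f] f by simp
  thus ?thesis by (simp add: G_def f'_def)
 qed
 have "K-lipschitz_on ?V G"
  by (rule lipschitz_onI[OF _ K]) (auto simp: dist_norm G d)
 from uniformly_continuous_on_extension_on_closure[OF lipschitz_on_uniformly_continuous[OF this]]
 obtain T where T0: "uniformly_continuous_on (closure ?V) T" "!!x. x \<in> ?V ==> G x = T x" by metis
 have T: "T (\<iota> f) = \<iota> (\<Phi> f)" if "f \<in> Cc" for f using T0(2)[of "\<iota> f"] G[OF that] that by simp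
 have cont: "continuous_on S T" for S
  using uniformly_continuous_imp_continuous[OF T0(1)] continuous_on_subset by (auto simp: iota_dense)
 note cc = continuous_on_compose2[OF cont[of UNIV] _ subset_UNIV]
 have ind: "P x" if "closed {x. P x}" "!!f. f \<in> Cc ==> P (\<iota> f)" for P x
 proof -
  have "closure ?V \<subseteq> {x. P x}" using that by (intro closure_minimal) auto
  thus ?thesis using iota_dense by auto
 qed
 have a1: "T (x + \<iota> g) = T x + T (\<iota> g)" if g: "g \<in> Cc" for x g
 proof (rule ind[where P = "\<lambda>x. T (x + \<iota> g) = T x + T (\<iota> g)"])
  show "closed {x. T (x + \<iota> g) = T x + T (\<iota> g)}"
   by (rule closed_Collect_eq[OF cc continuous_on_add[OF cont continuous_on_const]]) (intro continuous_intros)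
  show "T (\<iota> f + \<iota> g) = T (\<iota> f) + T (\<iota> g)" if f: "f \<in> Cc" for f
   unfolding iota_add[OF f g, symmetric] T[OF f] T[OF g] T[OF Cc_add[OF f g]] add[OF f g]
   by (rule iota_add[OF \<Phi>[OF f] \<Phi>[OF g]])
 qed
 have a2: "T (x + y) = T x + T y" for x y
 proof (rule ind[where P = "\<lambda>y. T (x + y) = T x + T y"])
  show "closed {y. T (x + y) = T x + T y}"
   by (rule closed_Collect_eq[OF cc continuous_on_add[OF continuous_on_const cont]]) (intro continuous_intros)
 qed (rule a1)
 have s: "T (c *\<^sub>C x) = c *\<^sub>C T x" for c x
 proof (rule ind[where P = "\<lambda>x. T (c *\<^sub>C x) = c *\<^sub>C T x"])
  show "closed {x. T (c *\<^sub>C x) = c *\<^sub>C T x}"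
   by (rule closed_Collect_eq[OF cc continuous_on_scaleC[OF continuous_on_const cont]])
    (intro continuous_on_scaleC continuous_on_const continuous_on_id)
  show "T (c *\<^sub>C \<iota> f) = c *\<^sub>C T (\<iota> f)" if f: "f \<in> Cc" for f
   unfolding iota_scaleC[OF f, symmetric] T[OF f] T[OF Cc_scaleC[OF f]] scale[OF f]
   by (rule iota_scaleC[OF \<Phi>[OF f]])
 qed
 have n: "norm (T x) <= K * norm x" for x
 proof (rule ind[where P = "\<lambda>x. norm (T x) <= K * norm x"])
  show "closed {x. norm (T x) <= K * norm x}"
   by (rule closed_Collect_le[OF continuous_on_norm[OF cont]]) (intro continuous_intros)
  show "norm (T (\<iota> f)) <= K * norm (\<iota> f)" if f: "f \<in> Cc" for f by (simp add: T f bd)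
 qed
 have Tb: "bcl T" by (rule bclI[where K = K]) (use a2 s n in "auto simp: mult.commute")
 have "L2_op \<iota> \<Phi> = T"
  unfolding L2_op_def
 proof (rule the_equality)
  show "bcl T \<and> (\<forall>f\<in>Cc. T (\<iota> f) = \<iota> (\<Phi> f))" using Tb T by simp
  fix S assume "bcl S \<and> (\<forall>f\<in>Cc. S (\<iota> f) = \<iota> (\<Phi> f))"
  thus "S = T" by (intro iota_eq Tb) (auto simp: T)
 qed
 thus "bcl (L2_op \<iota> \<Phi>)" "f \<in> Cc ==> L2_op \<iota> \<Phi> (\<iota> f) = \<iota> (\<Phi> f)" using Tb T by auto
qed

lemma
 assumes "!!xi. continuous_on UNIV (\<lambda>t. X t xi)" "!!t. bcl (X t)" "0 <= K" "!!t xi. norm (X t xi) <= K * norm xi"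
 shows L2_op_mult_bcl: "bcl (L2_op \<iota> (\<lambda>f t. X t (f t)))"
  and L2_op_mult_iota: "f \<in> Cc ==> L2_op \<iota> (\<lambda>f t. X t (f t)) (\<iota> f) = \<iota> (\<lambda>t. X t (f t))"
proof -
 note c = Cc_op[OF _ assms(1,2,4)]
 have n: "norm (\<iota> (\<lambda>t. X t (f t))) <= K * norm (\<iota> f)" if "f \<in> Cc" for f
  by (rule iota_norm_le[OF that c[OF that] assms(3,4)])
 show "bcl (L2_op \<iota> (\<lambda>f t. X t (f t)))"
  by (rule L2_op_bcl[OF c _ _ assms(3) n]) (simp_all add: bcl_add[OF assms(2)] bcl_scaleC[OF assms(2)])
 show "L2_op \<iota> (\<lambda>f t. X t (f t)) (\<iota> f) = \<iota> (\<lambda>t. X t (f t))" if "f \<in> Cc"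
  by (rule L2_op_iota[OF c _ _ assms(3) n that]) (simp_all add: bcl_add[OF assms(2)] bcl_scaleC[OF assms(2)])
qed

subsection \<open>Translations and the dual unitaries\<close>

lemma iota_shift_norm: assumes f: "f \<in> Cc" shows "norm (\<iota> (\<lambda>t. f (t - s))) = norm (\<iota> f)"
proof -
 have "(\<integral>t. (norm (f t))^2 \<partial>lborel) = (\<integral>t. (norm (f (t - s)))^2 \<partial>lborel)"
  using lborel_integral_real_affine[of 1 "\<lambda>t. (norm (f t))^2" "- s"] by simp
 hence "(norm (\<iota> (\<lambda>t. f (t - s))))^2 = (norm (\<iota> f))^2" by (simp only: iota_norm[OF f] iota_norm[OF Cc_shift[OF f]])
 thus ?thesis by simp
qed

lemma lam_bcl: "bcl (lm s)"
 and lam_iota: "f \<in> Cc ==> lm s (\<iota> f) = \<iota> (\<lambda>t. f (t - s))"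
 unfolding cp_lambda_def
 by (rule L2_op_bcl[where K = 1], auto simp: Cc_shift iota_shift_norm)[1]
  (rule L2_op_iota[where K = 1], auto simp: Cc_shift iota_shift_norm)[1]

lemma w_bcl: "bcl (wt s)"
 and w_iota: "f \<in> Cc ==> wt s (\<iota> f) = \<iota> (\<lambda>t. cis (- (s * t)) *\<^sub>C f t)"
proof -
 have c: "continuous_on UNIV (\<lambda>t. cis (- (s * t)) *\<^sub>C xi)" for xi :: 'h
  by (intro continuous_on_scaleC continuous_intros)
 have b: "bcl (\<lambda>xi::'h. cis (- (s * t)) *\<^sub>C xi)" for t by (intro bcl_cmult bcl_id)
 have n: "norm (cis (- (s * t)) *\<^sub>C xi) <= 1 * norm xi" for t and xi :: 'h by (simp add: norm_scaleC)
 show "bcl (wt s)" unfolding cp_w_def by (rule L2_op_mult_bcl[OF c b _ n]) simp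
 show "f \<in> Cc ==> wt s (\<iota> f) = \<iota> (\<lambda>t. cis (- (s * t)) *\<^sub>C f t)"
  unfolding cp_w_def by (rule L2_op_mult_iota[OF c b _ n]) simp_all
qed

lemma Cc_w: "f \<in> Cc ==> (\<lambda>t. cis (- (s * t)) *\<^sub>C f t) \<in> Cc"
 by (rule Cc_scaleC_fun) (auto intro!: continuous_intros)

lemma lam_lam: "lm s (lm t x) = lm (s + t) x"
proof -
 have "lm s o lm t = lm (s + t)"
  by (rule iota_eq[OF bcl_comp[OF lam_bcl lam_bcl] lam_bcl])
   (simp add: lam_iota Cc_shift algebra_simps)
 thus ?thesis by (metis comp_apply)
qed

lemma lam_0: "lm 0 x = x"
proof -
 have "lm 0 = id" by (rule iota_eq[OF lam_bcl bcl_id(1)]) (simp add: lam_iota)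
 thus ?thesis by simp
qed

lemma w_w: "wt s (wt t x) = wt (s + t) x"
proof -
 have "wt s o wt t = wt (s + t)"
 proof (rule iota_eq[OF bcl_comp[OF w_bcl w_bcl] w_bcl])
  fix f :: "real => 'h" assume f: "f \<in> Cc"
  have "(\<lambda>r. cis (- (s * r)) *\<^sub>C cis (- (t * r)) *\<^sub>C f r) = (\<lambda>r. cis (- ((s + t) * r)) *\<^sub>C f r)"
   by (simp add: scaleC_scaleC cis_mult algebra_simps)
  thus "(wt s o wt t) (\<iota> f) = wt (s + t) (\<iota> f)"
   by (simp only: comp_apply w_iota[OF f] w_iota[OF Cc_w[OF f]])
 qed
 thus ?thesis by (metis comp_apply)
qed

lemma w_0: "wt 0 x = x"
proof -
 have "wt 0 = id" by (rule iota_eq[OF w_bcl bcl_id(1)]) (simp add: w_iota)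
 thus ?thesis by simp
qed

lemma w_inverse [simp]: "wt s (wt (- s) x) = x" "wt (- s) (wt s x) = x"
 by (simp_all add: w_w w_0)

lemma lam_inverse [simp]: "lm s (lm (- s) x) = x" "lm (- s) (lm s x) = x"
 by (simp_all add: lam_lam lam_0)

lemma w_norm: "norm (wt s x) = norm x"
proof -
 have le: "norm (wt s x) <= norm x" for s x
 proof -
  have "closure (\<iota> ` Cc) \<subseteq> {x. norm (wt s x) <= norm x}"
  proof (rule closure_minimal)
   show "closed {x. norm (wt s x) <= norm x}"
    by (intro closed_Collect_le[OF continuous_on_norm[OF bcl_continuous_on[OF w_bcl]] continuous_on_norm[OF continuous_on_id]])
   show "\<iota> ` Cc \<subseteq> {x. norm (wt s x) <= norm x}"
    using iota_norm_le[OF _ Cc_w, where K = 1] by (auto simp: w_iota norm_scaleC)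
  qed
  thus ?thesis using iota_dense by auto
 qed
 show ?thesis using le[of s x] le[of "- s" "wt s x"] by simp
qed

lemma lam_norm: "norm (lm s x) = norm x"
proof -
 have "closure (\<iota> ` Cc) \<subseteq> {x. norm (lm s x) = norm x}"
 proof (rule closure_minimal)
  show "closed {x. norm (lm s x) = norm x}"
   by (intro closed_Collect_eq[OF continuous_on_norm[OF bcl_continuous_on[OF lam_bcl]] continuous_on_norm[OF continuous_on_id]])
  show "\<iota> ` Cc \<subseteq> {x. norm (lm s x) = norm x}"
   by (auto simp: lam_iota iota_shift_norm)
 qed
 thus ?thesis using iota_dense by auto
qed

end

lemma isometry_adj:
 assumes u: "bcl u" "!!x. norm (u x) = norm x" and v: "bcl v" "!!x. u (v x) = x" "!!x. v (u x) = x"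
 shows "cadj u = v"
proof (rule cadj_eqI[OF v(1)])
 have "cadj u o u = id"
 proof (rule quadratic_form_eq[OF bcl_comp[OF bcl_cadj[OF u(1)] u(1)] bcl_id(1)])
  show "cinner ((cadj u o u) x) x = cinner (id x) x" for x
   using cadj_left[OF u(1), of "u x" x] by (simp add: cinner_self u(2))
 qed
 hence c: "cadj u (u x) = x" for x by (metis comp_apply id_apply)
 show "cinner (u x) y = cinner x (v y)" for x y
  using cadj_left[OF u(1), of y x] cadj_right[OF u(1), of x y] c[of "v y"] by (simp add: v(2))
qed

context L2
begin

lemma cadj_w: "cadj (wt s) = wt (- s)"
 by (rule isometry_adj[OF w_bcl w_norm w_bcl]) simp_all

lemma cadj_lam: "cadj (lm s) = lm (- s)"
 by (rule isometry_adj[OF lam_bcl lam_norm lam_bcl]) simp_all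

text \<open>The Weyl relation between modulation and translation: shifting the argument by
  \<open>t\<close> changes the modulating character by a constant phase.\<close>

lemma w_lam: "wt s (lm t x) = cis (- (s * t)) *\<^sub>C lm t (wt s x)"
proof -
 have "wt s o lm t = (\<lambda>x. cis (- (s * t)) *\<^sub>C (lm t o wt s) x)"
 proof (rule iota_eq[OF bcl_comp[OF w_bcl lam_bcl] bcl_cmult[OF bcl_comp[OF lam_bcl w_bcl]]])
  fix f :: "real => 'h" assume f: "f \<in> Cc"
  have e: "cis (- (s * r)) = cis (- (s * t)) * cis (- (s * (r - t)))" for r by (simp add: cis_mult algebra_simps)
  have "(wt s o lm t) (\<iota> f) = \<iota> (\<lambda>r. cis (- (s * r)) *\<^sub>C f (r - t))"
   by (simp add: f lam_iota w_iota Cc_shift)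
  also have "... = \<iota> (\<lambda>r. cis (- (s * t)) *\<^sub>C cis (- (s * (r - t))) *\<^sub>C f (r - t))"
   by (subst e) (simp add: scaleC_scaleC)
  also have "... = cis (- (s * t)) *\<^sub>C \<iota> (\<lambda>r. cis (- (s * (r - t))) *\<^sub>C f (r - t))"
   by (rule iota_scaleC[OF Cc_shift[OF Cc_w[OF f]]])
  also have "... = cis (- (s * t)) *\<^sub>C (lm t o wt s) (\<iota> f)"
   by (simp only: comp_apply w_iota[OF f] lam_iota[OF Cc_w[OF f]])
  finally show "(wt s o lm t) (\<iota> f) = cis (- (s * t)) *\<^sub>C (lm t o wt s) (\<iota> f)" .
 qed
 thus ?thesis by (metis comp_apply)
qed

end

section \<open>The representation of the algebra and its covariance\<close>

locale crossed = M: vn_alg M + L2 \<iota>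
 for M :: "('h::chilbert_space => 'h) set" and \<iota> :: "(real => 'h) => 'k::chilbert_space" +
 fixes \<sigma> :: "real => ('h => 'h) => 'h => 'h"
 assumes aut: "automorphism_group M \<sigma>"
begin

abbreviation "\<pi> \<equiv> cp_pi \<iota> \<sigma>"

lemma sig_M: "x \<in> M ==> \<sigma> t x \<in> M"
 and sig_plus: "x \<in> M ==> y \<in> M ==> \<sigma> t (\<lambda>xi. x xi + y xi) = (\<lambda>xi. \<sigma> t x xi + \<sigma> t y xi)"
 and sig_comp: "x \<in> M ==> y \<in> M ==> \<sigma> t (x o y) = \<sigma> t x o \<sigma> t y"
 and sig_cadj: "x \<in> M ==> \<sigma> t (cadj x) = cadj (\<sigma> t x)"
 and sig_cmult: "x \<in> M ==> \<sigma> t (\<lambda>xi. c *\<^sub>C x xi) = (\<lambda>xi. c *\<^sub>C \<sigma> t x xi)"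
 and sig_0: "x \<in> M ==> \<sigma> 0 x = x"
 and sig_sig: "x \<in> M ==> \<sigma> s (\<sigma> t x) = \<sigma> (s + t) x"
 and sig_cont: "x \<in> M ==> continuous_on UNIV (\<lambda>t. \<sigma> t x xi)"
proof -
 note b = aut[unfolded automorphism_group_def]
 note b2 = b[THEN conjunct2] note b3 = b2[THEN conjunct2] note b4 = b3[THEN conjunct2] note b5 = b4[THEN conjunct2]
 note a = b[THEN conjunct1] b2[THEN conjunct1] b3[THEN conjunct1] b4[THEN conjunct1] b5[THEN conjunct1] b5[THEN conjunct2]
 show "x \<in> M ==> \<sigma> t x \<in> M" using a(1) bij_betwE by blast
 show "x \<in> M ==> y \<in> M ==> \<sigma> t (\<lambda>xi. x xi + y xi) = (\<lambda>xi. \<sigma> t x xi + \<sigma> t y xi)"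
  "x \<in> M ==> y \<in> M ==> \<sigma> t (x o y) = \<sigma> t x o \<sigma> t y" using a(2) by simp_all
 show "x \<in> M ==> \<sigma> t (cadj x) = cadj (\<sigma> t x)" "x \<in> M ==> \<sigma> t (\<lambda>xi. c *\<^sub>C x xi) = (\<lambda>xi. c *\<^sub>C \<sigma> t x xi)"
  using a(3) by simp_all
 show "x \<in> M ==> \<sigma> 0 x = x" "x \<in> M ==> \<sigma> s (\<sigma> t x) = \<sigma> (s + t) x" using a(4,5) by simp_all
 show "x \<in> M ==> continuous_on UNIV (\<lambda>t. \<sigma> t x xi)" using a(6) by simp
qed

lemma sig_bcl: "x \<in> M ==> bcl (\<sigma> t x)"
 by (intro M.A_bcl sig_M)

text \<open>Preservation of the unit comes from surjectivity: a preimage of the identity, multiplied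
  by the identity, leaves the image of the identity on the other side.\<close>

lemma sig_id: "\<sigma> t (\<lambda>xi. xi) = (\<lambda>xi. xi)"
proof -
 obtain x where x: "x \<in> M" "\<sigma> t x = (\<lambda>xi. xi)"
  using aut M.A_id unfolding automorphism_group_def bij_betw_def by (metis (no_types, lifting) imageE)
 have "\<sigma> t (x o (\<lambda>xi. xi)) = \<sigma> t x o \<sigma> t (\<lambda>xi. xi)" by (rule sig_comp[OF x(1) M.A_id])
 thus ?thesis using x(2) by (simp add: o_def)
qed

lemma sig_rmult: "x \<in> M ==> \<sigma> t (\<lambda>xi. r *\<^sub>R x xi) = (\<lambda>xi. r *\<^sub>R \<sigma> t x xi)"
 using sig_cmult[of x t "cor r"] by (simp add: scaleC_of_real)

lemma sig_minus: assumes x: "x \<in> M" and y: "y \<in> M" shows "\<sigma> t (\<lambda>xi. x xi - y xi) = (\<lambda>xi. \<sigma> t x xi - \<sigma> t y xi)"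
 using sig_plus[OF x M.A_cmult[OF y, of "-1"], of t] sig_cmult[OF y, of t "-1"] by (simp add: scaleC_minus_one)

text \<open>A positive square root of \<open>x\<close> inside \<open>M\<close> is carried to a
  self-adjoint operator whose square is the image of \<open>x\<close>.\<close>

lemma sig_pos: assumes "x \<in> pos_part M" shows "\<sigma> t x \<in> pos_part M"
proof -
 obtain y where y: "y \<in> pos_part M" "y o y = x" using M.positive_sqrt[OF assms] by blast
 have yM: "y \<in> M" and "self_adj y" using y(1) by (auto simp: M.pos_part_iff pos_iff)
 hence "cadj (\<sigma> t y) = \<sigma> t y" using sig_cadj[OF yM, of t] by (simp add: self_adj_iff)
 moreover have "\<sigma> t x = \<sigma> t y o \<sigma> t y" using sig_comp[OF yM yM] y(2) by simp
 ultimately have "pos (\<sigma> t x)" using positive_cadj_comp[OF sig_bcl[OF yM, of t]] by simp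
 moreover have "x \<in> M" using assms by (simp add: M.pos_part_iff)
 ultimately show ?thesis by (simp add: M.pos_part_iff sig_M)
qed

text \<open>A norm bound is the positivity of \<open>K\<^sup>2\<close> minus
  \<open>cadj x o x\<close> in \<open>M\<close>, and automorphisms preserve positivity, adjoints and
  the identity.\<close>

lemma sig_norm:
 assumes x: "x \<in> M" and K: "0 <= K" "!!xi. norm (x xi) <= K * norm xi" shows "norm (\<sigma> t x xi) <= K * norm xi"
proof -
 note xb = M.A_bcl[OF x] and sb = sig_bcl[OF x, of t]
 have xx: "cadj x o x \<in> M" by (intro M.A_comp M.A_cadj x)
 define y where "y = (\<lambda>xi. K\<^sup>2 *\<^sub>R xi - (cadj x o x) xi)"
 have f: "inner (cadj z (z xi)) xi = (norm (z xi))^2" if "bcl z" for z :: "'h => 'h" and xi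
  using cadj_left[OF that, of "z xi" xi, symmetric] by (simp add: inner_eq_Re_cinner cinner_self del: of_real_power)
 have "self_adj y"
  unfolding y_def using positive_cadj_comp[OF xb]
  by (intro self_adj_minus self_adj_rmult self_adj_id) (simp add: pos_iff o_def)
 moreover have "0 <= inner (y xi) xi" for xi
  using power_mono[OF K(2), of xi 2] by (simp add: y_def inner_diff_left f[OF xb] power_mult_distrib power2_norm_eq_inner)
 moreover have yM: "y \<in> M" unfolding y_def by (intro M.A_minus M.A_rmult M.A_id xx)
 ultimately have "y \<in> pos_part M" by (simp add: M.pos_part_iff pos_iff)
 hence "pos (\<sigma> t y)" using sig_pos[of y t] by (simp add: M.pos_part_iff)
 moreover have "\<sigma> t y = (\<lambda>xi. K\<^sup>2 *\<^sub>R xi - cadj (\<sigma> t x) (\<sigma> t x xi))"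
  unfolding y_def
  by (subst sig_minus[OF M.A_rmult[OF M.A_id] xx])
   (simp add: sig_rmult[OF M.A_id] sig_id sig_comp[OF M.A_cadj[OF x] x] sig_cadj[OF x])
 ultimately have "0 <= inner (K\<^sup>2 *\<^sub>R xi - cadj (\<sigma> t x) (\<sigma> t x xi)) xi" by (simp add: pos_iff)
 hence "(norm (\<sigma> t x xi))^2 <= (K * norm xi)^2"
  by (simp add: inner_diff_left f[OF sb] power_mult_distrib power2_norm_eq_inner)
 thus ?thesis by (rule power2_le_imp_le) (use K(1) in simp)
qed

lemma sig_uminus_cont: "x \<in> M ==> continuous_on UNIV (\<lambda>t. \<sigma> (- t) x xi)"
 by (rule continuous_on_compose2[OF sig_cont[of x xi] continuous_on_minus[OF continuous_on_id]]) auto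

lemma
 assumes x: "x \<in> M"
 shows pi_bcl: "bcl (\<pi> x)"
  and pi_iota: "f \<in> Cc ==> \<pi> x (\<iota> f) = \<iota> (\<lambda>t. \<sigma> (- t) x (f t))"
  and Cc_sig: "f \<in> Cc ==> (\<lambda>t. \<sigma> (- t) x (f t)) \<in> Cc"
proof -
 obtain K where K: "K > 0" "!!xi. norm (x xi) <= K * norm xi" using bcl_bound[OF M.A_bcl[OF x]] by blast
 have n: "norm (\<sigma> t x xi) <= K * norm xi" for t xi using K by (intro sig_norm[OF x]) auto
 note a = sig_uminus_cont[OF x] sig_bcl[OF x]
 show "bcl (\<pi> x)" unfolding cp_pi_def by (rule L2_op_mult_bcl[OF a _ n]) (use K in simp)
 show "f \<in> Cc ==> \<pi> x (\<iota> f) = \<iota> (\<lambda>t. \<sigma> (- t) x (f t))"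
  unfolding cp_pi_def by (rule L2_op_mult_iota[OF a _ n]) (use K in simp_all)
 show "f \<in> Cc ==> (\<lambda>t. \<sigma> (- t) x (f t)) \<in> Cc" by (rule Cc_op[OF _ a n])
qed

lemma pi_plus: assumes x: "x \<in> M" and y: "y \<in> M"
 shows "\<pi> (\<lambda>xi. x xi + y xi) = (\<lambda>xi. \<pi> x xi + \<pi> y xi)"
 by (rule iota_eq[OF pi_bcl[OF M.A_plus[OF x y]] bcl_plus[OF pi_bcl[OF x] pi_bcl[OF y]]])
  (simp add: pi_iota[OF M.A_plus[OF x y]] pi_iota[OF x] pi_iota[OF y] sig_plus[OF x y] iota_add Cc_sig[OF x] Cc_sig[OF y])

lemma pi_cmult: assumes x: "x \<in> M"
 shows "\<pi> (\<lambda>xi. c *\<^sub>C x xi) = (\<lambda>xi. c *\<^sub>C \<pi> x xi)"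
 by (rule iota_eq[OF pi_bcl[OF M.A_cmult[OF x]] bcl_cmult[OF pi_bcl[OF x]]])
  (simp add: pi_iota[OF M.A_cmult[OF x]] pi_iota[OF x] sig_cmult[OF x] iota_scaleC Cc_sig[OF x])

lemma pi_rmult: "x \<in> M ==> \<pi> (\<lambda>xi. r *\<^sub>R x xi) = (\<lambda>xi. r *\<^sub>R \<pi> x xi)"
 using pi_cmult[of x "cor r"] by (simp add: scaleC_of_real)

lemma pi_minus: assumes x: "x \<in> M" and y: "y \<in> M"
 shows "\<pi> (\<lambda>xi. x xi - y xi) = (\<lambda>xi. \<pi> x xi - \<pi> y xi)"
 using pi_plus[OF x M.A_cmult[OF y, of "-1"]] pi_cmult[OF y, of "-1"] by (simp add: scaleC_minus_one)

lemma pi_comp: assumes x: "x \<in> M" and y: "y \<in> M" shows "\<pi> (x o y) = \<pi> x o \<pi> y"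
 by (rule iota_eq[OF pi_bcl[OF M.A_comp[OF x y]] bcl_comp[OF pi_bcl[OF x] pi_bcl[OF y]]])
  (simp add: pi_iota[OF M.A_comp[OF x y]] pi_iota[OF x] pi_iota[OF y] sig_comp[OF x y] Cc_sig[OF y])

lemma pi_cadj: assumes x: "x \<in> M" shows "\<pi> (cadj x) = cadj (\<pi> x)"
proof (rule cadj_eqI[symmetric])
 note x' = M.A_cadj[OF x]
 show b: "bcl (\<pi> (cadj x))" by (rule pi_bcl[OF x'])
 have e: "cinner (\<sigma> t x z) y = cinner z (\<sigma> t (cadj x) y)" for t z y
  by (simp add: sig_cadj[OF x] cadj_right[OF sig_bcl[OF x]])
 have "cadj (\<pi> x) = \<pi> (cadj x)"
 proof (rule iota_eq[OF bcl_cadj[OF pi_bcl[OF x]] b])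
  fix f :: "real => 'h" assume f: "f \<in> Cc"
  have "cinner (\<iota> g) (cadj (\<pi> x) (\<iota> f) - \<pi> (cadj x) (\<iota> f)) = 0" if g: "g \<in> Cc" for g
   using cadj_right[OF pi_bcl[OF x], of "\<iota> g" "\<iota> f"]
   by (simp add: cinner_diff_right pi_iota[OF x g] pi_iota[OF x' f] iota_cinner Cc_sig[OF x] Cc_sig[OF x'] f g e)
  moreover have "closure (\<iota> ` Cc) \<subseteq> {z. cinner z (cadj (\<pi> x) (\<iota> f) - \<pi> (cadj x) (\<iota> f)) = 0}"
   using calculation by (intro closure_minimal closed_Collect_eq continuous_on_cinner continuous_intros) auto
  ultimately have "cinner z (cadj (\<pi> x) (\<iota> f) - \<pi> (cadj x) (\<iota> f)) = cinner z 0" for z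
   using iota_dense by auto
  from cinner_ext_right[OF this] show "cadj (\<pi> x) (\<iota> f) = \<pi> (cadj x) (\<iota> f)" by simp
 qed
 thus "cinner (\<pi> x z) y = cinner z (\<pi> (cadj x) y)" for z y
  using cadj_right[OF pi_bcl[OF x], of z y] by simp
qed

lemma pi_self_adj: "x \<in> M ==> self_adj x ==> self_adj (\<pi> x)"
 using pi_cadj[of x] pi_bcl[of x] by (simp add: self_adj_iff)

lemma pi_proj: assumes e: "e \<in> M" "proj e" shows "proj (\<pi> e)"
 using pi_comp[OF e(1) e(1)] pi_cadj[OF e(1)] pi_bcl[OF e(1)] e(2) by (simp add: is_projection_def)

text \<open>\<open>\<pi> d\<close> acts in the fibre over \<open>t\<close> as
  \<open>\<sigma> (- t) d\<close>, which is \<open>d\<close> itself at \<open>t = 0\<close>. A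
  negative value of the form of \<open>d\<close> persists near zero by continuity, and a tent
  function supported there would make the form of \<open>\<pi> d\<close> negative.\<close>

lemma pi_order_embedding:
 assumes x: "x \<in> M" "self_adj x" and y: "y \<in> M" "self_adj y"
  and le: "!!xi. inner (\<pi> x xi) xi <= inner (\<pi> y xi) xi"
 shows "op_le x y"
proof -
 define d where "d = (\<lambda>xi. y xi - x xi)"
 have dM: "d \<in> M" unfolding d_def by (intro M.A_minus x y)
 have "0 <= inner (d xi) xi" for xi
 proof (rule ccontr)
  assume neg: "\<not> 0 <= inner (d xi) xi"
  define c where "c = - inner (d xi) xi / 2"
  have c: "c > 0" using neg by (simp add: c_def)
  define G where "G t = inner (\<sigma> (- t) d xi) xi" for t
  have G: "continuous_on UNIV G" unfolding G_def by (intro continuous_intros sig_uminus_cont dM)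
  have "(G \<longlongrightarrow> G 0) (at 0)" using G by (simp add: continuous_on_def)
  moreover have "G 0 < - c" using c by (simp add: G_def sig_0[OF dM] c_def)
  ultimately have "eventually (\<lambda>t. G t < - c) (at 0)" by (rule order_tendstoD)
  then obtain r where r: "r > 0" "!!t. t ~= 0 ==> \<bar>t\<bar> < r ==> G t < - c"
   unfolding eventually_at by auto
  have Gr: "G t <= - c" if "\<bar>t\<bar> < r" for t
   using less_imp_le[OF \<open>G 0 < - c\<close>] less_imp_le[OF r(2)[OF _ that]] by (cases "t = 0") simp_all
  define \<phi> where "\<phi> t = max 0 (r - \<bar>t\<bar>)" for t :: real
  define f where "f t = \<phi> t *\<^sub>R xi" for t
  have \<phi>c: "continuous_on UNIV \<phi>" unfolding \<phi>_def by (intro continuous_intros)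
  have f: "f \<in> Cc"
  proof (rule CcI[where C = r])
   show "continuous_on UNIV f" unfolding f_def by (intro continuous_intros \<phi>c)
  qed (auto simp: f_def \<phi>_def max_def split: if_splits)
  have \<phi>0: "f t = 0 ==> (\<phi> t)\<^sup>2 = 0" for t using neg by (auto simp: f_def bcl_0[OF M.A_bcl[OF dM]])
  have i1: "integrable lborel (\<lambda>t. (\<phi> t)^2)" by (rule Cc_integrable[OF f _ \<phi>0]) (intro continuous_intros \<phi>c)
  have i2: "integrable lborel (\<lambda>t. (\<phi> t)^2 * G t)"
   by (rule Cc_integrable[OF f]) (auto intro!: continuous_intros \<phi>c G dest: \<phi>0)
  have "0 <= inner (\<pi> d (\<iota> f)) (\<iota> f)"
   using le[of "\<iota> f"] by (simp add: d_def pi_minus x y inner_diff_left)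
  also have "... = Re (\<integral>t. cinner (\<sigma> (- t) d (f t)) (f t) \<partial>lborel)"
   by (simp add: inner_eq_Re_cinner pi_iota[OF dM f] iota_cinner Cc_sig[OF dM] f)
  also have "... = (\<integral>t. Re (cinner (\<sigma> (- t) d (f t)) (f t)) \<partial>lborel)"
  proof (rule integral_Re[symmetric], rule Cc_integrable[OF f])
   show "continuous_on UNIV (\<lambda>t. cinner (\<sigma> (- t) d (f t)) (f t))"
    by (intro continuous_on_cinner CcD Cc_sig dM f)
  qed simp
  also have "... = (\<integral>t. (\<phi> t)^2 * G t \<partial>lborel)"
   by (simp add: f_def bcl_scaleR[OF sig_bcl[OF dM]] G_def power2_eq_square mult.assoc flip: inner_eq_Re_cinner)
  also have "... <= (\<integral>t. (\<phi> t)^2 * (- c) \<partial>lborel)"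
  proof (rule integral_mono[OF i2])
   show "integrable lborel (\<lambda>t. (\<phi> t)^2 * - c)" by (intro integrable_mult_left i1)
   show "(\<phi> t)^2 * G t <= (\<phi> t)^2 * - c" for t
   proof (cases "\<bar>t\<bar> < r")
    case True show ?thesis by (rule mult_left_mono[OF Gr[OF True]]) simp
   qed (simp add: \<phi>_def)
  qed
  finally have "c * (\<integral>t. (\<phi> t)^2 \<partial>lborel) <= 0" by (simp add: mult.commute)
  hence "(\<integral>t. (\<phi> t)^2 \<partial>lborel) <= 0" using c by (simp add: mult_le_0_iff)
  moreover have "(\<integral>t. (r / 2)^2 * indicator {- r / 2..r / 2} t \<partial>lborel) <= (\<integral>t. (\<phi> t)^2 \<partial>lborel)"
  proof (rule integral_mono[OF _ i1])
   show "integrable lborel (\<lambda>t. (r / 2)^2 * indicator {- r / 2..r / 2} t :: real)"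
    by (intro integrable_mult_right integrable_real_indicator) (use r(1) in auto)
   show "(r / 2)^2 * indicator {- r / 2..r / 2} t <= (\<phi> t)^2" for t
    using r(1) by (auto simp: indicator_def \<phi>_def intro!: power_mono)
  qed
  moreover have "(\<integral>t. (r / 2)^2 * indicator {- r / 2..r / 2} t \<partial>lborel) = (r / 2)^2 * r" using r(1) by simp
  moreover have "(r / 2)^2 * r > 0" using r(1) by simp
  ultimately show False by linarith
 qed
 thus ?thesis using x y by (simp add: op_le_iff d_def inner_diff_left)
qed

lemma lam_pi: assumes x: "x \<in> M"
 shows "lm t (\<pi> x xi) = \<pi> (\<sigma> t x) (lm t xi)"
proof -
 have "lm t o \<pi> x = \<pi> (\<sigma> t x) o lm t"
  by (rule iota_eq[OF bcl_comp[OF lam_bcl pi_bcl[OF x]] bcl_comp[OF pi_bcl[OF sig_M[OF x]] lam_bcl]])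
   (simp add: pi_iota[OF x] pi_iota[OF sig_M[OF x]] lam_iota Cc_shift Cc_sig[OF x] sig_sig[OF x])
 thus ?thesis by (metis comp_apply)
qed

lemma w_pi: assumes x: "x \<in> M"
 shows "wt s (\<pi> x xi) = \<pi> x (wt s xi)"
proof -
 have "wt s o \<pi> x = \<pi> x o wt s"
  by (rule iota_eq[OF bcl_comp[OF w_bcl pi_bcl[OF x]] bcl_comp[OF pi_bcl[OF x] w_bcl]])
   (simp add: pi_iota[OF x] w_iota Cc_w Cc_sig[OF x] bcl_scaleC[OF sig_bcl[OF x]])
 thus ?thesis by (metis comp_apply)
qed

subsection \<open>The algebra\<close>

abbreviation "CP \<equiv> crossed_product M \<sigma> \<iota>"

lemma gen_bcl: "x \<in> \<pi> ` M \<union> range lm ==> bcl x"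
 using pi_bcl lam_bcl by auto

lemma gen_cadj: "x \<in> \<pi> ` M \<union> range lm ==> cadj x \<in> \<pi> ` M \<union> range lm"
 using pi_cadj[symmetric] M.A_cadj cadj_lam by auto

lemma CP_vna: "von_neumann_algebra CP"
 unfolding crossed_product_def by (rule double_commutant_vna[OF gen_bcl gen_cadj])

lemma gen_CP: "x \<in> \<pi> ` M \<union> range lm ==> x \<in> CP"
 using gen_bcl[of x] by (auto simp: crossed_product_def commutant_def[of "commutant _"]) (auto simp: commutant_def)

lemma pi_CP: "x \<in> M ==> \<pi> x \<in> CP" and lam_CP: "lm t \<in> CP"
 by (auto intro: gen_CP)

lemma w_gen_comm:
 assumes u: "u \<in> commutant (\<pi> ` M \<union> range lm)"
 shows "wt s o u o wt (- s) \<in> commutant (\<pi> ` M \<union> range lm)"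
proof -
 have ub: "bcl u" using u by (simp add: commutant_def)
 have up: "u (\<pi> x xi) = \<pi> x (u xi)" if "x \<in> M" for x xi
  using u that by (auto simp: commutant_def fun_eq_iff)
 have ul: "u (lm t xi) = lm t (u xi)" for t xi
  using u by (auto simp: commutant_def fun_eq_iff)
 have "wt s (u (wt (- s) (\<pi> x xi))) = \<pi> x (wt s (u (wt (- s) xi)))" if "x \<in> M" for x xi
  by (simp only: w_pi[OF that] up[OF that])
 moreover have "wt s (u (wt (- s) (lm t xi))) = lm t (wt s (u (wt (- s) xi)))" for t xi
  by (simp add: w_lam ul bcl_scaleC[OF ub] bcl_scaleC[OF w_bcl] scaleC_scaleC cis_mult)
 ultimately show ?thesis
  using bcl_comp[OF bcl_comp[OF w_bcl ub] w_bcl] by (auto simp: commutant_def fun_eq_iff)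
qed

lemma dual_action_CP:
 assumes x: "x \<in> CP" shows "\<theta> s x \<in> CP"
proof -
 let ?S = "\<pi> ` M \<union> range lm"
 have xb: "bcl x" using x by (simp add: crossed_product_def commutant_def[of "commutant _"])
 have "wt s (x (wt (- s) (u xi))) = u (wt s (x (wt (- s) xi)))" if u: "u \<in> commutant ?S" for u xi
 proof -
  let ?v = "wt (- s) o u o wt (- (- s))"
  have "x o ?v = ?v o x" using x w_gen_comm[OF u, of "- s"] by (auto simp: crossed_product_def commutant_def[of "commutant _"])
  hence e: "x (?v z) = ?v (x z)" for z by (metis comp_apply)
  have "wt s (x (wt (- s) (u xi))) = wt s (x (?v (wt (- s) xi)))" by simp
  also have "... = u (wt s (x (wt (- s) xi)))" unfolding e by simp
  finally show ?thesis .
 qed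
 thus ?thesis using bcl_comp[OF bcl_comp[OF w_bcl xb] w_bcl]
  by (auto simp: crossed_product_def commutant_def[of "commutant _"] dual_action_def fun_eq_iff)
qed

lemma dual_action_commutant:
 assumes u: "u \<in> commutant CP" shows "wt s o u o wt (- s) \<in> commutant CP"
proof -
 have ub: "bcl u" using u by (simp add: commutant_def)
 have "wt s (u (wt (- s) (x xi))) = x (wt s (u (wt (- s) xi)))" if x: "x \<in> CP" for x xi
 proof -
  let ?y = "\<theta> (- s) x"
  have "u o ?y = ?y o u" using u dual_action_CP[OF x, of "- s"] by (auto simp: commutant_def)
  hence e: "u (?y z) = ?y (u z)" for z by (metis comp_apply)
  have "wt s (u (wt (- s) (x xi))) = wt s (u (?y (wt (- s) xi)))" by (simp add: dual_action_def)
  also have "... = x (wt s (u (wt (- s) xi)))" unfolding e by (simp add: dual_action_def)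
  finally show ?thesis .
 qed
 thus ?thesis using bcl_comp[OF bcl_comp[OF w_bcl ub] w_bcl] by (auto simp: commutant_def fun_eq_iff)
qed

lemma dual_action_proj:
 assumes p: "proj p" shows "proj (\<theta> s p)"
proof -
 have e: "cadj (wt (- s)) = wt s" by (simp add: cadj_w)
 have "self_adj (\<theta> s p)"
  using positive_sandwich[OF proj_pos[OF p] w_bcl[of "- s"]] by (simp add: dual_action_def e pos_iff o_def)
 thus ?thesis by (simp add: is_projection_iff dual_action_def proj_idem[OF p])
qed

end

section \<open>Operators scaled by the dual action\<close>

context vn_alg
begin

lemma affiliated_comp: "aff A S ==> aff A T ==> aff A (S O T)"
 unfolding affiliated_def by fast

lemma affiliated_si:
 assumes H: "psa H" "aff A H" and f: "f \<in> BM"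
 shows "aff A (sint (resol H) f)"
proof -
 note E = psa_resolution(1)[OF H(1)]
 have "(u x, u y) \<in> sint (resol H) f"
  if u: "u \<in> commutant A" and xy: "(x, y) \<in> sint (resol H) f" for u x y
 proof (rule si_intertwine[where \<phi> = "\<lambda>r. r", OF E E comm_bcl[OF u] _ _ f xy])
  show "u (resol H B x) = resol H ((\<lambda>r. r) -` B) (u x)" if "B \<in> sets borel" for B x
   using comm_eq[OF resolution_A[OF H that] u] by (simp add: vimage_def)
 qed simp
 thus ?thesis by (auto simp: affiliated_def)
qed

end

context L2
begin

lemma cinner_w: "cinner (wt (- s) x) y = cinner x (wt s y)"
 using cadj_right[OF w_bcl, of "- s" x y] by (simp add: cadj_w)

text \<open>Degree of homogeneity under the dual action: conjugation by \<open>wt s\<close>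
  multiplies \<open>T\<close> by \<open>exp (- (a * s))\<close>. Requiring one inclusion is enough
  because \<open>s\<close> may be replaced by its negative.\<close>

definition homog :: "real => 'k uop => bool" where
 "homog a T \<longleftrightarrow> (\<forall>s x y. (x, y) \<in> T --> (wt s x, exp (a * s) *\<^sub>R wt s y) \<in> T)"

lemma homogD: "homog a T ==> (x, y) \<in> T ==> (wt s x, exp (a * s) *\<^sub>R wt s y) \<in> T"
 by (simp add: homog_def)

lemma homog_one:
 assumes "!!s. dual_action_uop \<iota> s T = {(xi, exp (- s) *\<^sub>R \<eta>) |xi \<eta>. (xi, \<eta>) \<in> T}"
 shows "homog 1 T"
 unfolding homog_def
proof (intro allI impI)
 fix s x y assume xy: "(x, y) \<in> T"
 have "(wt s x, wt s y) \<in> dual_action_uop \<iota> s T" using xy by (auto simp: dual_action_uop_def)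
 then obtain z where z: "(wt s x, z) \<in> T" "wt s y = exp (- s) *\<^sub>R z" unfolding assms by auto
 have "exp (1 * s) *\<^sub>R wt s y = z" unfolding z(2) by (simp flip: exp_add)
 thus "(wt s x, exp (1 * s) *\<^sub>R wt s y) \<in> T" using z(1) by simp
qed

lemma homog_comp:
 assumes S: "homog a S" and T: "homog b T" "linear_rel T" shows "homog (a + b) (S O T)"
 unfolding homog_def
proof (intro allI impI, elim relcompE, clarify)
 fix s x y z assume 1: "(x, y) \<in> S" and 2: "(y, z) \<in> T"
 have "(exp (a * s) *\<^sub>R wt s y, exp (a * s) *\<^sub>R exp (b * s) *\<^sub>R wt s z) \<in> T"
  by (rule linear_rel_scaleR[OF T(2) homogD[OF T(1) 2]])
 moreover have "exp (a * s) *\<^sub>R exp (b * s) *\<^sub>R wt s z = exp ((a + b) * s) *\<^sub>R wt s z"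
  by (simp add: distrib_right exp_add)
 ultimately show "(wt s x, exp ((a + b) * s) *\<^sub>R wt s z) \<in> S O T"
  using homogD[OF S 1, of s] by auto
qed

lemma homog_adj:
 assumes T: "homog a T" shows "homog a (graph_adj T)"
 unfolding homog_def
proof (intro allI impI)
 fix s y z assume yz: "(y, z) \<in> graph_adj T"
 show "(wt s y, exp (a * s) *\<^sub>R wt s z) \<in> graph_adj T"
 proof (rule graph_adjI)
  fix u v assume "(u, v) \<in> T"
  from graph_adjD[OF yz homogD[OF T this, of "- s"]]
  have e: "cor (exp (- (a * s))) * cinner v (wt s y) = cinner u (wt s z)"
   by (simp add: cinner_scaleR_left cinner_w)
  have "cinner v (wt s y) = cor (exp (a * s)) * (cor (exp (- (a * s))) * cinner v (wt s y))"
   by (simp add: mult.assoc[symmetric] exp_minus flip: of_real_mult)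
  thus "cinner v (wt s y) = cinner u (exp (a * s) *\<^sub>R wt s z)"
   by (simp only: e cinner_scaleR_right)
 qed
qed

lemma homog_graph: "(!!s x. wt s (X x) = X (wt s x)) ==> homog 0 (graph X)"
 by (auto simp: homog_def)

lemma homog_resolution:
 assumes H: "psa H" "homog 1 H" and B: "B \<in> sets borel"
 shows "wt s (resol H B x) = resol H ((\<lambda>r. r / exp s) -` B) (wt s x)"
proof -
 note E = psa_resolution[OF H(1)]
 have "(wt s x, exp s *\<^sub>R wt s y) \<in> H" if "(x, y) \<in> H" for x y using homogD[OF H(2) that, of s] by simp
 moreover have "(cadj (wt s) x, (1 / exp s) *\<^sub>R cadj (wt s) y) \<in> H" if "(x, y) \<in> H" for x y
  using homogD[OF H(2) that, of "- s"] by (simp add: cadj_w exp_minus inverse_eq_divide)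
 ultimately show ?thesis
  using spectral_measure_equivariant[OF E(1) E(1) w_bcl, of "exp s" s B x] E(2,3) B by simp
qed

lemma homog_sib:
 assumes H: "psa H" "homog 1 H" and f: "bdd_borel f"
 shows "wt s (sib (resol H) f x) =
  sib (resol H) (\<lambda>r. f (r / exp s)) (wt s x)"
proof -
 note E = psa_resolution(1)[OF H(1)]
 show ?thesis
 proof (rule sib_intertwine[OF E E w_bcl _ _ f])
  show "wt s (resol H B x) = resol H ((\<lambda>r. r / exp s) -` B) (wt s x)"
   if "B \<in> sets borel" for B x by (rule homog_resolution[OF H that])
 qed measurable
qed

lemma homog_si:
 assumes H: "psa H" "homog 1 H" and f: "f \<in> BM"
  and xy: "(x, y) \<in> sint (resol H) f"
 shows "(wt s x, wt s y) \<in> sint (resol H) (\<lambda>r. f (r / exp s))"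
proof -
 note E = psa_resolution(1)[OF H(1)]
 show ?thesis
 proof (rule si_intertwine[OF E E w_bcl _ _ f xy])
  show "wt s (resol H B x) = resol H ((\<lambda>r. r / exp s) -` B) (wt s x)"
   if "B \<in> sets borel" for B x by (rule homog_resolution[OF H that])
 qed measurable
qed

lemma homog_sqrt:
 assumes H: "psa H" "homog 1 H"
 shows "homog (1 / 2) (sint (resol H) (\<lambda>r. cor (sqrt r)))"
 unfolding homog_def
proof (intro allI impI)
 let ?E = "resol H"
 note E = psa_resolution(1)[OF H(1)]
 have sm: "(\<lambda>r. cor (sqrt r)) \<in> BM" by measurable
 fix s x y assume xy: "(x, y) \<in> sint ?E (\<lambda>r. cor (sqrt r))"
 have "(wt s x, sib ?E (\<lambda>r. cor (exp (s / 2))) (wt s y)) \<in>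
  sint ?E (\<lambda>r. cor (exp (s / 2)) * cor (sqrt (r / exp s)))"
  by (rule si_left[OF E _ bdd_borel_const homog_si[OF H sm xy]]) measurable
 moreover have "cor (exp (s / 2)) * cor (sqrt (r / exp s)) = cor (sqrt r)" for r
 proof -
  have "sqrt (exp s) = exp (s / 2)" by (rule real_sqrt_unique) (simp_all add: power2_eq_square flip: exp_add)
  hence "exp (s / 2) * sqrt (r / exp s) = sqrt r" by (simp add: real_sqrt_divide)
  thus ?thesis by (simp only: of_real_mult[symmetric])
 qed
 ultimately show "(wt s x, exp (1 / 2 * s) *\<^sub>R wt s y) \<in> sint ?E (\<lambda>r. cor (sqrt r))"
  by (simp add: sib_const[OF E] scaleC_of_real)
qed

text \<open>Besides having total dilation integral 1 on the positive half-line, this function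
  satisfies \<open>r * tailinv r = indicator {1..} r\<close>. The second property later produces a
  spectral projection as a limit of elements of controlled trace.\<close>

definition tailinv :: "real => real" where "tailinv r = indicator {1..} r / r"

lemma tailinv_meas [measurable]: "tailinv \<in> BM"
 unfolding tailinv_def by measurable

lemma tailinv_bounds: "0 <= tailinv r" "tailinv r <= 1"
 by (auto simp: tailinv_def indicator_def divide_le_eq_1)

lemma tailinv_bdd: "bdd_borel (\<lambda>r. cor (tailinv r))"
 by (rule bdd_borel_of_real[where K = 1]) (use tailinv_bounds in auto)

text \<open>The substitution \<open>s = ln r - u\<close> turns the integrand into
  \<open>exp (- u)\<close> on the half-line \<open>u >= 0\<close>.\<close>

lemma tailinv_integral: "(\<integral>\<^sup>+s. ennreal (tailinv (r / exp s)) \<partial>lborel) = indicator {0<..} r"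
proof (cases "r > 0")
 case True
 define L where "L = ln r"
 have r: "r = exp L" using True by (simp add: L_def)
 have "tailinv (r / exp (L + (- 1) * u)) = u ^ 0 * exp (- u) * indicator {0..} u" for u
  by (simp add: tailinv_def indicator_def r exp_minus field_simps flip: exp_diff)
 hence "(\<integral>\<^sup>+s. ennreal (tailinv (r / exp s)) \<partial>lborel) = (\<integral>\<^sup>+u. ennreal (u ^ 0 * exp (- u) * indicator {0..} u) \<partial>lborel)"
  by (subst nn_integral_real_affine[where c = "-1" and t = L]) (simp_all only: ennreal_1, simp_all)
 also have "... = (\<integral>\<^sup>+u. ennreal (u ^ 0 * exp (- u)) * indicator {0..} u \<partial>lborel)"
  by (intro nn_integral_cong) (auto simp: indicator_def)
 also have "... = 1" using nn_intergal_power_times_exp_Ici[of 0] by simp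
 finally show ?thesis using True by simp
next
 case False
 hence "\<not> 1 <= r / exp s" for s by (smt (verit) divide_nonpos_pos exp_gt_zero)
 hence "tailinv (r / exp s) = 0" for s by (simp add: tailinv_def)
 thus ?thesis using False by simp
qed

text \<open>The operator-valued weight \<open>T x = \<integral> \<theta>\<^sub>s(x) ds\<close> sends \<open>g(H)\<close>, for \<open>g(r) = 1/r\<close> on \<open>[1, \<infinity>)\<close>, to the
 support projection of \<open>H\<close>, because \<open>\<integral> g(e\<^sup>-\<^sup>s r) ds = 1\<close> for \<open>r > 0\<close>.\<close>

lemma dual_average:
 assumes H: "psa H" "homog 1 H"
  and X: "bcl X" "!!s x. wt s (X x) = X (wt s x)"
 shows "(\<integral>\<^sup>+s. ennreal (Re (cinner (\<theta> s
   (cadj X o sib (resol H) (\<lambda>r. cor (tailinv r)) o X) xi) xi)) \<partial>lborel)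
  = ennreal ((norm (resol H {0<..} (X xi)))^2)"
proof -
 let ?E = "resol H"
 let ?g = "\<lambda>r. cor (tailinv r)"
 note E = psa_resolution(1)[OF H(1)]
 define \<eta> where "\<eta> = X xi"
 define \<mu> where "\<mu> = scm ?E \<eta>"
 have \<mu>_sets [measurable_cong]: "sets \<mu> = sets borel" by (simp add: \<mu>_def scalar_measure_sets[OF E])
 interpret finite_measure \<mu> unfolding \<mu>_def by (rule finite_scalar[OF E])
 interpret P: pair_sigma_finite \<mu> lborel ..
 have "ennreal (Re (cinner (\<theta> s (cadj X o sib ?E ?g o X) xi) xi)) =
  (\<integral>\<^sup>+r. ennreal (tailinv (r / exp s)) \<partial>\<mu>)" for s
 proof -
  have g': "bdd_borel (\<lambda>r. cor (tailinv (r / exp s)))"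
   by (rule bdd_borel_of_real[where K = 1]) (use tailinv_bounds in auto)
  have "cinner (\<theta> s (cadj X o sib ?E ?g o X) xi) xi =
   cinner (wt s (cadj X (sib ?E ?g (wt (- s) \<eta>)))) xi"
   by (simp add: dual_action_def X(2) \<eta>_def)
  also have "... = cinner (sib ?E ?g (wt (- s) \<eta>)) (wt (- s) \<eta>)"
   using cadj_right[OF w_bcl[of s], of "cadj X (sib ?E ?g (wt (- s) \<eta>))" xi]
    cadj_left[OF X(1), of "sib ?E ?g (wt (- s) \<eta>)" "wt (- s) xi"]
   by (simp add: cadj_w X(2) \<eta>_def)
  also have "... = cinner (wt s (sib ?E ?g (wt (- s) \<eta>))) \<eta>"
   using cadj_right[OF w_bcl[of s], of "sib ?E ?g (wt (- s) \<eta>)" \<eta>] by (simp add: cadj_w)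
  also have "... = cinner (sib ?E (\<lambda>r. cor (tailinv (r / exp s))) \<eta>) \<eta>"
   by (simp add: homog_sib[OF H tailinv_bdd])
  also have "... = (\<integral>r. cor (tailinv (r / exp s)) \<partial>\<mu>)"
   unfolding \<mu>_def by (rule sib_form[OF E g'])
  finally have "Re (cinner (\<theta> s (cadj X o sib ?E ?g o X) xi) xi) = (\<integral>r. tailinv (r / exp s) \<partial>\<mu>)"
   by (simp only: integral_complex_of_real Re_complex_of_real)
  moreover have "ennreal (\<integral>r. tailinv (r / exp s) \<partial>\<mu>) = (\<integral>\<^sup>+r. ennreal (tailinv (r / exp s)) \<partial>\<mu>)"
  proof (rule nn_integral_eq_integral[symmetric])
   show "integrable \<mu> (\<lambda>r. tailinv (r / exp s))"
    unfolding \<mu>_def by (rule integrable_scalar[OF E, where K = 1]) (use tailinv_bounds in auto)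
  qed (simp add: tailinv_bounds)
  ultimately show ?thesis by simp
 qed
 hence "(\<integral>\<^sup>+s. ennreal (Re (cinner (\<theta> s (cadj X o sib ?E ?g o X) xi) xi)) \<partial>lborel)
  = (\<integral>\<^sup>+s. (\<integral>\<^sup>+r. ennreal (tailinv (r / exp s)) \<partial>\<mu>) \<partial>lborel)" by simp
 also have "... = (\<integral>\<^sup>+r. (\<integral>\<^sup>+s. ennreal (tailinv (r / exp s)) \<partial>lborel) \<partial>\<mu>)"
  by (rule P.Fubini') measurable
 also have "... = (\<integral>\<^sup>+r. indicator {0<..} r \<partial>\<mu>)" by (simp only: tailinv_integral)
 also have "... = ennreal ((norm (?E {0<..} \<eta>))^2)" by (simp add: \<mu>_def emeasure_scalar[OF E] scalar_measure_sets[OF E])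
 finally show ?thesis by (simp only: \<eta>_def)
qed

end

section \<open>The density of the dual weight\<close>

text \<open>Expressions such as \<open>sqrt (s / (1 + \<epsilon> * s))\<close> behave well for
  \<open>s >= 0\<close> only. This allows replacing them by functions cut off at zero, which are
  bounded everywhere.\<close>

lemma sib_cong_nonneg:
 assumes E: "spm E" and neg: "!!x. E {..<0} x = 0" and eq: "!!r. 0 <= r ==> f r = g r"
  and f: "f \<in> BM" and g: "g \<in> BM"
 shows "sib E f = sib E g"
proof -
 have "(\<integral>r. f r \<partial>scm E x) = (\<integral>r. g r \<partial>scm E x)" for x
 proof (rule integral_cong_AE)
  show "AE r in scm E x. f r = g r"
  proof (rule AE_I[where N = "{..<0}"])
   show "{r \<in> space (scm E x). f r ~= g r} \<subseteq> {..<0}"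
    using eq by (metis (mono_tags, lifting) lessThan_iff mem_Collect_eq not_le subsetI)
   show "emeasure (scm E x) {..<0} = 0" by (simp add: emeasure_scalar[OF E] neg)
  qed (simp add: scalar_measure_sets[OF E])
 qed (use f g in "simp_all add: measurable_scalar[OF E]")
 thus ?thesis unfolding spectral_int_bdd_def by simp
qed

locale canonical = crossed M \<iota> \<sigma> + W: vn_weight M \<nu> + T: vn_trace "crossed_product M \<sigma> \<iota>" \<tau>
 for M :: "('h::chilbert_space => 'h) set" and \<iota> :: "(real => 'h) => 'k::chilbert_space" and \<sigma> \<nu> \<tau> +
 fixes h :: "'k uop"
 assumes tr_dual: "x \<in> pos_part (crossed_product M \<sigma> \<iota>) ==> \<tau> (\<theta> s x) = ennreal (exp (- s)) * \<tau> x"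
  and h: "psa h" and h_nonsing: "nonsingular h" and h_aff: "aff (crossed_product M \<sigma> \<iota>) h"
  and h_homog: "homog 1 h"
  and h_imag: "imag_power h t = lm t"
  and h_density: "x \<in> pos_part (crossed_product M \<sigma> \<iota>) ==> dual_weight M \<nu> \<sigma> \<iota> x = weight_density \<tau> h x"
begin

definition "E = resol h"

lemma E: "spm E" and E_int: "sint E cor = h" and E_neg: "E {..<0} x = 0"
 unfolding E_def by (rule psa_resolution[OF h])+

lemma E_zero: "E {0} x = 0"
 using spectral_nonsingular[OF E] h_nonsing by (simp add: E_int)

lemma E_pos: "E {0<..} x = x"
proof -
 have "E ({..<0} \<union> {0}) x = 0" by (subst sm_Un[OF E]) (auto simp: E_neg E_zero)
 moreover have "- {0<..} = {..<0::real} \<union> {0}" by auto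
 ultimately show ?thesis using sm_compl[OF E, of "{0<..}" x] by simp
qed

abbreviation "g \<equiv> \<lambda>r. cor (tailinv r)"
abbreviation "g2 \<equiv> \<lambda>r. cor (sqrt (tailinv r))"

lemma g2_bdd: "bdd_borel g2"
 by (rule bdd_borel_of_real[where K = 1]) (use tailinv_bounds in auto)

text \<open>Square root of the bounded approximation of \<open>h\<close> in
  \<open>weight_density\<close> at \<open>\<epsilon> = 1 / real (Suc n)\<close>, set to zero on the
  negative half-line. A sequence in place of the family allows monotone limits.\<close>

definition kk :: "nat => real => real" where
 "kk n r = indicator {0..} r * sqrt (r / (1 + r / real (Suc n)))"

definition hk :: "nat => 'k => 'k" where "hk n = sib E (\<lambda>r. cor (kk n r))"

lemma kk_meas [measurable]: "kk n \<in> BM"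
 unfolding kk_def by measurable

lemma kk_nonneg: "0 <= kk n r"
 by (auto simp: kk_def indicator_def)

lemma kk_sq: "(kk n r)^2 = indicator {0..} r * (r / (1 + r / real (Suc n)))"
 by (auto simp: kk_def indicator_def power_mult_distrib)

lemma kk_bound: "kk n r <= sqrt (real (Suc n))"
proof (cases "0 <= r")
 case True
 have "r / (1 + r / real (Suc n)) <= real (Suc n)" using True by (simp add: divide_le_eq add_pos_nonneg field_simps)
 thus ?thesis using True by (simp add: kk_def)
qed (simp add: kk_def)

lemma kk_bdd: "bdd_borel (\<lambda>r. cor (kk n r))"
 by (rule bdd_borel_of_real[where K = "sqrt (real (Suc n))"]) (use kk_nonneg kk_bound in auto)

lemma kk_mono: "(kk n r)^2 <= (kk (Suc n) r)^2"
proof (cases "0 <= r")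
 case True
 have "r / real (Suc (Suc n)) <= r / real (Suc n)" using True by (intro divide_left_mono) auto
 hence "r / (1 + r / real (Suc n)) <= r / (1 + r / real (Suc (Suc n)))"
  using True by (intro divide_left_mono mult_pos_pos add_pos_nonneg) auto
 thus ?thesis using True by (simp only: kk_sq) simp
qed (simp add: kk_sq)

lemma hk_sa: "self_adj (hk n)" and hk_CP: "hk n \<in> CP" and hk_bcl: "bcl (hk n)"
proof -
 show "self_adj (hk n)" unfolding hk_def by (rule sib_self_adj[OF E kk_bdd]) simp
 thus "bcl (hk n)" by (rule self_adj_bcl)
 show "hk n \<in> CP" unfolding hk_def E_def by (rule T.sib_A[OF h h_aff kk_bdd])
qed

lemma hk_norm: "(norm (hk n x))^2 = (\<integral>r. (kk n r)^2 \<partial>scm E x)"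
 using sib_norm[OF E kk_bdd, of n x] kk_nonneg by (simp add: hk_def)

lemma hk_norm_mono: "norm (hk n x) <= norm (hk (Suc n) x)"
proof -
 have i: "integrable (scm E x) (\<lambda>r. (kk n r)^2)" for n
 proof (rule integrable_scalar[OF E, where K = "(sqrt (real (Suc n)))^2"])
  show "norm ((kk n r)^2) <= (sqrt (real (Suc n)))^2" for r
   using power_mono[OF kk_bound kk_nonneg, of n r 2] by simp
 qed measurable
 have "(norm (hk n x))^2 <= (norm (hk (Suc n) x))^2"
  unfolding hk_norm by (rule integral_mono[OF i i kk_mono])
 thus ?thesis by (rule power2_le_imp_le) simp
qed

text \<open>The squared norm is the integral of \<open>(cmod (f r))\<^sup>2\<close>, so its
  vanishing makes the positive half-line a null set of the scalar measure; nonsingularity of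
  \<open>h\<close> puts all mass there.\<close>

lemma sib_injective:
 assumes f: "bdd_borel f" and nz: "!!r. r > 0 ==> f r ~= 0" and x: "sib E f x = 0"
 shows "x = 0"
proof -
 obtain K where K: "f \<in> BM" "K > 0" "!!s. cmod (f s) <= K" using bdd_borelE[OF f] by metis
 have i: "integrable (scm E x) (\<lambda>r. (cmod (f r))^2)"
 proof (rule integrable_scalar[OF E, where K = "K\<^sup>2"])
  show "norm ((cmod (f r))^2) <= K\<^sup>2" for r using power_mono[OF K(3), of r 2] by simp
 qed (use K(1) in measurable)
 have "(\<integral>r. (cmod (f r))^2 \<partial>scm E x) = 0" using sib_norm[OF E f, of x] x by simp
 hence "AE r in scm E x. (cmod (f r))^2 = 0"
  using integral_nonneg_eq_0_iff_AE[OF i] by simp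
 hence "AE r in scm E x. r \<notin> {0<..}" by (rule AE_mp) (use nz in auto)
 hence "emeasure (scm E x) {0<..} = 0"
  by (subst (asm) AE_iff_measurable[where N = "{0<..}"]) (auto simp: scalar_measure_sets[OF E] scalar_measure_space[OF E])
 thus ?thesis by (simp add: emeasure_scalar[OF E] E_pos)
qed

lemma hk_dense: assumes z: "!!x. cinner z (hk 0 x) = 0" shows "z = 0"
proof (rule sib_injective[OF kk_bdd])
 show "cor (kk 0 r) ~= 0" if "0 < r" for r using that by (simp add: kk_def)
 have "hk 0 z = 0"
  using cinner_ext[of "hk 0 z" 0] z by (simp add: self_adj_cinner[OF hk_sa])
 thus "sib E (\<lambda>r. cor (kk 0 r)) z = 0" by (simp only: hk_def)
qed

lemma hk_density: "\<tau> (hk n o x o hk n) <= weight_density \<tau> h x"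
proof -
 have "fun_calc_bdd h (\<lambda>s. cor (sqrt (s / (1 + (1 / real (Suc n)) * s)))) = hk n"
  unfolding fun_calc_bdd_def hk_def E_def[symmetric]
  by (rule sib_cong_nonneg[OF E E_neg]) (auto simp: kk_def)
 thus ?thesis unfolding weight_density_def by (intro SUP_upper2[where i = "1 / real (Suc n)"]) auto
qed

text \<open>Cyclicity moves \<open>r\<close> to the outside. The resulting elements increase with
  \<open>n\<close> and have bounded trace, the input for \<open>bounded_trace_dense\<close>.\<close>

lemma trace_density:
 assumes r: "r \<in> CP" shows "\<tau> (r o (hk n o hk n) o cadj r) <= weight_density \<tau> h (cadj r o r)"
proof -
 have "cadj (r o hk n) = hk n o cadj r"
  using cadj_comp[OF T.A_bcl[OF r] hk_bcl] hk_sa by (simp add: self_adj_iff)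
 hence "\<tau> (hk n o (cadj r o r) o hk n) = \<tau> (r o (hk n o hk n) o cadj r)"
  using T.tr_cyclic[OF T.A_comp[OF r hk_CP], of n] by (simp add: o_assoc)
 thus ?thesis using hk_density[of n "cadj r o r"] by simp
qed

text \<open>Every competitor \<open>y\<close> in the supremum satisfies
  \<open>\<pi> y <= \<pi> e\<close> as forms, hence \<open>y <= e\<close> because
  \<open>\<pi>\<close> reflects the order.\<close>

lemma dual_weight_le:
 assumes e: "e \<in> M" "proj e"
  and x: "!!xi. (\<integral>\<^sup>+s. ennreal (Re (cinner (\<theta> s x xi) xi)) \<partial>lborel) <= ennreal ((norm (\<pi> e xi))^2)"
 shows "dual_weight M \<nu> \<sigma> \<iota> x <= \<nu> e"
 unfolding dual_weight_def
proof (rule SUP_least, clarify)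
 fix y assume y: "y \<in> pos_part M" "\<forall>xi. ennreal (Re (cinner (\<pi> y xi) xi))
  <= (\<integral>\<^sup>+s. ennreal (Re (cinner (\<theta> s x xi) xi)) \<partial>lborel)"
 have "inner (\<pi> y xi) xi <= inner (\<pi> e xi) xi" for xi
 proof -
  have "ennreal (inner (\<pi> y xi) xi) <= ennreal ((norm (\<pi> e xi))^2)"
   using order_trans[OF spec[OF y(2)] x] by (simp only: inner_eq_Re_cinner)
  thus ?thesis by (simp add: proj_inner[OF pi_proj[OF e]])
 qed
 hence "op_le y e" using y(1) e by (intro pi_order_embedding) (auto simp: M.pos_part_iff pos_iff proj_sa)
 thus "\<nu> y <= \<nu> e" by (intro W.tr_mono y(1) M.proj_pos_part e)
qed

lemma tail_square:
 assumes H: "psa H" "aff CP H" and X: "X \<in> CP"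
 defines "r \<equiv> sib (resol H) g2 o X"
 shows "r \<in> CP" and "cadj r = cadj X o sib (resol H) g2" and "cadj r o r = cadj X o sib (resol H) g o X"
proof -
 note F = psa_resolution(1)[OF H(1)] and Xb = T.A_bcl[OF X]
 show "r \<in> CP" unfolding r_def by (intro T.A_comp T.sib_A[OF H g2_bdd] X)
 have "self_adj (sib (resol H) g2)" by (rule sib_self_adj[OF F g2_bdd]) simp
 thus cr: "cadj r = cadj X o sib (resol H) g2"
  by (simp add: r_def cadj_comp sib_bcl[OF F g2_bdd] Xb self_adj_iff)
 show "cadj r o r = cadj X o sib (resol H) g o X"
  unfolding cr by (simp add: r_def fun_eq_iff sib_mult[OF F g2_bdd g2_bdd] tailinv_bounds flip: of_real_mult)
qed

lemma X_pos:
 assumes "psa H" "aff CP H" "X \<in> CP" shows "cadj X o sib (resol H) g o X \<in> pos_part CP"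
 unfolding tail_square(3)[OF assms, symmetric] T.pos_part_iff
 by (intro conjI T.A_comp T.A_cadj positive_cadj_comp T.A_bcl tail_square(1) assms)

lemma dual_average_h:
 assumes "bcl X" "!!s x. wt s (X x) = X (wt s x)"
 shows "(\<integral>\<^sup>+s. ennreal (Re (cinner (\<theta> s (cadj X o sib E g o X) xi) xi)) \<partial>lborel)
  = ennreal ((norm (X xi))^2)"
 using dual_average[OF h h_homog assms, of xi] by (simp add: E_def[symmetric] E_pos)

lemma dual_average_zero:
 assumes X: "bcl X" "!!s x. wt s (X x) = X (wt s x)"
  and 0: "!!xi. cadj X (sib E g (X xi)) = 0"
 shows "X xi = 0"
proof -
 have "\<theta> s (cadj X o sib E g o X) xi = 0" for s
  by (simp add: dual_action_def 0 bcl_0[OF w_bcl])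
 thus ?thesis using dual_average_h[OF X, of xi] by simp
qed

text \<open>Equality with the weight given by \<open>h\<close> makes the trace of the element
  sandwiched by \<open>hk 0\<close> vanish. The trace is faithful and \<open>hk 0\<close> has dense
  range, so the element is zero; its average over the dual action, which is the squared norm of
  \<open>X xi\<close>, is then zero too.\<close>

lemma dual_weight_zero:
 assumes X: "X \<in> CP" "!!s x. wt s (X x) = X (wt s x)"
  and 0: "dual_weight M \<nu> \<sigma> \<iota> (cadj X o sib E g o X) = 0"
 shows "X xi = 0"
proof (rule dual_average_zero[OF T.A_bcl[OF X(1)] X(2)])
 define Y where "Y = cadj X o sib E g o X"
 have Y: "Y \<in> pos_part CP" unfolding Y_def E_def by (rule X_pos[OF h h_aff X(1)])
 have Yb: "bcl Y" and Yp: "pos Y" and YA: "Y \<in> CP" using Y T.A_bcl by (auto simp: T.pos_part_iff)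
 have ch: "cadj (hk 0) = hk 0" using hk_sa by (simp add: self_adj_iff)
 have "\<tau> (hk 0 o Y o hk 0) <= 0" using hk_density[of 0 Y] h_density[OF Y] 0 by (simp add: Y_def)
 moreover have kyk: "hk 0 o Y o hk 0 \<in> pos_part CP"
  using positive_sandwich[OF Yp hk_bcl[of 0]] T.A_comp[OF T.A_comp[OF hk_CP YA] hk_CP] by (simp add: T.pos_part_iff ch)
 ultimately have "hk 0 o Y o hk 0 = (\<lambda>xi. 0)" by (intro T.tr_faithful) simp_all
 hence "cinner (Y (hk 0 x)) (hk 0 y) = 0" for x y
  using self_adj_cinner[OF hk_sa[of 0], of "Y (hk 0 x)" y] by (simp add: fun_eq_iff)
 hence 1: "Y (hk 0 x) = 0" for x by (intro hk_dense) blast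
 have "cinner (Y z) (hk 0 x) = 0" for z x
  using 1 Yp by (simp add: self_adj_cinner pos_iff)
 hence "Y z = 0" for z by (intro hk_dense) blast
 thus "cadj X (sib E g (X xi)) = 0" for xi by (simp add: Y_def)
qed

subsection \<open>Invariance of the weight under the modular group\<close>

text \<open>As \<open>h\<close> is nonsingular, averaging this element over the dual action gives
  exactly \<open>\<pi> e\<close>, and the supremum is attained at \<open>e\<close> itself.\<close>

lemma dual_weight_proj:
 assumes e: "e \<in> M" "proj e"
 shows "dual_weight M \<nu> \<sigma> \<iota> (\<pi> e o sib E g o \<pi> e) = \<nu> e"
proof (rule antisym)
 have "cadj (\<pi> e) = \<pi> e" using pi_self_adj[OF e(1) proj_sa[OF e(2)]] by (simp add: self_adj_iff)
 hence eq: "(\<integral>\<^sup>+s. ennreal (Re (cinner (\<theta> s (\<pi> e o sib E g o \<pi> e) xi) xi)) \<partial>lborel)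
  = ennreal ((norm (\<pi> e xi))^2)" for xi
  using dual_average_h[OF pi_bcl[OF e(1)] w_pi[OF e(1)], of xi] by simp
 show "dual_weight M \<nu> \<sigma> \<iota> (\<pi> e o sib E g o \<pi> e) <= \<nu> e"
  by (rule dual_weight_le[OF e]) (simp only: eq order_refl)
 show "\<nu> e <= dual_weight M \<nu> \<sigma> \<iota> (\<pi> e o sib E g o \<pi> e)"
  unfolding dual_weight_def eq
  by (rule SUP_upper) (simp add: M.proj_pos_part[OF e] proj_inner[OF pi_proj[OF e]] flip: inner_eq_Re_cinner)
qed

definition iph :: "real => real => complex" where
 "iph t r = (if 0 < r then cis (t * ln r) else 0)"

lemma iph_bdd: "bdd_borel (iph t)"
proof (rule bdd_borelI[where K = 1])
 show "iph t \<in> BM" unfolding iph_def cis_conv_exp by measurable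
qed (simp add: iph_def)

lemma lam_eq: "lm t = sib E (iph t)"
proof -
 have "(\<lambda>s. cor s powr (\<i> * cor t)) = (\<lambda>s. if s = 0 then 0 else
  exp (\<i> * cor t * (cor (ln \<bar>s\<bar>) + (if s < 0 then 1 else 0) * cor pi * \<i>)))"
  by (auto simp: powr_def Ln_of_real')
 hence "(\<lambda>s. cor s powr (\<i> * cor t)) \<in> BM"
  by (simp only:) measurable
 moreover have "cor r powr (\<i> * cor t) = iph t r" if "0 <= r" for r
  using that by (cases "r = 0") (auto simp: iph_def powr_def cis_conv_exp Ln_of_real mult.commute mult.left_commute)
 ultimately have "imag_power h t = sib E (iph t)"
  unfolding imag_power_def fun_calc_bdd_def E_def[symmetric]
  by (intro sib_cong_nonneg[OF E E_neg]) (auto intro: bdd_borel_meas iph_bdd)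
 thus ?thesis by (simp add: h_imag)
qed

lemma lam_sib: "bdd_borel f ==> lm t (sib E f x) = sib E f (lm t x)"
 unfolding lam_eq by (simp add: sib_mult[OF E] iph_bdd mult.commute)

lemma tr_unitary:
 assumes x: "x \<in> CP" shows "\<tau> (lm t o (x o cadj x) o lm (- t)) = \<tau> (x o cadj x)"
proof -
 let ?u = "lm t o x"
 have c: "cadj ?u = cadj x o lm (- t)" by (simp add: cadj_comp lam_bcl T.A_bcl[OF x] cadj_lam)
 have "\<tau> (?u o cadj ?u) = \<tau> (cadj ?u o ?u)" using T.tr_cyclic[OF T.A_comp[OF lam_CP x]] by simp
 also have "cadj ?u o ?u = cadj x o x" unfolding c by (simp add: fun_eq_iff)
 also have "\<tau> (cadj x o x) = \<tau> (x o cadj x)" by (rule T.tr_cyclic[OF x])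
 finally show ?thesis unfolding c by (simp only: o_assoc)
qed

lemma weight_density_lam:
 assumes y: "y \<in> CP" "self_adj y" and c: "c \<in> CP" "self_adj c"
 shows "weight_density \<tau> h (lm t o (y o (c o c) o y) o lm (- t)) = weight_density \<tau> h (y o (c o c) o y)"
 unfolding weight_density_def
proof (rule SUP_cong[OF refl])
 fix \<epsilon> :: real assume "\<epsilon> \<in> {0<..}"
 hence \<epsilon>: "\<epsilon> > 0" by simp
 let ?k = "\<lambda>r. cor (indicator {0..} r * sqrt (r / (1 + \<epsilon> * r)))"
 define k where "k = sib E ?k"
 have b: "bdd_borel ?k"
 proof (rule bdd_borel_of_real[where K = "sqrt (1 / \<epsilon>)"])
  show "\<bar>indicator {0..} r * sqrt (r / (1 + \<epsilon> * r))\<bar> <= sqrt (1 / \<epsilon>)" for r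
  proof (cases "0 <= r")
   case True
   have "r / (1 + \<epsilon> * r) <= 1 / \<epsilon>" using True \<epsilon> by (simp add: divide_le_eq add_pos_nonneg field_simps)
   thus ?thesis using True \<epsilon> by (simp del: real_sqrt_divide add: abs_of_nonneg)
  qed (use \<epsilon> in simp)
 qed measurable
 have kA: "k \<in> CP" unfolding k_def E_def by (rule T.sib_A[OF h h_aff b])
 have ksa: "self_adj k" unfolding k_def by (rule sib_self_adj[OF E b]) simp
 have k: "fun_calc_bdd h (\<lambda>s. cor (sqrt (s / (1 + \<epsilon> * s)))) = k"
  unfolding fun_calc_bdd_def k_def E_def[symmetric] by (rule sib_cong_nonneg[OF E E_neg]) auto
 have kl: "k (lm r x) = lm r (k x)" for r x unfolding k_def by (simp only: lam_sib[OF b])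
 let ?x = "k o y o c"
 have xA: "?x \<in> CP" by (intro T.A_comp kA y c)
 have "cadj ?x = c o (y o k)"
  using y(2) c(2) ksa by (simp add: cadj_comp bcl_comp self_adj_iff o_assoc)
 hence e: "?x o cadj ?x = k o (y o (c o c) o y) o k" by (simp add: o_assoc)
 have "k o (lm t o (y o (c o c) o y) o lm (- t)) o k = lm t o (?x o cadj ?x) o lm (- t)"
  unfolding e by (simp add: fun_eq_iff kl)
 hence "\<tau> (k o (lm t o (y o (c o c) o y) o lm (- t)) o k) = \<tau> (k o (y o (c o c) o y) o k)"
  by (simp only: tr_unitary[OF xA] e[symmetric])
 thus "\<tau> (fun_calc_bdd h (\<lambda>s. cor (sqrt (s / (1 + \<epsilon> * s)))) o (lm t o (y o (c o c) o y) o lm (- t)) o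
   fun_calc_bdd h (\<lambda>s. cor (sqrt (s / (1 + \<epsilon> * s))))) =
  \<tau> (fun_calc_bdd h (\<lambda>s. cor (sqrt (s / (1 + \<epsilon> * s)))) o (y o (c o c) o y) o
   fun_calc_bdd h (\<lambda>s. cor (sqrt (s / (1 + \<epsilon> * s)))))"
  by (simp only: k)
qed

lemma g2g2: "sib E g2 o sib E g2 = sib E g"
 by (simp add: fun_eq_iff sib_mult[OF E g2_bdd g2_bdd] tailinv_bounds flip: of_real_mult)

lemma g2_CP: "sib E g2 \<in> CP" and g2_sa: "self_adj (sib E g2)"
 unfolding E_def by (rule T.sib_A[OF h h_aff g2_bdd], rule sib_self_adj[OF psa_resolution(1)[OF h] g2_bdd], simp)

text \<open>Conjugation by \<open>lm t\<close>, an imaginary power of \<open>h\<close>, commutes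
  with functions of \<open>h\<close> and preserves the trace, hence preserves the weight with
  density \<open>h\<close>. It carries \<open>\<pi> e\<close> to
  \<open>\<pi> (\<sigma> t e)\<close>, so invariance descends to \<open>\<nu>\<close> through
  \<open>dual_weight_proj\<close>.\<close>

lemma weight_sig:
 assumes e: "e \<in> M" "proj e" "proj (\<sigma> t e)" shows "\<nu> (\<sigma> t e) = \<nu> e"
proof -
 have dw: "\<nu> p = weight_density \<tau> h (\<pi> p o sib E g o \<pi> p)" if p: "p \<in> M" "proj p" for p
 proof -
  have "cadj (\<pi> p) = \<pi> p" using pi_self_adj[OF p(1) proj_sa[OF p(2)]] by (simp add: self_adj_iff)
  thus ?thesis
   using dual_weight_proj[OF p] h_density[OF X_pos[OF h h_aff pi_CP[OF p(1)]]] by (simp add: E_def)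
 qed
 have "\<pi> (\<sigma> t e) o sib E g o \<pi> (\<sigma> t e) = lm t o (\<pi> e o sib E g o \<pi> e) o lm (- t)"
 proof
  fix xi
  have "\<pi> (\<sigma> t e) z = lm t (\<pi> e (lm (- t) z))" for z
   using lam_pi[OF e(1), of t "lm (- t) z"] by simp
  thus "(\<pi> (\<sigma> t e) o sib E g o \<pi> (\<sigma> t e)) xi = (lm t o (\<pi> e o sib E g o \<pi> e) o lm (- t)) xi"
   by (simp add: lam_sib[OF tailinv_bdd, symmetric])
 qed
 thus ?thesis
  using weight_density_lam[OF pi_CP[OF e(1)] pi_self_adj[OF e(1) proj_sa[OF e(2)]] g2_CP g2_sa, of t]
  by (simp only: dw[OF sig_M[OF e(1)] e(3)] dw[OF e(1,2)] g2g2)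
qed

end

lemma closed_graph_comp:
 fixes p :: "'a::chilbert_space => 'a" and T :: "'a uop"
 assumes p: "bcl p" and T: "closed T" shows "closed (graph p O T)"
 unfolding closed_sequential_limits
proof (intro allI impI)
 fix X q assume X: "(\<forall>n. X n \<in> graph p O T) \<and> X ----> q"
 have "(p (fst (X n)), snd (X n)) \<in> T" for n
 proof -
  have "(fst (X n), snd (X n)) \<in> graph p O T" using X by simp
  thus ?thesis by auto
 qed
 moreover have "(\<lambda>n. (p (fst (X n)), snd (X n))) ----> (p (fst q), snd q)"
  using X by (intro tendsto_Pair bcl_tendsto[OF p] tendsto_fst tendsto_snd) auto
 ultimately have "(p (fst q), snd q) \<in> T" by (rule closed_sequentially[OF T])
 thus "q \<in> graph p O T" by (cases q) auto
qed

context canonical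
begin

section \<open>Projections of finite weight\<close>

definition "NP = {e \<in> M. proj e \<and> \<nu> e < \<infinity>}"

lemma n_ideal_proj: "e \<in> n_ideal M \<nu> \<and> proj e \<longleftrightarrow> e \<in> NP"
 by (auto simp: NP_def n_ideal_def is_projection_def)

lemma NP_D: "e \<in> NP ==> e \<in> M" "e \<in> NP ==> proj e" "e \<in> NP ==> \<nu> e < \<infinity>"
 by (auto simp: NP_def)

lemma NP_pi: "e \<in> NP ==> proj (\<pi> e)" "e \<in> NP ==> bcl (\<pi> e)"
 "e \<in> NP ==> \<pi> e \<in> CP"
 by (auto simp: NP_def intro: pi_proj pi_bcl pi_CP)

lemma NP_sig: assumes e: "e \<in> NP" shows "\<sigma> t e \<in> NP"
proof -
 note e' = NP_D[OF e]
 have "proj (\<sigma> t e)"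
  using sig_comp[OF e'(1) e'(1), of t] sig_cadj[OF e'(1), of t] e'(2) sig_bcl[OF e'(1)] by (simp add: is_projection_def)
 thus ?thesis using e' weight_sig[OF e'(1,2), of t] sig_M[OF e'(1)] by (simp add: NP_def)
qed

text \<open>Spectral projections of \<open>y*y\<close> away from zero have finite weight for \<open>y\<close> in the left ideal, so the
 projections of finite weight detect all of the left ideal, which is dense by semifiniteness.\<close>

lemma NP_total_M:
 assumes v: "!!e. e \<in> NP ==> e v = 0" shows "v = 0"
proof -
 have yv: "y v = 0" if y: "y \<in> n_ideal M \<nu>" for y
 proof -
  have yM: "y \<in> M" and fin: "\<nu> (cadj y o y) < \<infinity>" using y by (auto simp: n_ideal_def)
  note yb = M.A_bcl[OF yM]
  define S where "S = cadj y o y"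
  have SM: "S \<in> M" unfolding S_def by (intro M.A_comp M.A_cadj yM)
  have Sp: "pos S" unfolding S_def by (rule positive_cadj_comp[OF yb])
  have Ssa: "self_adj S" using Sp by (simp add: pos_iff)
  note Sb = self_adj_bcl[OF Ssa]
  have f: "inner (S xi) xi = (norm (y xi))^2" for xi
   using cadj_left[OF yb, of "y xi" xi, symmetric] by (simp add: S_def inner_eq_Re_cinner cinner_self del: of_real_power)
  have "(norm (y v))^2 <= \<epsilon> * (norm v)^2" if \<epsilon>: "\<epsilon> > 0" for \<epsilon>
  proof -
   define A where "A = (\<lambda>xi. S xi - \<epsilon> *\<^sub>R xi)"
   have A: "self_adj A" unfolding A_def by (intro self_adj_minus self_adj_rmult self_adj_id Ssa)
   have "\<exists>q. proj q \<and>
    (\<forall>u. bcl u --> (\<forall>x. u (A x) = A (u x)) --> (\<forall>x. cadj u (A x) = A (cadj u x)) --> (\<forall>x. u (q x) = q (u x))) \<and>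
    (\<forall>x. q x = x --> 0 <= inner (A x) x) \<and> (\<forall>x. q x = 0 --> inner (A x) x <= 0) \<and> (\<forall>x. A x = 0 --> q x = x)"
    by (rule sign_projection[OF A])
   then obtain q where q: "proj q"
    "!!u x. bcl u ==> \<forall>x. u (A x) = A (u x) ==> \<forall>x. cadj u (A x) = A (cadj u x) ==> u (q x) = q (u x)"
    "!!x. q x = x ==> 0 <= inner (A x) x" "!!x. q x = 0 ==> inner (A x) x <= 0" by blast
   have uA: "u (A x) = A (u x)" if u: "u \<in> commutant M" for u x
    by (simp add: A_def bcl_diff[OF M.comm_bcl[OF u]] bcl_scaleR[OF M.comm_bcl[OF u]] M.comm_eq[OF SM u])
   have qM: "q \<in> M"
   proof (rule M.A_I[OF proj_bcl[OF q(1)]])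
    fix u xi assume u: "u \<in> commutant M"
    show "u (q xi) = q (u xi)" by (rule q(2)[OF M.comm_bcl[OF u]]) (use uA[OF u] uA[OF M.comm_cadj[OF u]] in auto)
   qed
   have Sq: "S (q x) = q (S x)" for x
   proof (rule q(2)[OF Sb])
    have "cadj S = S" using Ssa by (simp add: self_adj_iff)
    moreover have "S (A x) = A (S x)" for x by (simp add: A_def bcl_diff[OF Sb] bcl_scaleR[OF Sb])
    ultimately show "\<forall>x. S (A x) = A (S x)" "\<forall>x. cadj S (A x) = A (cadj S x)" by auto
   qed
   have le: "\<epsilon> * inner (q x) x <= inner (S x) x" for x
   proof -
    define a b where "a = q x" and "b = x - q x"
    have qa: "q a = a" and x: "x = a + b" by (simp_all add: a_def b_def proj_idem[OF q(1)])
    have "inner (S a) b = inner (q (S a)) b" by (simp only: Sq[symmetric] qa)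
    also have "... = 0"
     by (simp add: self_adj_inner[OF proj_sa[OF q(1)]]) (simp add: b_def bcl_diff[OF proj_bcl[OF q(1)]] proj_idem[OF q(1)])
    finally have "inner (S x) x = inner (S a) a + inner (S b) b"
     using self_adj_inner[OF Ssa, of b a] by (simp add: x bcl_add[OF Sb] inner_add_left inner_add_right inner_commute)
    moreover have "0 <= inner (S b) b" using Sp by (simp add: pos_iff)
    moreover have "\<epsilon> * inner a a <= inner (S a) a" using q(3)[OF qa] by (simp add: A_def inner_diff_left)
    moreover have "inner (q x) x = inner a a" by (simp add: proj_inner[OF q(1)] a_def power2_norm_eq_inner)
    ultimately show ?thesis by simp
   qed
   have "op_le (\<lambda>x. \<epsilon> *\<^sub>R q x) S" using le by (simp add: op_le_iff Ssa self_adj_rmult proj_sa[OF q(1)])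
   moreover have "(\<lambda>x. \<epsilon> *\<^sub>R q x) \<in> pos_part M"
    using proj_pos[OF q(1)] \<epsilon> by (simp add: M.pos_part_iff M.A_rmult[OF qM] pos_iff self_adj_rmult)
   ultimately have "\<nu> (\<lambda>x. \<epsilon> *\<^sub>R q x) <= \<nu> S" using Sp SM by (intro W.tr_mono) (auto simp: M.pos_part_iff)
   also have "\<nu> S < \<infinity>" using fin by (simp add: S_def)
   finally have "ennreal \<epsilon> * \<nu> q < \<infinity>" using \<epsilon> by (simp add: W.tr_scale M.proj_pos_part qM q(1))
   hence "\<nu> q < \<infinity>" using \<epsilon> by (auto simp: ennreal_mult_less_top)
   hence "q \<in> NP" by (simp add: NP_def qM q(1))
   from q(4)[OF v[OF this]] show ?thesis by (simp add: A_def inner_diff_left f power2_norm_eq_inner)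
  qed
  hence "(norm (y v))^2 <= 0 * (norm v)^2"
  proof -
   assume le: "!!\<epsilon>. \<epsilon> > 0 ==> (norm (y v))\<^sup>2 <= \<epsilon> * (norm v)^2"
   have "((\<lambda>\<epsilon>. \<epsilon> * (norm v)^2) \<longlongrightarrow> 0 * (norm v)^2) (at_right 0)" by (intro tendsto_intros)
   thus ?thesis by (rule tendsto_lowerbound) (auto intro: le eventually_at_right_less eventually_mono)
  qed
  thus "y v = 0" by simp
 qed
 have "norm v < \<epsilon>" if "\<epsilon> > 0" for \<epsilon>
 proof -
  have "semifinite_weight M \<nu>" using W.weight by (simp add: fns_weight_def)
  from bspec[OF this[unfolded semifinite_weight_def] M.A_id, THEN spec[of _ "{v}"]] that
  have "\<exists>y\<in>n_ideal M \<nu>. \<forall>xi\<in>{v}. norm (xi - y xi) < \<epsilon>" by simp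
  then obtain y where y: "y \<in> n_ideal M \<nu>" "norm (v - y v) < \<epsilon>" by auto
  show ?thesis using y(2) yv[OF y(1)] by simp
 qed
 thus ?thesis by (metis less_irrefl zero_less_norm_iff)
qed

lemma pi_eq_0: assumes x: "x \<in> M" and 0: "!!xi. \<pi> x xi = 0" shows "x xi = 0"
proof -
 note xb = M.A_bcl[OF x]
 have xx: "cadj x o x \<in> M" "self_adj (cadj x o x)"
  using positive_cadj_comp[OF xb] M.A_comp[OF M.A_cadj[OF x] x] by (auto simp: pos_iff)
 have z: "(\<lambda>xi. 0 *\<^sub>R xi) \<in> M" by (rule M.A_rmult[OF M.A_id])
 have "op_le (cadj x o x) (\<lambda>xi. 0 *\<^sub>R xi)"
 proof (rule pi_order_embedding[OF xx z])
  show "self_adj (\<lambda>xi. 0 *\<^sub>R xi)" by (rule self_adj_rmult[OF self_adj_id(2)])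
  show "inner (\<pi> (cadj x o x) xi) xi <= inner (\<pi> (\<lambda>xi. 0 *\<^sub>R xi) xi) xi" for xi
   unfolding pi_rmult[OF M.A_id] by (simp add: pi_comp[OF M.A_cadj[OF x] x] 0 bcl_0[OF pi_bcl[OF M.A_cadj[OF x]]])
 qed
 hence "0 <= inner (0 *\<^sub>R xi - (cadj x o x) xi) xi" by (simp only: op_le_def pos_iff)
 hence "inner (cadj x (x xi)) xi <= 0" by simp
 moreover have "inner (cadj x (x xi)) xi = (norm (x xi))^2"
  using cadj_left[OF xb, of "x xi" xi, symmetric] by (simp add: inner_eq_Re_cinner cinner_self del: of_real_power)
 ultimately show ?thesis by simp
qed

lemma projection_w:
 assumes q: "proj q" and inv: "!!s x. q x = x ==> q (wt s x) = wt s x"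
 shows "wt s (q x) = q (wt s x)"
 by (rule proj_commute[OF q w_bcl, symmetric]) (simp_all add: inv cadj_w)

text \<open>The projection \<open>Q\<close> onto the common kernel is fixed by the dual action. A
  positive \<open>y\<close> with \<open>\<pi> y\<close> below \<open>Q\<close> annihilates every
  finite projection, hence is zero by \<open>NP_total_M\<close>. The dual weight of the element
  compressed by \<open>Q\<close> is therefore zero, and so is \<open>Q\<close>.\<close>

lemma NP_total:
 assumes z: "!!e. e \<in> NP ==> \<pi> e \<zeta> = 0" shows "\<zeta> = 0"
proof -
 obtain Q where Q: "Q \<in> CP" "proj Q" "!!x. Q x = x \<longleftrightarrow> (\<forall>e\<in>NP. \<pi> e x = 0)"
  by (rule T.A_equalizer[of "(\<lambda>e. (\<pi> e, \<lambda>x. 0)) ` NP"]) (use NP_pi(3) T.A_zero that in auto)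
 have wQ: "wt s (Q x) = Q (wt s x)" for s x
 proof (rule projection_w[OF Q(2)])
  fix s x assume "Q x = x"
  thus "Q (wt s x) = wt s x"
   using Q(3) by (auto simp: w_pi[OF NP_D(1), symmetric] bcl_0[OF w_bcl])
 qed
 note Qb = proj_bcl[OF Q(2)]
 have pQ: "\<pi> e (Q x) = 0" if "e \<in> NP" for e x
  using Q(3)[of "Q x"] proj_idem[OF Q(2)] that by simp
 have Qp: "Q (\<pi> e x) = 0" if e: "e \<in> NP" for e x
 proof -
  have "cinner (Q (\<pi> e x)) z = cinner 0 z" for z
   by (simp add: self_adj_cinner[OF proj_sa[OF Q(2)]] self_adj_cinner[OF proj_sa[OF NP_pi(1)[OF e]]] pQ[OF e])
  thus ?thesis by (rule cinner_ext)
 qed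
 have cQ: "cadj Q = Q" using Q(2) by (simp add: is_projection_def)
 have "dual_weight M \<nu> \<sigma> \<iota> (cadj Q o sib E g o Q) <= 0"
  unfolding dual_weight_def dual_average_h[OF Qb wQ]
 proof (rule SUP_least, clarify)
  fix y assume y: "y \<in> pos_part M" "\<forall>xi. ennreal (Re (cinner (\<pi> y xi) xi)) <= ennreal ((norm (Q xi))^2)"
  obtain z where z: "z \<in> pos_part M" "z o z = y" using M.positive_sqrt[OF y(1)] by blast
  have zM: "z \<in> M" and zsa: "self_adj z" using z(1) by (auto simp: M.pos_part_iff pos_iff)
  have f: "inner (\<pi> y xi) xi = (norm (\<pi> z xi))^2" for xi
   by (simp add: z(2)[symmetric] pi_comp[OF zM zM] self_adj_inner[OF pi_self_adj[OF zM zsa]] power2_norm_eq_inner)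
  have "z xi = 0" for xi
  proof (rule NP_total_M)
   fix e assume e: "e \<in> NP"
   note e' = NP_D[OF e]
   have "\<pi> (z o e) x = 0" for x
    using spec[OF y(2), of "\<pi> e x"] f[of "\<pi> e x"]
    by (simp add: pi_comp[OF zM e'(1)] Qp[OF e] inner_eq_Re_cinner)
   hence ze: "(z o e) xi = 0" for xi by (rule pi_eq_0[OF M.A_comp[OF zM e'(1)]])
   have "cinner (e (z xi)) x = cinner 0 x" for x
    using ze[of x] by (simp add: self_adj_cinner[OF proj_sa[OF e'(2)]] self_adj_cinner[OF zsa])
   thus "e (z xi) = 0" by (rule cinner_ext)
  qed
  hence "y = (\<lambda>xi. 0)" by (simp add: z(2)[symmetric] fun_eq_iff)
  thus "\<nu> y <= 0" by (simp add: W.tr_zero)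
 qed
 hence "Q \<zeta> = 0" by (intro dual_weight_zero[OF Q(1) wQ]) simp
 moreover have "Q \<zeta> = \<zeta>" using Q(3) z by simp
 ultimately show ?thesis by simp
qed

subsection \<open>The square root of the density\<close>

definition "hs = sint E (\<lambda>r. cor (sqrt r))"

lemma sq_meas: "(\<lambda>r. cor (sqrt r)) \<in> BM"
 by measurable

lemma hs_clinear: "clinear_graph hs" and hs_linear: "linear_rel hs" and hs_closed: "closed hs"
 using si_clinear[OF E sq_meas] si_closed[OF E sq_meas] by (auto simp: hs_def clinear_graph_iff)

lemma hs_aff: "aff CP hs" and hs_homog: "homog (1 / 2) hs"
 unfolding hs_def E_def by (rule T.affiliated_si[OF h h_aff sq_meas], rule homog_sqrt[OF h h_homog])

lemma AE_nonneg: "AE r in scm E x. 0 <= r"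
proof (rule AE_I[where N = "{..<0}"])
 show "emeasure (scm E x) {..<0} = 0" by (simp add: emeasure_scalar[OF E] E_neg)
qed (auto simp: scalar_measure_sets[OF E])

lemma hs_domain:
 assumes c: "!!n. (norm (hk n x))^2 <= c" shows "x \<in> Domain hs"
proof -
 let ?f = "\<lambda>r. cor (sqrt r)"
 \<comment> \<open>Where \<open>sqrt r <= n\<close>, one has \<open>r <= n * n\<close>, so
   \<open>(kk (n * n) r)\<^sup>2\<close> is at least \<open>r / 2\<close>: hence the index
   \<open>n * n\<close> and the factor 2.\<close>
 have "norm (sib E (cutoff ?f n) x) <= sqrt (2 * c)" for n
 proof -
  have i1: "integrable (scm E x) (\<lambda>r. (cmod (cutoff ?f n r))^2)"
  proof (rule integrable_scalar[OF E, where K = "(real n)^2"])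
   show "(\<lambda>r. (cmod (cutoff ?f n r))^2) \<in> BM"
    using bdd_borel_meas[OF bdd_borel_cutoff[OF sq_meas, of n]] by measurable
   show "norm ((cmod (cutoff ?f n r))^2) <= (real n)^2" for r
    by (auto simp: cutoff_def intro!: power_mono)
  qed
  have i2: "integrable (scm E x) (\<lambda>r. 2 * (kk (n * n) r)^2)"
  proof (rule integrable_mult_right, rule integrable_scalar[OF E, where K = "(sqrt (real (Suc (n * n))))^2"])
   show "norm ((kk (n * n) r)^2) <= (sqrt (real (Suc (n * n))))^2" for r
    using power_mono[OF kk_bound kk_nonneg, of "n * n" r 2] by simp
  qed measurable
  have "(norm (sib E (cutoff ?f n) x))^2 <= (\<integral>r. 2 * (kk (n * n) r)^2 \<partial>scm E x)"
   unfolding sib_norm[OF E bdd_borel_cutoff[OF sq_meas]]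
  proof (rule integral_mono_AE[OF i1 i2])
   show "AE r in scm E x. (cmod (cutoff ?f n r))^2 <= 2 * (kk (n * n) r)^2"
   proof (rule AE_mp[OF AE_nonneg], rule AE_I2, rule impI)
    fix r :: real assume r: "0 <= r"
    show "(cmod (cutoff ?f n r))^2 <= 2 * (kk (n * n) r)^2"
    proof (cases "sqrt r <= real n")
     case True
     hence "(sqrt r)^2 <= (real n)^2" using r by (intro power_mono) auto
     hence "r / real (Suc (n * n)) <= 1" using r by (simp add: power2_eq_square)
     hence "r / 2 <= r / (1 + r / real (Suc (n * n)))" using r by (intro divide_left_mono) (auto intro: add_pos_nonneg)
     moreover have "(cmod (cutoff ?f n r))^2 = r" using r True by (simp add: cutoff_def norm_of_real)
     moreover have "(kk (n * n) r)^2 = r / (1 + r / real (Suc (n * n)))" using r by (simp add: kk_sq del: of_nat_Suc)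
     ultimately show ?thesis by linarith
    qed (simp add: cutoff_def r)
   qed
  qed
  also have "... <= 2 * c" using c[of "n * n"] by (simp add: hk_norm)
  finally show ?thesis by (simp add: real_le_rsqrt)
 qed
 from si_exists[OF E sq_meas this] show ?thesis by (auto simp: hs_def)
qed

lemma hs_limit:
 assumes xy: "(x, y) \<in> hs" shows "(\<lambda>n. hk n x) ----> y"
proof -
 let ?g = "\<lambda>n r. cor (indicator {0..} r / sqrt (1 + r / real (Suc n)))"
 have b: "cmod (?g n r) <= 1" for n r by (auto simp: indicator_def norm_divide divide_le_eq_1)
 have g: "bdd_borel (?g n)" for n by (rule bdd_borelI[OF _ b]) measurable
 have e: "(\<lambda>r. ?g n r * cor (sqrt r)) = (\<lambda>r. cor (kk n r))" for n
  by (auto simp: fun_eq_iff kk_def indicator_def real_sqrt_divide)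
 have "hk n x = sib E (?g n) y" for n
  unfolding hk_def e[symmetric]
  by (rule si_apply[OF E xy[unfolded hs_def] sq_meas g, symmetric]) (simp only: e kk_bdd)
 moreover have "(\<lambda>n. sib E (?g n) y) ----> sib E (indicator {0..}) y"
 proof (rule sib_limit[OF E _ b])
  show "(\<lambda>n. ?g n r) ----> indicator {0..} r" for r
  proof -
   have "(\<lambda>n. r / real (Suc n)) ----> 0" by (rule LIMSEQ_Suc[OF lim_const_over_n])
   hence "(\<lambda>n. indicator {0..} r / sqrt (1 + r / real (Suc n))) ----> indicator {0..} r / sqrt (1 + 0)"
    by (intro tendsto_intros) auto
   hence "(\<lambda>n. ?g n r) ----> cor (indicator {0..} r)" by (intro tendsto_of_real) simp
   moreover have "cor (indicator {0..} r) = indicator {0..} r" by (simp add: indicator_def)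
   ultimately show ?thesis by (simp only:)
  qed
 qed (use g bdd_borel_meas in blast)
 moreover have "sib E (indicator {0..}) y = y"
  using sm_mono[OF E, of "{0<..}" "{0..}" y] E_pos[of y] by (simp add: sib_indicator[OF E] subset_eq)
 ultimately show ?thesis by simp
qed

text \<open>The projection acts first and the root of \<open>h\<close> second. In this order the
  operator is closed without taking a closure; density of the domain is then the point to be
  proved.\<close>

definition "Te e = graph (\<pi> e) O hs"

lemma Te_iff: "(x, y) \<in> Te e \<longleftrightarrow> (\<pi> e x, y) \<in> hs"
 by (auto simp: Te_def)

lemma Te_aff: "e \<in> NP ==> aff CP (Te e)"
 unfolding Te_def by (intro T.affiliated_comp T.affiliated_graph NP_pi hs_aff)

lemma Te_linear: "e \<in> NP ==> linear_rel (Te e)"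
 unfolding Te_def by (intro linear_rel_comp linear_rel_graph NP_pi hs_linear)

lemma Te_homog: "e \<in> NP ==> homog (1 / 2) (Te e)"
 using homog_comp[OF homog_graph[of "\<pi> e"] hs_homog hs_linear] w_pi[OF NP_D(1)] by (simp add: Te_def)

lemma NP_finite: assumes "e \<in> NP" obtains C where "0 <= C" "\<nu> e = ennreal C"
 using NP_D(3)[OF assms] by (cases "\<nu> e") auto

definition "hks r n = r o (hk n o hk n) o cadj r"

lemma
 assumes r: "r \<in> CP"
 shows hks_form: "inner (hks r n x) x = (norm (hk n (cadj r x)))^2"
  and hks_pos: "hks r n \<in> pos_part CP" and hks_mono: "op_le (hks r n) (hks r (Suc n))"
proof -
 note rb = T.A_bcl[OF r]
 show f: "inner (hks r n x) x = (norm (hk n (cadj r x)))^2" for n x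
  using cadj_right[OF rb, of "hk n (hk n (cadj r x))" x]
  by (simp add: hks_def inner_eq_Re_cinner self_adj_cinner[OF hk_sa] cinner_self del: of_real_power)
 have "pos (hk n o hk n)" for n using positive_cadj_comp[OF hk_bcl, of n] hk_sa by (simp add: self_adj_iff)
 from positive_sandwich[OF this bcl_cadj[OF rb]] have pos: "pos (hks r n)" for n
  by (simp add: hks_def cadj_cadj[OF rb] o_assoc)
 thus "hks r n \<in> pos_part CP"
  by (simp add: T.pos_part_iff) (simp add: hks_def T.A_comp T.A_cadj r hk_CP)
 show "op_le (hks r n) (hks r (Suc n))"
  using pos hk_norm_mono by (simp add: op_le_iff pos_iff f)
qed

text \<open>Averaging over the dual action turns \<open>X\<close> with \<open>tailinv\<close> of
  \<open>H\<close> in the middle into \<open>X\<close> with the support projection of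
  \<open>H\<close> in the middle, which is dominated by \<open>\<pi> e\<close>. The dual weight is
  thus at most \<open>\<nu> e\<close>, and \<open>trace_density\<close> converts it into a
  trace.\<close>

lemma hks_trace:
 assumes e: "e \<in> NP" and H: "psa H" "homog 1 H" "aff CP H"
  and X: "X \<in> CP" "!!s x. wt s (X x) = X (wt s x)"
  and le: "!!x. norm (resol H {0<..} (X x)) <= norm (\<pi> e x)"
 defines "r \<equiv> sib (resol H) g2 o X"
 shows "r \<in> CP" and "cadj r = cadj X o sib (resol H) g2" and "\<tau> (hks r n) <= \<nu> e"
proof -
 note Xb = T.A_bcl[OF X(1)]
 note r = tail_square[OF H(1,3) X(1), folded r_def]
 show "r \<in> CP" "cadj r = cadj X o sib (resol H) g2" by (rule r)+
 have "weight_density \<tau> h (cadj r o r) = dual_weight M \<nu> \<sigma> \<iota> (cadj r o r)"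
  unfolding r(3) by (rule h_density[OF X_pos[OF H(1,3) X(1)], symmetric])
 also have "... <= \<nu> e"
  unfolding r(3)
 proof (rule dual_weight_le[OF NP_D(1,2)[OF e]])
  show "(\<integral>\<^sup>+s. ennreal (Re (cinner (\<theta> s (cadj X o sib (resol H) g o X) xi) xi)) \<partial>lborel)
   <= ennreal ((norm (\<pi> e xi))^2)" for xi
   unfolding dual_average[OF H(1,2) Xb X(2)] by (intro ennreal_leI power_mono le) auto
 qed
 finally show "\<tau> (hks r n) <= \<nu> e" using trace_density[OF r(1), of n] by (simp add: hks_def)
qed

text \<open>The projection \<open>Q\<close> onto the complement of the domain lies in the algebra,
  is fixed by the dual action and sits under \<open>\<pi> e\<close>. The elements
  \<open>hks r n\<close> have trace at most \<open>\<nu> e\<close>, so their limit form is densely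
  finite by \<open>bounded_trace_dense\<close>, and this forces \<open>Q = 0\<close>.\<close>

lemma Te_dense:
 assumes e: "e \<in> NP" shows "closure (Domain (Te e)) = UNIV"
proof (rule csubspace_dense[OF linear_rel_Domain[OF Te_linear[OF e]]])
 fix z assume z: "!!x. x \<in> Domain (Te e) ==> cinner z x = 0"
 define V where "V = {x. \<forall>d\<in>Domain (Te e). cinner x d = 0}"
 have V1: "csubspace V" unfolding V_def csubspace_def by (auto simp: cinner_add_left cinner_scaleC_left)
 have V2: "closed V"
 proof -
  have "V = (\<Inter>d\<in>Domain (Te e). {x. cinner x d = 0})" by (auto simp: V_def)
  moreover have "closed {x. cinner x d = 0}" for d :: 'k
   by (rule closed_Collect_eq[OF continuous_on_cinner[OF continuous_on_id continuous_on_const] continuous_on_const])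
  ultimately show ?thesis by (simp add: closed_INT)
 qed
 have inv: "u x \<in> V" if u: "u \<in> commutant CP" and x: "x \<in> V" for u x
  unfolding V_def
 proof (rule CollectI, rule ballI)
  fix d assume "d \<in> Domain (Te e)"
  hence "cadj u d \<in> Domain (Te e)" using T.affiliated_comm[OF Te_aff[OF e] T.comm_cadj[OF u]] by blast
  hence "cinner x (cadj u d) = 0" using x by (simp add: V_def)
  thus "cinner (u x) d = 0" by (simp add: cadj_right[OF T.comm_bcl[OF u]])
 qed
 obtain Q where Q: "Q \<in> CP" "proj Q" "!!x. Q x = x \<longleftrightarrow> x \<in> V"
  by (rule T.A_projection[where V = V, OF V1 V2], erule inv, assumption) (rule that)
 have wQ: "wt s (Q x) = Q (wt s x)" for s x
 proof (rule projection_w[OF Q(2)])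
  fix s x assume "Q x = x"
  hence x: "x \<in> V" using Q(3) by blast
  have "wt s x \<in> V" unfolding V_def
  proof (rule CollectI, rule ballI)
   fix d assume "d \<in> Domain (Te e)"
   hence "wt (- s) d \<in> Domain (Te e)" using homogD[OF Te_homog[OF e]] by blast
   hence "cinner x (wt (- s) d) = 0" using x by (simp add: V_def)
   thus "cinner (wt s x) d = 0" using cinner_w[of "- s" x d] by simp
  qed
  thus "Q (wt s x) = wt s x" using Q(3) by blast
 qed
 note Qb = proj_bcl[OF Q(2)] and p = NP_pi[OF e] and Qsa = proj_sa[OF Q(2)]
 note pb = p(2)
 have pQ: "\<pi> e (Q x) = Q x" for x
 proof -
  define d where "d = Q x - \<pi> e (Q x)"
  have pd: "\<pi> e d = 0" by (simp add: d_def bcl_diff[OF pb] proj_idem[OF p(1)])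
  hence "d \<in> Domain (Te e)" using linear_rel_zero[OF hs_linear] by (auto simp: Te_iff)
  moreover have "Q x \<in> V" using Q(3) proj_idem[OF Q(2)] by blast
  ultimately have "cinner (Q x) d = 0" by (simp add: V_def)
  moreover have "cinner (\<pi> e (Q x)) d = 0" by (simp add: self_adj_cinner[OF proj_sa[OF p(1)]] pd)
  ultimately have "cinner d d = 0" by (simp add: d_def cinner_diff_left)
  thus ?thesis by (simp add: cinner_self d_def)
 qed
 have Qp: "Q (\<pi> e x) = Q x" for x
 proof (rule cinner_ext)
  fix z show "cinner (Q (\<pi> e x)) z = cinner (Q x) z"
   by (simp add: self_adj_cinner[OF Qsa] self_adj_cinner[OF proj_sa[OF p(1)]] pQ)
 qed
 define r where "r = sib E g2 o Q"
 have le: "norm (resol h {0<..} (Q xi)) <= norm (\<pi> e xi)" for xi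
  using proj_norm[OF Q(2), of "\<pi> e xi"] by (simp add: Qp E_def[symmetric] E_pos)
 note r = hks_trace[OF e h h_homog h_aff Q(1) wQ le, folded E_def, folded r_def]
 have cr: "cadj r = Q o sib E g2" using r(2) Q(2) by (simp add: is_projection_def)
 obtain C where C: "\<nu> e = ennreal C" using NP_finite[OF e] by metis
 have "sib E g2 (Q \<eta>) = 0" for \<eta>
 proof (rule T.bounded_trace_dense[where B = "hks r" and C = C, OF hks_pos[OF r(1)] hks_mono[OF r(1)]])
  show "\<tau> (hks r n) <= ennreal C" for n using r(3)[of n] by (simp add: C)
  fix x c assume c: "!!n. inner (hks r n x) x <= c"
  \<comment> \<open>Finiteness of the limit form at \<open>x\<close> puts \<open>cadj r x\<close> in
    the domain of the root of \<open>h\<close>. That vector also lies in the range of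
    \<open>Q\<close>, hence is both in the domain of \<open>Te e\<close> and orthogonal to
    it.\<close>
  have "cadj r x \<in> Domain hs" by (rule hs_domain) (use c in "simp add: hks_form[OF r(1)]")
  moreover have "\<pi> e (cadj r x) = cadj r x" by (simp add: cr pQ)
  ultimately have "cadj r x \<in> Domain (Te e)" by (auto simp: Te_iff Domain_iff)
  moreover have "Q (cadj r x) = cadj r x" by (simp add: cr proj_idem[OF Q(2)])
  hence "cadj r x \<in> V" using Q(3) by blast
  ultimately have "cinner (cadj r x) (cadj r x) = 0" by (auto simp: V_def)
  hence "cadj r x = 0" by (simp add: cinner_self)
  thus "cinner (sib E g2 (Q \<eta>)) x = 0"
   using cadj_right[OF T.A_bcl[OF r(1)], of \<eta> x] by (simp add: r_def)
 qed
 hence "cadj Q (sib E g (Q xi)) = 0" for xi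
  using fun_cong[OF g2g2, of "Q xi"] bcl_0[OF sib_bcl[OF E g2_bdd]] bcl_0[OF bcl_cadj[OF Qb]] by simp
 hence "Q z = 0" by (rule dual_average_zero[OF Qb wQ])
 moreover have "z \<in> V" using z by (simp add: V_def)
 hence "Q z = z" using Q(3) by blast
 ultimately show "z = 0" by simp
qed

lemma Te_cdd: assumes e: "e \<in> NP" shows "cdd (Te e)"
 unfolding closed_densely_defined_def clinear_graph_iff
proof (intro conjI Te_linear e Te_dense)
 show "single_valued (Te e)"
  using clinear_graph_unique[OF hs_clinear] by (auto simp: single_valued_def Te_iff)
 show "closed (Te e)" unfolding Te_def by (rule closed_graph_comp[OF NP_pi(2)[OF e] hs_closed])
qed

text \<open>For \<open>H\<close> the square of the modulus of \<open>Te e\<close>, the elements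
  \<open>hks r n\<close> with \<open>r\<close> the root of \<open>tailinv\<close> at
  \<open>H\<close> increase to the spectral projection \<open>F {1..}\<close>, whose trace is thus
  at most \<open>\<nu> e\<close>. \<open>H\<close> has degree one, so the trace of
  \<open>F {exp s..}\<close> is \<open>exp (- s)\<close> times as large and becomes small.\<close>

lemma Te_trace_dense: assumes e: "e \<in> NP" shows "T.trace_dense (Domain (Te e))"
proof -
 note T1 = Te_cdd[OF e] and p = NP_pi[OF e]
 define H where "H = Te e O graph_adj (Te e)"
 define F where "F = resol H"
 have H: "psa H" unfolding H_def by (rule psa_square[OF T1])
 have Ha: "aff CP H" unfolding H_def by (intro T.affiliated_comp T.affiliated_adj Te_aff e)
 have Hh: "homog 1 H"
  using homog_comp[OF Te_homog[OF e] homog_adj[OF Te_homog[OF e]] graph_adj_linear] by (simp add: H_def)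
 have F: "spm F" and Fneg: "F {..<0} x = 0" for x unfolding F_def by (rule psa_resolution[OF H])+
 have FA: "B \<in> sets borel ==> F B \<in> CP" for B unfolding F_def by (rule T.resolution_A[OF H Ha])
 let ?P = "F {0<..}"
 have P: "proj ?P" by (rule sm_proj[OF F]) simp
 have Pp: "?P (\<pi> e x) = ?P x" for x
 proof -
  define d where "d = x - \<pi> e x"
  have "\<pi> e d = 0" by (simp add: d_def bcl_diff[OF p(2)] proj_idem[OF p(1)])
  hence "(d, 0) \<in> Te e" using linear_rel_zero[OF hs_linear] by (simp add: Te_iff)
  hence "(d, 0) \<in> H" unfolding H_def by (rule relcompI[OF _ linear_rel_zero[OF graph_adj_linear]])
  hence "?P d = 0" unfolding F_def spectral_kernel[OF psa_resolution(1,3)[OF H]] psa_resolution(2)[OF H] .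
  thus ?thesis by (simp add: d_def bcl_diff[OF proj_bcl[OF P]])
 qed
 have pP: "\<pi> e (?P x) = ?P x" for x
 proof (rule cinner_ext)
  fix z show "cinner (\<pi> e (?P x)) z = cinner (?P x) z"
   by (simp add: self_adj_cinner[OF proj_sa[OF P]] self_adj_cinner[OF proj_sa[OF p(1)]] Pp)
 qed
 define r where "r = sib F g2"
 have "id \<in> CP" using T.A_id by (simp add: id_def)
 moreover have "norm (resol H {0<..} (id xi)) <= norm (\<pi> e xi)" for xi
  using proj_norm[OF P, of "\<pi> e xi"] by (simp add: Pp F_def[symmetric])
 ultimately have r: "r \<in> CP" "cadj r = r" "!!n. \<tau> (hks r n) <= \<nu> e"
  using hks_trace[OF e H Hh Ha, of id] by (simp_all add: r_def F_def cadj_id)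
 note Sf = hks_form[OF r(1), unfolded r(2)] and SA = hks_pos[OF r(1)] and Smono = hks_mono[OF r(1)]
 have Sp: "pos (hks r n)" and Ssa: "self_adj (hks r n)" for n using SA by (auto simp: T.pos_part_iff pos_iff)
 have pr: "\<pi> e (r x) = r x" for x
 proof -
  have "(\<lambda>s. indicator {0<..} s * g2 s) = g2" by (auto simp: fun_eq_iff indicator_def tailinv_def)
  hence "?P (r x) = r x" unfolding r_def using sib_E[OF F g2_bdd, of "{0<..}" x] by simp
  thus ?thesis using pP[of "r x"] by simp
 qed
 have lim: "(\<lambda>n. inner (hks r n x) x) ----> (norm (F {1..} x))\<^sup>2" for x
 proof -
  have 1: "bdd_borel (\<lambda>s. cor (sqrt s) * g2 s)"
  proof (rule bdd_borelI[where K = 1])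
   show "cmod (cor (sqrt s) * g2 s) <= 1" for s
    by (auto simp: tailinv_def indicator_def norm_mult real_sqrt_divide)
  qed measurable
  have "(\<lambda>s. cor (sqrt s) * g2 s) = indicator {1..}"
   by (auto simp: fun_eq_iff tailinv_def indicator_def real_sqrt_divide)
  with si_bounded_range[OF F sq_meas g2_bdd 1, of x]
  have "(r x, F {1..} x) \<in> abs_op (Te e)"
   unfolding abs_op_eq[OF T1] H_def[symmetric] F_def[symmetric] by (simp add: r_def sib_indicator[OF F])
  from abs_op_imp(1)[OF T1 this] obtain y where y: "(r x, y) \<in> Te e" "norm y = norm (F {1..} x)" by blast
  hence "(r x, y) \<in> hs" by (simp add: Te_iff pr)
  from tendsto_power[OF tendsto_norm[OF hs_limit[OF this]], of 2] show ?thesis by (simp add: Sf y(2))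
 qed
 have inc: "incseq (\<lambda>n. inner (hks r n x) x)" for x
  using Smono by (intro incseq_SucI) (simp add: op_le_iff Ssa)
 have F1: "proj (F {1..})" by (rule sm_proj[OF F]) simp
 have "inner (hks r n x) x <= 1 * (norm x)^2" for n x
 proof -
  have "inner (hks r n x) x <= (norm (F {1..} x))^2" by (rule incseq_le[OF inc lim])
  also have "... <= (norm x)^2" by (rule power_mono[OF proj_norm[OF F1]]) simp
  finally show ?thesis by simp
 qed
 with monotone_operator_limit[where T = "hks r" and C = 1] Sp Smono
 have "\<exists>L. pos L \<and> (\<forall>x. (\<lambda>n. hks r n x) ----> L x)" by blast
 then obtain L where L: "pos L" "!!x. (\<lambda>n. hks r n x) ----> L x" by blast
 have "L = F {1..}"
 proof (rule self_adj_eq)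
  show "self_adj L" using L(1) by (simp add: pos_iff)
  show "inner (L x) x = inner (F {1..} x) x" for x
   using LIMSEQ_unique[OF tendsto_inner[OF L(2)[of x] tendsto_const[of x]] lim] by (simp add: proj_inner[OF F1])
 qed (rule proj_sa[OF F1])
 hence "\<tau> (F {1..}) = (SUP n. \<tau> (hks r n))" using T.tr_normal(2)[where x = "hks r", OF SA Smono L] by simp
 also have "... <= \<nu> e"
 proof (rule SUP_least)
  show "\<tau> (hks r n) <= \<nu> e" for n by (rule r(3))
 qed
 finally have \<tau>1: "\<tau> (F {1..}) <= \<nu> e" .
 obtain C where C: "0 <= C" "\<nu> e = ennreal C" using NP_finite[OF e] by metis
 show ?thesis
  unfolding T.trace_dense_def
 proof (intro allI impI)
  fix \<delta> :: real assume \<delta>: "\<delta> > 0"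
  \<comment> \<open>Makes \<open>exp (- s) * (C + 1)\<close> equal to \<open>\<delta>\<close>;
    adding 1 keeps the argument of the logarithm positive when \<open>C = 0\<close>.\<close>
  define s where "s = ln ((C + 1) / \<delta>)"
  have es: "exp s = (C + 1) / \<delta>" using C \<delta> by (simp add: s_def)
  have "(\<lambda>r. r / exp s) -` {1..} = {exp s..}" by (auto simp: pos_le_divide_eq)
  hence "wt s (F {1..} (wt (- s) x)) = F {exp s..} x" for x
   using homog_resolution[OF H Hh, of "{1..}" s "wt (- s) x"] by (simp add: F_def)
  hence "\<theta> s (F {1..}) = F {exp s..}" by (simp add: dual_action_def fun_eq_iff)
  hence "\<tau> (F {exp s..}) = ennreal (exp (- s)) * \<tau> (F {1..})"
   using tr_dual[OF T.proj_pos_part[OF FA F1], of s] by simp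
  also have "... <= ennreal (exp (- s)) * ennreal C" using \<tau>1 C(2) by (intro mult_left_mono) auto
  also have "... = ennreal (exp (- s) * C)" using C(1) by (simp add: ennreal_mult)
  also have "... <= ennreal \<delta>"
  proof (rule ennreal_leI)
   have "exp (- s) * C = \<delta> * (C / (C + 1))" using C(1) by (simp add: exp_minus es field_simps)
   also have "... <= \<delta> * 1" using C(1) \<delta> by (intro mult_left_mono) auto
   finally show "exp (- s) * C <= \<delta>" by simp
  qed
  finally have le: "\<tau> (F {exp s..}) <= ennreal \<delta>" .
  let ?q = "F {..<exp s}"
  have q: "?q \<in> CP" "proj ?q" by (rule FA, simp) (rule sm_proj[OF F], simp)
  have "- {..<exp s} = {exp s..}" by auto
  hence "(\<lambda>xi. xi - ?q xi) = F {exp s..}" using sm_compl[OF F, of "{..<exp s}"] by (simp add: fun_eq_iff)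
  hence "\<tau> (\<lambda>xi. xi - ?q xi) <= ennreal \<delta>" using le by simp
  moreover have "x \<in> Domain (Te e)" if x: "?q x = x" for x
  proof -
   have "{..<exp s} = {..<0} \<union> {0..<exp s}" by (auto simp: not_less intro: less_trans[OF _ exp_gt_zero])
   moreover have "{..<0} \<inter> {0..<exp s} = {}" by auto
   ultimately have x0: "F {0..<exp s} x = x" using x sm_Un[OF F, of "{..<0}" "{0..<exp s}" x] Fneg[of x] by simp
   have B: "{0..<exp s} \<in> sets borel" by simp
   have i: "bdd_borel (indicator {0..<exp s} :: real => complex)" by (rule bdd_borel_indicator[OF B])
   have "bdd_borel (\<lambda>r. indicator {0..<exp s} r * cor (sqrt r))"
    by (rule bdd_borel_indicator_mult[where K = "sqrt (exp s)", OF sq_meas B]) auto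
   hence b: "bdd_borel (\<lambda>r. cor (sqrt r) * indicator {0..<exp s} r)" by (simp add: mult.commute)
   from si_bounded_range[OF F sq_meas i b, of x] x0
   obtain z where "(x, z) \<in> sint F (\<lambda>r. cor (sqrt r))" by (auto simp: sib_indicator[OF F B])
   hence "(x, z) \<in> abs_op (Te e)" unfolding abs_op_eq[OF T1] H_def[symmetric] F_def[symmetric] .
   from abs_op_imp(1)[OF T1 this] show ?thesis by blast
  qed
  ultimately show "\<exists>p\<in>CP. proj p \<and> (\<forall>x. p x = x --> x \<in> Domain (Te e)) \<and> \<tau> (\<lambda>xi. xi - p xi) <= ennreal \<delta>"
   using q by blast
 qed
qed

end

section \<open>Weighted operators\<close>

context canonical
begin

text \<open>The characteristic function of the standard normal law at \<open>ln r\<close>, so at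
  \<open>h\<close> it is the Gaussian average of the operators \<open>lm t\<close>. It decays fast
  enough at infinity to absorb the growth of \<open>kappa\<close>.\<close>

definition "gauss r = indicator {0<..} r * exp (- (ln r)\<^sup>2 / 2)" for r :: real

lemma gauss_meas [measurable]: "gauss \<in> BM"
 unfolding gauss_def by measurable

lemma gauss_bounds: "0 <= gauss r" "gauss r <= 1"
 by (auto simp: gauss_def indicator_def)

lemma gauss_bdd: "bdd_borel (\<lambda>r. cor (gauss r))"
 by (rule bdd_borel_of_real[where K = 1]) (use gauss_bounds in auto)

lemma gauss_iph: "cor (gauss r) = (\<integral>t. iph t r \<partial>std_normal_distribution)"
proof (cases "r > 0")
 case True
 have "(\<integral>t. iph t r \<partial>std_normal_distribution) = char std_normal_distribution (ln r)"
  using True by (simp add: char_def iph_def cis_conv_exp mult.commute mult.left_commute)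
 thus ?thesis using True by (simp add: char_std_normal_distribution gauss_def)
qed (simp add: gauss_def iph_def)

text \<open>Fubini for the scalar measure and the normal law. Only quadratic forms are averaged, so
  no operator-valued integral is needed; \<open>gauss_orth\<close> polarises.\<close>

lemma gauss_form:
 "integrable std_normal_distribution (\<lambda>t. cinner (lm t x) x)"
 "cinner (sib E (\<lambda>r. cor (gauss r)) x) x =
   (\<integral>t. cinner (lm t x) x \<partial>std_normal_distribution)"
proof -
 define \<mu> where "\<mu> = scm E x"
 let ?N = std_normal_distribution
 have [measurable_cong]: "sets \<mu> = sets borel" by (simp add: \<mu>_def scalar_measure_sets[OF E])
 interpret N: real_distribution ?N by (rule real_dist_normal_dist)
 interpret \<mu>: finite_measure \<mu> unfolding \<mu>_def by (rule finite_scalar[OF E])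
 interpret P: pair_sigma_finite ?N \<mu> ..
 interpret NP: finite_measure "?N \<Otimes>\<^sub>M \<mu>" by (rule finite_measure_pair_measure) unfold_locales
 have m: "(\<lambda>(t, r). iph t r) \<in> borel_measurable (?N \<Otimes>\<^sub>M \<mu>)" unfolding iph_def cis_conv_exp by measurable
 have i: "integrable (?N \<Otimes>\<^sub>M \<mu>) (\<lambda>(t, r). iph t r)"
  by (rule NP.integrable_const_bound[where B = 1, OF _ m]) (auto simp: iph_def)
 have q: "cinner (lm t x) x = (\<integral>r. iph t r \<partial>\<mu>)" for t
  unfolding lam_eq \<mu>_def by (rule sib_form[OF E iph_bdd])
 show "integrable ?N (\<lambda>t. cinner (lm t x) x)"
  unfolding q using P.integrable_fst'[OF i] by simp
 have "cinner (sib E (\<lambda>r. cor (gauss r)) x) x = (\<integral>r. (\<integral>t. iph t r \<partial>?N) \<partial>\<mu>)"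
  unfolding \<mu>_def gauss_iph[symmetric] by (rule sib_form[OF E gauss_bdd])
 also have "... = (\<integral>t. (\<integral>r. iph t r \<partial>\<mu>) \<partial>?N)" by (rule P.Fubini_integral[OF i])
 finally show "cinner (sib E (\<lambda>r. cor (gauss r)) x) x = (\<integral>t. cinner (lm t x) x \<partial>?N)"
  by (simp only: q)
qed

lemma gauss_orth:
 assumes 0: "!!t. cinner (lm t x) y = 0"
 shows "cinner (sib E (\<lambda>r. cor (gauss r)) x) y = 0"
proof -
 let ?N = std_normal_distribution
 let ?q = "\<lambda>z t. cinner (lm t z) z"
 note i = gauss_form(1)
 have "4 * cinner (sib E (\<lambda>r. cor (gauss r)) x) y =
  (\<integral>t. ?q (x + y) t \<partial>?N) - (\<integral>t. ?q (x - y) t \<partial>?N) + \<i> * (\<integral>t. ?q (x + \<i> *\<^sub>C y) t \<partial>?N) - \<i> * (\<integral>t. ?q (x - \<i> *\<^sub>C y) t \<partial>?N)"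
  unfolding cinner_polarization[OF sib_bcl[OF E gauss_bdd], of x y] gauss_form(2) by simp
 also have "... = (\<integral>t. ?q (x + y) t - ?q (x - y) t + \<i> * ?q (x + \<i> *\<^sub>C y) t - \<i> * ?q (x - \<i> *\<^sub>C y) t \<partial>?N)"
  by (simp add: i)
 also have "(\<lambda>t. ?q (x + y) t - ?q (x - y) t + \<i> * ?q (x + \<i> *\<^sub>C y) t - \<i> * ?q (x - \<i> *\<^sub>C y) t) =
  (\<lambda>t. 4 * cinner (lm t x) y)"
  unfolding cinner_polarization[OF lam_bcl, of _ x y] by (simp add: fun_eq_iff diff_divide_distrib add_divide_distrib)
 finally show ?thesis by (simp add: 0)
qed

lemma lam_E: "B \<in> sets borel ==> lm t (E B x) = E B (lm t x)"
 using lam_sib[OF bdd_borel_indicator, of B t x] by (simp add: sib_indicator[OF E])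

end

text \<open>Both fundamental functions enter only through these quasiconcavity properties, which
  lets the two kinds of Orlicz space be treated together.\<close>

locale weighted = canonical +
 fixes \<phi> :: "real => real"
 assumes phi_meas: "\<phi> \<in> BM"
  and phi_nonpos: "r <= 0 ==> \<phi> r = 0" and phi_pos: "0 < r ==> 0 < \<phi> r"
  and phi_mono: "0 < r ==> r <= r' ==> \<phi> r <= \<phi> r'"
  and phi_quot: "0 < r ==> r <= r' ==> r * \<phi> r' <= r' * \<phi> r"
begin

declare phi_meas [measurable]

definition "kappa r = cor (sqrt (\<phi> r))"

lemma kappa_meas [measurable]: "kappa \<in> BM"
 unfolding kappa_def by measurable

lemma phi_nonneg: "0 <= \<phi> r"
 using phi_nonpos[of r] phi_pos[of r] by (cases "0 < r") auto

lemma phi_bound: "\<phi> r <= \<phi> 1 * (1 + \<bar>r\<bar>)"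
proof -
 have p: "0 < \<phi> 1" by (rule phi_pos) simp
 consider "r <= 0" | "0 < r" "r <= 1" | "1 <= r" by linarith
 thus ?thesis
 proof cases
  case 1 thus ?thesis using p by (simp add: phi_nonpos)
 next
  case 2
  have "\<phi> r <= \<phi> 1 * 1" using phi_mono[OF 2] by simp
  also have "... <= \<phi> 1 * (1 + \<bar>r\<bar>)" using p by (intro mult_left_mono) auto
  finally show ?thesis .
 next
  case 3
  have "\<phi> r <= \<phi> 1 * r" using phi_quot[OF _ 3] by (simp add: mult.commute)
  also have "... <= \<phi> 1 * (1 + \<bar>r\<bar>)" using p by (intro mult_left_mono) auto
  finally show ?thesis .
 qed
qed

section \<open>The operator \<open>k\<close> and its products with projections of finite
  weight\<close>

definition "k = sint E kappa"

lemma k_sym: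
 assumes "(x, y) \<in> k" "(x', y') \<in> k" shows "cinner y x' = cinner x y'"
proof -
 let ?c = "\<lambda>n. sib E (cutoff kappa n)"
 have b: "bdd_borel (cutoff kappa n)" for n by (rule bdd_borel_cutoff[OF kappa_meas])
 have sa: "self_adj (?c n)" for n by (rule sib_self_adj[OF E b]) (simp add: cutoff_def kappa_def)
 have "(\<lambda>n. cinner (?c n x) x') ----> cinner y x'"
  by (rule tendsto_cinner[OF si_D[OF E assms(1)[unfolded k_def]] tendsto_const])
 moreover have "(\<lambda>n. cinner x (?c n x')) ----> cinner x y'"
  by (rule tendsto_cinner[OF tendsto_const si_D[OF E assms(2)[unfolded k_def]]])
 ultimately show ?thesis by (simp only: self_adj_cinner[OF sa]) (rule LIMSEQ_unique)
qed

lemma k_psa: "psa k"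
proof (rule positive_selfadjointI)
 show "clinear_graph k" unfolding k_def by (rule si_clinear[OF E kappa_meas])
 show "cinner y x' = cinner x y'" if "(x, y) \<in> k" "(x', y') \<in> k" for x y x' y' by (rule k_sym[OF that])
 show "0 <= inner y x" if xy: "(x, y) \<in> k" for x y
 proof -
  let ?c = "\<lambda>n. sib E (cutoff kappa n)"
  have b: "bdd_borel (cutoff kappa n)" for n by (rule bdd_borel_cutoff[OF kappa_meas])
  have "0 <= inner (?c n x) x" for n
  proof -
   have e: "cutoff kappa n = (\<lambda>r. cor (if sqrt (\<phi> r) <= real n then sqrt (\<phi> r) else 0))"
    by (auto simp: cutoff_def kappa_def fun_eq_iff phi_nonneg)
   have "cinner (?c n x) x =
    cor (\<integral>r. (if sqrt (\<phi> r) <= real n then sqrt (\<phi> r) else 0) \<partial>scm E x)"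
    unfolding sib_form[OF E b] unfolding e by (rule integral_complex_of_real)
   thus ?thesis by (simp add: inner_eq_Re_cinner phi_nonneg)
  qed
  moreover have "(\<lambda>n. inner (?c n x) x) ----> inner y x"
   by (rule tendsto_inner[OF si_D[OF E xy[unfolded k_def]] tendsto_const])
  ultimately show ?thesis by (intro LIMSEQ_le_const) auto
 qed
 show "\<exists>x. (x, z - x) \<in> k" for z
 proof -
  let ?g = "\<lambda>r. cor (1 / (1 + sqrt (\<phi> r)))"
  have p: "0 < 1 + sqrt (\<phi> r)" for r using phi_nonneg[of r] by (simp add: add_pos_nonneg)
  have g: "bdd_borel ?g"
  proof (rule bdd_borel_of_real[where K = 1])
   show "\<bar>1 / (1 + sqrt (\<phi> r))\<bar> <= 1" for r using p[of r] phi_nonneg[of r] by (simp add: divide_le_eq)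
  qed measurable
  have kg': "kappa r * ?g r = 1 - ?g r" for r
  proof -
   have "sqrt (\<phi> r) * (1 / (1 + sqrt (\<phi> r))) = 1 - 1 / (1 + sqrt (\<phi> r))" using p[of r] by (simp add: field_simps)
   thus ?thesis unfolding kappa_def of_real_mult[symmetric] by (simp only:) simp
  qed
  have kg: "bdd_borel (\<lambda>r. kappa r * ?g r)" unfolding kg' by (rule bdd_borel_diff[OF bdd_borel_const g])
  have "sib E (\<lambda>r. kappa r * ?g r) z = z - sib E ?g z"
   unfolding kg' sib_diff[OF E bdd_borel_const g] by (simp add: sib_const[OF E])
  thus ?thesis using si_bounded_range[OF E kappa_meas g kg, of z] by (auto simp: k_def)
 qed
qed

lemmas k_clinear = psa_clinear[OF k_psa] and k_linear = psa_linear[OF k_psa] and k_closed = psa_closed[OF k_psa]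
 and k_adj = psa_adj[OF k_psa]

lemma k_aff: "aff CP k"
 unfolding k_def E_def by (rule T.affiliated_si[OF h h_aff kappa_meas])

text \<open>Monotonicity bounds \<open>kappa\<close> on \<open>r <= 1\<close>, and monotonicity of
  the quotient bounds \<open>kappa r / sqrt r\<close> beyond. Splitting each cutoff at 1 writes it
  as a bounded function plus a bounded multiple of the square root.\<close>

lemma hs_k: "Domain hs \<subseteq> Domain k"
proof
 fix x assume "x \<in> Domain hs"
 then obtain y where xy: "(x, y) \<in> sint E (\<lambda>r. cor (sqrt r))" by (auto simp: hs_def)
 define K where "K = sqrt (2 * \<phi> 1)"
 have K: "0 <= K" using phi_nonneg by (simp add: K_def)
 have low: "cmod (kappa r) <= K" if "r <= 1" for r
 proof (cases "0 < r")
  case True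
  hence "\<phi> r <= \<phi> 1" using that by (rule phi_mono)
  hence "\<phi> r <= 2 * \<phi> 1" using phi_nonneg[of 1] by simp
  thus ?thesis by (simp add: kappa_def K_def phi_nonneg del: real_sqrt_mult)
 qed (use K in "simp add: kappa_def phi_nonpos")
 have high: "cmod (kappa r / cor (sqrt r)) <= K" if "r > 1" for r
 proof -
  have "\<phi> r <= r * \<phi> 1" using phi_quot[of 1 r] that by simp
  hence "\<phi> r / r <= \<phi> 1" using that by (simp add: divide_le_eq mult.commute)
  hence "\<phi> r / r <= 2 * \<phi> 1" using phi_nonneg[of 1] by linarith
  thus ?thesis using that by (simp add: kappa_def K_def norm_divide phi_nonneg real_sqrt_divide[symmetric] del: real_sqrt_mult real_sqrt_divide)
 qed
 have "norm (sib E (cutoff kappa n) x) <= K * norm x + K * norm y" for n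
 proof -
  let ?S = "{r. cmod (kappa r) <= real n}"
  have S: "?S \<in> sets borel" by (rule cutoff_set[OF kappa_meas])
  let ?g1 = "\<lambda>r. indicator (?S \<inter> {..1}) r * kappa r"
  let ?g2 = "\<lambda>r. indicator (?S \<inter> {1<..}) r * (kappa r / cor (sqrt r))"
  have S1: "?S \<inter> {..1} \<in> sets borel" and S2: "?S \<inter> {1<..} \<in> sets borel" using S by auto
  have c1: "cmod (?g1 r) <= K" for r
   using low[of r] K by (cases "r \<in> ?S \<inter> {..1}") simp_all
  have c2: "cmod (?g2 r) <= K" for r
  proof (cases "r \<in> ?S \<inter> {1<..}")
   case True
   hence "?g2 r = kappa r / cor (sqrt r)" by simp
   thus ?thesis using high[of r] True by (simp only:) simp
  next
   case False
   hence "?g2 r = 0" by simp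
   thus ?thesis using K by (simp only: norm_zero)
  qed
  have "?g1 \<in> BM" using S1 by measurable
  hence g1: "bdd_borel ?g1" by (rule bdd_borelI[OF _ c1])
  have "?g2 \<in> BM" using S2 by measurable
  hence g2: "bdd_borel ?g2" by (rule bdd_borelI[OF _ c2])
  have gf: "bdd_borel (\<lambda>r. ?g2 r * cor (sqrt r))"
  proof (rule bdd_borelI[where K = "real n"])
   show "cmod (?g2 r * cor (sqrt r)) <= real n" for r
   proof (cases "r \<in> ?S \<inter> {1<..}")
    case True
    hence "?g2 r * cor (sqrt r) = kappa r" by simp
    thus ?thesis using True by simp
   qed simp
   show "(\<lambda>r. ?g2 r * cor (sqrt r)) \<in> BM" using S2 by measurable
  qed
  have "cutoff kappa n = (\<lambda>r. ?g1 r + ?g2 r * cor (sqrt r))"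
  proof
   fix r show "cutoff kappa n r = ?g1 r + ?g2 r * cor (sqrt r)"
    by (cases "r <= 1") (simp_all add: cutoff_def indicator_def)
  qed
  hence "sib E (cutoff kappa n) x = sib E ?g1 x + sib E ?g2 y"
   by (simp only: sib_add[OF E g1 gf] si_apply[OF E xy sq_meas g2 gf])
  also have "norm ... <= K * norm x + K * norm y"
   by (rule order_trans[OF norm_triangle_ineq add_mono[OF sib_norm_le[OF E g1 c1] sib_norm_le[OF E g2 c2]]])
  finally show ?thesis .
 qed
 from si_exists[OF E kappa_meas this] show "x \<in> Domain k" by (auto simp: k_def)
qed

text \<open>The unclosed right factor of the products defining the space; the left factor, a strong
  product, is exactly its adjoint by \<open>Rop_adj\<close>. In this order the operator is
  closed.\<close>

definition "Rop e = graph (\<pi> e) O k"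

lemma Rop_iff: "(x, y) \<in> Rop e \<longleftrightarrow> (\<pi> e x, y) \<in> k"
 by (auto simp: Rop_def)

lemma Rop_cdd: assumes e: "e \<in> NP" shows "cdd (Rop e)"
 unfolding closed_densely_defined_def clinear_graph_iff
proof (intro conjI)
 show "linear_rel (Rop e)" unfolding Rop_def by (intro linear_rel_comp linear_rel_graph NP_pi k_linear e)
 show "single_valued (Rop e)"
  using clinear_graph_unique[OF k_clinear] by (auto simp: single_valued_def Rop_iff)
 show "closed (Rop e)" unfolding Rop_def by (rule closed_graph_comp[OF NP_pi(2)[OF e] k_closed])
 have "Domain (Te e) \<subseteq> Domain (Rop e)" using hs_k by (force simp: Te_iff Rop_iff)
 thus "closure (Domain (Rop e)) = UNIV" using Te_dense[OF e] closure_mono by blast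
qed

lemma Rop_aff: "e \<in> NP ==> aff CP (Rop e)"
 unfolding Rop_def by (intro T.affiliated_comp T.affiliated_graph NP_pi k_aff)

lemma Rop_trace_dense: assumes e: "e \<in> NP" shows "T.trace_dense (Domain (Rop e))"
proof -
 have "Domain (Te e) \<subseteq> Domain (Rop e)" using hs_k by (force simp: Te_iff Rop_iff)
 thus ?thesis by (rule T.trace_dense_mono[OF Te_trace_dense[OF e]])
qed

lemma Rop_adj: assumes e: "e \<in> NP" shows "graph_adj (Rop e) = closure (k O graph (\<pi> e))"
proof -
 let ?S = "k O graph (\<pi> e)"
 have "graph_adj ?S = Rop e"
 proof (intro set_eqI)
  fix p show "p \<in> graph_adj ?S \<longleftrightarrow> p \<in> Rop e"
  proof (cases p)
   case (Pair y z)
   have "(y, z) \<in> graph_adj ?S \<longleftrightarrow> (\<forall>x w. (x, w) \<in> k --> cinner (\<pi> e w) y = cinner x z)"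
   proof -
    have "(y, z) \<in> graph_adj ?S \<longleftrightarrow> (\<forall>x v. (x, v) \<in> ?S --> cinner v y = cinner x z)"
     by (auto simp: graph_adj_def)
    thus ?thesis by (auto simp: relcomp_unfold)
   qed
   also have "... \<longleftrightarrow> (\<pi> e y, z) \<in> graph_adj k"
    by (auto simp: graph_adj_def self_adj_cinner[OF proj_sa[OF NP_pi(1)[OF e]]])
   finally show ?thesis using Pair by (simp add: k_adj Rop_iff)
  qed
 qed
 moreover have "linear_rel ?S" by (intro linear_rel_comp linear_rel_graph NP_pi k_linear e)
 ultimately show ?thesis using graph_adj2 by metis
qed

text \<open>\<open>lm t\<close> is an imaginary power of \<open>h\<close>, hence commutes with
  \<open>k\<close>, and it conjugates \<open>\<pi> e\<close> into
  \<open>\<pi> (\<sigma> t e)\<close>.\<close>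

lemma Rop_lam: assumes e: "e \<in> NP" and xy: "(x, y) \<in> Rop e"
 shows "(lm t x, lm t y) \<in> Rop (\<sigma> t e)"
proof -
 have "(lm t (\<pi> e x), lm t y) \<in> sint E (\<lambda>r. kappa r)"
 proof (rule si_intertwine[where \<phi> = "\<lambda>r. r", OF E E lam_bcl _ _ kappa_meas])
  show "lm t (E B x) = E ((\<lambda>r. r) -` B) (lm t x)" if "B \<in> sets borel" for B x
   using lam_E[OF that] by (simp add: vimage_def)
  show "(\<pi> e x, y) \<in> sint E kappa" using xy by (simp add: Rop_iff k_def)
 qed simp
 thus ?thesis by (simp add: Rop_iff k_def lam_pi[OF NP_D(1)[OF e]])
qed

lemma kappa_gauss_bound: "cmod (kappa r * cor (gauss r)) <= sqrt (\<phi> 1 * (1 + exp 1))"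
proof (cases "r > 0")
 case True
 define L where "L = ln r"
 have r: "r = exp L" using True by (simp add: L_def)
 have "\<phi> r * (gauss r)^2 <= (\<phi> 1 * (1 + exp L)) * exp (- L\<^sup>2)"
 proof -
  have "(gauss r)^2 = exp (- L\<^sup>2)" using True by (simp add: gauss_def L_def power2_eq_square flip: exp_add)
  moreover have "\<phi> r <= \<phi> 1 * (1 + exp L)" using phi_bound[of r] by (simp add: r)
  ultimately show ?thesis by (simp add: mult_right_mono)
 qed
 also have "... = \<phi> 1 * (exp (- L\<^sup>2) + exp (L - L\<^sup>2))" by (simp add: algebra_simps exp_diff exp_minus field_simps)
 also have "... <= \<phi> 1 * (1 + exp 1)"
 proof (intro mult_left_mono add_mono phi_nonneg)
  have "0 <= (L - 1 / 2)^2" by simp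
  thus "exp (L - L\<^sup>2) <= exp 1" by (simp add: power2_eq_square algebra_simps)
 qed simp
 finally have "\<phi> r * (gauss r)^2 <= \<phi> 1 * (1 + exp 1)" .
 hence "sqrt (\<phi> r * (gauss r)^2) <= sqrt (\<phi> 1 * (1 + exp 1))" by (rule real_sqrt_le_mono)
 moreover have "cmod (kappa r * cor (gauss r)) = sqrt (\<phi> r * (gauss r)^2)"
  using gauss_bounds(1)[of r] phi_nonneg[of r] by (simp add: kappa_def norm_mult real_sqrt_mult)
 ultimately show ?thesis by simp
qed (simp add: gauss_def phi_nonneg)

text \<open>The orthogonal complement of all ranges is invariant under \<open>h\<^sup>i\<^sup>t\<close>, hence under Gaussian functions of
 \<open>ln h\<close>, which map into the domain of \<open>\<phi>(h)\<^sup>1\<^sup>/\<^sup>2\<close>.\<close>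

lemma range_total:
 assumes v: "!!e x y. e \<in> NP ==> (x, y) \<in> Rop e ==> cinner v y = 0" shows "v = 0"
proof -
 let ?g = "\<lambda>r. cor (gauss r)"
 define v' where "v' = sib E ?g v"
 have v': "cinner v' y = 0" if e: "e \<in> NP" and xy: "(x, y) \<in> Rop e" for e x y
  unfolding v'_def
 proof (rule gauss_orth)
  fix t
  have "cinner v (lm (- t) y) = 0" by (rule v[OF NP_sig[OF e] Rop_lam[OF e xy]])
  thus "cinner (lm t v) y = 0" using cadj_right[OF lam_bcl, of t v y] by (simp add: cadj_lam)
 qed
 have kg: "bdd_borel (\<lambda>r. kappa r * ?g r)" by (rule bdd_borelI[OF _ kappa_gauss_bound]) measurable
 define y where "y = sib E (\<lambda>r. kappa r * ?g r) v"
 have y: "(v', y) \<in> k" unfolding k_def v'_def y_def by (rule si_bounded_range[OF E kappa_meas gauss_bdd kg])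
 have "\<pi> e y = 0" if e: "e \<in> NP" for e
 proof (rule dense_orthogonal[OF cdd_dense[OF Rop_cdd[OF e]]])
  fix x assume "x \<in> Domain (Rop e)"
  then obtain u where u: "(x, u) \<in> Rop e" by blast
  have "cinner y (\<pi> e x) = cinner v' u" using k_sym[OF y, of "\<pi> e x" u] u by (simp add: Rop_iff)
  thus "cinner (\<pi> e y) x = 0" by (simp add: self_adj_cinner[OF proj_sa[OF NP_pi(1)[OF e]]] v'[OF e u])
 qed
 hence "y = 0" by (rule NP_total)
 thus ?thesis unfolding y_def
 proof (rule sib_injective[OF kg, rotated])
  show "kappa r * cor (gauss r) ~= 0" if "0 < r" for r
   using phi_pos[OF that] that by (simp add: kappa_def gauss_def)
 qed
qed

text \<open>The value 1 on \<open>r <= 0\<close>, where \<open>\<phi>\<close> vanishes, keeps the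
  function invertible on the whole line.\<close>

definition "dil s r = (if 0 < r then sqrt (\<phi> (r / exp s) / \<phi> r) else 1)"

lemma dil_meas [measurable]: "dil s \<in> BM"
 unfolding dil_def by measurable

lemma dil_pos: "0 < dil s r"
 using phi_pos[of r] phi_pos[of "r / exp s"] by (simp add: dil_def)

lemma dil_le_1: "0 <= s ==> dil s r <= 1"
 using phi_pos[of r] phi_mono[of "r / exp s" r] by (auto simp: dil_def divide_le_eq mult_le_cancel_left1)

lemma dil_le: "dil s r <= exp \<bar>s\<bar>"
proof (cases "0 <= s")
 case True
 have "dil s r <= 1" by (rule dil_le_1[OF True])
 thus ?thesis by (rule order_trans) simp
next
 case False
 show ?thesis
 proof (cases "0 < r")
  case True
  have "r <= r / exp s" using False True by (simp add: pos_le_divide_eq mult_le_cancel_left1)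
  from phi_quot[OF True this] have "\<phi> (r / exp s) / \<phi> r <= exp (- s)"
   using True phi_pos[OF True] by (simp add: divide_le_eq exp_minus field_simps)
  also have "... <= (exp \<bar>s\<bar>)^2" using False by (simp add: power2_eq_square flip: exp_add)
  finally show ?thesis using True by (simp add: dil_def real_le_lsqrt)
 qed (simp add: dil_def)
qed

text \<open>The reciprocal is the factor for \<open>- s\<close> at the dilated point
  \<open>r / exp s\<close>, so \<open>dil_le\<close> bounds it as well.\<close>

lemma dil_inverse: "1 / dil s r <= exp \<bar>s\<bar>"
proof (cases "0 < r")
 case True
 have "1 / dil s r = dil (- s) (r / exp s)"
  using True by (simp add: dil_def exp_minus real_sqrt_divide)
 thus ?thesis using dil_le[of "- s" "r / exp s"] by simp
qed (simp add: dil_def)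

definition "DD s = sib E (\<lambda>r. cor (dil s r))"
definition "DI s = sib E (\<lambda>r. cor (1 / dil s r))"

lemma dil_bdd: "bdd_borel (\<lambda>r. cor (dil s r))"
 by (rule bdd_borel_of_real[where K = "exp \<bar>s\<bar>"]) (use dil_le dil_pos in "auto simp: abs_of_pos")

lemma dili_bdd: "bdd_borel (\<lambda>r. cor (1 / dil s r))"
proof (rule bdd_borel_of_real[where K = "exp \<bar>s\<bar>"])
 show "\<bar>1 / dil s r\<bar> <= exp \<bar>s\<bar>" for r using dil_inverse[of s r] dil_pos[of s r] by simp
qed measurable

lemma DD_DI: "DD s (DI s x) = x" "DI s (DD s x) = x"
proof -
 have "cor (dil s r) * cor (1 / dil s r) = 1"
  "cor (1 / dil s r) * cor (dil s r) = 1" for r using dil_pos[of s r] by simp_all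
 thus "DD s (DI s x) = x" "DI s (DD s x) = x"
  unfolding DD_def DI_def by (simp_all only: sib_mult[OF E dil_bdd dili_bdd] sib_mult[OF E dili_bdd dil_bdd] sib_const[OF E] scaleC_one)
qed

lemma DD_CP: "DD s \<in> CP" and DD_sa: "self_adj (DD s)" and DD_bcl: "bcl (DD s)" and DI_bcl: "bcl (DI s)"
proof -
 show "DD s \<in> CP" unfolding DD_def E_def by (rule T.sib_A[OF h h_aff dil_bdd])
 show "self_adj (DD s)" unfolding DD_def by (rule sib_self_adj[OF E dil_bdd]) simp
 thus "bcl (DD s)" by (rule self_adj_bcl)
 show "bcl (DI s)" unfolding DI_def by (rule sib_bcl[OF E dili_bdd])
qed

lemma DD_norm: "0 <= s ==> norm (DD s x) <= norm x"
 unfolding DD_def using sib_norm_le[OF E dil_bdd, of s 1 x] dil_le_1[of s] dil_pos[of s]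
 by (simp add: abs_of_pos)

text \<open>Covariance of \<open>k\<close> read on vectors: dilating the symbol costs the factor
  \<open>dil s\<close>, and the bounded inverse \<open>DI s\<close> restores
  \<open>kappa\<close>.\<close>

lemma k_w: assumes xy: "(x, y) \<in> k" shows "(wt s x, DI s (wt s y)) \<in> k"
proof -
 have "(wt s x, wt s y) \<in> sint E (\<lambda>r. kappa (r / exp s))"
  using homog_si[OF h h_homog kappa_meas, of x y s] xy by (simp add: k_def E_def)
 moreover have "(\<lambda>r. kappa (r / exp s)) \<in> BM" by measurable
 ultimately have "(wt s x, DI s (wt s y)) \<in> sint E (\<lambda>r. cor (1 / dil s r) * kappa (r / exp s))"
  unfolding DI_def using si_left[OF E _ dili_bdd] by blast
 moreover have "cor (1 / dil s r) * kappa (r / exp s) = kappa r" for r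
 proof (cases "0 < r")
  case True
  thus ?thesis using phi_pos[of r] phi_pos[of "r / exp s"]
   by (simp add: dil_def kappa_def real_sqrt_divide)
 next
  case False
  hence "r / exp s <= 0" by (simp add: divide_le_0_iff)
  thus ?thesis using False by (simp add: kappa_def phi_nonpos)
 qed
 ultimately show ?thesis by (simp add: k_def)
qed

lemma Rop_w: assumes e: "e \<in> NP" and xy: "(x, y) \<in> Rop e" shows "(wt s x, DI s (wt s y)) \<in> Rop e"
 using k_w[of "\<pi> e x" y s] xy by (simp add: Rop_iff w_pi[OF NP_D(1)[OF e]])

end

context vn_trace
begin

lemma trace_dense_UNIV: "trace_dense UNIV"
 unfolding trace_dense_def
proof (intro allI impI)
 fix \<delta> :: real
 have "proj (\<lambda>x::'a. x)" by (simp add: is_projection_iff self_adj_id)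
 thus "\<exists>p\<in>A. proj p \<and> (\<forall>x. p x = x --> x \<in> UNIV) \<and> \<tau> (\<lambda>xi. xi - p xi) <= ennreal \<delta>"
  using A_id by (intro bexI[of _ "\<lambda>x. x"]) (simp_all add: tr_zero)
qed

lemma core_orth:
 assumes T: "cdd T" "aff A T" and V: "trace_dense V" "csubspace V"
  and 0: "!!x y. (x, y) \<in> T ==> x \<in> V ==> cinner z y = 0" and xy: "(x, y) \<in> T"
 shows "cinner z y = 0"
proof -
 obtain X where X: "!!n. X n \<in> {(a, b). (a, b) \<in> T \<and> a \<in> V}" "X ----> (x, y)"
  using trace_dense_core[OF T V xy] by (auto simp: closure_sequential)
 have "cinner z (snd (X n)) = 0" for n using X(1)[of n] 0[of "fst (X n)" "snd (X n)"] by (auto simp: split_beta)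
 moreover have "(\<lambda>n. snd (X n)) ----> y" using tendsto_snd[OF X(2)] by simp
 hence "(\<lambda>n. cinner z (snd (X n))) ----> cinner z y" by (rule tendsto_cinner[OF tendsto_const])
 ultimately show ?thesis by (simp add: LIMSEQ_const_iff)
qed

end

lemma csubspace_Int: "csubspace V ==> csubspace W ==> csubspace (V \<inter> W)"
 by (auto simp: csubspace_def)

text \<open>The dual action carries a projection under \<open>V\<close> to one under the new
  subspace and multiplies the trace of its complement by \<open>exp s\<close>, whence the tolerance
  \<open>\<delta> * exp (- s)\<close>.\<close>

lemma (in canonical) trace_dense_w:
 assumes V: "T.trace_dense V" shows "T.trace_dense {x. wt s x \<in> V}"
 unfolding T.trace_dense_def
proof (intro allI impI)
 fix \<delta> :: real assume \<delta>: "\<delta> > 0"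
 hence "\<delta> * exp (- s) > 0" by simp
 then obtain p where p: "p \<in> CP" "proj p" "!!x. p x = x ==> x \<in> V" "\<tau> (\<lambda>xi. xi - p xi) <= ennreal (\<delta> * exp (- s))"
  by (rule T.trace_denseE[OF V]) (rule that)
 let ?q = "\<theta> (- s) p"
 have "(\<lambda>xi. xi - ?q xi) = \<theta> (- s) (\<lambda>xi. xi - p xi)"
  by (simp add: dual_action_def fun_eq_iff bcl_diff[OF w_bcl])
 moreover have "(\<lambda>xi. xi - p xi) \<in> pos_part CP"
  by (intro T.proj_pos_part T.A_minus T.A_id p proj_compl)
 ultimately have "\<tau> (\<lambda>xi. xi - ?q xi) = ennreal (exp s) * \<tau> (\<lambda>xi. xi - p xi)" using tr_dual[of _ "- s"] by simp
 also have "... <= ennreal (exp s) * ennreal (\<delta> * exp (- s))" by (intro mult_left_mono p(4)) simp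
 also have "... = ennreal \<delta>" using \<delta> by (simp add: exp_minus field_simps flip: ennreal_mult)
 finally have "\<tau> (\<lambda>xi. xi - ?q xi) <= ennreal \<delta>" .
 moreover have "wt s x \<in> V" if "?q x = x" for x
 proof (rule p(3))
  have "wt s (?q x) = wt s x" by (simp only: that)
  thus "p (wt s x) = wt s x" by (simp add: dual_action_def)
 qed
 ultimately show "\<exists>p\<in>CP. proj p \<and> (\<forall>x. p x = x --> x \<in> {x. wt s x \<in> V}) \<and> \<tau> (\<lambda>xi. xi - p xi) <= ennreal \<delta>"
  using dual_action_CP[OF p(1), of "- s"] dual_action_proj[OF p(2), of "- s"] by blast
qed

section \<open>The dilated operator\<close>

text \<open>The last assumption records only that the unclosed triple product lies in a
  single-valued operator of degree one. This avoids associativity of strong products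
  altogether.\<close>

locale element = weighted M \<iota> \<sigma> \<nu> \<tau> h \<phi>
 for M :: "('h::chilbert_space => 'h) set" and \<iota> :: "(real => 'h) => 'k::chilbert_space" and \<sigma> \<nu> \<tau> h \<phi> +
 fixes a :: "'k uop" and s :: real
 assumes a_cdd: "cdd a" and a_aff: "aff (crossed_product M \<sigma> \<iota>) a"
  and a_dense: "T.trace_dense (Domain a)" and s: "0 <= s"
  and product: "e \<in> NP ==> f \<in> NP ==>
   \<exists>X. clinear_graph X \<and> homog 1 X \<and> Rop f O a O graph_adj (Rop e) \<subseteq> X"
begin

text \<open>This is \<open>e^s D \<theta>_s(a) D\<close> for \<open>D = DD s\<close>. Writing it
  with the bounded inverse \<open>DI s\<close> exhibits its graph as the preimage of the graph of
  \<open>a\<close> under a continuous map, so closedness is inherited.\<close>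

definition "W = {(x, z). (wt (- s) (DD s x), exp (- s) *\<^sub>R wt (- s) (DI s z)) \<in> a}"

lemma W_iff: "(x, z) \<in> W \<longleftrightarrow> (wt (- s) (DD s x), exp (- s) *\<^sub>R wt (- s) (DI s z)) \<in> a"
 by (simp add: W_def)

lemma W_value: "(wt (- s) (DD s x), v) \<in> a \<longleftrightarrow> (x, exp s *\<^sub>R DD s (wt s v)) \<in> W"
 by (simp add: W_iff bcl_scaleR[OF DI_bcl] bcl_scaleR[OF w_bcl] DD_DI exp_minus)

lemma W_linear: "linear_rel W"
proof -
 note lin = cdd_linear[OF a_cdd]
 note b = bcl_add[OF DI_bcl] bcl_add[OF DD_bcl] bcl_add[OF w_bcl] bcl_scaleC[OF DI_bcl] bcl_scaleC[OF DD_bcl] bcl_scaleC[OF w_bcl]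
  bcl_0[OF DI_bcl] bcl_0[OF DD_bcl] bcl_0[OF w_bcl]
 have "(0, 0) \<in> W" using linear_rel_zero[OF lin] by (simp add: W_iff b)
 moreover have "(x + x', z + z') \<in> W" if "(x, z) \<in> W" "(x', z') \<in> W" for x z x' z'
  using linear_rel_add[OF lin that[unfolded W_iff]] by (simp add: W_iff b scaleR_add_right)
 moreover have "(c *\<^sub>C x, c *\<^sub>C z) \<in> W" if "(x, z) \<in> W" for c x z
  using linear_rel_scaleC[OF lin that[unfolded W_iff], of c] by (simp add: W_iff b scaleC_scaleR_commute)
 ultimately show ?thesis by (auto simp: linear_rel_def)
qed

lemma W_dense: "T.trace_dense (Domain W)"
proof -
 have "T.trace_dense {x. \<exists>y. (x, y) \<in> graph (DD s) \<and> y \<in> {x. wt (- s) x \<in> Domain a}}"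
 proof (rule T.trace_dense_preimage[OF cdd_graph[OF DD_bcl] T.affiliated_graph[OF DD_CP] _ trace_dense_w[OF a_dense]])
  show "T.trace_dense (Domain (graph (DD s)))"
   by (rule T.trace_dense_mono[OF T.trace_dense_UNIV]) (auto simp: graph_def)
 qed
 moreover have "{x. \<exists>y. (x, y) \<in> graph (DD s) \<and> y \<in> {x. wt (- s) x \<in> Domain a}} \<subseteq> Domain W"
  using W_value by auto
 ultimately show ?thesis by (rule T.trace_dense_mono)
qed

lemma W_cdd: "cdd W"
 unfolding closed_densely_defined_def clinear_graph_iff
proof (intro conjI W_linear)
 have "z = z'" if "(x, z) \<in> W" "(x, z') \<in> W" for x z z'
 proof -
  have "exp (- s) *\<^sub>R wt (- s) (DI s z) = exp (- s) *\<^sub>R wt (- s) (DI s z')"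
   by (rule clinear_graph_unique[OF cdd_clinear[OF a_cdd] that[unfolded W_iff]])
  hence "wt (- s) (DI s z) = wt (- s) (DI s z')" by simp
  hence "DD s (wt s (wt (- s) (DI s z))) = DD s (wt s (wt (- s) (DI s z')))" by (rule arg_cong)
  thus ?thesis by (simp add: DD_DI)
 qed
 thus "single_valued W" by (auto simp: single_valued_def)
 show "closure (Domain W) = UNIV"
  by (rule T.trace_dense_closure[OF W_dense linear_rel_Domain[OF W_linear]])
 show "closed W"
  unfolding closed_sequential_limits
 proof (intro allI impI)
  fix X q assume X: "(\<forall>n. X n \<in> W) \<and> X ----> q"
  have "(fst (X n), snd (X n)) \<in> W" for n using X by simp
  hence "(wt (- s) (DD s (fst (X n))), exp (- s) *\<^sub>R wt (- s) (DI s (snd (X n)))) \<in> a" for n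
   by (simp only: W_iff)
  moreover have "(\<lambda>n. (wt (- s) (DD s (fst (X n))), exp (- s) *\<^sub>R wt (- s) (DI s (snd (X n))))) ---->
   (wt (- s) (DD s (fst q)), exp (- s) *\<^sub>R wt (- s) (DI s (snd q)))"
  proof -
   have f: "(\<lambda>n. fst (X n)) ----> fst q" and g: "(\<lambda>n. snd (X n)) ----> snd q"
    using X tendsto_fst tendsto_snd by blast+
   show ?thesis
    by (rule tendsto_Pair[OF bcl_tendsto[OF w_bcl bcl_tendsto[OF DD_bcl f]]
      tendsto_scaleR[OF tendsto_const bcl_tendsto[OF w_bcl bcl_tendsto[OF DI_bcl g]]]])
  qed
  ultimately have "(wt (- s) (DD s (fst q)), exp (- s) *\<^sub>R wt (- s) (DI s (snd q))) \<in> a"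
   by (rule closed_sequentially[OF cdd_closed[OF a_cdd]])
  hence "(fst q, snd q) \<in> W" by (simp only: W_iff)
  thus "q \<in> W" by simp
 qed
qed

lemma W_aff: "aff CP W"
 unfolding affiliated_def
proof (clarify)
 fix u x z assume u: "u \<in> commutant CP" and xz: "(x, z) \<in> W"
 define u' where "u' = wt (- s) o u o wt (- (- s))"
 have u': "u' \<in> commutant CP" unfolding u'_def by (rule dual_action_commutant[OF u])
 have c: "u' (wt (- s) y) = wt (- s) (u y)" for y by (simp add: u'_def)
 have DI: "DI s \<in> CP" unfolding DI_def E_def by (rule T.sib_A[OF h h_aff dili_bdd])
 have "(u' (wt (- s) (DD s x)), u' (exp (- s) *\<^sub>R wt (- s) (DI s z))) \<in> a"
  by (rule T.affiliated_comm[OF a_aff u' xz[unfolded W_iff]])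
 thus "(u x, u z) \<in> W"
  by (simp add: W_iff c bcl_scaleR[OF T.comm_bcl[OF u']] T.comm_eq[OF DD_CP u] T.comm_eq[OF DI u])
qed

lemma cinner_0_sym: "cinner x y = 0 ==> cinner y x = 0"
 using cinner_commute[of x y] by simp

section \<open>Agreement of \<open>a\<close> with its dilation \<open>W\<close>\<close>

definition "Z e f = Domain (Rop f O a O graph_adj (Rop e))"

lemma Z_dense: assumes e: "e \<in> NP" and f: "f \<in> NP" shows "T.trace_dense (Z e f)" "csubspace (Z e f)"
proof -
 let ?L = "graph_adj (Rop e)"
 have "T.trace_dense (Domain ?L)" by (rule T.trace_dense_adj[OF Rop_cdd Rop_aff Rop_trace_dense]) (rule e)+
 from T.trace_dense_preimage[OF Rop_cdd[OF f] Rop_aff[OF f] Rop_trace_dense[OF f] T.trace_dense_preimage[OF a_cdd a_aff a_dense this]]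
 show "T.trace_dense (Z e f)" by (rule T.trace_dense_mono) (auto simp: Z_def)
 show "csubspace (Z e f)"
  unfolding Z_def by (intro linear_rel_Domain linear_rel_comp cdd_linear Rop_cdd a_cdd graph_adj_linear e f)
qed

text \<open>As both \<open>xi\<close> and \<open>wt (- s) xi\<close> lie in \<open>Z e f\<close>,
  the operator \<open>X\<close> can be evaluated at \<open>xi\<close> directly and through its
  homogeneity. Moving \<open>DI s\<close> across the pairings with the range of \<open>Rop e\<close>
  turns equality of the two values into the stated identity.\<close>

lemma product_values:
 assumes e: "e \<in> NP" and f: "f \<in> NP" and xi: "xi \<in> Z e f" "wt (- s) xi \<in> Z e f"
 shows "\<exists>u v v'. (xi, u) \<in> Rop f \<and> (u, v) \<in> a \<and> (u, v') \<in> W \<and> (\<forall>\<eta> q. (\<eta>, q) \<in> Rop e --> cinner v q = cinner v' q)"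
proof -
 obtain X where X: "clinear_graph X" "homog 1 X" "Rop f O a O graph_adj (Rop e) \<subseteq> X" using product[OF e f] by blast
 obtain u v z where 1: "(xi, u) \<in> Rop f" "(u, v) \<in> a" "(v, z) \<in> graph_adj (Rop e)" using xi(1) by (auto simp: Z_def)
 obtain u1 v1 z1 where 2: "(wt (- s) xi, u1) \<in> Rop f" "(u1, v1) \<in> a" "(v1, z1) \<in> graph_adj (Rop e)"
  using xi(2) by (auto simp: Z_def)
 note uf = clinear_graph_unique[OF cdd_clinear[OF Rop_cdd[OF f]]] and ue = clinear_graph_unique[OF cdd_clinear[OF Rop_cdd[OF e]]]
 have "(xi, z) \<in> X" using 1 X(3) by blast
 moreover have "(wt (- s) xi, z1) \<in> X" using 2 X(3) by blast
 from homogD[OF X(2) this, of s] have "(xi, exp s *\<^sub>R wt s z1) \<in> X" by simp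
 ultimately have z: "z = exp s *\<^sub>R wt s z1" by (rule clinear_graph_unique[OF X(1)])
 have "(xi, DI s (wt s u1)) \<in> Rop f" using Rop_w[OF f 2(1), of s] by simp
 hence u: "u = DI s (wt s u1)" by (rule uf[OF 1(1)])
 define v' where "v' = exp s *\<^sub>R DD s (wt s v1)"
 have v': "(u, v') \<in> W" unfolding v'_def W_value[symmetric] using 2(2) by (simp add: u DD_DI)
 have "cinner v q = cinner v' q" if \<eta>: "(\<eta>, q) \<in> Rop e" for \<eta> q
 proof -
  define q1 where "q1 = DI (- s) (wt (- s) q)"
  have q1: "(wt (- s) \<eta>, q1) \<in> Rop e" unfolding q1_def by (rule Rop_w[OF e \<eta>])
  have "(\<eta>, DI s (wt s q1)) \<in> Rop e" using Rop_w[OF e q1, of s] by simp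
  hence "q = DI s (wt s q1)" by (rule ue[OF \<eta>])
  hence Dq: "DD s q = wt s q1" by (simp add: DD_DI)
  have "cinner q v = cinner \<eta> z" by (rule graph_adjD[OF 1(3) \<eta>])
  also have "... = cor (exp s) * cinner \<eta> (wt s z1)" by (simp add: z cinner_scaleR_right)
  also have "cinner \<eta> (wt s z1) = cinner (wt (- s) \<eta>) z1" by (rule cinner_w[symmetric])
  also have "... = cinner q1 v1" by (rule graph_adjD[OF 2(3) q1, symmetric])
  also have "... = cinner (wt s q1) (wt s v1)" using cinner_w[of s "wt s q1" v1] by simp
  also have "... = cinner q (DD s (wt s v1))" by (simp only: Dq[symmetric] self_adj_cinner[OF DD_sa])
  also have "cor (exp s) * ... = cinner q v'" by (simp add: v'_def cinner_scaleR_right)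
  finally have "cnj (cinner q v) = cnj (cinner q v')" by simp
  thus ?thesis by (simp only: cinner_commute[symmetric])
 qed
 thus ?thesis using 1(1,2) v' by blast
qed

text \<open>\<open>product_values\<close> speaks only of vectors \<open>u\<close> reached from a
  special subspace. For fixed \<open>q\<close> its identity becomes orthogonality of
  \<open>p - p'\<close> to such \<open>u\<close>; the subspace is a core of \<open>Rop f\<close>, so
  orthogonality extends to its whole range, and all ranges together are total.\<close>

lemma adjoints_agree:
 assumes e: "e \<in> NP" and q: "(\<eta>, q) \<in> Rop e" and p: "(q, p) \<in> graph_adj a" and p': "(q, p') \<in> graph_adj W"
 shows "p = p'"
proof -
 have "cinner (p - p') y = 0" if f: "f \<in> NP" and xy: "(x, y) \<in> Rop f" for f x y
 proof (rule T.core_orth[OF Rop_cdd[OF f] Rop_aff[OF f] _ _ _ xy])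
  let ?V = "Z e f \<inter> {x. wt (- s) x \<in> Z e f}"
  show "T.trace_dense ?V" by (intro T.trace_dense_Int trace_dense_w Z_dense e f)
  have "csubspace {x. wt (- s) x \<in> Z e f}"
   using Z_dense(2)[OF e f] by (simp add: csubspace_def bcl_simps[OF w_bcl])
  thus "csubspace ?V" by (intro csubspace_Int Z_dense e f)
  fix xi u assume xu: "(xi, u) \<in> Rop f" and "xi \<in> ?V"
  then obtain u0 v v' where 1: "(xi, u0) \<in> Rop f" "(u0, v) \<in> a" "(u0, v') \<in> W"
   "!!\<eta> q. (\<eta>, q) \<in> Rop e ==> cinner v q = cinner v' q"
   using product_values[OF e f, of xi] by blast
  have "u0 = u" by (rule clinear_graph_unique[OF cdd_clinear[OF Rop_cdd[OF f]] 1(1) xu])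
  hence "cinner v q = cinner u p" "cinner v' q = cinner u p'"
   using graph_adjD[OF p 1(2)] graph_adjD[OF p' 1(3)] by simp_all
  hence "cinner u (p - p') = 0" using 1(4)[OF q] by (simp add: cinner_diff_right)
  thus "cinner (p - p') u = 0" by (rule cinner_0_sym)
 qed
 hence "p - p' = 0" by (rule range_total)
 thus ?thesis by simp
qed

text \<open>The same argument one level up, now for arbitrary \<open>u\<close>: vectors
  \<open>q\<close> in both adjoint domains come from a core of \<open>Rop e\<close>, and there the
  adjoints have just been shown to agree.\<close>

lemma values_agree:
 assumes v: "(u, v) \<in> a" and v': "(u, v') \<in> W" shows "v = v'"
proof -
 have "cinner (v - v') y = 0" if e: "e \<in> NP" and xy: "(x, y) \<in> Rop e" for e x y
 proof (rule T.core_orth[OF Rop_cdd[OF e] Rop_aff[OF e] _ _ _ xy])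
  let ?D = "Domain (graph_adj a) \<inter> Domain (graph_adj W)"
  let ?V = "{x. \<exists>y. (x, y) \<in> Rop e \<and> y \<in> ?D}"
  show "T.trace_dense ?V"
   by (intro T.trace_dense_preimage Rop_cdd Rop_aff Rop_trace_dense T.trace_dense_Int T.trace_dense_adj
     a_cdd a_aff a_dense W_cdd W_aff W_dense e)
  show "csubspace ?V"
   by (intro csubspace_preimage csubspace_Int linear_rel_Domain graph_adj_linear cdd_linear Rop_cdd e)
  fix \<eta> q assume \<eta>: "(\<eta>, q) \<in> Rop e" and "\<eta> \<in> ?V"
  then obtain q0 where "(\<eta>, q0) \<in> Rop e" "q0 \<in> ?D" by blast
  moreover from this have "q0 = q" using clinear_graph_unique[OF cdd_clinear[OF Rop_cdd[OF e]]] \<eta> by blast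
  ultimately obtain p p' where p: "(q, p) \<in> graph_adj a" "(q, p') \<in> graph_adj W" by blast
  have "p = p'" by (rule adjoints_agree[OF e \<eta> p])
  hence "cinner v q = cinner v' q" using graph_adjD[OF p(1) v] graph_adjD[OF p(2) v'] by simp
  thus "cinner (v - v') q = 0" by (simp add: cinner_diff_left)
 qed
 hence "v - v' = 0" by (rule range_total)
 thus ?thesis by simp
qed

section \<open>Spectral tails and singular values\<close>

abbreviation "F \<equiv> resol (abs_op a)"

lemma F_proj: "B \<in> sets borel ==> F B \<in> CP" "B \<in> sets borel ==> proj (F B)"
 by (rule T.modulus_A[OF a_cdd a_aff], assumption) (rule sm_proj[OF abs_op_resolution(1)[OF a_cdd]])

text \<open>The projection \<open>q\<close> confines the comparison to vectors where
  \<open>a\<close> and \<open>W\<close> are both defined; it costs trace at most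
  \<open>\<delta>\<close>, which is sent to zero at the end. Strictness in the assumption on
  \<open>l\<close> is what excludes nonzero vectors in the final estimate.\<close>

lemma tail_bound:
 assumes s0: "0 <= s0" "\<tau> (F {s0<..}) <= 1" and l: "exp s * s0 < l"
 shows "\<tau> (F {l<..}) <= ennreal (exp (- s))"
proof -
 have l0: "0 < l" using l s0(1) by (meson exp_ge_zero le_less_trans mult_nonneg_nonneg)
 define P where "P = \<theta> s (F {s0<..})"
 have P: "P \<in> CP" "proj P" unfolding P_def by (intro dual_action_CP dual_action_proj F_proj, simp)+
 have "\<tau> P = ennreal (exp (- s)) * \<tau> (F {s0<..})"
  unfolding P_def by (rule tr_dual) (intro T.proj_pos_part F_proj, simp_all)
 also have "... <= ennreal (exp (- s)) * 1" by (intro mult_left_mono s0) simp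
 finally have \<tau>P: "\<tau> P <= ennreal (exp (- s))" by simp
 have F: "F {l<..} \<in> CP" "proj (F {l<..})" by (rule F_proj, simp)+
 have "\<tau> (F {l<..}) <= ennreal (exp (- s) + \<delta>)" if \<delta>: "\<delta> > 0" for \<delta>
 proof -
  obtain q where q: "q \<in> CP" "proj q" "!!x. q x = x ==> x \<in> Domain a \<inter> Domain W" "\<tau> (\<lambda>xi. xi - q xi) <= ennreal \<delta>"
   by (rule T.trace_denseE[OF T.trace_dense_Int[OF a_dense W_dense] \<delta>]) (rule that)
  obtain m where m: "m \<in> CP" "proj m" "!!x. m x = x \<longleftrightarrow> F {l<..} x = x \<and> q x = x"
   "\<tau> (\<lambda>xi. F {l<..} xi - m xi) <= \<tau> (\<lambda>xi. xi - q xi)" "(\<lambda>xi. F {l<..} xi - m xi) \<in> CP" "proj (\<lambda>xi. F {l<..} xi - m xi)"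
   by (rule T.meet[OF F q(1,2) T.A_id]) (rule that)
  have "\<tau> m <= \<tau> P"
  proof (rule T.comparison[where x = "P o (DD s o m)"])
   show "P o (DD s o m) \<in> CP" by (intro T.A_comp P DD_CP m)
   show "P ((P o (DD s o m)) xi) = (P o (DD s o m)) xi" for xi by (simp add: proj_idem[OF P(2)])
   fix xi assume 0: "(P o (DD s o m)) xi = 0"
   define x where "x = m xi"
   have "m x = x" by (simp add: x_def proj_idem[OF m(2)])
   hence Fx: "F {l<..} x = x" and "q x = x" using m(3) by blast+
   then obtain v v' where v: "(x, v) \<in> a" "(x, v') \<in> W" using q(3) by blast
   define y where "y = wt (- s) (DD s x)"
   have "wt (- s) (P (DD s x)) = 0" using 0 by (simp add: x_def bcl_0[OF w_bcl])
   hence "F {s0<..} y = 0" by (simp add: P_def dual_action_def y_def)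
   hence "F {..s0} y = y"
    using sm_compl[OF abs_op_resolution(1)[OF a_cdd], of "{..s0}" y] by simp
   then obtain b where b: "(y, b) \<in> a" "norm b <= s0 * norm y" using modulus_low[OF a_cdd s0(1)] by blast
   have "(x, exp s *\<^sub>R DD s (wt s b)) \<in> W" using b(1) by (simp add: y_def W_value)
   hence "v = exp s *\<^sub>R DD s (wt s b)" by (rule values_agree[OF v(1)])
   hence "norm v = exp s * norm (DD s (wt s b))" by simp
   also have "... <= exp s * norm (wt s b)" by (intro mult_left_mono DD_norm s) simp
   also have "norm (wt s b) = norm b" by (rule w_norm)
   also have "exp s * norm b <= exp s * (s0 * norm x)"
   proof (rule mult_left_mono)
    have "norm y <= norm x" using DD_norm[OF s, of x] by (simp add: y_def w_norm)
    thus "norm b <= s0 * norm x" using b(2) s0(1) by (meson mult_left_mono order_trans)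
   qed simp
   finally have "norm v <= (exp s * s0) * norm x" by simp
   moreover have "l * norm x <= norm v" by (rule modulus_high[OF a_cdd l0 Fx v(1)])
   ultimately have "(l - exp s * s0) * norm x <= 0" by (simp add: left_diff_distrib)
   hence "norm x <= 0" using l by (simp add: mult_le_0_iff)
   thus "m xi = 0" by (simp add: x_def)
  qed (intro m P)+
  have "\<tau> (F {l<..}) = \<tau> (\<lambda>xi. m xi + (F {l<..} xi - m xi))" by simp
  also have "... = \<tau> m + \<tau> (\<lambda>xi. F {l<..} xi - m xi)"
   by (rule T.tr_add) (intro T.proj_pos_part m)+
  also have "... <= ennreal (exp (- s)) + ennreal \<delta>"
   by (intro add_mono order_trans[OF \<open>\<tau> m <= \<tau> P\<close> \<tau>P] order_trans[OF m(4) q(4)])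
  also have "... = ennreal (exp (- s) + \<delta>)" using \<delta> by (simp add: ennreal_plus)
  finally show ?thesis .
 qed
 note le = this
 have "((\<lambda>\<delta>. ennreal (exp (- s) + \<delta>)) \<longlongrightarrow> ennreal (exp (- s) + 0)) (at_right 0)"
  by (intro tendsto_ennrealI tendsto_intros)
 hence "\<tau> (F {l<..}) <= ennreal (exp (- s) + 0)"
  by (rule tendsto_lowerbound) (auto intro: le eventually_mono[OF eventually_at_right_less])
 thus ?thesis by simp
qed

lemma sing_val_bound: "exp (- s) * sing_val \<tau> (exp (- s)) a <= sing_val \<tau> 1 a"
proof -
 let ?S = "\<lambda>t. {l. 0 <= l \<and> \<tau> (F {l<..}) <= ennreal t}"
 \<comment> \<open>The infimum defining the singular value at 1 is informative only over a nonempty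
   set; trace density of the domain provides an element.\<close>
 have "\<exists>l>0. \<tau> (F {l<..}) <= ennreal 1" by (rule T.modulus_tail[OF a_cdd a_aff a_dense]) simp
 hence ne: "?S 1 ~= {}" by (auto intro: less_imp_le)
 have bd: "bdd_below (?S t)" for t by (rule bdd_belowI[where m = 0]) auto
 show ?thesis
  unfolding sing_val_def
 proof (rule cInf_greatest[OF ne])
  fix s0 assume "s0 \<in> ?S 1"
  hence s0: "0 <= s0" "\<tau> (F {s0<..}) <= 1" by auto
  have "Inf (?S (exp (- s))) <= exp s * s0 + \<epsilon>" if "\<epsilon> > 0" for \<epsilon>
  proof (rule cInf_lower[OF _ bd])
   have "0 <= exp s * s0" using s0(1) by simp
   thus "exp s * s0 + \<epsilon> \<in> ?S (exp (- s))" using tail_bound[OF s0, of "exp s * s0 + \<epsilon>"] that by simp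
  qed
  hence "Inf (?S (exp (- s))) <= exp s * s0" by (rule field_le_epsilon)
  hence "exp (- s) * Inf (?S (exp (- s))) <= exp (- s) * (exp s * s0)" by (intro mult_left_mono) auto
  also have "... = s0" by (simp add: exp_minus)
  finally show "exp (- s) * Inf (?S (exp (- s))) <= s0" .
 qed
qed

end

section \<open>Fundamental functions\<close>

text \<open>A weakening of the Orlicz conditions that is stable under conjugation: star-shapedness
  in place of convexity, an affine minorant in place of divergence. Stability matters because
  \<open>fund_orl (conj_fun \<psi>)\<close> involves the second conjugate of
  \<open>\<psi>\<close>.\<close>

definition young :: "(real => ereal) => bool" where
 "young \<Psi> \<longleftrightarrow> (\<forall>u\<ge>0. 0 <= \<Psi> u) \<and> (\<forall>u\<ge>0. \<forall>c\<in>{0..1}. \<Psi> (c * u) <= ereal c * \<Psi> u) \<and>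
   (\<exists>v>0. \<Psi> v < \<infinity>) \<and> (\<exists>\<alpha>>0. \<exists>\<beta>. \<forall>v\<ge>0. ereal (\<alpha> * v - \<beta>) <= \<Psi> v)"

text \<open>Conjugation exchanges the two growth conditions: the conjugate is finite at the slope
  \<open>\<alpha>\<close> of a minorant, and a point \<open>v0\<close> where \<open>\<Psi>\<close>
  is finite is the slope of a minorant of the conjugate.\<close>

lemma young_conj:
 assumes \<Psi>: "young \<Psi>" shows "young (conj_fun \<Psi>)"
proof -
 have pos: "!!u. 0 <= u ==> 0 <= \<Psi> u" and star: "!!u c. 0 <= u ==> c \<in> {0..1} ==> \<Psi> (c * u) <= ereal c * \<Psi> u"
  using \<Psi> by (auto simp: young_def)
 obtain v0 K where v0: "0 < v0" "\<Psi> v0 = ereal K"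
 proof -
  obtain v where "0 < v" "\<Psi> v < \<infinity>" using \<Psi> by (auto simp: young_def)
  moreover from this have "0 <= \<Psi> v" using pos by simp
  ultimately show thesis using that by (cases "\<Psi> v") auto
 qed
 have K: "0 <= K" using pos[of v0] v0 by simp
 obtain \<alpha> \<beta> where ab: "0 < \<alpha>" "!!v. 0 <= v ==> ereal (\<alpha> * v - \<beta>) <= \<Psi> v" using \<Psi> by (auto simp: young_def)
 have lower: "ereal (u * v) - \<Psi> v <= conj_fun \<Psi> u" if "0 < v" for u v
  unfolding conj_fun_def by (rule SUP_upper) (use that in simp)
 have nonneg: "0 <= conj_fun \<Psi> u" if u: "0 <= u" for u
 proof (rule ereal_le_epsilon2)
  fix \<epsilon> :: real assume \<epsilon>: "0 < \<epsilon>"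
  \<comment> \<open>The supremum runs over \<open>v > 0\<close>, so the value 0 expected at
    \<open>v = 0\<close> is approached along \<open>c * v0\<close>, where star-shapedness keeps
    \<open>\<Psi>\<close> below \<open>c * K <= \<epsilon>\<close>.\<close>
  define c where "c = min 1 (\<epsilon> / (K + 1))"
  have c: "0 < c" "c <= 1" using \<epsilon> K by (auto simp: c_def)
  have cK: "c * K <= \<epsilon>"
  proof -
   have "c * K <= \<epsilon> / (K + 1) * K" using K by (intro mult_right_mono) (auto simp: c_def)
   also have "... <= \<epsilon>" using K \<epsilon> by (simp add: divide_le_eq field_simps)
   finally show ?thesis .
  qed
  have "\<Psi> (c * v0) <= ereal (c * K)" using star[of v0 c] c v0 by simp
  moreover have "0 <= \<Psi> (c * v0)" using pos c v0 by simp
  ultimately obtain r where r: "\<Psi> (c * v0) = ereal r" "r <= c * K" by (cases "\<Psi> (c * v0)") auto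
  have "ereal (- \<epsilon>) <= ereal (u * (c * v0)) - \<Psi> (c * v0)"
  proof -
   have "0 <= u * (c * v0)" using u c v0 by simp
   thus ?thesis using r cK by simp
  qed
  also have "... <= conj_fun \<Psi> u" by (rule lower) (use c v0 in simp)
  finally have "ereal (- \<epsilon>) <= conj_fun \<Psi> u" .
  thus "0 <= conj_fun \<Psi> u + ereal \<epsilon>" by (cases "conj_fun \<Psi> u") auto
 qed
 have star': "conj_fun \<Psi> (c * u) <= ereal c * conj_fun \<Psi> u" if u: "0 <= u" and c: "c \<in> {0..1}" for u c
  unfolding conj_fun_def[of \<Psi> "c * u"]
 proof (rule SUP_least)
  fix v :: real assume "v \<in> {0<..}"
  hence v: "0 < v" by simp
  show "ereal (c * u * v) - \<Psi> v <= ereal c * conj_fun \<Psi> u"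
  proof (cases "\<Psi> v")
   case (real r)
   have "0 <= r" using pos[of v] v real by simp
   hence "c * r <= r" using c by (simp add: mult_left_le_one_le)
   hence "ereal (c * u * v) - \<Psi> v <= ereal c * (ereal (u * v) - \<Psi> v)" using real by (simp add: algebra_simps)
   also have "... <= ereal c * conj_fun \<Psi> u" by (rule ereal_mult_left_mono[OF lower[OF v]]) (use c in simp)
   finally show ?thesis .
  qed (use pos[of v] v in auto)
 qed
 have fin: "conj_fun \<Psi> \<alpha> < \<infinity>"
 proof -
  have "conj_fun \<Psi> \<alpha> <= ereal \<beta>"
   unfolding conj_fun_def
  proof (rule SUP_least)
   fix v :: real assume "v \<in> {0<..}"
   thus "ereal (\<alpha> * v) - \<Psi> v <= ereal \<beta>" using ab(2)[of v] by (cases "\<Psi> v") auto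
  qed
  thus ?thesis by auto
 qed
 have "ereal (v0 * u - K) <= conj_fun \<Psi> u" for u using lower[OF v0(1), of u] v0(2) by (simp add: mult.commute)
 with nonneg star' fin ab(1) v0(1) show ?thesis unfolding young_def by blast
qed

lemma young_orlicz:
 assumes \<psi>: "orlicz_function \<psi>" shows "young \<psi>"
proof -
 have pos: "!!u. 0 <= u ==> 0 <= \<psi> u" and zero: "\<psi> 0 = 0"
  and conv: "!!u v c. 0 <= u ==> 0 <= v ==> c \<in> {0..1} ==>
   \<psi> ((1 - c) * u + c * v) <= ereal (1 - c) * \<psi> u + ereal c * \<psi> v"
  and lim: "(\<psi> \<longlongrightarrow> \<infinity>) at_top" and fin: "\<exists>u>0. \<psi> u ~= \<infinity>"
  using \<psi> unfolding orlicz_function_def by blast+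
 have star: "\<psi> (c * u) <= ereal c * \<psi> u" if "0 <= u" "c \<in> {0..1}" for u c
  using conv[of 0 u c] that zero by simp
 have "eventually (\<lambda>v. 1 < \<psi> v) at_top" using order_tendstoD(1)[OF lim, of 1] by simp
 then obtain N where N: "!!v. N <= v ==> 1 < \<psi> v" by (auto simp: eventually_at_top_linorder)
 define n where "n = max N 1"
 have n: "0 < n" "1 < \<psi> n" using N[of n] by (auto simp: n_def)
 have "ereal (1 / n * v - 1) <= \<psi> v" if v: "0 <= v" for v
 proof (cases "v <= n")
  case True
  hence "ereal (1 / n * v - 1) <= 0" using n(1) by (simp add: divide_le_eq)
  thus ?thesis using pos[OF v] by (rule order_trans)
 next
  case False
  hence v0: "0 < v" "n < v" using n by auto
  have "1 <= \<psi> n" using n by simp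
  also have "\<psi> n <= ereal (n / v) * \<psi> v" using star[of v "n / v"] v0 n(1) by simp
  finally have 1: "1 <= ereal (n / v) * \<psi> v" .
  show ?thesis
  proof (cases "\<psi> v")
   case (real r)
   hence "1 <= n / v * r" using 1 by (simp add: one_ereal_def)
   hence "v / n <= r" using v0 n(1) by (simp add: field_simps)
   thus ?thesis using real by simp
  qed (use pos[OF v] in auto)
 qed
 hence "\<exists>\<alpha>>0. \<exists>\<beta>. \<forall>v\<ge>0. ereal (\<alpha> * v - \<beta>) <= \<psi> v" using n(1) by (intro exI[of _ "1 / n"] conjI exI[of _ 1]) auto
 moreover have "\<exists>v>0. \<psi> v < \<infinity>" using fin by auto
 ultimately show ?thesis using pos star unfolding young_def by blast
qed

definition quasiconcave :: "(real => real) => bool" where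
 "quasiconcave \<phi> \<longleftrightarrow> (\<forall>r\<le>0. \<phi> r = 0) \<and> (\<forall>r>0. 0 < \<phi> r) \<and>
   (\<forall>r>0. \<forall>r'\<ge>r. \<phi> r <= \<phi> r' \<and> r * \<phi> r' <= r' * \<phi> r)"

lemma quasiconcave_measurable:
 assumes \<phi>: "quasiconcave \<phi>" shows "\<phi> \<in> BM"
proof (rule borel_measurable_mono, rule monoI)
 fix r r' :: real assume "r <= r'"
 thus "\<phi> r <= \<phi> r'" using \<phi> unfolding quasiconcave_def by (metis less_eq_real_def not_less order_refl)
qed

text \<open>Star-shapedness of \<open>\<Psi>\<close> becomes \<open>c * I t <= I (c * t)\<close> for
  the generalised inverse \<open>I\<close> and \<open>c\<close> up to 1, which is the quotient
  inequality. The affine minorant bounds the sets whose suprema define \<open>I\<close>.\<close>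

lemma quasiconcave_lux:
 assumes \<Psi>: "young \<Psi>" shows "quasiconcave (fund_lux \<Psi>)"
proof -
 let ?S = "\<lambda>t. {s. 0 <= s \<and> \<Psi> s <= ereal t}"
 let ?I = "orlicz_inv \<Psi>"
 have pos: "!!u. 0 <= u ==> 0 <= \<Psi> u" and star: "!!u c. 0 <= u ==> c \<in> {0..1} ==> \<Psi> (c * u) <= ereal c * \<Psi> u"
  using \<Psi> by (auto simp: young_def)
 obtain v0 K where v0: "0 < v0" "\<Psi> v0 = ereal K" "0 <= K"
 proof -
  obtain v where "0 < v" "\<Psi> v < \<infinity>" using \<Psi> by (auto simp: young_def)
  moreover from this have "0 <= \<Psi> v" using pos by simp
  ultimately show thesis using that by (cases "\<Psi> v") auto
 qed
 obtain \<alpha> \<beta> where ab: "0 < \<alpha>" "!!v. 0 <= v ==> ereal (\<alpha> * v - \<beta>) <= \<Psi> v" using \<Psi> by (auto simp: young_def)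
 have bd: "bdd_above (?S t)" for t
 proof (rule bdd_aboveI[where M = "(t + \<beta>) / \<alpha>"])
  fix v assume "v \<in> ?S t"
  hence "ereal (\<alpha> * v - \<beta>) <= ereal t" using order_trans[OF ab(2)[of v], of "ereal t"] by simp
  thus "v <= (t + \<beta>) / \<alpha>" using ab(1) by (simp add: le_divide_eq mult.commute)
 qed
 have inS: "\<exists>v>0. v \<in> ?S t" if t: "0 < t" for t
 proof -
  define c where "c = min 1 (t / (K + 1))"
  have c: "0 < c" "c <= 1" using t v0(3) by (auto simp: c_def)
  have "c * K <= t / (K + 1) * K" using v0(3) by (intro mult_right_mono) (auto simp: c_def)
  also have "... <= t" using v0(3) t by (simp add: divide_le_eq field_simps)
  finally have "c * K <= t" .
  moreover have "\<Psi> (c * v0) <= ereal (c * K)" using star[of v0 c] c v0 by simp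
  ultimately have "\<Psi> (c * v0) <= ereal t" by (meson ereal_less_eq(3) order_trans)
  thus ?thesis using c v0 by (intro exI[of _ "c * v0"]) auto
 qed
 have I_pos: "0 < ?I t" if t: "0 < t" for t
 proof -
  obtain v where "0 < v" "v \<in> ?S t" using inS[OF t] by blast
  thus ?thesis unfolding orlicz_inv_def using cSup_upper[OF _ bd] less_le_trans by blast
 qed
 have I_mono: "?I t <= ?I t'" if "0 < t" "t <= t'" for t t'
  unfolding orlicz_inv_def
 proof (rule cSup_subset_mono[OF _ bd])
  show "?S t ~= {}" using inS[OF that(1)] by blast
  show "?S t \<subseteq> ?S t'" using that(2) order_trans by fastforce
 qed
 have I_star: "c * ?I t <= ?I (c * t)" if c: "0 < c" "c <= 1" and t: "0 < t" for c t
 proof -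
  have "?I t <= ?I (c * t) / c"
   unfolding orlicz_inv_def[of _ t]
  proof (rule cSup_least)
   show "?S t ~= {}" using inS[OF t] by blast
   fix v assume v: "v \<in> ?S t"
   have "\<Psi> (c * v) <= ereal c * \<Psi> v" using star[of v c] v c by simp
   also have "... <= ereal c * ereal t" using v c by (intro ereal_mult_left_mono) auto
   finally have "c * v \<in> ?S (c * t)" using v c by simp
   hence "c * v <= ?I (c * t)" unfolding orlicz_inv_def by (rule cSup_upper[OF _ bd])
   thus "v <= ?I (c * t) / c" using c by (simp add: le_divide_eq mult.commute)
  qed
  thus ?thesis using c by (simp add: le_divide_eq mult.commute)
 qed
 show ?thesis
  unfolding quasiconcave_def
 proof (intro conjI allI impI)
  show "fund_lux \<Psi> r = 0" if "r <= 0" for r using that by (simp add: fund_lux_def)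
  show "0 < fund_lux \<Psi> r" if "0 < r" for r using that I_pos[of "1 / r"] by (simp add: fund_lux_def)
  fix r r' :: real assume r: "0 < r" "r <= r'"
  hence r': "0 < r'" by simp
  have p: "0 < ?I (1 / r)" "0 < ?I (1 / r')" using I_pos r r' by auto
  have "?I (1 / r') <= ?I (1 / r)" by (rule I_mono) (use r r' in "auto simp: frac_le")
  thus "fund_lux \<Psi> r <= fund_lux \<Psi> r'" using p r r' by (simp add: fund_lux_def frac_le)
  have "r / r' * ?I (1 / r) <= ?I (r / r' * (1 / r))" by (rule I_star) (use r r' in auto)
  hence "r / r' * ?I (1 / r) <= ?I (1 / r')" using r by simp
  hence "r * ?I (1 / r) <= r' * ?I (1 / r')" using r' by (simp add: divide_le_eq mult.commute)
  thus "r * fund_lux \<Psi> r' <= r' * fund_lux \<Psi> r" using p r r' by (simp add: fund_lux_def field_simps)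
 qed
qed

text \<open>Passing from a function to \<open>r\<close> divided by it exchanges the monotonicity and
  the quotient inequality.\<close>

lemma quasiconcave_orl:
 assumes \<Psi>: "young \<Psi>" shows "quasiconcave (fund_orl \<Psi>)"
proof -
 let ?L = "fund_lux (conj_fun \<Psi>)"
 have L: "quasiconcave ?L" by (rule quasiconcave_lux[OF young_conj[OF \<Psi>]])
 have p: "0 < ?L r" if "0 < r" for r using L that by (simp add: quasiconcave_def)
 show ?thesis
  unfolding quasiconcave_def
 proof (intro conjI allI impI)
  show "fund_orl \<Psi> r = 0" if "r <= 0" for r using that by (simp add: fund_orl_def)
  show "0 < fund_orl \<Psi> r" if "0 < r" for r using that p by (simp add: fund_orl_def)
  fix r r' :: real assume r: "0 < r" "r <= r'"
  hence r': "0 < r'" by simp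
  have "?L r <= ?L r'" "r * ?L r' <= r' * ?L r" using L r by (simp_all add: quasiconcave_def)
  thus "fund_orl \<Psi> r <= fund_orl \<Psi> r'" "r * fund_orl \<Psi> r' <= r' * fund_orl \<Psi> r"
   using p[OF r(1)] p[OF r'] r r' by (simp_all add: fund_orl_def field_simps mult_left_mono)
 qed
qed

theorem theorem3p10:
  fixes M :: "('h::chilbert_space \<Rightarrow> 'h) set"
    and \<nu> :: "('h \<Rightarrow> 'h) \<Rightarrow> ennreal"
    and \<Lambda> :: "('h \<Rightarrow> 'h) \<Rightarrow> 'g::chilbert_space"
    and \<rho> :: "('h \<Rightarrow> 'h) \<Rightarrow> 'g \<Rightarrow> 'g"
    and \<sigma> :: "real \<Rightarrow> ('h \<Rightarrow> 'h) \<Rightarrow> 'h \<Rightarrow> 'h"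
    and \<iota> :: "(real \<Rightarrow> 'h) \<Rightarrow> 'k::chilbert_space"
    and \<tau> :: "('k \<Rightarrow> 'k) \<Rightarrow> ennreal"
    and h a :: "'k uop"
    and \<psi> :: "real \<Rightarrow> ereal"
    and t :: real
  assumes "von_neumann_algebra M"
    and "fns_weight M \<nu>"
    and "gns_representation M \<nu> \<Lambda> \<rho>"
    and "modular_group M \<nu> \<Lambda> \<rho> \<sigma>"
    and "L2_space \<iota>"
    and "canonical_trace_density M \<nu> \<sigma> \<iota> \<tau> h"
    and "orlicz_function \<psi>"
    and "a \<in> orlicz_space_lux M \<nu> \<sigma> \<iota> \<tau> h \<psi> \<union> orlicz_space_orl M \<nu> \<sigma> \<iota> \<tau> h \<psi>"
    and "0 < t" and "t \<le> 1"
  shows "t * sing_val \<tau> t a \<le> sing_val \<tau> 1 a"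
proof -
  let ?CP = "crossed_product M \<sigma> \<iota>"
  interpret crossed M \<iota> \<sigma>
    using assms(1,4,5) by unfold_locales (simp_all add: modular_group_def)
  note can = assms(6)[unfolded canonical_trace_density_def]
  interpret T: vn_trace ?CP \<tau> by (rule vn_traceI[OF CP_vna]) (use can in blast)
  interpret canonical M \<iota> \<sigma> \<nu> \<tau> h
  proof unfold_locales
    show "fns_weight M \<nu>" by (rule assms(2))
    show "homog 1 h" by (rule homog_one) (use can in blast)
  qed (use can in blast)+
  have "young (conj_fun \<psi>)" by (rule young_conj[OF young_orlicz[OF assms(7)]])
  with assms(8) obtain \<phi> where \<phi>: "quasiconcave \<phi>" and a: "a \<in> weighted_space M \<nu> \<sigma> \<iota> \<tau> h \<phi>"
    by (auto simp: orlicz_space_lux_def orlicz_space_orl_def intro: quasiconcave_lux quasiconcave_orl)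
  interpret weighted M \<iota> \<sigma> \<nu> \<tau> h \<phi>
    by unfold_locales (use \<phi> quasiconcave_measurable[OF \<phi>] in \<open>auto simp: quasiconcave_def\<close>)
  have k: "fun_calc h (\<lambda>s. complex_of_real (sqrt (\<phi> s))) = k"
    by (simp add: fun_calc_def k_def E_def kappa_def[abs_def])
  have meas: "a \<in> measurable_ops ?CP \<tau>" using a by (simp add: weighted_space_def)
  \<comment> \<open>The choice \<open>s = - ln t\<close> gives \<open>exp (- s) = t\<close>, and
    \<open>t <= 1\<close> gives the sign of \<open>s\<close> for which the dilation factor is a
    contraction.\<close>
  interpret element M \<iota> \<sigma> \<nu> \<tau> h \<phi> a "- ln t"
  proof unfold_locales
    show "closed_densely_defined a" "affiliated ?CP a" using meas by (auto simp: measurable_ops_def)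
    show "T.trace_dense (Domain a)"
      unfolding T.trace_dense_def
    proof (intro allI impI)
      fix \<delta> :: real assume "\<delta> > 0"
      then obtain p where p: "p \<in> ?CP" "is_projection p" "range p \<subseteq> Domain a" "\<tau> (\<lambda>\<xi>. \<xi> - p \<xi>) \<le> ennreal \<delta>"
        using meas by (auto simp: measurable_ops_def)
      have "x \<in> Domain a" if "p x = x" for x using p(3) rangeI[of p x] that by auto
      with p show "\<exists>p\<in>?CP. is_projection p \<and> (\<forall>x. p x = x \<longrightarrow> x \<in> Domain a) \<and> \<tau> (\<lambda>\<xi>. \<xi> - p \<xi>) \<le> ennreal \<delta>"
        by blast
    qed
    show "0 \<le> - ln t" using assms(9,10) by simp
    fix e f assume e: "e \<in> NP" and f: "f \<in> NP"
    define X where "X = sprod (sprod (sprod (graph (cp_pi \<iota> \<sigma> e)) k) a) (sprod k (graph (cp_pi \<iota> \<sigma> f)))"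
    have "e \<in> n_ideal M \<nu>" "is_projection e" "f \<in> n_ideal M \<nu>" "is_projection f"
      using n_ideal_proj e f by auto
    hence X: "X \<in> haagerup_L1 M \<sigma> \<iota> \<tau>" using a by (simp add: weighted_space_def k X_def)
    have "closed_densely_defined X" using X by (auto simp: haagerup_L1_def measurable_ops_def)
    hence "clinear_graph X" by (rule cdd_clinear)
    moreover have "homog 1 X" by (rule homog_one) (use X in \<open>simp add: haagerup_L1_def\<close>)
    \<comment> \<open>The leftmost relation acts first. Each remaining closure in the nested strong
      products only enlarges the graph, and the factor with \<open>e\<close> equals
      \<open>graph_adj (Rop e)\<close> exactly.\<close>
    moreover have "Rop f O a O graph_adj (Rop e) \<subseteq> X"
    proof -
      have "a O graph_adj (Rop e) \<subseteq> sprod (sprod (graph (cp_pi \<iota> \<sigma> e)) k) a"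
        unfolding sprod_def Rop_adj[OF e] by (rule closure_subset)
      moreover have "Rop f \<subseteq> sprod k (graph (cp_pi \<iota> \<sigma> f))"
        unfolding sprod_def Rop_def by (rule closure_subset)
      ultimately have "Rop f O (a O graph_adj (Rop e)) \<subseteq>
          sprod k (graph (cp_pi \<iota> \<sigma> f)) O sprod (sprod (graph (cp_pi \<iota> \<sigma> e)) k) a" by (rule relcomp_mono[rotated])
      also have "\<dots> \<subseteq> X" unfolding X_def sprod_def[of "sprod _ a"] by (rule closure_subset)
      finally show ?thesis .
    qed
    ultimately show "\<exists>X. clinear_graph X \<and> homog 1 X \<and> Rop f O a O graph_adj (Rop e) \<subseteq> X" by blast
  qed
  show ?thesis using sing_val_bound assms(9) by (simp add: exp_minus)
qed

end
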